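(* Let $\mathbf{B}$ be a braided monoidal category. Let $G$ be a group. There is an equivalence of categories $$\mathbf{Alg}\left(\mathbb{D}\otimes(\mathbb{B}\otimes\mathbb{G})\otimes\mathbb{D}^{op},\mathbf{B}\right)\simeq\mathbf{GBimon}(\mathbf{B}).$$
   Context: For $n\geq 1$, $\underline{n}=\{1,\dots,n\}$, and $\underline{0}=\emptyset$. A PROB is a braided strict monoidal category whose objects are the sets $\underline{n}$, $n\ge 0$, with tensor product of objects given by addition. For a PROB $T$ and a braided monoidal category $\mathbf{B}$, $\mathbf{Alg}(T,\mathbf{B})$ is the category of braided strict monoidal functors $T\to\mathbf{B}$ and natural transformations. $\mathbf{Bimon}(\mathbf{B})$ is the category of bimonoids in $\mathbf{B}$ (objects with compatible monoid and comonoid structures). Regarding $G$ as a one-object category, $\mathbf{GBimon}(\mathbf{B})=\mathrm{Fun}(G,\mathbf{Bimon}(\mathbf{B}))$. $\mathbb{D}$ is the strict monoidal category of the sets $\underline{n}$ and order-preserving maps (tensor product: ordinal sum, written $\amalg$ on morphisms); $m:\underline{2}\to\underline{1}$ and $u:\underline{0}\to\underline{1}$ are its unique such maps. $B_n$ is the braid group. An element of $G^n\rtimes B_n$ is a braid with a label $x_i\in G$ on the strand starting at position $i$; multiplication composes braids and multiplies labels along strands, $(y;b')(x;b)=\big((y_{\sigma(i)}x_i)_i;\,b'b\big)$, where $\sigma$ is the underlying permutation of $b$. The PROB $Q=\mathbb{D}\otimes\mathbb{B}\otimes\mathbb{G}$ has as morphisms $\underline{n}\to\underline{m}$ the pairs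 $(\phi,g)$ with $\phi\in\mathrm{Hom}_{\mathbb{D}}(\underline{n},\underline{m})$, $g\in G^n\rtimes B_n$ (think "$\phi\circ g$"), with composition $(\phi_2,g_2)\circ(\phi_1,g_1)=\big(\phi_2\circ(g_2)_\star(\phi_1),\ \phi_1^\star(g_2)\,g_1\big)$. Here for $\phi\in\mathrm{Hom}_{\mathbb{D}}(\underline{n},\underline{m})$ and $g\in G^m\rtimes B_m$ with underlying permutation $\sigma$: $g_\star(\phi)$ is the order-preserving map $\underline{n}\to\underline{m}$ whose fibre over $\sigma(i)$ has $|\phi^{-1}(i)|$ elements, and $\phi^\star(g)$ is obtained from $g$ by replacing its $i$-th strand by $|\phi^{-1}(i)|$ parallel strands (deleting it if this number is $0$), each carrying the label $x_i$. Tensor product is juxtaposition and the braiding is given by block braids with trivial labels. The isomorphisms of $Q$ are the labelled braids. $Q^{op}\otimes_{\mathbb{B}\otimes\mathbb{G}}Q$ and $Q\otimes_{\mathbb{B}\otimes\mathbb{G}}Q^{op}$ denote the categories of equivalence classes of cospans, respectively spans, in $Q$, where two (co)spans are equivalent if they differ by an isomorphism of the middle object. The PROB $\mathbb{D}\otimes(\mathbb{B}\otimes\mathbb{G})\otimes\mathbb{D}^{op}$ is (isomorphic to) the composite PROB $Q\otimes_{\mathbb{B}\otimes\mathbb{G}}Q^{op}$: its morphisms $\underline{n}\to\underline{m}$ are the classes of spans $\underline{n}\leftarrow\underline{p}\to\underline{m}$ in $Q$, and two spans are composed by replacing the inner cospan by a span by means of the distributive law of PROBs $Q^{op}\otimes_{\mathbb{B}\otimes\mathbb{G}}Q\to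 Q\otimes_{\mathbb{B}\otimes\mathbb{G}}Q^{op}$ determined as follows. (i) For $g,h\in G^n\rtimes B_n$: $\underline{n}\xrightarrow{g}\underline{n}\xleftarrow{h}\underline{n}\ \mapsto\ \underline{n}\xleftarrow{g^{-1}}\underline{n}\xrightarrow{h^{-1}}\underline{n}$. (ii) For $\phi\in\mathrm{Hom}_{\mathbb{D}}(\underline{n},\underline{m})$ and $g\in G^m\rtimes B_m$: $\underline{n}\xrightarrow{\phi}\underline{m}\xleftarrow{g}\underline{m}\ \mapsto\ \underline{n}\xleftarrow{\phi^\star(g)}\underline{n}\xrightarrow{g_\star(\phi)}\underline{m}$ and $\underline{m}\xrightarrow{g}\underline{m}\xleftarrow{\phi}\underline{n}\ \mapsto\ \underline{m}\xleftarrow{g_\star(\phi)}\underline{n}\xrightarrow{\phi^\star(g)}\underline{n}$. (iii) $\underline{2}\xrightarrow{m}\underline{1}\xleftarrow{m}\underline{2}\ \mapsto\ \underline{2}\xleftarrow{m^{\amalg 2}\circ\sigma_{2,3}}\underline{4}\xrightarrow{m^{\amalg 2}}\underline{2}$; $\ \underline{0}\xrightarrow{u}\underline{1}\xleftarrow{u}\underline{0}\ \mapsto\ \underline{0}\xleftarrow{\mathrm{id}_0}\underline{0}\xrightarrow{\mathrm{id}_0}\underline{0}$; $\ \underline{2}\xrightarrow{m}\underline{1}\xleftarrow{u}\underline{0}\ \mapsto\ \underline{2}\xleftarrow{u^{\amalg 2}}\underline{0}\xrightarrow{\mathrm{id}_0}\underline{0}$; $\ \underline{0}\xrightarrow{u}\underline{1}\xleftarrow{m}\underline{2}\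 \mapsto\ \underline{0}\xleftarrow{\mathrm{id}_0}\underline{0}\xrightarrow{u^{\amalg 2}}\underline{2}$, where $\sigma_{2,3}=\mathrm{id}_1\amalg\sigma\amalg\mathrm{id}_1$ and $\sigma$ is the generator of the braid group $B_2$.
   Formalization: In rule (ii) of the distributive law φ and g_⋆(φ) are interchanged, as the printed rule is not well defined on classes; strict functors into non-strict B are strict up to coherence isomorphisms; natural transformations in Alg are monoidal. Read literally, the claim fails. *)

theory Defs
  imports "HOL-Algebra.Group" "HOL-Combinatorics.Transposition"
begin

section \<open>Categories, functors, equivalences\<close>

record ('o, 'a) cat =
  Obj :: "'o set"
  Arr :: "'a set"
  Dom :: "'a \<Rightarrow> 'o"
  Cod :: "'a \<Rightarrow> 'o"
  Id :: "'o \<Rightarrow> 'a"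
  Comp :: "'a \<Rightarrow> 'a \<Rightarrow> 'a"  (infixr "\<cdot>\<index>" 70)

definition Hom :: "('o, 'a, 'z) cat_scheme \<Rightarrow> 'o \<Rightarrow> 'o \<Rightarrow> 'a set" where
  "Hom C X Y = {f \<in> Arr C. Dom C f = X \<and> Cod C f = Y}"

locale category =
  fixes C :: "('o, 'a, 'z) cat_scheme" (structure)
  assumes Dom_Obj: "f \<in> Arr C \<Longrightarrow> Dom C f \<in> Obj C"
    and Cod_Obj: "f \<in> Arr C \<Longrightarrow> Cod C f \<in> Obj C"
    and Id_Hom: "X \<in> Obj C \<Longrightarrow> Id C X \<in> Hom C X X"
    and Comp_Hom: "f \<in> Hom C X Y \<Longrightarrow> g \<in> Hom C Y Z \<Longrightarrow> g \<cdot> f \<in> Hom C X Z"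
    and Comp_Id_right: "f \<in> Hom C X Y \<Longrightarrow> f \<cdot> Id C X = f"
    and Comp_Id_left: "f \<in> Hom C X Y \<Longrightarrow> Id C Y \<cdot> f = f"
    and Comp_assoc: "f \<in> Hom C W X \<Longrightarrow> g \<in> Hom C X Y \<Longrightarrow> h \<in> Hom C Y Z \<Longrightarrow>
          (h \<cdot> g) \<cdot> f = h \<cdot> (g \<cdot> f)"

definition inverse_arrows :: "('o, 'a, 'z) cat_scheme \<Rightarrow> 'a \<Rightarrow> 'a \<Rightarrow> bool" where
  "inverse_arrows C f g \<longleftrightarrow>
     f \<in> Arr C \<and> g \<in> Hom C (Cod C f) (Dom C f) \<and>
     g \<cdot>\<^bsub>C\<^esub> f = Id C (Dom C f) \<and> f \<cdot>\<^bsub>C\<^esub> g = Id C (Cod C f)"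

definition is_iso :: "('o, 'a, 'z) cat_scheme \<Rightarrow> 'a \<Rightarrow> bool" where
  "is_iso C f \<longleftrightarrow> (\<exists>g. inverse_arrows C f g)"

definition inv_arr :: "('o, 'a, 'z) cat_scheme \<Rightarrow> 'a \<Rightarrow> 'a" where
  "inv_arr C f = (THE g. inverse_arrows C f g)"

record ('o1, 'a1, 'o2, 'a2) funct =
  fobj :: "'o1 \<Rightarrow> 'o2"
  farr :: "'a1 \<Rightarrow> 'a2"

definition is_functor ::
  "('o1, 'a1, 'y) cat_scheme \<Rightarrow> ('o2, 'a2, 'z) cat_scheme \<Rightarrow>
   ('o1, 'a1, 'o2, 'a2, 'x) funct_scheme \<Rightarrow> bool" where
  "is_functor C D F \<longleftrightarrow>
     (\<forall>X\<in>Obj C. fobj F X \<in> Obj D) \<and>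
     (\<forall>f\<in>Arr C. farr F f \<in> Hom D (fobj F (Dom C f)) (fobj F (Cod C f))) \<and>
     (\<forall>X\<in>Obj C. farr F (Id C X) = Id D (fobj F X)) \<and>
     (\<forall>f\<in>Arr C. \<forall>g\<in>Arr C. Cod C f = Dom C g \<longrightarrow>
        farr F (g \<cdot>\<^bsub>C\<^esub> f) = farr F g \<cdot>\<^bsub>D\<^esub> farr F f)"

definition is_nat_trans ::
  "('o1, 'a1, 'y) cat_scheme \<Rightarrow> ('o2, 'a2, 'z) cat_scheme \<Rightarrow>
   ('o1, 'a1, 'o2, 'a2, 'x) funct_scheme \<Rightarrow> ('o1, 'a1, 'o2, 'a2, 'w) funct_scheme \<Rightarrow>
   ('o1 \<Rightarrow> 'a2) \<Rightarrow> bool" where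
  "is_nat_trans C D F H \<alpha> \<longleftrightarrow>
     (\<forall>X\<in>Obj C. \<alpha> X \<in> Hom D (fobj F X) (fobj H X)) \<and>
     (\<forall>f\<in>Arr C. \<alpha> (Cod C f) \<cdot>\<^bsub>D\<^esub> farr F f = farr H f \<cdot>\<^bsub>D\<^esub> \<alpha> (Dom C f))"

definition is_nat_iso ::
  "('o1, 'a1, 'y) cat_scheme \<Rightarrow> ('o2, 'a2, 'z) cat_scheme \<Rightarrow>
   ('o1, 'a1, 'o2, 'a2, 'x) funct_scheme \<Rightarrow> ('o1, 'a1, 'o2, 'a2, 'w) funct_scheme \<Rightarrow>
   ('o1 \<Rightarrow> 'a2) \<Rightarrow> bool" where
  "is_nat_iso C D F H \<alpha> \<longleftrightarrow> is_nat_trans C D F H \<alpha> \<and> (\<forall>X\<in>Obj C. is_iso D (\<alpha> X))"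

definition id_funct :: "('o, 'a, 'o, 'a) funct" where
  "id_funct = \<lparr>fobj = \<lambda>X. X, farr = \<lambda>f. f\<rparr>"

definition comp_funct ::
  "('o2, 'a2, 'o3, 'a3) funct \<Rightarrow> ('o1, 'a1, 'o2, 'a2) funct \<Rightarrow> ('o1, 'a1, 'o3, 'a3) funct" where
  "comp_funct H F = \<lparr>fobj = \<lambda>X. fobj H (fobj F X), farr = \<lambda>f. farr H (farr F f)\<rparr>"

definition equivalent_categories ::
  "('o1, 'a1, 'y) cat_scheme \<Rightarrow> ('o2, 'a2, 'z) cat_scheme \<Rightarrow> bool" where
  "equivalent_categories C D \<longleftrightarrow>
     (\<exists>(F :: ('o1, 'a1, 'o2, 'a2) funct) (H :: ('o2, 'a2, 'o1, 'a1) funct) \<eta> \<epsilon>.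
        is_functor C D F \<and> is_functor D C H \<and>
        is_nat_iso C C id_funct (comp_funct H F) \<eta> \<and>
        is_nat_iso D D (comp_funct F H) id_funct \<epsilon>)"

text \<open>Functors and transformations are made extensional, so that equality in the functor category
  only concerns their values on the objects and arrows of \<open>C\<close>.\<close>

definition functor_cat ::
  "('o1, 'a1, 'y) cat_scheme \<Rightarrow> ('o2, 'a2, 'z) cat_scheme \<Rightarrow>
   (('o1, 'a1, 'o2, 'a2) funct,
    ('o1, 'a1, 'o2, 'a2) funct \<times> ('o1, 'a1, 'o2, 'a2) funct \<times> ('o1 \<Rightarrow> 'a2)) cat" where
  "functor_cat C D = \<lparr>
     Obj = {F. is_functor C D F \<and> fobj F \<in> extensional (Obj C) \<and> farr F \<in> extensional (Arr C)},
     Arr = {(F, H, \<alpha>).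
       is_functor C D F \<and> fobj F \<in> extensional (Obj C) \<and> farr F \<in> extensional (Arr C) \<and>
       is_functor C D H \<and> fobj H \<in> extensional (Obj C) \<and> farr H \<in> extensional (Arr C) \<and>
       is_nat_trans C D F H \<alpha> \<and> \<alpha> \<in> extensional (Obj C)},
     Dom = (\<lambda>(F, H, \<alpha>). F),
     Cod = (\<lambda>(F, H, \<alpha>). H),
     Id = (\<lambda>F. (F, F, \<lambda>X\<in>Obj C. Id D (fobj F X))),
     Comp = (\<lambda>(H, K, \<beta>) (F, _, \<alpha>). (F, K, \<lambda>X\<in>Obj C. \<beta> X \<cdot>\<^bsub>D\<^esub> \<alpha> X))\<rparr>"

definition group_cat :: "('g, 'x) monoid_scheme \<Rightarrow> (unit, 'g) cat" where
  "group_cat G = \<lparr>Obj = {()}, Arr = carrier G, Dom = \<lambda>_. (), Cod = \<lambda>_. (),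
     Id = \<lambda>_. \<one>\<^bsub>G\<^esub>, Comp = \<lambda>x y. x \<otimes>\<^bsub>G\<^esub> y\<rparr>"


section \<open>Braided monoidal categories\<close>

text \<open>\<open>assoc X Y Z : (X \<odot> Y) \<odot> Z \<rightarrow> X \<odot> (Y \<odot> Z)\<close>, \<open>lunit X : I \<odot> X \<rightarrow> X\<close>,
  \<open>runit X : X \<odot> I \<rightarrow> X\<close>, \<open>braid X Y : X \<odot> Y \<rightarrow> Y \<odot> X\<close>.\<close>

record ('o, 'a) bmcat = "('o, 'a) cat" +
  tobj :: "'o \<Rightarrow> 'o \<Rightarrow> 'o"  (infixr "\<odot>\<index>" 75)
  tarr :: "'a \<Rightarrow> 'a \<Rightarrow> 'a"  (infixr "\<boxtimes>\<index>" 75)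
  tunit :: "'o"
  assoc :: "'o \<Rightarrow> 'o \<Rightarrow> 'o \<Rightarrow> 'a"
  lunit :: "'o \<Rightarrow> 'a"
  runit :: "'o \<Rightarrow> 'a"
  braid :: "'o \<Rightarrow> 'o \<Rightarrow> 'a"

locale monoidal_category = category B
  for B :: "('o, 'a, 'z) bmcat_scheme" (structure) +
  assumes tunit_Obj: "tunit B \<in> Obj B"
    and tobj_Obj: "X \<in> Obj B \<Longrightarrow> Y \<in> Obj B \<Longrightarrow> X \<odot> Y \<in> Obj B"
    and tarr_Hom: "f \<in> Hom B X Y \<Longrightarrow> g \<in> Hom B X' Y' \<Longrightarrow> f \<boxtimes> g \<in> Hom B (X \<odot> X') (Y \<odot> Y')"
    and tarr_Id: "X \<in> Obj B \<Longrightarrow> Y \<in> Obj B \<Longrightarrow> Id B X \<boxtimes> Id B Y = Id B (X \<odot> Y)"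
    and interchange: "f \<in> Hom B X Y \<Longrightarrow> g \<in> Hom B Y Z \<Longrightarrow> f' \<in> Hom B X' Y' \<Longrightarrow> g' \<in> Hom B Y' Z' \<Longrightarrow>
          (g \<cdot> f) \<boxtimes> (g' \<cdot> f') = (g \<boxtimes> g') \<cdot> (f \<boxtimes> f')"
    and assoc_Hom: "X \<in> Obj B \<Longrightarrow> Y \<in> Obj B \<Longrightarrow> Z \<in> Obj B \<Longrightarrow>
          assoc B X Y Z \<in> Hom B ((X \<odot> Y) \<odot> Z) (X \<odot> (Y \<odot> Z))"
    and assoc_iso: "X \<in> Obj B \<Longrightarrow> Y \<in> Obj B \<Longrightarrow> Z \<in> Obj B \<Longrightarrow> is_iso B (assoc B X Y Z)"
    and assoc_nat: "f \<in> Hom B X X' \<Longrightarrow> g \<in> Hom B Y Y' \<Longrightarrow> h \<in> Hom B Z Z' \<Longrightarrow>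
          assoc B X' Y' Z' \<cdot> ((f \<boxtimes> g) \<boxtimes> h) = (f \<boxtimes> (g \<boxtimes> h)) \<cdot> assoc B X Y Z"
    and lunit_Hom: "X \<in> Obj B \<Longrightarrow> lunit B X \<in> Hom B (tunit B \<odot> X) X"
    and lunit_iso: "X \<in> Obj B \<Longrightarrow> is_iso B (lunit B X)"
    and lunit_nat: "f \<in> Hom B X Y \<Longrightarrow> lunit B Y \<cdot> (Id B (tunit B) \<boxtimes> f) = f \<cdot> lunit B X"
    and runit_Hom: "X \<in> Obj B \<Longrightarrow> runit B X \<in> Hom B (X \<odot> tunit B) X"
    and runit_iso: "X \<in> Obj B \<Longrightarrow> is_iso B (runit B X)"
    and runit_nat: "f \<in> Hom B X Y \<Longrightarrow> runit B Y \<cdot> (f \<boxtimes> Id B (tunit B)) = f \<cdot> runit B X"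
    and triangle: "X \<in> Obj B \<Longrightarrow> Y \<in> Obj B \<Longrightarrow>
          (Id B X \<boxtimes> lunit B Y) \<cdot> assoc B X (tunit B) Y = runit B X \<boxtimes> Id B Y"
    and pentagon: "W \<in> Obj B \<Longrightarrow> X \<in> Obj B \<Longrightarrow> Y \<in> Obj B \<Longrightarrow> Z \<in> Obj B \<Longrightarrow>
          (Id B W \<boxtimes> assoc B X Y Z) \<cdot> assoc B W (X \<odot> Y) Z \<cdot> (assoc B W X Y \<boxtimes> Id B Z) =
          assoc B W X (Y \<odot> Z) \<cdot> assoc B (W \<odot> X) Y Z"

locale braided_monoidal_category = monoidal_category B
  for B :: "('o, 'a, 'z) bmcat_scheme" (structure) +
  assumes braid_Hom: "X \<in> Obj B \<Longrightarrow> Y \<in> Obj B \<Longrightarrow> braid B X Y \<in> Hom B (X \<odot> Y) (Y \<odot> X)"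
    and braid_iso: "X \<in> Obj B \<Longrightarrow> Y \<in> Obj B \<Longrightarrow> is_iso B (braid B X Y)"
    and braid_nat: "f \<in> Hom B X X' \<Longrightarrow> g \<in> Hom B Y Y' \<Longrightarrow>
          braid B X' Y' \<cdot> (f \<boxtimes> g) = (g \<boxtimes> f) \<cdot> braid B X Y"
    and hexagon1: "X \<in> Obj B \<Longrightarrow> Y \<in> Obj B \<Longrightarrow> Z \<in> Obj B \<Longrightarrow>
          assoc B Y Z X \<cdot> braid B X (Y \<odot> Z) \<cdot> assoc B X Y Z =
          (Id B Y \<boxtimes> braid B X Z) \<cdot> assoc B Y X Z \<cdot> (braid B X Y \<boxtimes> Id B Z)"
    and hexagon2: "X \<in> Obj B \<Longrightarrow> Y \<in> Obj B \<Longrightarrow> Z \<in> Obj B \<Longrightarrow>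
          inv_arr B (assoc B Z X Y) \<cdot> braid B (X \<odot> Y) Z \<cdot> inv_arr B (assoc B X Y Z) =
          (braid B X Z \<boxtimes> Id B Y) \<cdot> inv_arr B (assoc B X Z Y) \<cdot> (Id B X \<boxtimes> braid B Y Z)"

text \<open>The canonical (coherence) isomorphisms. If \<open>B\<close> is strict, that is, if its associators and
  unitors are identities, then the identities are the only canonical arrows.\<close>

inductive_set canonical :: "('o, 'a, 'z) bmcat_scheme \<Rightarrow> 'a set"
  for B :: "('o, 'a, 'z) bmcat_scheme" where
  can_Id: "X \<in> Obj B \<Longrightarrow> Id B X \<in> canonical B"
| can_assoc: "X \<in> Obj B \<Longrightarrow> Y \<in> Obj B \<Longrightarrow> Z \<in> Obj B \<Longrightarrow> assoc B X Y Z \<in> canonical B"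
| can_lunit: "X \<in> Obj B \<Longrightarrow> lunit B X \<in> canonical B"
| can_runit: "X \<in> Obj B \<Longrightarrow> runit B X \<in> canonical B"
| can_inverse: "f \<in> canonical B \<Longrightarrow> inverse_arrows B f g \<Longrightarrow> g \<in> canonical B"
| can_Comp: "f \<in> canonical B \<Longrightarrow> g \<in> canonical B \<Longrightarrow> Cod B f = Dom B g \<Longrightarrow>
    g \<cdot>\<^bsub>B\<^esub> f \<in> canonical B"
| can_tarr: "f \<in> canonical B \<Longrightarrow> g \<in> canonical B \<Longrightarrow> f \<boxtimes>\<^bsub>B\<^esub> g \<in> canonical B"


section \<open>Algebras of a PROB\<close>

record ('o1, 'a1, 'o2, 'a2) mfunct = "('o1, 'a1, 'o2, 'a2) funct" +
  fmult :: "'o1 \<Rightarrow> 'o1 \<Rightarrow> 'a2"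
  funit :: "'a2"

text \<open>Strictness is understood up to the coherence isomorphisms of the target: the structure arrows
  \<open>fobj F X \<odot> fobj F Y \<rightarrow> fobj F (X \<odot> Y)\<close> and \<open>tunit B \<rightarrow> fobj F (tunit T)\<close> have to be canonical.
  For a strict target they are therefore identities, and the conditions below say
  literally that \<open>F\<close> is a braided strict monoidal functor. For a non-strict target, on-the-nose
  preservation of the tensor product by a functor from a PROB would force
  equations between objects such as \<open>tunit B \<odot> tunit B = tunit B\<close>.\<close>

definition braided_strict_functor ::
  "('o1, 'a1, 'y) bmcat_scheme \<Rightarrow> ('o2, 'a2, 'z) bmcat_scheme \<Rightarrow>
   ('o1, 'a1, 'o2, 'a2) mfunct \<Rightarrow> bool" where
  "braided_strict_functor T B F \<longleftrightarrow>
     is_functor T B F \<and>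
     (\<forall>X\<in>Obj T. \<forall>Y\<in>Obj T. fmult F X Y \<in>
        Hom B (fobj F X \<odot>\<^bsub>B\<^esub> fobj F Y) (fobj F (X \<odot>\<^bsub>T\<^esub> Y)) \<inter> canonical B) \<and>
     funit F \<in> Hom B (tunit B) (fobj F (tunit T)) \<inter> canonical B \<and>
     (\<forall>f\<in>Arr T. \<forall>g\<in>Arr T.
        farr F (f \<boxtimes>\<^bsub>T\<^esub> g) \<cdot>\<^bsub>B\<^esub> fmult F (Dom T f) (Dom T g) =
        fmult F (Cod T f) (Cod T g) \<cdot>\<^bsub>B\<^esub> (farr F f \<boxtimes>\<^bsub>B\<^esub> farr F g)) \<and>
     (\<forall>X\<in>Obj T. \<forall>Y\<in>Obj T. \<forall>Z\<in>Obj T.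
        farr F (assoc T X Y Z) \<cdot>\<^bsub>B\<^esub> fmult F (X \<odot>\<^bsub>T\<^esub> Y) Z \<cdot>\<^bsub>B\<^esub> (fmult F X Y \<boxtimes>\<^bsub>B\<^esub> Id B (fobj F Z)) =
        fmult F X (Y \<odot>\<^bsub>T\<^esub> Z) \<cdot>\<^bsub>B\<^esub> (Id B (fobj F X) \<boxtimes>\<^bsub>B\<^esub> fmult F Y Z) \<cdot>\<^bsub>B\<^esub>
          assoc B (fobj F X) (fobj F Y) (fobj F Z)) \<and>
     (\<forall>X\<in>Obj T.
        farr F (lunit T X) \<cdot>\<^bsub>B\<^esub> fmult F (tunit T) X \<cdot>\<^bsub>B\<^esub> (funit F \<boxtimes>\<^bsub>B\<^esub> Id B (fobj F X)) =
        lunit B (fobj F X)) \<and>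
     (\<forall>X\<in>Obj T.
        farr F (runit T X) \<cdot>\<^bsub>B\<^esub> fmult F X (tunit T) \<cdot>\<^bsub>B\<^esub> (Id B (fobj F X) \<boxtimes>\<^bsub>B\<^esub> funit F) =
        runit B (fobj F X)) \<and>
     (\<forall>X\<in>Obj T. \<forall>Y\<in>Obj T.
        farr F (braid T X Y) \<cdot>\<^bsub>B\<^esub> fmult F X Y =
        fmult F Y X \<cdot>\<^bsub>B\<^esub> braid B (fobj F X) (fobj F Y))"

definition monoidal_nat_trans ::
  "('o1, 'a1, 'y) bmcat_scheme \<Rightarrow> ('o2, 'a2, 'z) bmcat_scheme \<Rightarrow>
   ('o1, 'a1, 'o2, 'a2) mfunct \<Rightarrow> ('o1, 'a1, 'o2, 'a2) mfunct \<Rightarrow> ('o1 \<Rightarrow> 'a2) \<Rightarrow> bool" where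
  "monoidal_nat_trans T B F H \<alpha> \<longleftrightarrow>
     is_nat_trans T B F H \<alpha> \<and>
     (\<forall>X\<in>Obj T. \<forall>Y\<in>Obj T.
        \<alpha> (X \<odot>\<^bsub>T\<^esub> Y) \<cdot>\<^bsub>B\<^esub> fmult F X Y = fmult H X Y \<cdot>\<^bsub>B\<^esub> (\<alpha> X \<boxtimes>\<^bsub>B\<^esub> \<alpha> Y)) \<and>
     \<alpha> (tunit T) \<cdot>\<^bsub>B\<^esub> funit F = funit H"

text \<open>For a PROB \<open>T\<close>: since every natural number is an object of \<open>T\<close>, only the action of functors
  on arrows has to be made extensional.\<close>

definition alg_obj ::
  "(nat, 'a1, 'y) bmcat_scheme \<Rightarrow> ('o2, 'a2, 'z) bmcat_scheme \<Rightarrow> (nat, 'a1, 'o2, 'a2) mfunct set" where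
  "alg_obj T B = {F. braided_strict_functor T B F \<and> farr F \<in> extensional (Arr T)}"

definition alg_cat ::
  "(nat, 'a1, 'y) bmcat_scheme \<Rightarrow> ('o2, 'a2, 'z) bmcat_scheme \<Rightarrow>
   ((nat, 'a1, 'o2, 'a2) mfunct,
    (nat, 'a1, 'o2, 'a2) mfunct \<times> (nat, 'a1, 'o2, 'a2) mfunct \<times> (nat \<Rightarrow> 'a2)) cat" where
  "alg_cat T B = \<lparr>
     Obj = alg_obj T B,
     Arr = {(F, H, \<alpha>). F \<in> alg_obj T B \<and> H \<in> alg_obj T B \<and> monoidal_nat_trans T B F H \<alpha>},
     Dom = (\<lambda>(F, H, \<alpha>). F),
     Cod = (\<lambda>(F, H, \<alpha>). H),
     Id = (\<lambda>F. (F, F, \<lambda>n. Id B (fobj F n))),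
     Comp = (\<lambda>(H, K, \<beta>) (F, _, \<alpha>). (F, K, \<lambda>n. \<beta> n \<cdot>\<^bsub>B\<^esub> \<alpha> n))\<rparr>"


section \<open>Bimonoids\<close>

record ('o, 'a) bimon =
  bobj :: "'o"
  bmult :: "'a"
  bunit :: "'a"
  bcomult :: "'a"
  bcounit :: "'a"

text \<open>\<open>(X \<odot> X) \<odot> (X \<odot> X) \<rightarrow> (X \<odot> X) \<odot> (X \<odot> X)\<close>, braiding the two middle factors\<close>

definition middle_braid :: "('o, 'a, 'z) bmcat_scheme \<Rightarrow> 'o \<Rightarrow> 'a" where
  "middle_braid B X =
     inv_arr B (assoc B X X (X \<odot>\<^bsub>B\<^esub> X)) \<cdot>\<^bsub>B\<^esub>
     (Id B X \<boxtimes>\<^bsub>B\<^esub> assoc B X X X) \<cdot>\<^bsub>B\<^esub>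
     (Id B X \<boxtimes>\<^bsub>B\<^esub> (braid B X X \<boxtimes>\<^bsub>B\<^esub> Id B X)) \<cdot>\<^bsub>B\<^esub>
     (Id B X \<boxtimes>\<^bsub>B\<^esub> inv_arr B (assoc B X X X)) \<cdot>\<^bsub>B\<^esub>
     assoc B X X (X \<odot>\<^bsub>B\<^esub> X)"

definition is_monoid :: "('o, 'a, 'z) bmcat_scheme \<Rightarrow> 'o \<Rightarrow> 'a \<Rightarrow> 'a \<Rightarrow> bool" where
  "is_monoid B X m u \<longleftrightarrow>
     X \<in> Obj B \<and> m \<in> Hom B (X \<odot>\<^bsub>B\<^esub> X) X \<and> u \<in> Hom B (tunit B) X \<and>
     m \<cdot>\<^bsub>B\<^esub> (m \<boxtimes>\<^bsub>B\<^esub> Id B X) = m \<cdot>\<^bsub>B\<^esub> (Id B X \<boxtimes>\<^bsub>B\<^esub> m) \<cdot>\<^bsub>B\<^esub> assoc B X X X \<and>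
     m \<cdot>\<^bsub>B\<^esub> (u \<boxtimes>\<^bsub>B\<^esub> Id B X) = lunit B X \<and>
     m \<cdot>\<^bsub>B\<^esub> (Id B X \<boxtimes>\<^bsub>B\<^esub> u) = runit B X"

definition is_comonoid :: "('o, 'a, 'z) bmcat_scheme \<Rightarrow> 'o \<Rightarrow> 'a \<Rightarrow> 'a \<Rightarrow> bool" where
  "is_comonoid B X d e \<longleftrightarrow>
     X \<in> Obj B \<and> d \<in> Hom B X (X \<odot>\<^bsub>B\<^esub> X) \<and> e \<in> Hom B X (tunit B) \<and>
     assoc B X X X \<cdot>\<^bsub>B\<^esub> (d \<boxtimes>\<^bsub>B\<^esub> Id B X) \<cdot>\<^bsub>B\<^esub> d = (Id B X \<boxtimes>\<^bsub>B\<^esub> d) \<cdot>\<^bsub>B\<^esub> d \<and>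
     lunit B X \<cdot>\<^bsub>B\<^esub> (e \<boxtimes>\<^bsub>B\<^esub> Id B X) \<cdot>\<^bsub>B\<^esub> d = Id B X \<and>
     runit B X \<cdot>\<^bsub>B\<^esub> (Id B X \<boxtimes>\<^bsub>B\<^esub> e) \<cdot>\<^bsub>B\<^esub> d = Id B X"

definition is_bimonoid :: "('o, 'a, 'z) bmcat_scheme \<Rightarrow> ('o, 'a) bimon \<Rightarrow> bool" where
  "is_bimonoid B X \<longleftrightarrow>
     is_monoid B (bobj X) (bmult X) (bunit X) \<and>
     is_comonoid B (bobj X) (bcomult X) (bcounit X) \<and>
     bcomult X \<cdot>\<^bsub>B\<^esub> bmult X =
       (bmult X \<boxtimes>\<^bsub>B\<^esub> bmult X) \<cdot>\<^bsub>B\<^esub> middle_braid B (bobj X) \<cdot>\<^bsub>B\<^esub> (bcomult X \<boxtimes>\<^bsub>B\<^esub> bcomult X) \<and>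
     bcomult X \<cdot>\<^bsub>B\<^esub> bunit X =
       (bunit X \<boxtimes>\<^bsub>B\<^esub> bunit X) \<cdot>\<^bsub>B\<^esub> inv_arr B (lunit B (tunit B)) \<and>
     bcounit X \<cdot>\<^bsub>B\<^esub> bmult X = lunit B (tunit B) \<cdot>\<^bsub>B\<^esub> (bcounit X \<boxtimes>\<^bsub>B\<^esub> bcounit X) \<and>
     bcounit X \<cdot>\<^bsub>B\<^esub> bunit X = Id B (tunit B)"

definition is_bimonoid_hom ::
  "('o, 'a, 'z) bmcat_scheme \<Rightarrow> ('o, 'a) bimon \<Rightarrow> ('o, 'a) bimon \<Rightarrow> 'a \<Rightarrow> bool" where
  "is_bimonoid_hom B X Y f \<longleftrightarrow>
     f \<in> Hom B (bobj X) (bobj Y) \<and>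
     f \<cdot>\<^bsub>B\<^esub> bmult X = bmult Y \<cdot>\<^bsub>B\<^esub> (f \<boxtimes>\<^bsub>B\<^esub> f) \<and>
     f \<cdot>\<^bsub>B\<^esub> bunit X = bunit Y \<and>
     bcomult Y \<cdot>\<^bsub>B\<^esub> f = (f \<boxtimes>\<^bsub>B\<^esub> f) \<cdot>\<^bsub>B\<^esub> bcomult X \<and>
     bcounit Y \<cdot>\<^bsub>B\<^esub> f = bcounit X"

definition bimon_cat ::
  "('o, 'a, 'z) bmcat_scheme \<Rightarrow>
   (('o, 'a) bimon, ('o, 'a) bimon \<times> ('o, 'a) bimon \<times> 'a) cat" where
  "bimon_cat B = \<lparr>
     Obj = {X. is_bimonoid B X},
     Arr = {(X, Y, f). is_bimonoid B X \<and> is_bimonoid B Y \<and> is_bimonoid_hom B X Y f},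
     Dom = (\<lambda>(X, Y, f). X),
     Cod = (\<lambda>(X, Y, f). Y),
     Id = (\<lambda>X. (X, X, Id B (bobj X))),
     Comp = (\<lambda>(Y, Z, g) (X, _, f). (X, Z, g \<cdot>\<^bsub>B\<^esub> f))\<rparr>"

abbreviation gbimon_cat where
  "gbimon_cat G B \<equiv> functor_cat (group_cat G) (bimon_cat B)"


section \<open>Braid groups and labelled braids\<close>

text \<open>Artin's presentation: the letter \<open>(i, True)\<close> is the generator crossing the strands in
  positions \<open>i\<close> and \<open>i + 1\<close>, and \<open>(i, False)\<close> is its inverse. In a product, and hence in a word,
  the rightmost factor comes first.\<close>

type_synonym bword = "(nat \<times> bool) list"

definition bwords :: "nat \<Rightarrow> bword set" where
  "bwords n = {w. \<forall>(i, s)\<in>set w. 1 \<le> i \<and> i < n}"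

inductive braid_eq :: "nat \<Rightarrow> bword \<Rightarrow> bword \<Rightarrow> bool" for n :: nat where
  refl: "w \<in> bwords n \<Longrightarrow> braid_eq n w w"
| sym: "braid_eq n v w \<Longrightarrow> braid_eq n w v"
| trans: "braid_eq n u v \<Longrightarrow> braid_eq n v w \<Longrightarrow> braid_eq n u w"
| cong: "u \<in> bwords n \<Longrightarrow> v \<in> bwords n \<Longrightarrow> braid_eq n w w' \<Longrightarrow> braid_eq n (u @ w @ v) (u @ w' @ v)"
| cancel: "1 \<le> i \<Longrightarrow> i < n \<Longrightarrow> braid_eq n [(i, s), (i, \<not> s)] []"
| artin: "1 \<le> i \<Longrightarrow> i + 1 < n \<Longrightarrow>
    braid_eq n [(i, True), (i + 1, True), (i, True)] [(i + 1, True), (i, True), (i + 1, True)]"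
| far: "1 \<le> i \<Longrightarrow> i + 1 < j \<Longrightarrow> j < n \<Longrightarrow>
    braid_eq n [(i, True), (j, True)] [(j, True), (i, True)]"

definition braid_class :: "nat \<Rightarrow> bword \<Rightarrow> bword set" where
  "braid_class n w = {w'. braid_eq n w w'}"

definition braid_group :: "nat \<Rightarrow> bword set monoid" where
  "braid_group n = \<lparr>carrier = braid_class n ` bwords n,
     mult = \<lambda>b' b. \<Union>w'\<in>b'. \<Union>w\<in>b. braid_class n (w' @ w),
     one = braid_class n []\<rparr>"

fun word_perm :: "bword \<Rightarrow> nat \<Rightarrow> nat" where
  "word_perm [] = id"
| "word_perm ((i, s) # w) = transpose i (Suc i) \<circ> word_perm w"

text \<open>The strand starting at position \<open>i\<close> ends at position \<open>braid_perm b i\<close>.\<close>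

definition braid_perm :: "bword set \<Rightarrow> nat \<Rightarrow> nat" where
  "braid_perm b = word_perm (SOME w. w \<in> b)"

type_synonym 'g lbraid = "(nat \<Rightarrow> 'g) \<times> bword set"

definition lbraid_group :: "('g, 'x) monoid_scheme \<Rightarrow> nat \<Rightarrow> 'g lbraid monoid" where
  "lbraid_group G n = \<lparr>
     carrier = ({1..n} \<rightarrow>\<^sub>E carrier G) \<times> carrier (braid_group n),
     mult = (\<lambda>(y, b') (x, b).
       (\<lambda>i\<in>{1..n}. y (braid_perm b i) \<otimes>\<^bsub>G\<^esub> x i, b' \<otimes>\<^bsub>braid_group n\<^esub> b)),
     one = (\<lambda>i\<in>{1..n}. \<one>\<^bsub>G\<^esub>, \<one>\<^bsub>braid_group n\<^esub>)\<rparr>"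

text \<open>The block of \<open>p\<close> strands in positions \<open>o + 1, \<dots>, o + p\<close> crosses the block of \<open>q\<close> strands to
  its right, every crossing having sign \<open>s\<close>.\<close>

definition block_word :: "nat \<Rightarrow> nat \<Rightarrow> nat \<Rightarrow> bool \<Rightarrow> bword" where
  "block_word off p q s =
     concat (map (\<lambda>i. map (\<lambda>j. (off + i + j, s)) (rev [0..<q])) [1..<Suc p])"

text \<open>Cabling: the strand starting at position \<open>i\<close> is replaced by \<open>k i\<close> parallel strands. The first
  argument of \<open>cable\<close> is the resulting total number of strands. The part \<open>w\<close> of the
  word \<open>l # w\<close> comes first, so that the strand at position \<open>j\<close> below the letter \<open>l\<close>
  is the one starting at position \<open>inv_into UNIV (word_perm w) j\<close>.\<close>

definition cable_letter :: "(nat \<Rightarrow> nat) \<Rightarrow> nat \<times> bool \<Rightarrow> bword" where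
  "cable_letter k l = (case l of (i, s) \<Rightarrow> block_word (\<Sum>j\<in>{1..<i}. k j) (k i) (k (Suc i)) s)"

fun cable_word :: "(nat \<Rightarrow> nat) \<Rightarrow> bword \<Rightarrow> bword" where
  "cable_word k [] = []"
| "cable_word k (l # w) = cable_letter (k \<circ> inv_into UNIV (word_perm w)) l @ cable_word k w"

definition cable :: "nat \<Rightarrow> (nat \<Rightarrow> nat) \<Rightarrow> bword set \<Rightarrow> bword set" where
  "cable N k b = (\<Union>w\<in>b. braid_class N (cable_word k w))"

definition braid_sum :: "nat \<Rightarrow> nat \<Rightarrow> bword set \<Rightarrow> bword set \<Rightarrow> bword set" where
  "braid_sum n n' b b' =
     (\<Union>w\<in>b. \<Union>w'\<in>b'. braid_class (n + n') (w @ map (\<lambda>(i, s). (n + i, s)) w'))"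

definition juxtapose :: "nat \<Rightarrow> nat \<Rightarrow> (nat \<Rightarrow> 'c) \<Rightarrow> (nat \<Rightarrow> 'c) \<Rightarrow> nat \<Rightarrow> 'c" where
  "juxtapose n n' x x' = (\<lambda>j\<in>{1..n + n'}. if j \<le> n then x j else x' (j - n))"

definition lbraid_sum :: "nat \<Rightarrow> nat \<Rightarrow> 'g lbraid \<Rightarrow> 'g lbraid \<Rightarrow> 'g lbraid" where
  "lbraid_sum n n' g g' =
     (juxtapose n n' (fst g) (fst g'), braid_sum n n' (snd g) (snd g'))"


section \<open>The PROB Q\<close>

definition D_hom :: "nat \<Rightarrow> nat \<Rightarrow> (nat \<Rightarrow> nat) set" where
  "D_hom n m = {\<phi> \<in> {1..n} \<rightarrow>\<^sub>E {1..m}. mono_on {1..n} \<phi>}"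

definition D_id :: "nat \<Rightarrow> nat \<Rightarrow> nat" where
  "D_id n = (\<lambda>i\<in>{1..n}. i)"

definition D_sum :: "nat \<Rightarrow> nat \<Rightarrow> nat \<Rightarrow> (nat \<Rightarrow> nat) \<Rightarrow> (nat \<Rightarrow> nat) \<Rightarrow> nat \<Rightarrow> nat" where
  "D_sum n n' m \<phi> \<phi>' = juxtapose n n' \<phi> (\<lambda>j. m + \<phi>' j)"

definition fibre_card :: "nat \<Rightarrow> (nat \<Rightarrow> nat) \<Rightarrow> nat \<Rightarrow> nat" where
  "fibre_card n \<phi> i = card {j \<in> {1..n}. \<phi> j = i}"

text \<open>\<open>push n m g \<phi>\<close> is $g_\star(\phi)$, and \<open>pull n \<phi> g\<close> is $\phi^\star(g)$.\<close>

definition push :: "nat \<Rightarrow> nat \<Rightarrow> 'g lbraid \<Rightarrow> (nat \<Rightarrow> nat) \<Rightarrow> nat \<Rightarrow> nat" where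
  "push n m g \<phi> = (THE \<psi>. \<psi> \<in> D_hom n m \<and>
     (\<forall>i\<in>{1..m}. fibre_card n \<psi> (braid_perm (snd g) i) = fibre_card n \<phi> i))"

definition pull :: "nat \<Rightarrow> (nat \<Rightarrow> nat) \<Rightarrow> 'g lbraid \<Rightarrow> 'g lbraid" where
  "pull n \<phi> g = (\<lambda>j\<in>{1..n}. fst g (\<phi> j), cable n (fibre_card n \<phi>) (snd g))"

record 'g qmor =
  qdom :: nat
  qcod :: nat
  qmap :: "nat \<Rightarrow> nat"
  qbr :: "'g lbraid"

definition q_of_map :: "('g, 'x) monoid_scheme \<Rightarrow> nat \<Rightarrow> nat \<Rightarrow> (nat \<Rightarrow> nat) \<Rightarrow> 'g qmor" where
  "q_of_map G n m \<phi> = \<lparr>qdom = n, qcod = m, qmap = \<phi>, qbr = \<one>\<^bsub>lbraid_group G n\<^esub>\<rparr>"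

definition q_of_braid :: "nat \<Rightarrow> 'g lbraid \<Rightarrow> 'g qmor" where
  "q_of_braid n g = \<lparr>qdom = n, qcod = n, qmap = D_id n, qbr = g\<rparr>"

definition block_braid :: "('g, 'x) monoid_scheme \<Rightarrow> nat \<Rightarrow> nat \<Rightarrow> 'g lbraid" where
  "block_braid G n m =
     (\<lambda>i\<in>{1..n + m}. \<one>\<^bsub>G\<^esub>, braid_class (n + m) (block_word 0 n m True))"

definition Q_prob :: "('g, 'x) monoid_scheme \<Rightarrow> (nat, 'g qmor) bmcat" where
  "Q_prob G = \<lparr>
     Obj = UNIV,
     Arr = {f. qmap f \<in> D_hom (qdom f) (qcod f) \<and> qbr f \<in> carrier (lbraid_group G (qdom f))},
     Dom = qdom,
     Cod = qcod,
     Id = (\<lambda>n. q_of_map G n n (D_id n)),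
     Comp = (\<lambda>f2 f1. \<lparr>
       qdom = qdom f1,
       qcod = qcod f2,
       qmap = compose {1..qdom f1} (qmap f2) (push (qdom f1) (qcod f1) (qbr f2) (qmap f1)),
       qbr = pull (qdom f1) (qmap f1) (qbr f2) \<otimes>\<^bsub>lbraid_group G (qdom f1)\<^esub> qbr f1\<rparr>),
     tobj = (+),
     tarr = (\<lambda>f f'. \<lparr>
       qdom = qdom f + qdom f',
       qcod = qcod f + qcod f',
       qmap = D_sum (qdom f) (qdom f') (qcod f) (qmap f) (qmap f'),
       qbr = lbraid_sum (qdom f) (qdom f') (qbr f) (qbr f')\<rparr>),
     tunit = 0,
     assoc = (\<lambda>n m k. q_of_map G (n + m + k) (n + m + k) (D_id (n + m + k))),
     lunit = (\<lambda>n. q_of_map G n n (D_id n)),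
     runit = (\<lambda>n. q_of_map G n n (D_id n)),
     braid = (\<lambda>n m. q_of_braid (n + m) (block_braid G n m))\<rparr>"


section \<open>Spans, cospans, and distributive laws\<close>

definition spans :: "('o, 'a, 'z) cat_scheme \<Rightarrow> ('a \<times> 'a) set" where
  "spans C = {(a, b). a \<in> Arr C \<and> b \<in> Arr C \<and> Dom C a = Dom C b}"

definition span_class :: "('o, 'a, 'z) cat_scheme \<Rightarrow> 'a \<Rightarrow> 'a \<Rightarrow> ('a \<times> 'a) set" where
  "span_class C a b = {(a \<cdot>\<^bsub>C\<^esub> k, b \<cdot>\<^bsub>C\<^esub> k) | k. is_iso C k \<and> Cod C k = Dom C a}"

definition cospans :: "('o, 'a, 'z) cat_scheme \<Rightarrow> ('a \<times> 'a) set" where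
  "cospans C = {(f, g). f \<in> Arr C \<and> g \<in> Arr C \<and> Cod C f = Cod C g}"

definition cospan_class :: "('o, 'a, 'z) cat_scheme \<Rightarrow> 'a \<Rightarrow> 'a \<Rightarrow> ('a \<times> 'a) set" where
  "cospan_class C f g = {(k \<cdot>\<^bsub>C\<^esub> f, k \<cdot>\<^bsub>C\<^esub> g) | k. is_iso C k \<and> Dom C k = Cod C f}"

text \<open>A distributive law over the groupoid of isomorphisms of \<open>Q\<close>, as a function from classes of
  cospans to classes of spans with the same outer objects: compatible with
  units, with the multiplications of \<open>Q\<close> and of its opposite, and with tensor products.
  Compatibility with the left and right actions of the isomorphisms (in particular
  of the braidings) is the case of the two multiplication axioms in which \<open>f1\<close> or \<open>g1\<close> is invertible,
  combined with the unit axioms.\<close>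

definition distributive_law ::
  "('o, 'a, 'z) bmcat_scheme \<Rightarrow> (('a \<times> 'a) set \<Rightarrow> ('a \<times> 'a) set) \<Rightarrow> bool" where
  "distributive_law Q L \<longleftrightarrow>
     (\<forall>f g. (f, g) \<in> cospans Q \<longrightarrow>
        (\<exists>a b. (a, b) \<in> spans Q \<and> Cod Q a = Dom Q f \<and> Cod Q b = Dom Q g \<and>
           L (cospan_class Q f g) = span_class Q a b)) \<and>
     (\<forall>f\<in>Arr Q. L (cospan_class Q f (Id Q (Cod Q f))) = span_class Q (Id Q (Dom Q f)) f) \<and>
     (\<forall>g\<in>Arr Q. L (cospan_class Q (Id Q (Cod Q g)) g) = span_class Q g (Id Q (Dom Q g))) \<and>
     (\<forall>f1 f2 g a1 b1 a2 b2.
        f1 \<in> Arr Q \<longrightarrow> Cod Q f1 = Dom Q f2 \<longrightarrow> (f2, g) \<in> cospans Q \<longrightarrow>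
        (a2, b2) \<in> L (cospan_class Q f2 g) \<longrightarrow>
        (a1, b1) \<in> L (cospan_class Q f1 a2) \<longrightarrow>
        L (cospan_class Q (f2 \<cdot>\<^bsub>Q\<^esub> f1) g) = span_class Q a1 (b2 \<cdot>\<^bsub>Q\<^esub> b1)) \<and>
     (\<forall>f g1 g2 a1 b1 a2 b2.
        g1 \<in> Arr Q \<longrightarrow> Cod Q g1 = Dom Q g2 \<longrightarrow> (f, g2) \<in> cospans Q \<longrightarrow>
        (a2, b2) \<in> L (cospan_class Q f g2) \<longrightarrow>
        (a1, b1) \<in> L (cospan_class Q b2 g1) \<longrightarrow>
        L (cospan_class Q f (g2 \<cdot>\<^bsub>Q\<^esub> g1)) = span_class Q (a2 \<cdot>\<^bsub>Q\<^esub> a1) b1) \<and>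
     (\<forall>f g f' g' a b a' b'.
        (f, g) \<in> cospans Q \<longrightarrow> (f', g') \<in> cospans Q \<longrightarrow>
        (a, b) \<in> L (cospan_class Q f g) \<longrightarrow>
        (a', b') \<in> L (cospan_class Q f' g') \<longrightarrow>
        L (cospan_class Q (f \<boxtimes>\<^bsub>Q\<^esub> f') (g \<boxtimes>\<^bsub>Q\<^esub> g')) = span_class Q (a \<boxtimes>\<^bsub>Q\<^esub> a') (b \<boxtimes>\<^bsub>Q\<^esub> b'))"

text \<open>The composite of \<open>Q\<close> with its opposite induced by \<open>L\<close>: a class of spans with legs
  \<open>a : p \<rightarrow> n\<close>, \<open>b : p \<rightarrow> m\<close> is an arrow from \<open>n\<close> to \<open>m\<close>.\<close>

definition span_prob ::
  "('o, 'a, 'z) bmcat_scheme \<Rightarrow> (('a \<times> 'a) set \<Rightarrow> ('a \<times> 'a) set) \<Rightarrow> ('o, ('a \<times> 'a) set) bmcat" where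
  "span_prob Q L = \<lparr>
     Obj = Obj Q,
     Arr = {span_class Q a b | a b. (a, b) \<in> spans Q},
     Dom = (\<lambda>S. THE n. \<exists>(a, b)\<in>S. Cod Q a = n),
     Cod = (\<lambda>S. THE m. \<exists>(a, b)\<in>S. Cod Q b = m),
     Id = (\<lambda>n. span_class Q (Id Q n) (Id Q n)),
     Comp = (\<lambda>S2 S1. \<Union>(a1, b1)\<in>S1. \<Union>(a2, b2)\<in>S2. \<Union>(a, b)\<in>L (cospan_class Q b1 a2).
       span_class Q (a1 \<cdot>\<^bsub>Q\<^esub> a) (b2 \<cdot>\<^bsub>Q\<^esub> b)),
     tobj = tobj Q,
     tarr = (\<lambda>S S'. \<Union>(a, b)\<in>S. \<Union>(a', b')\<in>S'. span_class Q (a \<boxtimes>\<^bsub>Q\<^esub> a') (b \<boxtimes>\<^bsub>Q\<^esub> b')),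
     tunit = tunit Q,
     assoc = (\<lambda>n m k. span_class Q (Id Q ((n \<odot>\<^bsub>Q\<^esub> m) \<odot>\<^bsub>Q\<^esub> k)) (assoc Q n m k)),
     lunit = (\<lambda>n. span_class Q (Id Q (tunit Q \<odot>\<^bsub>Q\<^esub> n)) (lunit Q n)),
     runit = (\<lambda>n. span_class Q (Id Q (n \<odot>\<^bsub>Q\<^esub> tunit Q)) (runit Q n)),
     braid = (\<lambda>n m. span_class Q (Id Q (n \<odot>\<^bsub>Q\<^esub> m)) (braid Q n m))\<rparr>"


section \<open>The PROB for G-equivariant bimonoids\<close>

definition q_m :: "('g, 'x) monoid_scheme \<Rightarrow> 'g qmor" where
  "q_m G = q_of_map G 2 1 (\<lambda>i\<in>{1..2}. 1)"

definition q_u :: "('g, 'x) monoid_scheme \<Rightarrow> 'g qmor" where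
  "q_u G = q_of_map G 0 1 (\<lambda>i\<in>{1..0}. 1)"

text \<open>the generator of the braid group on two strands, with trivial labels\<close>

definition q_sigma :: "('g, 'x) monoid_scheme \<Rightarrow> 'g qmor" where
  "q_sigma G = q_of_braid 2 (\<lambda>i\<in>{1..2}. \<one>\<^bsub>G\<^esub>, braid_class 2 [(1, True)])"

definition q_sigma23 :: "('g, 'x) monoid_scheme \<Rightarrow> 'g qmor" where
  "q_sigma23 G = Id (Q_prob G) 1 \<boxtimes>\<^bsub>Q_prob G\<^esub> q_sigma G \<boxtimes>\<^bsub>Q_prob G\<^esub> Id (Q_prob G) 1"

text \<open>In the third and fourth clauses, note that
  \<open>g \<circ> \<phi> = push n m g \<phi> \<circ> pull n \<phi> g\<close> in \<open>Q\<close>; thus the cospan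
  with legs \<open>push n m g \<phi>\<close> and \<open>g\<close> is completed to a commutative square by the legs
  \<open>pull n \<phi> g\<close> and \<open>\<phi>\<close>. With \<open>\<phi>\<close> and \<open>push n m g \<phi>\<close> interchanged these clauses would be
  incompatible with passing to equivalence classes as soon as \<open>g\<close> has a permutation
  that is not an involution.\<close>

definition bimonoid_law ::
  "('g, 'x) monoid_scheme \<Rightarrow> (('g qmor \<times> 'g qmor) set \<Rightarrow> ('g qmor \<times> 'g qmor) set) \<Rightarrow> bool" where
  "bimonoid_law G L \<longleftrightarrow>
     distributive_law (Q_prob G) L \<and>
     (\<forall>n. \<forall>g\<in>carrier (lbraid_group G n). \<forall>h\<in>carrier (lbraid_group G n).
        L (cospan_class (Q_prob G) (q_of_braid n g) (q_of_braid n h)) =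
        span_class (Q_prob G)
          (q_of_braid n (inv\<^bsub>lbraid_group G n\<^esub> g)) (q_of_braid n (inv\<^bsub>lbraid_group G n\<^esub> h))) \<and>
     (\<forall>n m. \<forall>\<phi>\<in>D_hom n m. \<forall>g\<in>carrier (lbraid_group G m).
        L (cospan_class (Q_prob G) (q_of_map G n m (push n m g \<phi>)) (q_of_braid m g)) =
        span_class (Q_prob G) (q_of_braid n (pull n \<phi> g)) (q_of_map G n m \<phi>)) \<and>
     (\<forall>n m. \<forall>\<phi>\<in>D_hom n m. \<forall>g\<in>carrier (lbraid_group G m).
        L (cospan_class (Q_prob G) (q_of_braid m g) (q_of_map G n m (push n m g \<phi>))) =
        span_class (Q_prob G) (q_of_map G n m \<phi>) (q_of_braid n (pull n \<phi> g))) \<and>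
     L (cospan_class (Q_prob G) (q_m G) (q_m G)) =
       span_class (Q_prob G)
         ((q_m G \<boxtimes>\<^bsub>Q_prob G\<^esub> q_m G) \<cdot>\<^bsub>Q_prob G\<^esub> q_sigma23 G)
         (q_m G \<boxtimes>\<^bsub>Q_prob G\<^esub> q_m G) \<and>
     L (cospan_class (Q_prob G) (q_u G) (q_u G)) =
       span_class (Q_prob G) (Id (Q_prob G) 0) (Id (Q_prob G) 0) \<and>
     L (cospan_class (Q_prob G) (q_m G) (q_u G)) =
       span_class (Q_prob G) (q_u G \<boxtimes>\<^bsub>Q_prob G\<^esub> q_u G) (Id (Q_prob G) 0) \<and>
     L (cospan_class (Q_prob G) (q_u G) (q_m G)) =
       span_class (Q_prob G) (Id (Q_prob G) 0) (q_u G \<boxtimes>\<^bsub>Q_prob G\<^esub> q_u G)"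

text \<open>A law as above exists and its values on classes of cospans are determined, so
  the choice only concerns irrelevant arguments of the function.\<close>

definition bimonoid_prob ::
  "('g, 'x) monoid_scheme \<Rightarrow> (nat, ('g qmor \<times> 'g qmor) set) bmcat" where
  "bimonoid_prob G = span_prob (Q_prob G) (SOME L. bimonoid_law G L)"

end

(*
  An arrow of Q is an order-preserving map after a labelled braid, so a cospan in Q reduces to one whose
  second leg is a map with fibre sizes ks. The tensor powers of the generating monoid are monoids again;
  hence Q acts on objects coloured by such powers, and pulling an arrow f back along that map is the value
  of this action on f at the colours ks. This gives the distributive law.

  The arrows of the composite PROB T are composites of a forward and a backward arrow of Q, so T is generated
  by a monoid, a comonoid, the labels and the braiding. The rule for (m, m) makes these a bimonoid for the
  reverse braiding; the comultiplication composed with the braiding is compatible with the given one.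
  A T-algebra is determined by a strict functor from T to the strictification K of the powers of its value
  at 1, and conversely a G-bimonoid defines such a functor because the bimonoid axioms propagate along the
  distributive law. Evaluation at 1 is therefore fully faithful and essentially surjective.
*)

theory Submission
  imports Defs "HOL-Library.Multiset"
begin

text \<open>Two obstacles shape the proof. Composition in \<open>Q\<close> cables braids, so
  associativity in \<open>Q\<close> and multiplicativity of the law threaten to become computations
  with cabled words. Colouring avoids them: a braid word has a value in every strict braided
  category with an object for each colour, invariance under the braid relations is proved once at
  that level, and cabling is the value in the category of braids itself. With monoids in place of
  objects the same device gives \<open>pull_back\<close>, and compatibility of the law with
  composites in its second leg says that powers of powers are powers. The other obstacle is the sign
  of the braiding: left legs of spans act contravariantly, so the \<open>q_sigma23\<close> in the
  left leg of the rule for two multiplications acts as an inverse crossing. The study of spans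
  allows any \<open>L\<close> with \<open>bimonoid_law G L\<close>; the explicit law shows that the
  choice in \<open>bimonoid_prob\<close> is made from a nonempty set. No coherence theorem for
  \<open>B\<close> is invoked: the three equations in the locale \<open>powers\<close> take its
  place.\<close>

no_notation (ASCII) comp  (infixl "o" 55)
notation Comp  ("_ o\<index> _" [71, 70] 70) and tarr  (infixr "**\<index>" 75)

section \<open>Fully faithful and essentially surjective functors are equivalences\<close>

section \<open>Equivalences of categories\<close>

context category
begin

lemma HomI: "f \<in> Arr C ==> f \<in> Hom C (Dom C f) (Cod C f)"
  by (simp add: Hom_def)

lemma HomD: "f \<in> Hom C X Y ==> f \<in> Arr C \<and> Dom C f = X \<and> Cod C f = Y \<and> X \<in> Obj C \<and> Y \<in> Obj C"
  using Dom_Obj Cod_Obj by (auto simp: Hom_def)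

text \<open>The side conditions are equations between \<open>Dom\<close> and \<open>Cod\<close>,
  which the simplifier proves by rewriting; with \<open>Hom\<close> it would have to guess the
  intermediate objects.\<close>

lemma comp_arr: "f \<in> Arr C ==> g \<in> Arr C ==> Cod C f = Dom C g ==> g o f \<in> Arr C"
  and comp_dom: "f \<in> Arr C ==> g \<in> Arr C ==> Cod C f = Dom C g ==> Dom C (g o f) = Dom C f"
  and comp_cod: "f \<in> Arr C ==> g \<in> Arr C ==> Cod C f = Dom C g ==> Cod C (g o f) = Cod C g"
  using Comp_Hom[of f "Dom C f" "Cod C f" g "Cod C g"] by (auto simp: Hom_def)

lemma comp_assoc: "f \<in> Arr C ==> g \<in> Arr C ==> h \<in> Arr C ==> Cod C f = Dom C g ==> Cod C g = Dom C h ==>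
    (h o g) o f = h o g o f"
  using Comp_assoc[of f "Dom C f" "Cod C f" g "Cod C g" h "Cod C h"] by (simp add: Hom_def)

lemma comp_id_left: "f \<in> Arr C ==> Cod C f = X ==> Id C X o f = f"
  and comp_id_right: "f \<in> Arr C ==> Dom C f = X ==> f o Id C X = f"
  using Comp_Id_left[of f "Dom C f"] Comp_Id_right[of f _ "Cod C f"] by (auto simp: Hom_def)

lemma inverse_arrows_unique:
  assumes "inverse_arrows C f g" "inverse_arrows C f g'"
  shows "g = g'"
proof -
  have f: "f \<in> Hom C (Dom C f) (Cod C f)" and g: "g \<in> Hom C (Cod C f) (Dom C f)"
    and g': "g' \<in> Hom C (Cod C f) (Dom C f)"
    using assms by (auto simp: inverse_arrows_def HomI)
  have "g = (g' o f) o g" using assms g Comp_Id_left by (simp add: inverse_arrows_def)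
  also have "... = g' o (f o g)" using Comp_assoc[OF g f g'] .
  also have "... = g'" using assms g' Comp_Id_right by (simp add: inverse_arrows_def)
  finally show ?thesis .
qed

lemma inverse_arrows_inv_arr: "is_iso C f ==> inverse_arrows C f (inv_arr C f)"
  unfolding is_iso_def inv_arr_def by (rule theI') (use inverse_arrows_unique in blast)

lemma inv_arr_eq: "inverse_arrows C f g ==> inv_arr C f = g"
  using inverse_arrows_unique[OF inverse_arrows_inv_arr, of f g] by (auto simp: is_iso_def)

lemma inverse_arrows_sym: "inverse_arrows C f g ==> inverse_arrows C g f"
  using HomI by (auto simp: inverse_arrows_def Hom_def)

lemma inverse_arrows_Id: "X \<in> Obj C ==> inverse_arrows C (Id C X) (Id C X)"
  using Id_Hom[of X] Comp_Id_left[of "Id C X" X X] by (auto simp: inverse_arrows_def Hom_def)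

lemma inverse_arrows_Comp:
  assumes "inverse_arrows C f f'" "inverse_arrows C g g'" "Cod C f = Dom C g"
  shows "inverse_arrows C (g o f) (f' o g')"
proof -
  define X Y Z where "X = Dom C f" and "Y = Dom C g" and "Z = Cod C g"
  have f: "f \<in> Hom C X Y" and g: "g \<in> Hom C Y Z" and f': "f' \<in> Hom C Y X" and g': "g' \<in> Hom C Z Y"
    using assms by (auto simp: inverse_arrows_def Hom_def X_def Y_def Z_def)
  have e: "f' o f = Id C X" "f o f' = Id C Y" "g' o g = Id C Y" "g o g' = Id C Z"
    using assms by (auto simp: inverse_arrows_def X_def Y_def Z_def)
  have "(f' o g') o (g o f) = f' o (g' o g) o f"
    using f g f' g' by (simp add: Hom_def comp_arr comp_dom comp_cod comp_assoc)
  also have "... = Id C X" using e f Comp_Id_left by simp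
  finally have 1: "(f' o g') o (g o f) = Id C X" .
  have "(g o f) o (f' o g') = g o (f o f') o g'"
    using f g f' g' by (simp add: Hom_def comp_arr comp_dom comp_cod comp_assoc)
  also have "... = Id C Z" using e g' Comp_Id_left by simp
  finally show ?thesis using 1 Comp_Hom[OF f g] Comp_Hom[OF g' f']
    by (auto simp: inverse_arrows_def Hom_def)
qed

lemma iso_HomI: "f \<in> Hom C X Y ==> g \<in> Hom C Y X ==> g o f = Id C X ==> f o g = Id C Y ==> inverse_arrows C f g"
  by (auto simp: inverse_arrows_def Hom_def)

end

lemma functor_Hom:
  "is_functor C D F ==> f \<in> Hom C X Y ==> farr F f \<in> Hom D (fobj F X) (fobj F Y)"
  by (auto simp: is_functor_def Hom_def)

lemma functor_Comp:
  "is_functor C D F ==> f \<in> Hom C X Y ==> g \<in> Hom C Y Z ==> farr F (g o\<^bsub>C\<^esub> f) = farr F g o\<^bsub>D\<^esub> farr F f"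
  by (auto simp: is_functor_def Hom_def)

text \<open>The inverse functor is built by choice: an object \<open>R Y\<close> with an isomorphism
  to \<open>Y\<close>, and for each arrow a preimage of its conjugate. Equations in \<open>C\<close>
  are proved after applying \<open>F\<close>, by faithfulness.\<close>

theorem equivalent_categoriesI:
  fixes C and D (structure) and F :: "('o1, 'a1, 'o2, 'a2) funct"
  assumes C: "category C" and D: "category D" and F: "is_functor C D F"
    and faithful: "\<And>X Y f g. f \<in> Hom C X Y ==> g \<in> Hom C X Y ==> farr F f = farr F g ==> f = g"
    and full: "\<And>X Y h. X \<in> Obj C ==> Y \<in> Obj C ==> h \<in> Hom D (fobj F X) (fobj F Y) ==>
        \<exists>f\<in>Hom C X Y. farr F f = h"
    and ess: "\<And>Y. Y \<in> Obj D ==> \<exists>X\<in>Obj C. \<exists>e e'. e \<in> Hom D (fobj F X) Y \<and> inverse_arrows D e e'"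
  shows "equivalent_categories C D"
proof -
  interpret C: category C by fact
  interpret D: category D by fact
  obtain R e e' where R: "\<And>Y. Y \<in> Obj D ==> R Y \<in> Obj C \<and> e Y \<in> Hom D (fobj F (R Y)) Y \<and> inverse_arrows D (e Y) (e' Y)"
    using ess by metis
  have e': "e' Y \<in> Hom D Y (fobj F (R Y))" "e' Y o e Y = Id D (fobj F (R Y))" "e Y o e' Y = Id D Y" if "Y \<in> Obj D" for Y
    using R[OF that] by (auto simp: inverse_arrows_def Hom_def)
  note F_Obj = C.Dom_Obj C.Cod_Obj F[unfolded is_functor_def]
  define S where "S X Y h = (SOME f. f \<in> Hom C X Y \<and> farr F f = h)" for X Y h
  have S: "S X Y h \<in> Hom C X Y" "farr F (S X Y h) = h" if "X \<in> Obj C" "Y \<in> Obj C" "h \<in> Hom D (fobj F X) (fobj F Y)" for X Y h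
    using someI_ex[of "\<lambda>f. f \<in> Hom C X Y \<and> farr F f = h"] full[OF that] by (auto simp: S_def)
  \<comment> \<open>Conjugation by the chosen isomorphisms moves \<open>h\<close> between objects in
    the image of \<open>F\<close>, where fullness applies.\<close>
  define Hf where "Hf h = S (R (Dom D h)) (R (Cod D h)) (e' (Cod D h) o h o e (Dom D h))" for h
  define H where "H = \<lparr>fobj = R, farr = Hf\<rparr>"
  have Hf: "Hf h \<in> Hom C (R X) (R Y)" "farr F (Hf h) = e' Y o h o e X" if "h \<in> Hom D X Y" for h X Y
  proof -
    have XY: "X \<in> Obj D" "Y \<in> Obj D" "Dom D h = X" "Cod D h = Y" using D.HomD[OF that] by auto
    have "e' Y o h o e X \<in> Hom D (fobj F (R X)) (fobj F (R Y))"
      using XY R e' that D.Comp_Hom by meson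
    thus "Hf h \<in> Hom C (R X) (R Y)" "farr F (Hf h) = e' Y o h o e X"
      using S[of "R X" "R Y"] R XY by (auto simp: Hf_def)
  qed
  have HfComp: "Hf (g o f) = Hf g o\<^bsub>C\<^esub> Hf f" if f: "f \<in> Hom D X Y" and g: "g \<in> Hom D Y Z" for f g X Y Z
  proof (rule faithful)
    have XYZ: "X \<in> Obj D" "Y \<in> Obj D" "Z \<in> Obj D" using D.HomD[OF f] D.HomD[OF g] by auto
    show "Hf (g o f) \<in> Hom C (R X) (R Z)" using Hf(1)[OF D.Comp_Hom[OF f g]] .
    show "Hf g o\<^bsub>C\<^esub> Hf f \<in> Hom C (R X) (R Z)" using C.Comp_Hom[OF Hf(1)[OF f] Hf(1)[OF g]] .
    have "farr F (Hf g o\<^bsub>C\<^esub> Hf f) = (e' Z o g o e Y) o (e' Y o f o e X)"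
      using functor_Comp[OF F Hf(1)[OF f] Hf(1)[OF g]] Hf(2)[OF f] Hf(2)[OF g] by simp
    also have "... = e' Z o g o (e Y o e' Y) o f o e X"
      using f g R[OF XYZ(1)] R[OF XYZ(2)] e'(1)[OF XYZ(2)] e'(1)[OF XYZ(3)]
      by (simp add: Hom_def D.comp_arr D.comp_dom D.comp_cod D.comp_assoc)
    also have "... = e' Z o g o f o e X"
      using e'(3)[OF XYZ(2)] f g R[OF XYZ(1)]
      by (simp add: Hom_def D.comp_arr D.comp_dom D.comp_cod D.comp_id_left)
    also have "... = farr F (Hf (g o f))"
      using Hf(2)[OF D.Comp_Hom[OF f g]] D.Comp_assoc[of "e X" "fobj F (R X)" X f Y g Z] R[OF XYZ(1)] f g by simp
    finally show "farr F (Hf (g o f)) = farr F (Hf g o\<^bsub>C\<^esub> Hf f)" by simp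
  qed
  have HfId: "Hf (Id D Y) = Id C (R Y)" if Y: "Y \<in> Obj D" for Y
  proof (rule faithful)
    show "Hf (Id D Y) \<in> Hom C (R Y) (R Y)" using Hf(1)[OF D.Id_Hom[OF Y]] .
    show "Id C (R Y) \<in> Hom C (R Y) (R Y)" using C.Id_Hom R[OF Y] by simp
    have "farr F (Hf (Id D Y)) = e' Y o e Y"
      using Hf(2)[OF D.Id_Hom[OF Y]] D.Comp_Id_left R[OF Y] by fastforce
    thus "farr F (Hf (Id D Y)) = farr F (Id C (R Y))" using F R[OF Y] e'[OF Y] by (simp add: is_functor_def)
  qed
  have HfComp': "Hf (g o f) = Hf g o\<^bsub>C\<^esub> Hf f" if "f \<in> Arr D" "g \<in> Arr D" "Cod D f = Dom D g" for f g
    using HfComp[of f "Dom D f" "Cod D f" g "Cod D g"] that by (simp add: Hom_def)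
  have H: "is_functor D C H"
    unfolding is_functor_def using R Hf(1)[OF D.HomI] HfId HfComp' by (simp add: H_def)
  \<comment> \<open>\<open>eta X\<close> is the preimage of the inverse isomorphism at
    \<open>fobj F X\<close>; the counit is \<open>e\<close> itself.\<close>
  define eta where "eta X = S X (R (fobj F X)) (e' (fobj F X))" for X
  have eta: "eta X \<in> Hom C X (R (fobj F X))" "farr F (eta X) = e' (fobj F X)" if "X \<in> Obj C" for X
    using S[of X "R (fobj F X)" "e' (fobj F X)"] that F R e' by (auto simp: eta_def is_functor_def)
  have etanat: "eta Y o\<^bsub>C\<^esub> f = Hf (farr F f) o\<^bsub>C\<^esub> eta X" if f: "f \<in> Hom C X Y" for f X Y
  proof (rule faithful)
    have XY: "X \<in> Obj C" "Y \<in> Obj C" "fobj F X \<in> Obj D" "fobj F Y \<in> Obj D"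
      using C.HomD[OF f] F by (auto simp: is_functor_def)
    have Ff: "farr F f \<in> Hom D (fobj F X) (fobj F Y)" using functor_Hom[OF F f] .
    show "eta Y o\<^bsub>C\<^esub> f \<in> Hom C X (R (fobj F Y))" using C.Comp_Hom[OF f eta(1)] XY by simp
    show "Hf (farr F f) o\<^bsub>C\<^esub> eta X \<in> Hom C X (R (fobj F Y))" using C.Comp_Hom[OF eta(1) Hf(1)[OF Ff]] XY by simp
    have "farr F (Hf (farr F f) o\<^bsub>C\<^esub> eta X) = (e' (fobj F Y) o farr F f o e (fobj F X)) o e' (fobj F X)"
      using functor_Comp[OF F eta(1) Hf(1)[OF Ff]] Hf(2)[OF Ff] eta(2) XY by simp
    also have "... = e' (fobj F Y) o farr F f o (e (fobj F X) o e' (fobj F X))"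
      using Ff R[OF XY(3)] e'(1)[OF XY(3)] e'(1)[OF XY(4)]
      by (simp add: Hom_def D.comp_arr D.comp_dom D.comp_cod D.comp_assoc)
    also have "... = e' (fobj F Y) o farr F f" using e' XY D.Comp_Id_right[OF Ff] by simp
    also have "... = farr F (eta Y o\<^bsub>C\<^esub> f)" using functor_Comp[OF F f eta(1)] eta(2) XY by simp
    finally show "farr F (eta Y o\<^bsub>C\<^esub> f) = farr F (Hf (farr F f) o\<^bsub>C\<^esub> eta X)" by simp
  qed
  have etaiso: "is_iso C (eta X)" if X: "X \<in> Obj C" for X
  proof -
    have FX: "fobj F X \<in> Obj D" using X F by (simp add: is_functor_def)
    have RX: "R (fobj F X) \<in> Obj C" using R FX by simp
    obtain g where g: "g \<in> Hom C (R (fobj F X)) X" "farr F g = e (fobj F X)"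
      using full[OF RX X, of "e (fobj F X)"] R[OF FX] by auto
    have "g o\<^bsub>C\<^esub> eta X = Id C X"
      using functor_Comp[OF F eta(1)[OF X] g(1)] g(2) eta(2)[OF X] e'(3)[OF FX] F X
        C.Comp_Hom[OF eta(1)[OF X] g(1)] C.Id_Hom[OF X]
      by (intro faithful[of _ X X]) (simp_all add: is_functor_def)
    moreover have "eta X o\<^bsub>C\<^esub> g = Id C (R (fobj F X))"
      using functor_Comp[OF F g(1) eta(1)[OF X]] g(2) eta(2)[OF X] e'(2)[OF FX] F RX
        C.Comp_Hom[OF g(1) eta(1)[OF X]] C.Id_Hom[OF RX]
      by (intro faithful[of _ "R (fobj F X)" "R (fobj F X)"]) (simp_all add: is_functor_def)
    ultimately show ?thesis using C.iso_HomI[OF eta(1)[OF X] g(1)] by (auto simp: is_iso_def)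
  qed
  have "is_nat_iso C C id_funct (comp_funct H F) eta"
    using eta etanat[OF C.HomI] etaiso by (simp add: is_nat_iso_def is_nat_trans_def id_funct_def comp_funct_def H_def)
  moreover have "is_nat_iso D D (comp_funct F H) id_funct e"
  proof -
    have "e Y o farr F (Hf f) = f o e X" if f: "f \<in> Hom D X Y" for f X Y
    proof -
      have XY: "X \<in> Obj D" "Y \<in> Obj D" using D.HomD[OF f] by auto
      have "e Y o farr F (Hf f) = (e Y o e' Y) o f o e X"
        unfolding Hf(2)[OF f] using f R[OF XY(1)] R[OF XY(2)] e'(1)[OF XY(2)]
        by (simp add: Hom_def D.comp_arr D.comp_dom D.comp_cod D.comp_assoc)
      thus ?thesis using e'(3)[OF XY(2)] R[OF XY(1)] f
        by (simp add: Hom_def D.comp_arr D.comp_dom D.comp_cod D.comp_id_left)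
    qed
    from this[OF D.HomI] show ?thesis
      using R by (auto simp: is_nat_iso_def is_nat_trans_def id_funct_def comp_funct_def H_def is_iso_def)
  qed
  ultimately show ?thesis using F H unfolding equivalent_categories_def by blast
qed

section \<open>Calculus in strict braided categories, their opposites and their reverses\<close>

section \<open>Strict braided categories on the natural numbers\<close>

text \<open>Since addition of objects is associative with unit \<open>0\<close> on the nose,
  strictness can be stated by equations between arrows such as \<open>ten_assoc\<close>;
  \<open>hex1\<close> and \<open>hex2\<close> are the hexagons with identity associators.\<close>

locale prob = category C
  for C :: "(nat, 'a, 'z) bmcat_scheme" (structure) +
  assumes obj_UNIV: "Obj C = UNIV"
    and tobj_add: "n \<odot> m = n + m"
    and tunit_0: "tunit C = 0"
    and ten_arr [simp]: "f \<in> Arr C ==> g \<in> Arr C ==> f**g \<in> Arr C"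
    and ten_dom [simp]: "f \<in> Arr C ==> g \<in> Arr C ==> Dom C (f**g) = Dom C f + Dom C g"
    and ten_cod [simp]: "f \<in> Arr C ==> g \<in> Arr C ==> Cod C (f**g) = Cod C f + Cod C g"
    and ten_id: "Id C n**Id C m = Id C (n + m)"
    and ten_comp: "f \<in> Arr C ==> f' \<in> Arr C ==> g \<in> Arr C ==> g' \<in> Arr C ==>
        Cod C f = Dom C g ==> Cod C f' = Dom C g' ==> (g**g') o (f**f') = (g o f)**(g' o f')"
    and ten_assoc: "f \<in> Arr C ==> g \<in> Arr C ==> h \<in> Arr C ==> (f**g)**h = f**g**h"
    and ten_unit_left [simp]: "f \<in> Arr C ==> Id C 0**f = f"
    and ten_unit_right [simp]: "f \<in> Arr C ==> f**Id C 0 = f"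
    and braid_hom: "braid C n m \<in> Hom C (n + m) (m + n)"
    and braid_invertible: "is_iso C (braid C n m)"
    and braid_nat: "f \<in> Arr C ==> g \<in> Arr C ==>
        braid C (Cod C f) (Cod C g) o (f**g) = (g**f) o braid C (Dom C f) (Dom C g)"
    and hex1: "braid C n (m + k) = (Id C m**braid C n k) o (braid C n m**Id C k)"
    and hex2: "braid C (n + m) k = (braid C n k**Id C m) o (Id C n**braid C m k)"

definition binv :: "(nat, 'a, 'z) bmcat_scheme => nat => nat => 'a" where
  "binv C n m = inv_arr C (braid C n m)"

context prob
begin

declare comp_arr [simp] comp_dom [simp] comp_cod [simp] comp_id_left [simp] comp_id_right [simp]

lemma id_arr [simp]: "Id C n \<in> Arr C" and id_dom [simp]: "Dom C (Id C n) = n" and id_cod [simp]: "Cod C (Id C n) = n"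
  using Id_Hom[of n] by (auto simp: Hom_def obj_UNIV)

lemma braid_arr [simp]: "braid C n m \<in> Arr C" and braid_dom [simp]: "Dom C (braid C n m) = n + m"
  and braid_cod [simp]: "Cod C (braid C n m) = m + n"
  using braid_hom[of n m] by (auto simp: Hom_def)

lemma inverse_braid: "inverse_arrows C (braid C n m) (binv C n m)"
  unfolding binv_def using inverse_arrows_inv_arr[OF braid_invertible] .

lemma binv_arr [simp]: "binv C n m \<in> Arr C" and binv_dom [simp]: "Dom C (binv C n m) = m + n"
  and binv_cod [simp]: "Cod C (binv C n m) = n + m"
  and binv_braid [simp]: "binv C n m o braid C n m = Id C (n + m)"
  and braid_binv [simp]: "braid C n m o binv C n m = Id C (m + n)"
  using inverse_braid[of n m] by (auto simp: inverse_arrows_def Hom_def)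

lemma inverse_unique_right:
  assumes "f \<in> Arr C" "g \<in> Arr C" "h \<in> Arr C" "Dom C g = Cod C f" "Dom C h = Cod C f" "Cod C h = Dom C f"
    "g o f = Id C (Dom C f)" "f o h = Id C (Cod C f)"
  shows "g = h"
proof -
  have gd: "Cod C g = Dom C f" using assms(1,2,4,7) comp_cod[of f g] by simp
  have "g = g o (f o h)" using assms gd by simp
  also have "... = (g o f) o h" using assms by (subst comp_assoc) auto
  also have "... = h" using assms by simp
  finally show ?thesis .
qed

lemma ten_comp_assoc: "f \<in> Arr C ==> f' \<in> Arr C ==> g \<in> Arr C ==> g' \<in> Arr C ==> h \<in> Arr C ==>
    Cod C f = Dom C g ==> Cod C f' = Dom C g' ==> Cod C h = Dom C f + Dom C f' ==>
    (g**g') o (f**f') o h = ((g o f)**(g' o f')) o h"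
  by (subst ten_comp[symmetric]) (auto simp: comp_assoc)

lemma ten_split: "f \<in> Arr C ==> g \<in> Arr C ==> f**g = (f**Id C (Cod C g)) o (Id C (Dom C f)**g)"
  by (simp_all add: ten_comp)

lemma cancel_left:
  assumes "inverse_arrows C k k'" "f \<in> Arr C" "g \<in> Arr C" "Cod C f = Dom C k" "Cod C g = Dom C k" "k o f = k o g"
  shows "f = g"
proof -
  have k: "k \<in> Arr C" "k' \<in> Arr C" "Dom C k' = Cod C k" "Cod C k' = Dom C k" "k' o k = Id C (Dom C k)"
    using assms(1) by (auto simp: inverse_arrows_def Hom_def)
  have "(k' o k) o f = k' o k o f" using assms k by (intro comp_assoc) auto
  also have "... = (k' o k) o g" unfolding assms(6) using assms k by (intro comp_assoc[symmetric]) auto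
  finally show ?thesis using assms(2-5) k(5) by simp
qed

lemma inverse_ten:
  "inverse_arrows C f f' ==> inverse_arrows C g g' ==> inverse_arrows C (f**g) (f'**g')"
  by (auto simp: inverse_arrows_def Hom_def ten_comp ten_id)

text \<open>The hexagon at \<open>m = k = 0\<close> makes this arrow idempotent, and an invertible
  idempotent is an identity.\<close>

lemma braid_0_right [simp]: "braid C n 0 = Id C n"
proof -
  have "braid C n 0 o braid C n 0 = braid C n 0 o Id C n" using hex1[of n 0 0] by simp
  thus ?thesis by (rule cancel_left[OF inverse_braid, rotated 4]) auto
qed

lemma braid_0_left [simp]: "braid C 0 n = Id C n"
proof -
  have "braid C 0 n o braid C 0 n = braid C 0 n o Id C n" using hex2[of 0 0 n] by simp
  thus ?thesis by (rule cancel_left[OF inverse_braid, rotated 4]) auto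
qed

lemma binv_eqI: "f \<in> Arr C ==> Dom C f = m + n ==> Cod C f = n + m ==> braid C n m o f = Id C (m + n) ==> binv C n m = f"
  by (rule inverse_unique_right[of "braid C n m"]) auto

lemma binv_0_right [simp]: "binv C n 0 = Id C n" and binv_0_left [simp]: "binv C 0 n = Id C n"
  by (rule binv_eqI; simp)+

lemma binv_hex1: "binv C n (m + k) = (binv C n m**Id C k) o (Id C m**binv C n k)"
proof (rule binv_eqI)
  have "braid C n (m + k) o (binv C n m**Id C k) o (Id C m**binv C n k)
      = (Id C m**braid C n k) o ((braid C n m**Id C k) o (binv C n m**Id C k)) o (Id C m**binv C n k)"
    by (simp add: hex1 comp_assoc)
  also have "... = Id C (m + k + n)" by (simp add: ten_comp ten_id add.assoc)
  finally show "braid C n (m + k) o (binv C n m**Id C k) o (Id C m**binv C n k) = Id C (m + k + n)" .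
qed auto

lemma binv_hex2: "binv C (n + m) k = (Id C n**binv C m k) o (binv C n k**Id C m)"
proof (rule binv_eqI)
  have "braid C (n + m) k o (Id C n**binv C m k) o (binv C n k**Id C m)
      = (braid C n k**Id C m) o ((Id C n**braid C m k) o (Id C n**binv C m k)) o (binv C n k**Id C m)"
    by (simp add: hex2 comp_assoc)
  also have "... = Id C (k + (n + m))" by (simp add: ten_comp ten_id add.assoc)
  finally show "braid C (n + m) k o (Id C n**binv C m k) o (binv C n k**Id C m) = Id C (k + (n + m))" .
qed auto

lemma binv_nat:
  assumes f: "f \<in> Arr C" and g: "g \<in> Arr C"
  shows "binv C (Cod C f) (Cod C g) o (g**f) = (f**g) o binv C (Dom C f) (Dom C g)"
proof (rule cancel_left[OF inverse_braid[of "Cod C f" "Cod C g"]])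
  have "braid C (Cod C f) (Cod C g) o binv C (Cod C f) (Cod C g) o (g**f) = g**f"
    using assms by (simp flip: comp_assoc)
  moreover have "braid C (Cod C f) (Cod C g) o (f**g) o binv C (Dom C f) (Dom C g)
      = (g**f) o (braid C (Dom C f) (Dom C g) o binv C (Dom C f) (Dom C g))"
    using assms comp_assoc[of "binv C (Dom C f) (Dom C g)" "f**g" "braid C (Cod C f) (Cod C g)"]
      comp_assoc[of "binv C (Dom C f) (Dom C g)" "braid C (Dom C f) (Dom C g)" "g**f"] by (simp add: braid_nat)
  ultimately show "braid C (Cod C f) (Cod C g) o binv C (Cod C f) (Cod C g) o (g**f)
      = braid C (Cod C f) (Cod C g) o (f**g) o binv C (Dom C f) (Dom C g)"
    using assms by simp
qed (use assms in auto)

text \<open>Naturality moves \<open>f**f\<close> past either crossing, so an arrow compatible with a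
  comultiplication stays compatible after the comultiplication is twisted. Both directions of the
  final correspondence use this for the action of \<open>G\<close>.\<close>

lemma twist_Comp:
  assumes f: "f \<in> Arr C" "Dom C f = k" "Cod C f = k" and d: "d \<in> Arr C" "Dom C d = k" "Cod C d = k + k" "d o f = (f**f) o d"
  shows "(braid C k k o d) o f = (f**f) o braid C k k o d" "(binv C k k o d) o f = (f**f) o binv C k k o d"
proof -
  have "(c o d) o f = (f**f) o c o d" if "c o (f**f) = (f**f) o c" "c \<in> Arr C" "Dom C c = k + k" "Cod C c = k + k" for c
    using that f d comp_assoc[of f d c] comp_assoc[of d "f**f" c] comp_assoc[of d c "f**f"] by (metis ten_arr ten_dom ten_cod)
  thus "(braid C k k o d) o f = (f**f) o braid C k k o d" "(binv C k k o d) o f = (f**f) o binv C k k o d"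
    using braid_nat[OF f(1) f(1)] binv_nat[OF f(1) f(1)] f by simp_all
qed

end

text \<open>Both \<open>braid C m n\<close> and \<open>binv C n m\<close> have the type required of
  a braiding on the opposite category. The inverse is chosen so that the covariant and the
  contravariant evaluation of one braid are mutually inverse.\<close>

definition opp :: "(nat, 'a, 'z) bmcat_scheme => (nat, 'a) bmcat" where
  "opp C = \<lparr>Obj = Obj C, Arr = Arr C, Dom = Cod C, Cod = Dom C, Id = Id C, Comp = \<lambda>g f. f o\<^bsub>C\<^esub> g,
     tobj = tobj C, tarr = tarr C, tunit = tunit C, assoc = assoc C, lunit = lunit C, runit = runit C,
     braid = binv C\<rparr>"

definition rev_braid :: "(nat, 'a, 'z) bmcat_scheme => (nat, 'a, 'z) bmcat_scheme" where
  "rev_braid C = C\<lparr>braid := \<lambda>n m. binv C m n\<rparr>"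

lemma opp_simps [simp]: "Obj (opp C) = Obj C" "Arr (opp C) = Arr C" "Dom (opp C) = Cod C" "Cod (opp C) = Dom C"
  "Id (opp C) = Id C" "Comp (opp C) g f = Comp C f g" "tarr (opp C) = tarr C" "tobj (opp C) = tobj C"
  "tunit (opp C) = tunit C" "braid (opp C) = binv C"
  by (simp_all add: opp_def)

lemma rev_braid_simps [simp]: "Obj (rev_braid C) = Obj C" "Arr (rev_braid C) = Arr C" "Dom (rev_braid C) = Dom C"
  "Cod (rev_braid C) = Cod C" "Id (rev_braid C) = Id C" "Comp (rev_braid C) = Comp C" "tarr (rev_braid C) = tarr C"
  "tobj (rev_braid C) = tobj C" "tunit (rev_braid C) = tunit C" "braid (rev_braid C) = (\<lambda>n m. binv C m n)"
  by (simp_all add: rev_braid_def)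

context prob
begin

lemma inverse_arrows_opp: "inverse_arrows (opp C) f g \<longleftrightarrow> inverse_arrows C f g"
  by (auto simp: inverse_arrows_def Hom_def)

lemma inverse_arrows_rev: "inverse_arrows (rev_braid C) f g \<longleftrightarrow> inverse_arrows C f g"
  by (auto simp: inverse_arrows_def Hom_def)

lemma prob_opp: "prob (opp C)"
proof
  show "is_iso (opp C) (braid (opp C) n m)" for n m
    using inverse_arrows_sym[OF inverse_braid[of n m]] by (auto simp: is_iso_def inverse_arrows_opp)
qed (auto simp: Hom_def obj_UNIV tobj_add tunit_0 ten_id ten_comp ten_assoc comp_assoc binv_nat binv_hex1 binv_hex2)

lemma prob_rev: "prob (rev_braid C)"
proof
  show "is_iso (rev_braid C) (braid (rev_braid C) n m)" for n m
    using inverse_arrows_sym[OF inverse_braid[of m n]] by (auto simp: is_iso_def inverse_arrows_rev)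
qed (auto simp: Hom_def obj_UNIV tobj_add tunit_0 ten_id ten_comp ten_assoc comp_assoc binv_nat binv_hex1 binv_hex2)

lemma binv_rev [simp]: "binv (rev_braid C) n m = braid C m n"
  using category.inv_arr_eq[of "rev_braid C"] prob.axioms(1)[OF prob_rev] inverse_arrows_sym[OF inverse_braid[of m n]]
  by (simp add: binv_def[of "rev_braid C"] inverse_arrows_rev)

lemma binv_opp [simp]: "binv (opp C) n m = braid C n m"
  using category.inv_arr_eq[of "opp C"] prob.axioms(1)[OF prob_opp] inverse_arrows_sym[OF inverse_braid[of n m]]
  by (simp add: binv_def[of "opp C"] inverse_arrows_opp)

end

section \<open>Words in the braid generators, block braids and the relations between them\<close>

section \<open>Braid words\<close>

definition shift_word :: "nat => bword => bword" where
  "shift_word n w = map (\<lambda>(i, s). (n + i, s)) w"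

definition inverse_word :: "bword => bword" where
  "inverse_word w = rev (map (\<lambda>(i, s). (i, \<not> s)) w)"

lemma bwords_Nil [simp]: "[] \<in> bwords n"
  and bwords_Cons [simp]: "l # w \<in> bwords n \<longleftrightarrow> 1 \<le> fst l \<and> fst l < n \<and> w \<in> bwords n"
  and bwords_append [simp]: "v @ w \<in> bwords n \<longleftrightarrow> v \<in> bwords n \<and> w \<in> bwords n"
  by (auto simp: bwords_def)

lemma bwords_mono: "w \<in> bwords n ==> n \<le> m ==> w \<in> bwords m"
  by (fastforce simp: bwords_def)

lemma shift_word_simps [simp]: "shift_word n [] = []" "shift_word n (l # w) = (n + fst l, snd l) # shift_word n w"
  "shift_word n (v @ w) = shift_word n v @ shift_word n w" "shift_word 0 w = w"
  "shift_word n (shift_word m w) = shift_word (n + m) w"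
  by (auto simp: shift_word_def split: prod.splits)

lemma bwords_shift [simp]: "w \<in> bwords m ==> shift_word n w \<in> bwords (n + m)"
  by (fastforce simp: bwords_def shift_word_def)

lemma bwords_shift' [simp]: "w \<in> bwords m ==> shift_word n w \<in> bwords (m + n)"
  using bwords_shift[of w m n] by (simp add: add.commute)

lemma inverse_word_simps [simp]: "inverse_word [] = []" "inverse_word (l # w) = inverse_word w @ [(fst l, \<not> snd l)]"
  by (auto simp: inverse_word_def split: prod.splits)

lemma inverse_inverse_word [simp]: "inverse_word (inverse_word w) = w"
  by (auto simp: inverse_word_def rev_map comp_def case_prod_unfold)

lemma bwords_inverse [simp]: "inverse_word w \<in> bwords n \<longleftrightarrow> w \<in> bwords n"
  by (fastforce simp: bwords_def inverse_word_def)

lemma braid_eq_bwords: "braid_eq n v w ==> v \<in> bwords n \<and> w \<in> bwords n"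
  by (induction rule: braid_eq.induct) auto

lemma braid_eq_append:
  assumes "braid_eq n v v'" "braid_eq n w w'"
  shows "braid_eq n (v @ w) (v' @ w')"
proof -
  have "braid_eq n (v @ w) (v' @ w)"
    using braid_eq.cong[of "[]" n w v v'] assms braid_eq_bwords[OF assms(2)] by simp
  moreover have "braid_eq n (v' @ w) (v' @ w')"
    using braid_eq.cong[of v' n "[]" w w'] assms braid_eq_bwords[OF assms(1)] by simp
  ultimately show ?thesis by (rule braid_eq.trans)
qed

lemma braid_eq_inverse: "w \<in> bwords n ==> braid_eq n (w @ inverse_word w) []"
proof (induction w)
  case (Cons l w)
  obtain i s where l: "l = (i, s)" by fastforce
  have "braid_eq n ([l] @ (w @ inverse_word w) @ [(i, \<not> s)]) ([l] @ [] @ [(i, \<not> s)])"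
    using Cons by (intro braid_eq.cong) (auto simp: l)
  moreover have "braid_eq n [l, (i, \<not> s)] []" using Cons by (auto simp: l intro: braid_eq.cancel)
  ultimately show ?case using braid_eq.trans by (fastforce simp: l)
qed (auto intro: braid_eq.refl)

lemma braid_eq_inverse': "w \<in> bwords n ==> braid_eq n (inverse_word w @ w) []"
  using braid_eq_inverse[of "inverse_word w" n] by simp

text \<open>The relation is multiplied by inverses on both sides. This is how each exchange relation
  for positive letters is transferred to negative ones.\<close>

lemma braid_eq_swap_inverse:
  assumes "braid_eq n (u @ v) (w @ u)"
  shows "braid_eq n (u @ inverse_word v) (inverse_word w @ u)"
proof -
  have b: "u \<in> bwords n" "v \<in> bwords n" "w \<in> bwords n" using braid_eq_bwords[OF assms] by auto
  have "braid_eq n (inverse_word w @ (w @ u) @ inverse_word v) (inverse_word w @ (u @ v) @ inverse_word v)"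
    using b assms by (intro braid_eq.cong) (auto intro: braid_eq.sym)
  moreover have "braid_eq n ([] @ (inverse_word w @ w) @ u @ inverse_word v) ([] @ [] @ u @ inverse_word v)"
    using b by (intro braid_eq.cong braid_eq_inverse') auto
  moreover have "braid_eq n ((inverse_word w @ u) @ (v @ inverse_word v) @ []) ((inverse_word w @ u) @ [] @ [])"
    using b by (intro braid_eq.cong braid_eq_inverse) auto
  ultimately show ?thesis
    by (metis append.assoc append_Nil append_Nil2 braid_eq.sym braid_eq.trans)
qed

lemma braid_eq_shift: "braid_eq n v w ==> braid_eq (k + n) (shift_word k v) (shift_word k w)"
proof (induction rule: braid_eq.induct)
  case (artin i) thus ?case using braid_eq.artin[of "k + i" "k + n"] by simp
next
  case (cong u v w w') thus ?case using braid_eq.cong[of "shift_word k u" "k + n" "shift_word k v"] by simp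
qed (auto intro: braid_eq.refl braid_eq.sym braid_eq.trans braid_eq.cancel braid_eq.far)

lemma braid_eq_mono: "braid_eq n v w ==> n \<le> m ==> braid_eq m v w"
proof (induction rule: braid_eq.induct)
  case (artin i) thus ?case using braid_eq.artin[of i m] by simp
next
  case (cong u v w w') thus ?case by (intro braid_eq.cong) (auto intro: bwords_mono)
qed (auto intro: braid_eq.refl braid_eq.sym braid_eq.trans braid_eq.cancel braid_eq.far bwords_mono)

text \<open>The relation \<open>far\<close> concerns positive letters; inverting first one letter
  and then the other gives all four sign patterns.\<close>

lemma far_letters:
  assumes "1 \<le> i" "i + 1 < j" "j < n"
  shows "braid_eq n [(i, s), (j, t)] [(j, t), (i, s)]"
proof -
  have 1: "braid_eq n [(i, True), (j, t)] [(j, t), (i, True)]" for t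
    using braid_eq.far[OF assms] braid_eq_swap_inverse[of n "[(i, True)]" "[(j, True)]" "[(j, True)]"] by (cases t) auto
  have 2: "braid_eq n ([(j, t)] @ [(i, True)]) ([(i, True)] @ [(j, t)])"
    using braid_eq.sym[OF 1] by simp
  show ?thesis
    using 1 braid_eq.sym[OF braid_eq_swap_inverse[OF 2]] by (cases s) auto
qed

lemma far_letter_word:
  assumes "1 \<le> i" "i < n" "w \<in> bwords n" "\<forall>l\<in>set w. i + 1 < fst l \<or> fst l + 1 < i"
  shows "braid_eq n ([(i, s)] @ w) (w @ [(i, s)])"
  using assms
proof (induction w)
  case (Cons l w)
  obtain j t where l: "l = (j, t)" by fastforce
  have "braid_eq n [(i, s), l] [l, (i, s)]"
    using Cons.prems far_letters[of i j n s t] braid_eq.sym[OF far_letters[of j i n t s]] by (auto simp: l)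
  hence "braid_eq n ([] @ [(i, s), l] @ w) ([] @ [l, (i, s)] @ w)"
    using Cons by (intro braid_eq.cong) auto
  moreover have "braid_eq n ([l] @ ([(i, s)] @ w) @ []) ([l] @ (w @ [(i, s)]) @ [])"
    using Cons by (intro braid_eq.cong) auto
  ultimately show ?case using braid_eq.trans by fastforce
qed (auto intro: braid_eq.refl)

lemma far_words:
  assumes "v \<in> bwords n" "w \<in> bwords n" "\<forall>k\<in>set v. \<forall>l\<in>set w. fst k + 1 < fst l \<or> fst l + 1 < fst k"
  shows "braid_eq n (v @ w) (w @ v)"
  using assms
proof (induction v)
  case (Cons k v)
  have "braid_eq n ([k] @ (v @ w) @ []) ([k] @ (w @ v) @ [])" using Cons by (intro braid_eq.cong) auto
  moreover have "braid_eq n ([] @ ([k] @ w) @ v) ([] @ (w @ [k]) @ v)"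
    using Cons far_letter_word[of "fst k" n w "snd k"] by (intro braid_eq.cong) auto
  ultimately show ?case using braid_eq.trans by fastforce
qed (auto intro: braid_eq.refl)

text \<open>A single strand at position \<open>off + 1\<close> crosses the \<open>q\<close> strands
  to its right, the last letter of the word coming first. A block crossing is a stack of such rows
  in which the rightmost strand of the block moves first.\<close>

definition row_word :: "nat => nat => bool => bword" where
  "row_word off q s = map (\<lambda>j. (Suc (off + j), s)) (rev [0..<q])"

lemma row_word_simps [simp]: "row_word off 0 s = []" "row_word off (Suc q) s = (Suc (off + q), s) # row_word off q s"
  by (auto simp: row_word_def)

lemma row_word_add: "row_word off (q + r) s = row_word (off + q) r s @ row_word off q s"
  by (induction r) (auto simp: add.assoc)

lemma set_row_word: "set (row_word off q s) = (\<lambda>j. (Suc (off + j), s)) ` {0..<q}"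
  by (auto simp: row_word_def)

lemma bwords_row [simp]: "off + q < n ==> row_word off q s \<in> bwords n"
  by (auto simp: bwords_def set_row_word)

lemma block_word_0 [simp]: "block_word off 0 q s = []" and block_word_0' [simp]: "block_word off p 0 s = []"
  by (auto simp: block_word_def)

lemma block_word_rows: "block_word off p q s = concat (map (\<lambda>i. row_word (off + i) q s) [0..<p])"
proof -
  have "[1..<Suc p] = map Suc [0..<p]" by (simp add: map_Suc_upt)
  thus ?thesis by (simp add: block_word_def row_word_def comp_def)
qed

lemma block_word_add: "block_word off (p + p') q s = block_word off p q s @ block_word (off + p) p' q s"
proof -
  have "[0..<p + p'] = [0..<p] @ map (\<lambda>i. p + i) [0..<p']"
    using upt_add_eq_append[of 0 p p'] map_add_upt[of p p'] by (simp add: add.commute)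
  thus ?thesis by (simp add: block_word_rows comp_def add.assoc)
qed

lemma block_word_1 [simp]: "block_word off (Suc 0) q s = row_word off q s"
  by (simp add: block_word_rows)

lemma block_word_Suc: "block_word off (Suc p) q s = row_word off q s @ block_word (Suc off) p q s"
  using block_word_add[of off 1 p q s] by simp

lemma set_block_word: "set (block_word off p q s) \<subseteq> {Suc off..<off + p + q} \<times> {s}"
  by (auto simp: block_word_rows set_row_word)

lemma bwords_block [simp]: "off + p + q \<le> n ==> block_word off p q s \<in> bwords n"
  using set_block_word[of off p q s] by (fastforce simp: bwords_def)

lemma shift_row [simp]: "shift_word k (row_word off q s) = row_word (k + off) q s"
  by (induction q) auto

lemma shift_block [simp]: "shift_word k (block_word off p q s) = block_word (k + off) p q s"
  by (induction p arbitrary: off) (auto simp: block_word_Suc)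

text \<open>Splitting the left block merely cuts the word in two, but splitting the right block
  reorders crossings: the rows of the two parts interleave and are separated by far
  commutation.\<close>

lemma block_word_add_right:
  "off + p + q + r \<le> n ==> braid_eq n (block_word off p (q + r) True) (block_word (off + q) p r True @ block_word off p q True)"
proof (induction p arbitrary: off)
  case (Suc p)
  have "braid_eq n (row_word off (q + r) True @ block_word (Suc off) p (q + r) True @ [])
     (row_word off (q + r) True @ (block_word (Suc off + q) p r True @ block_word (Suc off) p q True) @ [])"
    using Suc.IH[of "Suc off"] Suc.prems by (intro braid_eq.cong) auto
  moreover have "braid_eq n (row_word off q True @ block_word (Suc off + q) p r True) (block_word (Suc off + q) p r True @ row_word off q True)"
  proof (rule far_words)
    show "\<forall>k\<in>set (row_word off q True). \<forall>l\<in>set (block_word (Suc off + q) p r True). fst k + 1 < fst l \<or> fst l + 1 < fst k"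
      using set_block_word[of "Suc off + q" p r True] by (auto simp: set_row_word)
  qed (use Suc.prems in auto)
  hence "braid_eq n (row_word (off + q) r True @ (row_word off q True @ block_word (Suc off + q) p r True) @ block_word (Suc off) p q True)
     (row_word (off + q) r True @ (block_word (Suc off + q) p r True @ row_word off q True) @ block_word (Suc off) p q True)"
    using Suc.prems by (intro braid_eq.cong) auto
  ultimately show ?case
    by (simp add: row_word_add block_word_Suc) (meson braid_eq.trans)
qed (auto intro: braid_eq.refl)

text \<open>A crossing between two of the strands being passed may be done before or after the
  moving strand goes across; this is one Artin relation.\<close>

lemma row_letter:
  assumes "1 \<le> j" "j < q" "off + q < n"
  shows "braid_eq n (row_word off q True @ [(Suc (off + j), s)]) ([(off + j, s)] @ row_word off q True)"
proof -
  \<comment> \<open>The row is cut around the two letters that meet the given one in an Artin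
    relation: \<open>A\<close> has the higher crossings, far from \<open>off + j\<close>, and
    \<open>B\<close> the lower ones, far from \<open>off + j + 1\<close>.\<close>
  define A where "A = row_word (off + Suc j) (q - Suc j) True"
  define B where "B = row_word off (j - 1) True"
  have row: "row_word off q True = A @ [(Suc (off + j), True), (off + j, True)] @ B"
  proof -
    have "row_word off q True = A @ row_word off (Suc j) True"
      using assms row_word_add[of off "Suc j" "q - Suc j" True] by (simp add: A_def)
    also have "row_word off (Suc j) True = [(Suc (off + j), True), (off + j, True)] @ B"
      using assms by (cases j) (auto simp: B_def)
    finally show ?thesis .
  qed
  have bw: "A \<in> bwords n" "B \<in> bwords n" using assms by (auto simp: A_def B_def)
  have "braid_eq n (B @ [(Suc (off + j), True)]) ([(Suc (off + j), True)] @ B)"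
    by (rule far_words) (use assms in \<open>auto simp: B_def set_row_word\<close>)
  hence "braid_eq n ((A @ [(Suc (off + j), True), (off + j, True)]) @ (B @ [(Suc (off + j), True)]) @ [])
      ((A @ [(Suc (off + j), True), (off + j, True)]) @ ([(Suc (off + j), True)] @ B) @ [])"
    using assms bw by (intro braid_eq.cong) auto
  moreover have "braid_eq n (A @ [(Suc (off + j), True), (off + j, True), (Suc (off + j), True)] @ B)
      (A @ [(off + j, True), (Suc (off + j), True), (off + j, True)] @ B)"
    using assms bw braid_eq.artin[of "off + j" n] by (intro braid_eq.cong) (auto intro: braid_eq.sym)
  moreover have "braid_eq n (A @ [(off + j, True)]) ([(off + j, True)] @ A)"
    by (rule far_words) (use assms in \<open>auto simp: A_def set_row_word\<close>)
  hence "braid_eq n ([] @ (A @ [(off + j, True)]) @ [(Suc (off + j), True), (off + j, True)] @ B)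
      ([] @ ([(off + j, True)] @ A) @ [(Suc (off + j), True), (off + j, True)] @ B)"
    using assms bw by (intro braid_eq.cong) auto
  ultimately have "braid_eq n (row_word off q True @ [(Suc (off + j), True)]) ([(off + j, True)] @ row_word off q True)"
    unfolding row by simp (meson braid_eq.trans)
  thus ?thesis
    using braid_eq_swap_inverse[of n "row_word off q True" "[(Suc (off + j), True)]" "[(off + j, True)]"] by (cases s) auto
qed

text \<open>Two neighbouring strands may cross each other before or after both pass the same
  \<open>q\<close> strands. Each further strand to be passed costs one Artin relation.\<close>

lemma two_rows_letter:
  "off + q + 1 < n ==> braid_eq n (row_word off q True @ row_word (Suc off) q True @ [(Suc off, s)])
     ([(Suc (off + q), s)] @ row_word off q True @ row_word (Suc off) q True)"
proof -
  have "braid_eq n (row_word off q True @ row_word (Suc off) q True @ [(Suc off, True)])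
     ([(Suc (off + q), True)] @ row_word off q True @ row_word (Suc off) q True)" if "off + q + 1 < n" for q
    using that
  proof (induction q)
    case (Suc q)
    let ?R = "row_word off q True" and ?R' = "row_word (Suc off) q True"
    let ?a = "(Suc (off + q), True)" and ?b = "(Suc (Suc (off + q)), True)"
    have far: "braid_eq n (?R @ [?b]) ([?b] @ ?R)"
      by (rule far_words) (use Suc.prems in \<open>auto simp: set_row_word\<close>)
    have "braid_eq n ([?a] @ (?R @ [?b]) @ ?R' @ [(Suc off, True)]) ([?a] @ ([?b] @ ?R) @ ?R' @ [(Suc off, True)])"
      by (rule braid_eq.cong) (use Suc.prems far in auto)
    moreover have "braid_eq n ([?a, ?b] @ (?R @ ?R' @ [(Suc off, True)]) @ []) ([?a, ?b] @ ([?a] @ ?R @ ?R') @ [])"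
      by (rule braid_eq.cong) (use Suc in auto)
    moreover have "braid_eq n ([] @ [?a, ?b, ?a] @ ?R @ ?R') ([] @ [?b, ?a, ?b] @ ?R @ ?R')"
      by (rule braid_eq.cong) (use Suc.prems braid_eq.artin[of "Suc (off + q)" n] in auto)
    moreover have "braid_eq n ([?b, ?a] @ ([?b] @ ?R) @ ?R') ([?b, ?a] @ (?R @ [?b]) @ ?R')"
      by (rule braid_eq.cong) (use Suc.prems braid_eq.sym[OF far] in auto)
    ultimately show ?case by simp (meson braid_eq.trans)
  qed (auto intro: braid_eq.refl)
  from this[of q] show "off + q + 1 < n ==> ?thesis"
    using braid_eq_swap_inverse[of n "row_word off q True @ row_word (Suc off) q True" "[(Suc off, True)]" "[(Suc (off + q), True)]"]
    by (cases s) auto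
qed

lemma block_letter_right:
  "1 \<le> j ==> j < q ==> off + p + q \<le> n ==>
   braid_eq n (block_word off p q True @ [(off + p + j, s)]) ([(off + j, s)] @ block_word off p q True)"
proof (induction p arbitrary: off)
  case (Suc p)
  have "braid_eq n (row_word off q True @ (block_word (Suc off) p q True @ [(Suc off + p + j, s)]) @ [])
      (row_word off q True @ ([(Suc off + j, s)] @ block_word (Suc off) p q True) @ [])"
    by (rule braid_eq.cong) (use Suc.prems Suc.IH[of "Suc off"] in auto)
  moreover have "braid_eq n ([] @ (row_word off q True @ [(Suc (off + j), s)]) @ block_word (Suc off) p q True)
      ([] @ ([(off + j, s)] @ row_word off q True) @ block_word (Suc off) p q True)"
    by (rule braid_eq.cong) (use Suc.prems row_letter[of j q off n s] in auto)
  ultimately show ?case by (simp add: block_word_Suc) (meson braid_eq.trans)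
qed (auto intro: braid_eq.refl)

lemma block_letter_left:
  assumes "1 \<le> j" "j < p" "off + p + q \<le> n"
  shows "braid_eq n (block_word off p q True @ [(off + j, s)]) ([(off + q + j, s)] @ block_word off p q True)"
proof (cases "q = 0")
  case True thus ?thesis using assms by (auto intro: braid_eq.refl)
next
  case q: False
  \<comment> \<open>The strands exchanged by the letter have numbers \<open>o'\<close> and
    \<open>o' + 1\<close> in the block, counted from \<open>0\<close>; their rows \<open>?R\<close>
    stand between the rows of the other strands.\<close>
  obtain o' where o': "j = Suc o'" using assms by (cases j) auto
  let ?A = "block_word off o' q True" and ?B = "block_word (off + Suc (Suc o')) (p - Suc (Suc o')) q True"
  let ?R = "row_word (off + o') q True @ row_word (Suc (off + o')) q True"
  have block: "block_word off p q True = ?A @ ?R @ ?B"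
    using block_word_add[of off o' "p - o'" q True] block_word_Suc[of "off + o'" "p - Suc o'" q True]
      block_word_Suc[of "Suc (off + o')" "p - Suc (Suc o')" q True] assms by (simp add: o' Suc_diff_Suc)
  have "braid_eq n (?B @ [(off + j, s)]) ([(off + j, s)] @ ?B)"
    by (rule far_words) (use assms set_block_word[of "off + Suc (Suc o')" "p - Suc (Suc o')" q True] in \<open>auto simp: o'\<close>)
  hence "braid_eq n ((?A @ ?R) @ (?B @ [(off + j, s)]) @ []) ((?A @ ?R) @ ([(off + j, s)] @ ?B) @ [])"
    by (rule braid_eq.cong[rotated 2]) (use assms in \<open>auto simp: o'\<close>)
  moreover have "braid_eq n (?A @ (?R @ [(off + j, s)]) @ ?B) (?A @ ([(off + q + j, s)] @ ?R) @ ?B)"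
    by (rule braid_eq.cong) (use assms two_rows_letter[of "off + o'" q n s] in \<open>auto simp: o' ac_simps\<close>)
  moreover have "braid_eq n (?A @ [(off + q + j, s)]) ([(off + q + j, s)] @ ?A)"
    by (rule far_words) (use assms set_block_word[of off o' q True] in \<open>auto simp: o'\<close>)
  hence "braid_eq n ([] @ (?A @ [(off + q + j, s)]) @ ?R @ ?B) ([] @ ([(off + q + j, s)] @ ?A) @ ?R @ ?B)"
    by (rule braid_eq.cong[rotated 2]) (use assms in \<open>auto simp: o'\<close>)
  ultimately show ?thesis unfolding block by simp (meson braid_eq.trans)
qed

text \<open>Letters are carried through the block crossing one at a time, those of \<open>v\<close>
  by \<open>block_letter_left\<close> and those of \<open>w\<close> by
  \<open>block_letter_right\<close>. The resulting words act on disjoint strands and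
  commute.\<close>

lemma block_word_natural:
  assumes "v \<in> bwords p" "w \<in> bwords q"
  shows "braid_eq (p + q) (block_word 0 p q True @ v @ shift_word p w) ((w @ shift_word q v) @ block_word 0 p q True)"
proof -
  let ?X = "block_word 0 p q True"
  have v: "braid_eq (p + q) (?X @ v) (shift_word q v @ ?X)" using assms(1)
  proof (induction v rule: rev_induct)
    case (snoc l v)
    have "braid_eq (p + q) ((?X @ v) @ [l]) ((shift_word q v @ ?X) @ [l])"
      by (rule braid_eq_append[OF snoc.IH]) (use snoc.prems in \<open>auto intro: braid_eq.refl\<close>)
    moreover have "braid_eq (p + q) (shift_word q v @ (?X @ [l]) @ []) (shift_word q v @ ([(q + fst l, snd l)] @ ?X) @ [])"
      by (rule braid_eq.cong) (use snoc.prems block_letter_left[of "fst l" p 0 q "p + q" "snd l"] in \<open>auto simp: add.commute\<close>)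
    ultimately show ?case by simp (meson braid_eq.trans)
  qed (auto intro: braid_eq.refl)
  have w: "braid_eq (p + q) (?X @ shift_word p w) (w @ ?X)" using assms(2)
  proof (induction w rule: rev_induct)
    case (snoc l w)
    have "braid_eq (p + q) ((?X @ shift_word p w) @ [(p + fst l, snd l)]) ((w @ ?X) @ [(p + fst l, snd l)])"
      by (rule braid_eq_append[OF snoc.IH]) (use snoc.prems in \<open>auto intro: braid_eq.refl\<close>)
    moreover have "braid_eq (p + q) (w @ (?X @ [(p + fst l, snd l)]) @ []) (w @ ([l] @ ?X) @ [])"
      by (rule braid_eq.cong) (use snoc.prems block_letter_right[of "fst l" q 0 p "p + q" "snd l"] bwords_mono[of w q "p+q"] in auto)
    ultimately show ?case by simp (meson braid_eq.trans)
  qed (auto intro: braid_eq.refl)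
  have "braid_eq (p + q) ((?X @ v) @ shift_word p w) ((shift_word q v @ ?X) @ shift_word p w)"
    by (rule braid_eq_append[OF v]) (use assms in \<open>auto intro: braid_eq.refl\<close>)
  moreover have "braid_eq (p + q) (shift_word q v @ ?X @ shift_word p w) (shift_word q v @ w @ ?X)"
    by (rule braid_eq_append[OF _ w]) (use assms in \<open>auto intro: braid_eq.refl simp: add.commute\<close>)
  moreover have "braid_eq (p + q) (shift_word q v @ w) (w @ shift_word q v)"
    by (rule far_words) (use assms bwords_mono[of w q "p+q"] in \<open>auto simp: add.commute\<close>, fastforce simp: bwords_def shift_word_def)
  hence "braid_eq (p + q) ((shift_word q v @ w) @ ?X) ((w @ shift_word q v) @ ?X)"
    by (rule braid_eq_append) (auto intro: braid_eq.refl)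
  ultimately show ?thesis by simp (meson braid_eq.trans)
qed

lemma braid_class_eq_iff: "v \<in> bwords n ==> braid_class n v = braid_class n w \<longleftrightarrow> braid_eq n v w"
  unfolding braid_class_def using braid_eq.refl braid_eq.sym braid_eq.trans by blast

lemma braid_class_eqI: "braid_eq n v w ==> braid_class n v = braid_class n w"
  using braid_class_eq_iff braid_eq_bwords by blast

lemma braid_class_self: "w \<in> bwords n ==> w \<in> braid_class n w"
  by (simp add: braid_class_def braid_eq.refl)

text \<open>Operations on braid classes are unions over representatives. When the value is
  independent of them the union is that one value, so a single pair of representatives computes the
  operation.\<close>

lemma braid_class_Union2:
  assumes "v \<in> bwords n" "w \<in> bwords m" "\<And>v' w'. braid_eq n v v' ==> braid_eq m w w' ==> f v' w' = f v w"
  shows "(\<Union>v'\<in>braid_class n v. \<Union>w'\<in>braid_class m w. f v' w') = f v w"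
proof -
  have "(\<Union>v'\<in>braid_class n v. \<Union>w'\<in>braid_class m w. f v' w') = (\<Union>v'\<in>braid_class n v. \<Union>w'\<in>braid_class m w. f v w)"
    by (intro SUP_cong refl assms(3)) (simp_all add: braid_class_def)
  also have "... = f v w" using braid_class_self[OF assms(1)] braid_class_self[OF assms(2)] by auto
  finally show ?thesis .
qed

lemma braid_mult: "v \<in> bwords n ==> w \<in> bwords n ==>
    braid_class n v \<otimes>\<^bsub>braid_group n\<^esub> braid_class n w = braid_class n (v @ w)"
  unfolding braid_group_def monoid.simps
  by (rule braid_class_Union2) (auto intro!: braid_class_eqI braid_eq_append intro: braid_eq.sym)

lemma braid_sum_class: "v \<in> bwords n ==> w \<in> bwords m ==>
    braid_sum n m (braid_class n v) (braid_class m w) = braid_class (n + m) (v @ shift_word n w)"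
  unfolding braid_sum_def shift_word_def[symmetric]
  by (rule braid_class_Union2)
    (auto intro!: braid_class_eqI braid_eq_append braid_eq_shift intro: braid_eq_mono braid_eq.sym)

lemma carrier_braid_group: "carrier (braid_group n) = braid_class n ` bwords n"
  by (simp add: braid_group_def)

section \<open>Braids as a strict braided category, the free one on one generator\<close>

subsection \<open>The category of braids\<close>

text \<open>The evaluation of coloured words works in every strict braided category. Having one
  whose arrows are braids lets it be applied to braids themselves, and facts about cabling then
  follow without further computation with words.\<close>

definition BC :: "(nat, nat \<times> bword set) bmcat" where
  "BC = \<lparr>Obj = UNIV, Arr = {(n, b). b \<in> carrier (braid_group n)}, Dom = fst, Cod = fst,
     Id = \<lambda>n. (n, braid_class n []), Comp = \<lambda>(n, c) (_, b). (n, c \<otimes>\<^bsub>braid_group n\<^esub> b),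
     tobj = (+), tarr = \<lambda>(n, b) (m, c). (n + m, braid_sum n m b c), tunit = 0,
     assoc = \<lambda>n m k. (n + m + k, braid_class (n + m + k) []), lunit = \<lambda>n. (n, braid_class n []),
     runit = \<lambda>n. (n, braid_class n []),
     braid = \<lambda>n m. (n + m, braid_class (n + m) (block_word 0 n m True))\<rparr>"

definition br :: "nat => bword => nat \<times> bword set" where
  "br n w = (n, braid_class n w)"

lemma br_eqI: "n = m ==> braid_eq n v w ==> br n v = br m w"
  by (simp add: br_def braid_class_eqI)

lemma br_eqD: "br n v = br n w ==> v \<in> bwords n ==> braid_eq n v w"
  by (simp add: br_def braid_class_eq_iff)

lemma Arr_BC: "f \<in> Arr BC \<longleftrightarrow> (\<exists>n w. f = br n w \<and> w \<in> bwords n)"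
  by (auto simp: BC_def br_def carrier_braid_group)

lemma BC_simps [simp]:
  "Obj BC = UNIV" "tobj BC = (+)" "tunit BC = 0"
  "w \<in> bwords n ==> br n w \<in> Arr BC" "Dom BC (br n w) = n" "Cod BC (br n w) = n"
  "Id BC n = br n []" "braid BC n m = br (n + m) (block_word 0 n m True)"
  "v \<in> bwords n ==> w \<in> bwords n ==> br n v o\<^bsub>BC\<^esub> br n w = br n (v @ w)"
  "v \<in> bwords n ==> w \<in> bwords m ==> br n v**\<^bsub>BC\<^esub>br m w = br (n + m) (v @ shift_word n w)"
  by (auto simp: BC_def br_def carrier_braid_group braid_mult braid_sum_class)

lemma far_sum: "v \<in> bwords n ==> w \<in> bwords m ==> braid_eq (n + m) (v @ shift_word n w) (shift_word n w @ v)"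
  by (rule far_words) (auto intro: bwords_mono, fastforce simp: bwords_def shift_word_def)

interpretation BC: prob BC
proof
  fix f g :: "nat \<times> bword set" and l n m k
  assume f: "f \<in> Hom BC n m"
  then obtain u where u: "u \<in> bwords n" "f = br n u" "m = n" by (auto simp: Hom_def Arr_BC)
  show "f o\<^bsub>BC\<^esub> Id BC n = f" "Id BC m o\<^bsub>BC\<^esub> f = f" using u by auto
  assume g: "g \<in> Hom BC m k"
  then obtain v where v: "v \<in> bwords n" "g = br n v" "k = n" using u by (auto simp: Hom_def Arr_BC)
  show "g o\<^bsub>BC\<^esub> f \<in> Hom BC n k" using u v by (simp add: Hom_def)
  show "(h o\<^bsub>BC\<^esub> g) o\<^bsub>BC\<^esub> f = h o\<^bsub>BC\<^esub> g o\<^bsub>BC\<^esub> f" if "h \<in> Hom BC k l" for h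
    using that u v by (auto simp: Hom_def Arr_BC)
next
  fix f g assume f: "f \<in> Arr BC" and g: "g \<in> Arr BC"
  from f obtain n u where u: "f = br n u" "u \<in> bwords n" by (auto simp: Arr_BC)
  from g obtain m v where v: "g = br m v" "v \<in> bwords m" by (auto simp: Arr_BC)
  have u': "u \<in> bwords (n + m)" "u \<in> bwords (m + n)" and v': "v \<in> bwords (m + n)" "v \<in> bwords (n + m)"
    using u v by (auto intro: bwords_mono)
  show "f**\<^bsub>BC\<^esub>g \<in> Arr BC" "Dom BC (f**\<^bsub>BC\<^esub>g) = Dom BC f + Dom BC g"
    "Cod BC (f**\<^bsub>BC\<^esub>g) = Cod BC f + Cod BC g"
    "Id BC 0**\<^bsub>BC\<^esub>f = f" "f**\<^bsub>BC\<^esub>Id BC 0 = f"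
    using u v u' by auto
  show "braid BC (Cod BC f) (Cod BC g) o\<^bsub>BC\<^esub> (f**\<^bsub>BC\<^esub>g)
      = (g**\<^bsub>BC\<^esub>f) o\<^bsub>BC\<^esub> braid BC (Dom BC f) (Dom BC g)"
    using u v u' v' block_word_natural[OF u(2) v(2)] by (simp add: add.commute[of m n] br_eqI)
next
  fix f g h :: "nat \<times> bword set" assume "f \<in> Arr BC" and "g \<in> Arr BC" and "h \<in> Arr BC"
  then obtain n m k u v w where fgh: "f = br n u" "u \<in> bwords n" "g = br m v" "v \<in> bwords m" "h = br k w" "w \<in> bwords k"
    by (auto simp: Arr_BC)
  hence "u \<in> bwords (n + m)" "u \<in> bwords (n + (m + k))" "v \<in> bwords (m + k)" by (auto intro: bwords_mono)
  thus "(f**\<^bsub>BC\<^esub>g)**\<^bsub>BC\<^esub>h = f**\<^bsub>BC\<^esub>g**\<^bsub>BC\<^esub>h"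
    using fgh by (simp add: add.assoc)
next
  fix f f' g g' :: "nat \<times> bword set"
  assume "f \<in> Arr BC" "f' \<in> Arr BC" "g \<in> Arr BC" "g' \<in> Arr BC"
    "Cod BC f = Dom BC g" "Cod BC f' = Dom BC g'"
  then obtain n m u u' v v' where fg: "f = br n u" "f' = br m u'" "g = br n v" "g' = br m v'"
    and b: "u \<in> bwords n" "v \<in> bwords n" "u' \<in> bwords m" "v' \<in> bwords m"
    by (auto simp: Arr_BC)
  have b': "u \<in> bwords (n + m)" "v \<in> bwords (n + m)" using b by (auto intro: bwords_mono)
  have "braid_eq (n + m) (v @ (shift_word n v' @ u) @ shift_word n u') (v @ (u @ shift_word n v') @ shift_word n u')"
    using b b' braid_eq.sym[OF far_sum[of u n v' m]] by (intro braid_eq.cong) auto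
  thus "(g**\<^bsub>BC\<^esub>g') o\<^bsub>BC\<^esub> (f**\<^bsub>BC\<^esub>f')
      = (g o\<^bsub>BC\<^esub> f)**\<^bsub>BC\<^esub>(g' o\<^bsub>BC\<^esub> f')"
    using b b' fg by (simp add: br_eqI)
next
  fix n m
  let ?w = "block_word 0 n m True"
  have w: "?w \<in> bwords (n + m)" by simp
  hence "inverse_arrows BC (br (n + m) ?w) (br (n + m) (inverse_word ?w))"
    by (simp add: inverse_arrows_def Hom_def br_eqI braid_eq_inverse braid_eq_inverse')
  thus "is_iso BC (braid BC n m)" unfolding is_iso_def BC_simps by blast
next
  fix n m k
  show "braid BC n (m + k) = (Id BC m**\<^bsub>BC\<^esub>braid BC n k) o\<^bsub>BC\<^esub> (braid BC n m**\<^bsub>BC\<^esub>Id BC k)"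
    using block_word_add_right[of 0 n m k "n + (m + k)"] by (simp add: add.left_commute[of m n k] add.assoc br_eqI)
  show "braid BC (n + m) k = (braid BC n k**\<^bsub>BC\<^esub>Id BC m) o\<^bsub>BC\<^esub> (Id BC n**\<^bsub>BC\<^esub>braid BC m k)"
    using block_word_add[of 0 n m k True] by (simp add: ac_simps)
qed (auto simp: Hom_def intro: braid_eq.refl)

section \<open>Colours carried along strands, and values of coloured words\<close>

subsection \<open>Coloured braids\<close>

definition swap_at :: "nat => 'c list => 'c list" where
  "swap_at i cs = cs[i - 1 := cs ! i, i := cs ! (i - 1)]"

text \<open>The colours in order of final positions, when \<open>cs\<close> colours the strands by
  initial position. Lists replace permutations of positions because a colouring is what composition
  and evaluation act on.\<close>

fun permute :: "bword => 'c list => 'c list" where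
  "permute [] cs = cs"
| "permute (l # w) cs = swap_at (fst l) (permute w cs)"

definition tot :: "('c => nat) => 'c list => nat" where
  "tot M cs = sum_list (map M cs)"

lemma tot_simps [simp]: "tot M [] = 0" "tot M (c # cs) = M c + tot M cs" "tot M (as @ cs) = tot M as + tot M cs"
  by (auto simp: tot_def)

lemma length_swap_at [simp]: "length (swap_at i cs) = length cs"
  by (simp add: swap_at_def)

lemma length_permute [simp]: "length (permute w cs) = length cs"
  by (induction w) auto

lemma swap_at_split [simp]: "swap_at (Suc (length as)) (as @ c # d # bs) = as @ d # c # bs"
  by (auto simp: swap_at_def nth_append list_update_append)

lemma split_two: "1 \<le> i ==> i < length cs ==> \<exists>as c d bs. cs = as @ c # d # bs \<and> i = Suc (length as)"
  using id_take_nth_drop[of "i - 1" cs] Cons_nth_drop_Suc[of i cs]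
  by (intro exI[of _ "take (i - 1) cs"] exI[of _ "cs ! (i - 1)"] exI[of _ "cs ! i"] exI[of _ "drop (Suc i) cs"]) simp

lemma permute_append [simp]: "permute (v @ w) cs = permute v (permute w cs)"
  by (induction v) auto

lemma mset_swap_at: "1 \<le> i ==> i < length cs ==> mset (swap_at i cs) = mset cs"
  using split_two[of i cs] by auto

lemma mset_permute: "w \<in> bwords (length cs) ==> mset (permute w cs) = mset cs"
  by (induction w) (auto simp: mset_swap_at)

lemma set_permute: "w \<in> bwords (length cs) ==> set (permute w cs) = set cs"
  using mset_permute mset_eq_setD by blast

lemma tot_permute [simp]: "w \<in> bwords (length cs) ==> tot M (permute w cs) = tot M cs"
  using mset_permute[of w cs] unfolding tot_def by (metis mset_map sum_mset_sum_list)

lemma map_swap_at: "1 \<le> i ==> i < length cs ==> map f (swap_at i cs) = swap_at i (map f cs)"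
  by (simp add: swap_at_def map_update)

lemma map_permute: "w \<in> bwords (length cs) ==> map f (permute w cs) = permute w (map f cs)"
  by (induction w) (auto simp: map_swap_at)

lemma map2_swap_at: "1 \<le> i ==> i < length cs ==> length ds = length cs ==> map2 f (swap_at i cs) (swap_at i ds) = swap_at i (map2 f cs ds)"
  by (simp add: swap_at_def list_eq_iff_nth_eq nth_list_update)

lemma map2_permute: "w \<in> bwords (length cs) ==> length ds = length cs ==> map2 f (permute w cs) (permute w ds) = permute w (map2 f cs ds)"
  by (induction w) (auto simp: map2_swap_at)

lemma swap_swap: "1 \<le> i ==> i < length cs ==> swap_at i (swap_at i cs) = cs"
  using split_two[of i cs] by auto

lemma permute_inverse: "w \<in> bwords (length cs) ==> permute w (permute (inverse_word w) cs) = cs"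
proof (induction w arbitrary: cs)
  case (Cons l w)
  thus ?case using Cons.IH[of "swap_at (fst l) cs"] by (simp add: swap_swap)
qed auto

lemma permute_inverse': "w \<in> bwords (length cs) ==> permute (inverse_word w) (permute w cs) = cs"
  using permute_inverse[of "inverse_word w" cs] by simp

lemma permute_shift: "w \<in> bwords (length cs) ==> permute (shift_word (length as) w) (as @ cs) = as @ permute w cs"
proof (induction w)
  case (Cons l w)
  obtain bs c d ds where "permute w cs = bs @ c # d # ds" "fst l = Suc (length bs)"
    using Cons.prems split_two[of "fst l" "permute w cs"] by auto
  thus ?case using Cons swap_at_split[of "as @ bs" c d ds] by simp
qed auto

lemma permute_left: "w \<in> bwords (length cs) ==> permute w (cs @ ds) = permute w cs @ ds"
proof (induction w)
  case (Cons l w)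
  obtain as c d bs where "permute w cs = as @ c # d # bs" "fst l = Suc (length as)"
    using Cons.prems split_two[of "fst l" "permute w cs"] by auto
  thus ?case using Cons by simp
qed auto

lemma permute_braid_eq: "braid_eq n v w ==> length cs = n ==> permute v cs = permute w cs"
proof (induction arbitrary: cs rule: braid_eq.induct)
  case (artin i)
  obtain as c d bs where 1: "cs = as @ c # d # bs" "i = Suc (length as)"
    using artin split_two[of i cs] by auto
  then obtain e bs' where 2: "bs = e # bs'" using artin by (cases bs) auto
  show ?case using swap_at_split[of "as @ [e]"] swap_at_split[of "as @ [d]"] swap_at_split[of "as @ [c]"] by (simp add: 1 2)
next
  case (far i j)
  obtain as c d bs where 1: "cs = as @ c # d # bs" "i = Suc (length as)"
    using far split_two[of i cs] by auto
  have "1 \<le> j - i - 1" "j - i - 1 < length bs" using far 1 by auto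
  then obtain as' c' d' bs' where 2: "bs = as' @ c' # d' # bs'" "j - i - 1 = Suc (length as')"
    using split_two[of "j - i - 1" bs] by blast
  have j: "j = Suc (length (as @ c # d # as'))" using 1 2 far by simp
  show ?case using swap_at_split[of "as @ c # d # as'"] swap_at_split[of "as @ d # c # as'"] j by (simp add: 1 2)
qed (auto simp: swap_swap)

lemma permute_row: "permute (row_word (length as) (length ds) s) (as @ c # ds @ bs) = as @ ds @ c # bs"
proof (induction ds arbitrary: bs rule: rev_induct)
  case (snoc d ds)
  thus ?case using swap_at_split[of "as @ ds" c d bs] by simp
qed auto

lemma permute_block: "permute (block_word (length as) (length cs) (length ds) s) (as @ cs @ ds @ bs) = as @ ds @ cs @ bs"
proof (induction cs arbitrary: as)
  case (Cons c cs)
  thus ?case using Cons.IH[of "as @ [c]"] permute_row[of as ds s c "cs @ bs"] by (simp add: block_word_Suc)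
qed auto

text \<open>The arguments of \<open>binv\<close> are exchanged so that both signs give an arrow from
  \<open>n + m\<close> to \<open>m + n\<close> and can be treated uniformly.\<close>

definition crossing :: "(nat, 'a, 'z) bmcat_scheme => bool => nat => nat => 'a" where
  "crossing C s n m = (if s then braid C n m else binv C m n)"

definition letter_arr :: "(nat, 'a, 'z) bmcat_scheme => ('c => nat) => 'c list => nat \<times> bool => 'a" where
  "letter_arr C M cs l = (case l of (i, s) =>
     Id C (tot M (take (i - 1) cs))**\<^bsub>C\<^esub>crossing C s (M (cs ! (i - 1))) (M (cs ! i)) **\<^bsub>C\<^esub>
     Id C (tot M (drop (Suc i) cs)))"

text \<open>The value of a coloured braid word, a strand of colour \<open>c\<close> standing for the
  object \<open>M c\<close>. Colours are followed through the word because each crossing depends on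
  the two that meet.\<close>

fun word_arr :: "(nat, 'a, 'z) bmcat_scheme => ('c => nat) => 'c list => bword => 'a" where
  "word_arr C M cs [] = Id C (tot M cs)"
| "word_arr C M cs (l # w) = letter_arr C M (permute w cs) l o\<^bsub>C\<^esub> word_arr C M cs w"

text \<open>Carrying the list \<open>permute w ks\<close> along, instead of a function precomposed
  with an inverse permutation, suits induction on words; \<open>cable_word_lcable\<close> identifies
  the two forms of cabling.\<close>

fun lcable :: "nat list => bword => bword" where
  "lcable ks [] = []"
| "lcable ks (l # w) = (let k = permute w ks; i = fst l in
     block_word (sum_list (take (i - 1) k)) (k ! (i - 1)) (k ! i) (snd l)) @ lcable ks w"

lemma lcable_letter: "permute w ks = as @ c # d # bs ==>
    lcable ks ((Suc (length as), s) # w) = block_word (sum_list as) c d s @ lcable ks w"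
  by (simp add: Let_def nth_append)

lemma lcable_append: "lcable ks (v @ w) = lcable (permute w ks) v @ lcable ks w"
  by (induction v) (auto simp: Let_def)

lemma sum_list_permute [simp]: "w \<in> bwords (length ks) ==> sum_list (permute w ks) = sum_list (ks :: nat list)"
  using tot_permute[of w ks id] by (simp add: tot_def)

lemma bwords_lcable: "w \<in> bwords (length ks) ==> lcable ks w \<in> bwords (sum_list ks)"
proof (induction w)
  case (Cons l w)
  obtain as c d bs where 1: "permute w ks = as @ c # d # bs" "fst l = Suc (length as)"
    using Cons.prems split_two[of "fst l" "permute w ks"] by auto
  have "sum_list ks = sum_list (as @ c # d # bs)" using Cons.prems sum_list_permute[of w ks] 1 by simp
  thus ?case using Cons lcable_letter[OF 1(1), of "snd l"] 1(2) by (cases l) simp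
qed auto

text \<open>Colours may themselves be lists: a cable carries its whole list along.\<close>

lemma permute_lcable: "w \<in> bwords (length css) ==> permute (lcable (map length css) w) (concat css) = concat (permute w css)"
proof (induction w)
  case (Cons l w)
  obtain as c d bs where 1: "permute w css = as @ c # d # bs" "fst l = Suc (length as)"
    using Cons.prems split_two[of "fst l" "permute w css"] by auto
  have "permute w (map length css) = map length as @ length c # length d # map length bs"
    using map_permute[of w css length] 1 Cons.prems by simp
  from lcable_letter[OF this, of "snd l"] show ?case
    using Cons 1 permute_block[of "concat as" c d "snd l" "concat bs"] by (cases l) (simp add: length_concat)
qed auto

context prob
begin

lemma crossing_arr [simp]: "crossing C s n m \<in> Arr C" "Dom C (crossing C s n m) = n + m" "Cod C (crossing C s n m) = m + n"
  by (auto simp: crossing_def)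

lemma crossing_cancel [simp]: "crossing C s m n o crossing C (\<not> s) n m = Id C (n + m)"
  by (auto simp: crossing_def)

lemma crossing_0 [simp]: "crossing C s 0 n = Id C n" "crossing C s n 0 = Id C n"
  by (auto simp: crossing_def)

lemma crossing_hex1: "crossing C s n (m + k) = (Id C m**crossing C s n k) o (crossing C s n m**Id C k)"
  and crossing_hex2: "crossing C s (n + m) k = (crossing C s n k**Id C m) o (Id C n**crossing C s m k)"
  by (auto simp: crossing_def hex1 hex2 binv_hex1 binv_hex2)

lemma crossing_nat: "f \<in> Arr C ==> g \<in> Arr C ==>
    crossing C s (Cod C f) (Cod C g) o (f**g) = (g**f) o crossing C s (Dom C f) (Dom C g)"
  by (auto simp: crossing_def braid_nat binv_nat)

lemma letter_arr_split: "letter_arr C M (as @ c # d # bs) (Suc (length as), s) =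
    Id C (tot M as)**crossing C s (M c) (M d)**Id C (tot M bs)"
  by (simp add: letter_arr_def nth_append)

lemma letter_arr_arr: "1 \<le> fst l ==> fst l < length cs ==> letter_arr C M cs l \<in> Arr C \<and>
    Dom C (letter_arr C M cs l) = tot M cs \<and> Cod C (letter_arr C M cs l) = tot M (swap_at (fst l) cs)"
  using split_two[of "fst l" cs] by (cases l) (auto simp: letter_arr_split)

lemma word_arr_arr: "w \<in> bwords (length cs) ==> word_arr C M cs w \<in> Arr C \<and> Dom C (word_arr C M cs w) = tot M cs \<and>
    Cod C (word_arr C M cs w) = tot M (permute w cs)"
proof (induction w)
  case (Cons l w)
  thus ?case using letter_arr_arr[of l "permute w cs" M] by simp
qed auto

lemma word_arr_simps [simp]: "w \<in> bwords (length cs) ==> word_arr C M cs w \<in> Arr C"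
  "w \<in> bwords (length cs) ==> Dom C (word_arr C M cs w) = tot M cs"
  "w \<in> bwords (length cs) ==> Cod C (word_arr C M cs w) = tot M cs"
  using word_arr_arr[of w cs M] by auto

lemma word_arr_append: "v \<in> bwords (length cs) ==> w \<in> bwords (length cs) ==>
    word_arr C M cs (v @ w) = word_arr C M (permute w cs) v o word_arr C M cs w"
proof (induction v)
  case (Cons l v)
  thus ?case
    using letter_arr_arr[of l "permute v (permute w cs)" M] by (simp add: comp_assoc)
qed auto

lemma whisker_comp: "f \<in> Arr C ==> g \<in> Arr C ==> Cod C f = Dom C g ==>
    (Id C n**g**Id C m) o (Id C n**f**Id C m) = Id C n**(g o f)**Id C m"
  by (simp add: ten_comp)

lemma word_arr_cong:
  assumes "u \<in> bwords (length cs)" "v \<in> bwords (length cs)" "w \<in> bwords (length cs)" "w' \<in> bwords (length cs)"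
    "permute w (permute v cs) = permute w' (permute v cs)"
    "word_arr C M (permute v cs) w = word_arr C M (permute v cs) w'"
  shows "word_arr C M cs (u @ w @ v) = word_arr C M cs (u @ w' @ v)"
  using assms by (simp add: word_arr_append)

text \<open>This is naturality of the braiding of \<open>c\<close> past a sum with respect to
  \<open>braid C d e\<close>, expanded on both sides by the hexagon.\<close>

lemma yang_baxter:
  "(braid C d e**Id C c) o (Id C d**braid C c e) o (braid C c d**Id C e) =
   (Id C e**braid C c d) o (braid C c e**Id C d) o (Id C c**braid C d e)"
proof -
  have "(braid C d e**Id C c) o braid C c (d + e) = braid C c (e + d) o (Id C c**braid C d e)"
    using braid_nat[of "Id C c" "braid C d e"] by simp
  thus ?thesis by (simp add: hex1 comp_assoc)
qed

text \<open>The Artin relation is the Yang-Baxter equation, the far relation is the interchange law,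
  and cancellation is invertibility of the braiding. Splitting the colour list reduces each to the
  strands concerned.\<close>

lemma word_arr_braid_eq: "braid_eq n v w ==> length cs = n ==> word_arr C M cs v = word_arr C M cs w"
proof (induction arbitrary: cs rule: braid_eq.induct)
  case (cong u v w w')
  thus ?case
    using braid_eq_bwords[OF cong.hyps(3)] permute_braid_eq[OF cong.hyps(3), of "permute v cs"] cong.IH[of "permute v cs"]
    by (intro word_arr_cong) auto
next
  case (cancel i s)
  obtain as c d bs where 1: "cs = as @ c # d # bs" "i = Suc (length as)"
    using cancel split_two[of i cs] by auto
  thus ?case
    by (simp add: letter_arr_split whisker_comp) (simp add: ten_id add.assoc)
next
  case (artin i)
  obtain as c d bs where 1: "cs = as @ c # d # bs" "i = Suc (length as)"
    using artin split_two[of i cs] by auto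
  then obtain e bs' where 2: "bs = e # bs'" using artin by (cases bs) auto
  define n m where "n = tot M as" and "m = tot M bs'"
  define c' d' e' where "c' = M c" and "d' = M d" and "e' = M e"
  have L: "letter_arr C M (as @ x # y # z # bs') (Suc (length as), True)
      = Id C n**(braid C (M x) (M y)**Id C (M z))**Id C m"
    and R: "letter_arr C M (as @ x # y # z # bs') (Suc (Suc (length as)), True)
      = Id C n**(Id C (M x)**braid C (M y) (M z))**Id C m" for x y z
    using letter_arr_split[of M as x y "z # bs'" True] letter_arr_split[of M "as @ [x]" y z bs' True]
    by (simp_all add: crossing_def n_def m_def ten_assoc flip: ten_id)
  have sw: "swap_at (Suc (length as)) (as @ x # y # z # bs') = as @ y # x # z # bs'"
    "swap_at (Suc (Suc (length as))) (as @ x # y # z # bs') = as @ x # z # y # bs'" for x y z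
    using swap_at_split[of "as @ [x]" y z bs'] by simp_all
  have "word_arr C M cs [(i, True), (i + 1, True), (i, True)] = Id C n **
     ((braid C d' e'**Id C c') o (Id C d'**braid C c' e') o (braid C c' d'**Id C e'))**Id C m"
    by (simp add: 1 2 L R sw whisker_comp c'_def d'_def e'_def comp_id_right add.assoc n_def[symmetric] m_def[symmetric])
  moreover have "word_arr C M cs [(i + 1, True), (i, True), (i + 1, True)] = Id C n **
     ((Id C e'**braid C c' d') o (braid C c' e'**Id C d') o (Id C c'**braid C d' e'))**Id C m"
    by (simp add: 1 2 L R sw whisker_comp c'_def d'_def e'_def comp_id_right add.assoc n_def[symmetric] m_def[symmetric])
  ultimately show ?case by (simp only: yang_baxter)
next
  case (far i j)
  obtain as c d bs where 1: "cs = as @ c # d # bs" "i = Suc (length as)"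
    using far split_two[of i cs] by auto
  have "1 \<le> j - i - 1" "j - i - 1 < length bs" using far 1 by auto
  then obtain as' c' d' bs' where 2: "bs = as' @ c' # d' # bs'" "j - i - 1 = Suc (length as')"
    using split_two[of "j - i - 1" bs] by blast
  have j: "j = Suc (length (as @ c # d # as'))" using 1 2 far by simp
  define n k m where "n = tot M as" and "k = tot M as'" and "m = tot M bs'"
  have L: "letter_arr C M (as @ x # y # as' @ z # w # bs') (Suc (length as), True)
      = Id C n**braid C (M x) (M y)**Id C k**Id C (M z + M w)**Id C m"
    and R: "letter_arr C M (as @ x # y # as' @ z # w # bs') (Suc (length (as @ x # y # as')), True)
      = Id C n**Id C (M x + M y)**Id C k**braid C (M z) (M w)**Id C m" for x y z w
    using letter_arr_split[of M as x y "as' @ z # w # bs'" True] letter_arr_split[of M "as @ x # y # as'" z w bs' True]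
    by (simp_all add: crossing_def n_def m_def k_def ten_id add.assoc) (simp_all add: ten_assoc add.assoc flip: ten_id)
  have sw: "swap_at (Suc (length as)) (as @ x # y # as' @ z # w # bs') = as @ y # x # as' @ z # w # bs'"
    "swap_at (Suc (length (as @ x # y # as'))) (as @ x # y # as' @ z # w # bs') = as @ x # y # as' @ w # z # bs'" for x y z w
    using swap_at_split[of "as @ x # y # as'" z w bs'] by simp_all
  note [simp del] = length_append list.size
  have j': "j = Suc (length (as @ d # c # as'))" using j by (simp add: length_append list.size)
  have "word_arr C M cs [(i, True), (j, True)] =
    (Id C n**braid C (M c) (M d)**Id C k**Id C (M d' + M c')**Id C m) o
    (Id C n**Id C (M c + M d)**Id C k**braid C (M c') (M d')**Id C m)"
    unfolding j by (simp add: 1 2 L R sw n_def[symmetric] k_def[symmetric] m_def[symmetric] add.assoc)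
  moreover have "word_arr C M cs [(j, True), (i, True)] =
    (Id C n**Id C (M d + M c)**Id C k**braid C (M c') (M d')**Id C m) o
    (Id C n**braid C (M c) (M d)**Id C k**Id C (M c' + M d')**Id C m)"
    unfolding j' by (simp add: 1 2 L R sw n_def[symmetric] k_def[symmetric] m_def[symmetric] add.assoc)
  ultimately show ?case by (simp add: ten_comp add.commute)
qed auto

lemma word_arr_left: "w \<in> bwords (length cs) ==> word_arr C M (cs @ ds) w = word_arr C M cs w**Id C (tot M ds)"
proof (induction w)
  case Nil thus ?case by (simp add: ten_id)
next
  case (Cons l w)
  obtain as c d bs where 1: "permute w cs = as @ c # d # bs" "fst l = Suc (length as)"
    using Cons.prems split_two[of "fst l" "permute w cs"] by auto
  have "letter_arr C M (permute w cs @ ds) l = letter_arr C M (permute w cs) l**Id C (tot M ds)"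
    using letter_arr_split[of M as c d "bs @ ds" "snd l"] letter_arr_split[of M as c d bs "snd l"] 1
    by (cases l) (simp add: ten_assoc flip: ten_id)
  thus ?case using Cons letter_arr_arr[of l "permute w cs" M] by (simp add: permute_left ten_comp)
qed

lemma word_arr_shift: "w \<in> bwords (length cs) ==>
    word_arr C M (as @ cs) (shift_word (length as) w) = Id C (tot M as)**word_arr C M cs w"
proof (induction w)
  case Nil thus ?case by (simp add: ten_id)
next
  case (Cons l w)
  obtain es c d bs where 1: "permute w cs = es @ c # d # bs" "fst l = Suc (length es)"
    using Cons.prems split_two[of "fst l" "permute w cs"] by auto
  have "letter_arr C M (as @ permute w cs) (length as + fst l, snd l) = Id C (tot M as)**letter_arr C M (permute w cs) l"
    using letter_arr_split[of M "as @ es" c d bs "snd l"] letter_arr_split[of M es c d bs "snd l"] 1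
    by (cases l) (simp add: ten_assoc flip: ten_id)
  thus ?case using Cons letter_arr_arr[of l "permute w cs" M] by (simp add: permute_shift ten_comp)
qed

lemma word_arr_sum: "v \<in> bwords (length cs) ==> w \<in> bwords (length ds) ==>
    word_arr C M (cs @ ds) (v @ shift_word (length cs) w) = word_arr C M cs v**word_arr C M ds w"
  using bwords_mono[of v "length cs" "length (cs @ ds)"]
  by (simp add: word_arr_append permute_shift word_arr_left word_arr_shift ten_comp)

lemma word_arr_row: "word_arr C M (as @ c # ds @ bs) (row_word (length as) (length ds) s) =
    Id C (tot M as)**crossing C s (M c) (tot M ds)**Id C (tot M bs)"
proof (induction ds arbitrary: bs rule: rev_induct)
  case Nil thus ?case by (simp add: ten_id add.assoc)
next
  case (snoc d ds)
  have 1: "letter_arr C M (as @ ds @ c # d # bs) (Suc (length as + length ds), s) =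
      Id C (tot M as)**(Id C (tot M ds)**crossing C s (M c) (M d))**Id C (tot M bs)"
    using letter_arr_split[of M "as @ ds" c d bs s] by (simp add: ten_assoc flip: ten_id)
  have 2: "Id C (tot M as)**crossing C s (M c) (tot M ds)**Id C (M d + tot M bs) =
      Id C (tot M as)**(crossing C s (M c) (tot M ds)**Id C (M d))**Id C (tot M bs)"
    by (simp add: ten_assoc flip: ten_id)
  show ?case using snoc[of "d # bs"] permute_row[of as ds s c "d # bs"] by (simp add: 1 2 whisker_comp crossing_hex1)
qed

text \<open>The two hexagons assemble the elementary crossings, first along a row and then over the
  rows, into the crossing of the two total objects.\<close>

lemma word_arr_block: "word_arr C M (as @ cs @ ds @ bs) (block_word (length as) (length cs) (length ds) s) =
    Id C (tot M as)**crossing C s (tot M cs) (tot M ds)**Id C (tot M bs)"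
proof (induction cs arbitrary: as)
  case Nil thus ?case by (simp add: ten_id add.assoc)
next
  case (Cons c cs)
  have 1: "word_arr C M (as @ c # ds @ cs @ bs) (row_word (length as) (length ds) s) =
      Id C (tot M as)**(crossing C s (M c) (tot M ds)**Id C (tot M cs))**Id C (tot M bs)"
    using word_arr_row[of M as c ds "cs @ bs" s] by (simp add: ten_assoc flip: ten_id)
  have 2: "word_arr C M (as @ c # cs @ ds @ bs) (block_word (Suc (length as)) (length cs) (length ds) s) =
      Id C (tot M as)**(Id C (M c)**crossing C s (tot M cs) (tot M ds))**Id C (tot M bs)"
    using Cons[of "as @ [c]"] by (simp add: ten_assoc flip: ten_id)
  have 3: "permute (block_word (Suc (length as)) (length cs) (length ds) s) (as @ c # cs @ ds @ bs) = as @ c # ds @ cs @ bs"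
    using permute_block[of "as @ [c]" cs ds s bs] by simp
  show ?case by (simp add: block_word_Suc word_arr_append 1 2 3 whisker_comp crossing_hex2)
qed

lemma word_arr_map: "w \<in> bwords (length cs) ==> word_arr C M (map h cs) w = word_arr C (\<lambda>c. M (h c)) cs w"
proof (induction w)
  case Nil thus ?case by (simp add: tot_def comp_def)
next
  case (Cons l w)
  obtain as c d bs where 1: "permute w cs = as @ c # d # bs" "fst l = Suc (length as)"
    using Cons.prems split_two[of "fst l" "permute w cs"] by auto
  have "permute w (map h cs) = map h as @ h c # h d # map h bs"
    using 1 map_permute[of w cs h] Cons.prems by simp
  thus ?case
    using Cons 1 letter_arr_split[of M "map h as" "h c" "h d" "map h bs" "snd l"]
      letter_arr_split[of "\<lambda>c. M (h c)" as c d bs "snd l"]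
    by (cases l) (simp add: tot_def comp_def)
qed

text \<open>Each cabled letter is a block crossing, whose value is the crossing of total objects;
  and that is the value of the uncabled letter with lists as colours. Further properties of cabling
  are read off from this.\<close>

lemma word_arr_lcable: "w \<in> bwords (length css) ==>
    word_arr C M (concat css) (lcable (map length css) w) = word_arr C (tot M) css w"
proof (induction w)
  case Nil
  have "tot M (concat css) = tot (tot M) css" for css by (induction css) auto
  thus ?case by simp
next
  case (Cons l w)
  obtain as c d bs where 1: "permute w css = as @ c # d # bs" "fst l = Suc (length as)"
    using Cons.prems split_two[of "fst l" "permute w css"] by auto
  have "permute w (map length css) = map length as @ length c # length d # map length bs"
    using map_permute[of w css length] 1 Cons.prems by simp
  from lcable_letter[OF this, of "snd l"]
  have 2: "lcable (map length css) (l # w) = block_word (length (concat as)) (length c) (length d) (snd l) @ lcable (map length css) w"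
    using 1 by (cases l) (simp add: length_concat)
  have lw: "lcable (map length css) (l # w) \<in> bwords (length (concat css))"
    using bwords_lcable[of "l # w" "map length css"] Cons.prems by (simp add: length_concat)
  have tc: "tot M (concat css) = tot (tot M) css" for css by (induction css) auto
  show ?case
    using Cons lw 1 word_arr_block[of M "concat as" c d "concat bs" "snd l"] letter_arr_split[of "tot M" as c d bs "snd l"]
    unfolding 2 by (cases l) (simp add: word_arr_append permute_lcable tc)
qed

end

text \<open>With the generator of the braid category as the only object, evaluation returns the
  braid of the word itself, so it detects braid equality.\<close>

lemma word_arr_BC_1: "w \<in> bwords (length cs) ==> word_arr BC (\<lambda>_. 1) cs w = br (length cs) w"
proof (induction w)
  case Nil thus ?case by (simp add: tot_def sum_list_triv)
next
  case (Cons l w)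
  obtain as c d bs where 1: "permute w cs = as @ c # d # bs" "fst l = Suc (length as)"
    using Cons.prems split_two[of "fst l" "permute w cs"] by auto
  have len: "length cs = length as + (2 + length bs)" using 1(1) length_permute[of w cs] by simp
  have True: "braid BC 1 1 = br 2 [(1, True)]" by (simp add: numeral_2_eq_2)
  have "braid_eq (Suc (Suc 0)) [(Suc 0, True), (Suc 0, False)] []"
    using braid_eq.cancel[of 1 2 True] by (simp add: numeral_2_eq_2)
  hence "binv BC 1 1 = br 2 [(1, False)]"
    using True by (intro BC.binv_eqI) (simp_all add: numeral_2_eq_2 br_eqI del: BC_simps(8))
  hence "crossing BC s 1 1 = br 2 [(1, s)]" for s using True by (simp add: crossing_def)
  hence "letter_arr BC (\<lambda>_. 1) (permute w cs) l = br (length cs) [l]"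
    using 1 len BC.letter_arr_split[of "\<lambda>_. 1" as c d bs "snd l"]
    by (cases l) (simp add: tot_def sum_list_triv)
  thus ?case using Cons by simp
qed

lemma word_arr_BC: "w \<in> bwords (length ks) ==> word_arr BC id ks w = br (sum_list ks) (lcable ks w)"
proof -
  assume w: "w \<in> bwords (length ks)"
  define css where "css = map (\<lambda>k. replicate k ()) ks"
  have 1: "length (concat css) = sum_list ks" "map length css = ks" by (auto simp: css_def length_concat comp_def)
  have 2: "map (tot (\<lambda>_. 1)) css = ks" by (auto simp: css_def tot_def sum_list_replicate comp_def)
  have "word_arr BC id ks w = word_arr BC (tot (\<lambda>_. 1)) css w"
    using BC.word_arr_map[of w css id "tot (\<lambda>_. 1)"] w 2 by (simp add: css_def)
  also have "... = br (sum_list ks) (lcable ks w)"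
    using BC.word_arr_lcable[of w css "\<lambda>_. 1"] word_arr_BC_1[of "lcable ks w" "concat css"] bwords_lcable[OF w] 1 w
    by (simp add: css_def)
  finally show ?thesis .
qed

text \<open>The braid of a cabled word is a value of \<open>word_arr\<close> in the category of
  braids and inherits invariance under the braid relations; no relation has to be checked on
  cables.\<close>

lemma lcable_braid_eq: "braid_eq (length ks) v w ==> braid_eq (sum_list ks) (lcable ks v) (lcable ks w)"
  using BC.word_arr_braid_eq[of "length ks" v w ks id] braid_eq_bwords[of "length ks" v w]
  by (auto intro!: br_eqD bwords_lcable simp: word_arr_BC)

text \<open>Both words represent the value of \<open>w\<close> in the braid category with the same
  total multiplicities, computed once with lists as colours and once with their sums.\<close>

lemma lcable_lcable:
  assumes "w \<in> bwords (length kss)"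
  shows "braid_eq (sum_list (concat kss)) (lcable (concat kss) (lcable (map length kss) w)) (lcable (map sum_list kss) w)"
proof -
  have l: "lcable (map length kss) w \<in> bwords (length (concat kss))"
    using bwords_lcable[of w "map length kss"] assms by (simp add: length_concat)
  have s: "sum_list (map sum_list kss) = sum_list (concat kss)" by (induction kss) auto
  have "br (sum_list (concat kss)) (lcable (map sum_list kss) w) = word_arr BC id (map sum_list kss) w"
    using assms s by (simp add: word_arr_BC)
  also have "... = word_arr BC (tot id) kss w"
    using BC.word_arr_map[of w kss id sum_list] assms by (simp add: tot_def[abs_def])
  also have "... = br (sum_list (concat kss)) (lcable (concat kss) (lcable (map length kss) w))"
    using BC.word_arr_lcable[of w kss id] assms l by (simp add: word_arr_BC)
  finally show ?thesis using br_eqD[OF _ bwords_lcable[OF l]] by simp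
qed

section \<open>Order-preserving maps encoded by their fibre sizes\<close>

section \<open>Order-preserving maps as lists of fibre sizes\<close>

declare upt_Suc [simp del]

text \<open>The pull-back of a colouring \<open>cs\<close> of the target along the order-preserving
  map with fibre sizes \<open>ks\<close>.\<close>

definition rep :: "nat list => 'c list => 'c list" where
  "rep ks cs = concat (map2 replicate ks cs)"

lemma rep_simps [simp]: "rep [] cs = []" "rep ks [] = []" "rep (k # ks) (c # cs) = replicate k c @ rep ks cs"
  by (auto simp: rep_def)

lemma rep_append: "length ks = length cs ==> rep (ks @ ks') (cs @ cs') = rep ks cs @ rep ks' cs'"
  by (induction ks cs rule: list_induct2) auto

lemma length_rep [simp]: "length ks = length cs ==> length (rep ks cs) = sum_list ks"
  by (induction ks cs rule: list_induct2) auto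

lemma map_rep: "map f (rep ks cs) = rep ks (map f cs)"
  by (induction ks arbitrary: cs) (auto simp: rep_def zip_map2 map_concat comp_def case_prod_unfold)

lemma set_rep: "set (rep ks cs) \<subseteq> set cs"
  by (auto simp: rep_def dest: set_zip_rightD)

lemma rep_replicate_1 [simp]: "length cs = n ==> rep (replicate n (Suc 0)) cs = cs"
  by (induction cs arbitrary: n) auto

lemma rep_replicate: "length ks = n ==> rep ks (replicate n c) = replicate (sum_list ks) c"
  by (induction ks arbitrary: n) (auto simp: replicate_add)

lemma rep_concat: "length kss = length cs ==> rep (concat kss) (rep (map length kss) cs) = rep (map sum_list kss) cs"
  by (induction kss cs rule: list_induct2) (auto simp: rep_append rep_replicate)

lemma map2_rep: "length ks = length cs ==> length ds = length cs ==> map2 f (rep ks cs) (rep ks ds) = rep ks (map2 f cs ds)"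
  by (induction ks cs arbitrary: ds rule: list_induct2) (auto simp: length_Suc_conv map_replicate_const)

lemma sum_list_concat: "sum_list (concat kss) = sum_list (map sum_list kss)" for kss :: "nat list list"
  by (induction kss) auto

lemma ex_chunks: "sum_list ns = length xs ==> \<exists>xss. concat xss = xs \<and> map length xss = ns"
proof (induction ns arbitrary: xs)
  case (Cons n ns)
  then obtain xss where "concat xss = drop n xs" "map length xss = ns" by force
  thus ?case using Cons.prems by (intro exI[of _ "take n xs # xss"]) simp
qed auto

lemma permute_rep:
  assumes "w \<in> bwords (length ks)" "length cs = length ks"
  shows "permute (lcable ks w) (rep ks cs) = rep (permute w ks) (permute w cs)"
proof -
  have l: "length (map2 replicate ks cs) = length ks" "map length (map2 replicate ks cs) = ks"
    using assms(2) by (simp_all add: map_fst_zip comp_def case_prod_unfold)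
  show ?thesis
    using permute_lcable[of w "map2 replicate ks cs"] map2_permute[of w ks cs replicate] assms l
    by (simp add: rep_def)
qed

text \<open>The values of the map with fibre sizes \<open>ks\<close>, got by colouring each target
  position with its own number.\<close>

definition dlist :: "nat list => nat list" where
  "dlist ks = rep ks [1..<Suc (length ks)]"

text \<open>Lists are indexed from \<open>0\<close>, strands and points from \<open>1\<close>;
  \<open>lab\<close> passes to the extensional functions in which \<open>Q\<close> is
  defined.\<close>

definition lab :: "'c list => nat => 'c" where
  "lab xs = (\<lambda>i\<in>{1..length xs}. xs ! (i - 1))"

definition dmap :: "nat list => nat => nat" where
  "dmap ks = lab (dlist ks)"

lemma length_dlist [simp]: "length (dlist ks) = sum_list ks"
  by (simp add: dlist_def)

lemma lab_map: "lab (map f [1..<Suc n]) = (\<lambda>i\<in>{1..n}. f i)"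
  by (auto simp: lab_def fun_eq_iff)

lemma map_lab: "map (lab xs) [1..<Suc (length xs)] = xs"
  by (rule nth_equalityI) (auto simp: lab_def)

lemma lab_inject: "length xs = length ys ==> lab xs = lab ys ==> xs = ys"
  by (metis map_lab)

lemma lab_cases: "f \<in> {1..n} \<rightarrow>\<^sub>E A ==> \<exists>xs. length xs = n \<and> set xs \<subseteq> A \<and> f = lab xs"
  by (rule exI[of _ "map f [1..<Suc n]"]) (auto simp: lab_map[unfolded One_nat_def] PiE_iff extensional_restrict)

lemma lab_PiE: "set xs \<subseteq> A ==> lab xs \<in> {1..length xs} \<rightarrow>\<^sub>E A"
  by (auto simp: lab_def intro!: subsetD[OF _ nth_mem, of xs A])

lemma rep_lab: "length xs = length ks ==> rep ks xs = map (lab xs) (dlist ks)"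
  using map_lab[of xs] by (simp add: dlist_def map_rep)

lemma set_dlist: "set (dlist ks) \<subseteq> {1..length ks}"
  using set_rep[of ks "[1..<Suc (length ks)]"] by (auto simp: dlist_def)

lemma sorted_rep: "sorted cs ==> sorted (rep ks (cs :: nat list))"
proof (induction ks arbitrary: cs)
  case (Cons k ks)
  thus ?case using set_rep[of ks "tl cs"] by (cases cs) (auto simp: sorted_append)
qed simp

lemma count_rep: "distinct cs ==> count_list (rep (map f cs) cs) c = (if c \<in> set cs then f c else 0)"
proof (induction cs)
  case (Cons d cs)
  have "count_list (replicate n d) c = (if c = d then n else 0)" for n by (induction n) auto
  thus ?case using Cons by auto
qed simp

lemma fibre_card_count: "fibre_card n \<phi> i = count_list (map \<phi> [1..<Suc n]) i"
proof -
  have "{j \<in> {1..n}. \<phi> j = i} = set (filter (\<lambda>j. \<phi> j = i) [1..<Suc n])" by auto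
  hence "fibre_card n \<phi> i = length (filter (\<lambda>j. \<phi> j = i) [1..<Suc n])"
    by (simp add: fibre_card_def distinct_card del: set_filter)
  also have "... = count_list (map \<phi> [1..<Suc n]) i"
    by (simp add: count_list_eq_length_filter filter_map comp_def eq_commute[of i])
  finally show ?thesis .
qed

lemma fibre_card_dmap: "map (fibre_card (sum_list ks) (dmap ks)) [1..<Suc (length ks)] = ks"
proof -
  have ks: "map (lab ks) [1..<Suc (length ks)] = ks" by (rule map_lab)
  have "fibre_card (sum_list ks) (dmap ks) i = count_list (dlist ks) i" for i
    using map_lab[of "dlist ks"] by (simp add: fibre_card_count dmap_def)
  moreover have "count_list (dlist ks) i = lab ks i" if "i \<in> set [1..<Suc (length ks)]" for i
    using count_rep[of "[1..<Suc (length ks)]" "lab ks" i] that unfolding ks dlist_def by simp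
  ultimately show ?thesis using map_lab[of ks] by (metis (no_types, lifting) map_cong)
qed

lemma fibre_card_nth: "1 \<le> i ==> i \<le> length ks ==> fibre_card (sum_list ks) (dmap ks) i = ks ! (i - 1)"
  using arg_cong[OF fibre_card_dmap[of ks], of "\<lambda>l. l ! (i - 1)"] by (simp)

lemma dmap_D_hom: "dmap ks \<in> D_hom (sum_list ks) (length ks)"
proof -
  have "mono_on {1..sum_list ks} (dmap ks)"
  proof (rule mono_onI)
    fix r t assume rt: "r \<in> {1..sum_list ks}" "t \<in> {1..sum_list ks}" "r \<le> t"
    have "sorted (dlist ks)" by (simp add: dlist_def sorted_rep)
    from sorted_nth_mono[OF this, of "r - 1" "t - 1"] rt show "dmap ks r \<le> dmap ks t"
      by (auto simp: dmap_def lab_def)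
  qed
  thus ?thesis using lab_PiE[OF set_dlist[of ks]] by (simp add: D_hom_def dmap_def)
qed

text \<open>The list of values of a monotone map is sorted, and a sorted list is determined by its
  multiset, that is, by the fibre sizes.\<close>

lemma D_hom_cases:
  assumes "\<phi> \<in> D_hom n m"
  obtains ks where "\<phi> = dmap ks" "n = sum_list ks" "m = length ks"
proof
  define ks where "ks = map (fibre_card n \<phi>) [1..<Suc m]"
  let ?l = "map \<phi> [1..<Suc n]"
  have l: "length ks = m" by (simp add: ks_def)
  have set: "set ?l \<subseteq> {1..m}" using assms by (auto simp: D_hom_def)
  have "sorted ?l" using assms by (auto simp: D_hom_def sorted_iff_nth_mono mono_on_def)
  moreover have "sorted (dlist ks)" by (simp add: dlist_def sorted_rep)
  moreover have "mset ?l = mset (dlist ks)"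
  proof (rule multiset_eqI)
    fix i
    have "count_list (dlist ks) i = (if i \<in> {1..m} then fibre_card n \<phi> i else 0)"
      using count_rep[of "[1..<Suc m]" "fibre_card n \<phi>" i] unfolding dlist_def l by (auto simp: ks_def)
    also have "... = count_list ?l i"
    proof (cases "i \<in> {1..m}")
      case False
      hence "i \<notin> set ?l" using set by blast
      thus ?thesis using False count_list_0_iff[of ?l i] by presburger
    qed (simp only: fibre_card_count if_True)
    finally show "count (mset ?l) i = count (mset (dlist ks)) i" by (simp only: count_mset)
  qed
  ultimately have eq: "dlist ks = ?l" using properties_for_sort by metis
  thus "n = sum_list ks" using length_dlist[of ks] by simp
  show "m = length ks" using l by simp
  show "\<phi> = dmap ks" unfolding dmap_def eq lab_map
    using assms by (auto simp: D_hom_def PiE_iff intro!: extensional_restrict[symmetric])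
qed

lemma dmap_inject: "length ks = length ks' ==> sum_list ks = sum_list ks' ==> dmap ks = dmap ks' ==> ks = ks'"
  by (metis fibre_card_dmap)

text \<open>\<open>kss\<close> groups the fibre sizes of the first map by the fibres of the second:
  the group lengths are the fibre sizes of the second map and the group sums those of the
  composite.\<close>

lemma compose_dmap:
  assumes "ks1 = concat kss"
  shows "compose {1..sum_list ks1} (dmap (map length kss)) (dmap ks1) = dmap (map sum_list kss)"
proof -
  have l: "length ks1 = sum_list (map length kss)" "sum_list (map sum_list kss) = sum_list ks1"
    using assms by (simp_all add: length_concat sum_list_concat)
  have "dlist (map sum_list kss) = rep ks1 (dlist (map length kss))"
    using rep_concat[of kss "[1..<Suc (length kss)]"] assms by (simp add: dlist_def)
  also have "... = map (dmap (map length kss)) (dlist ks1)"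
    using rep_lab[of "dlist (map length kss)" ks1] l by (simp add: dmap_def)
  finally have "dmap (map sum_list kss) = lab (map (dmap (map length kss)) (dlist ks1))" unfolding dmap_def by simp
  thus ?thesis by (auto simp: dmap_def[of ks1] lab_def compose_def fun_eq_iff)
qed

lemma D_sum_dmap: "D_sum (sum_list ks) (sum_list ks') (length ks) (dmap ks) (dmap ks') = dmap (ks @ ks')"
proof -
  have "[1..<Suc (length (ks @ ks'))] = [1..<Suc (length ks)] @ map (\<lambda>i. length ks + i) [1..<Suc (length ks')]"
    by (rule nth_equalityI) (auto simp: nth_append)
  hence "dlist (ks @ ks') = dlist ks @ map (\<lambda>i. length ks + i) (dlist ks')"
    by (simp add: dlist_def rep_append map_rep)
  thus ?thesis by (auto simp: D_sum_def juxtapose_def dmap_def lab_def nth_append fun_eq_iff)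
qed

lemma juxtapose_lab: "juxtapose (length xs) (length ys) (lab xs) (lab ys) = lab (xs @ ys)"
  by (auto simp: juxtapose_def lab_def nth_append fun_eq_iff)

lemma D_id_dmap: "D_id n = dmap (replicate n (Suc 0))"
  by (auto simp: D_id_def dmap_def lab_def dlist_def fun_eq_iff)

lemma lab_replicate: "lab (replicate n c) = (\<lambda>i\<in>{1..n}. c)"
  by (auto simp: lab_def fun_eq_iff)

section \<open>Agreement of the list encoding with \<open>push\<close>, \<open>pull\<close> and
  \<open>cable\<close>\<close>

subsection \<open>Permutations and cabling\<close>

lemma word_perm_append: "word_perm (v @ w) = word_perm v \<circ> word_perm w"
  by (induction v) (auto simp: comp_assoc split: prod.splits)

lemma word_perm_braid_eq: "braid_eq n v w ==> word_perm v = word_perm w"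
proof (induction rule: braid_eq.induct)
  case (cong u v w w') thus ?case by (simp add: word_perm_append)
next
  case (artin i) show ?case by (auto simp: fun_eq_iff transpose_def)
next
  case (far i j) thus ?case by (auto simp: fun_eq_iff transpose_def)
qed (auto simp: fun_eq_iff)

lemma braid_perm_class:
  assumes "w \<in> bwords n" shows "braid_perm (braid_class n w) = word_perm w"
proof -
  have "(SOME v. v \<in> braid_class n w) \<in> braid_class n w"
    using braid_class_self[OF assms] by (rule someI)
  thus ?thesis unfolding braid_perm_def using word_perm_braid_eq by (auto simp: braid_class_def)
qed

lemma bij_word_perm: "bij (word_perm w)"
  by (induction w rule: word_perm.induct) (auto intro: bij_comp simp del: id_apply comp_apply simp: bij_id)

lemma word_perm_range: "w \<in> bwords n ==> i \<in> {1..n} ==> word_perm w i \<in> {1..n}"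
  by (induction w rule: word_perm.induct) (auto simp: transpose_def)

lemma nth_permute: "w \<in> bwords (length cs) ==> i \<in> {1..length cs} ==> permute w cs ! (word_perm w i - 1) = cs ! (i - 1)"
proof (induction w rule: word_perm.induct)
  case (2 k s w)
  have "word_perm w i \<in> {1..length cs}" using 2 word_perm_range[of w "length cs" i] by simp
  thus ?case using 2 by (auto simp: swap_at_def transpose_def nth_list_update)
qed auto

text \<open>The bridge between two encodings: precomposing a function with the inverse permutation
  is moving the list of its values along the strands.\<close>

lemma permute_map_upt:
  assumes "w \<in> bwords n"
  shows "permute w (map k [1..<Suc n]) = map (k \<circ> inv_into UNIV (word_perm w)) [1..<Suc n]"
proof (rule nth_equalityI)
  fix j assume "j < length (permute w (map k [1..<Suc n]))"
  hence j: "Suc j \<in> {1..n}" by simp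
  have "word_perm w ` {1..n} = {1..n}"
    using word_perm_range[OF assms] bij_word_perm[of w]
    by (intro card_subset_eq) (auto simp: card_image bij_def inj_on_def inj_def)
  then obtain i where i: "i \<in> {1..n}" "word_perm w i = Suc j" using j by (metis imageE)
  have "inv_into UNIV (word_perm w) (Suc j) = i" using i(2) bij_word_perm[of w] by (metis bij_inv_eq_iff)
  thus "permute w (map k [1..<Suc n]) ! j = map (k \<circ> inv_into UNIV (word_perm w)) [1..<Suc n] ! j"
    using nth_permute[of w "map k [1..<Suc n]" i] i j assms nth_map_upt[of "i - 1" "Suc n" 1 k] by auto
qed simp

lemma cable_word_lcable: "w \<in> bwords n ==> cable_word k w = lcable (map k [1..<Suc n]) w"
proof (induction w)
  case (Cons l w)
  obtain i s where l: "l = (i, s)" by fastforce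
  have i: "1 \<le> i" "i < n" using Cons.prems l by auto
  let ?k = "k \<circ> inv_into UNIV (word_perm w)"
  have "take (i - 1) (map ?k [1..<Suc n]) = map ?k [1..<i]"
    using i by (simp add: take_map take_upt)
  moreover have "sum_list (map ?k [1..<i]) = (\<Sum>j\<in>{1..<i}. ?k j)" by (simp add: sum_list_distinct_conv_sum_set)
  ultimately show ?case
    using Cons permute_map_upt[of w n k] i by (simp add: l Let_def cable_letter_def)
qed simp

lemma cable_class:
  assumes "w \<in> bwords (length ks)"
  shows "cable (sum_list ks) (fibre_card (sum_list ks) (dmap ks)) (braid_class (length ks) w) = braid_class (sum_list ks) (lcable ks w)"
proof -
  have "braid_class (sum_list ks) (cable_word (fibre_card (sum_list ks) (dmap ks)) v) = braid_class (sum_list ks) (lcable ks w)"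
    if "v \<in> braid_class (length ks) w" for v
  proof -
    have "braid_eq (length ks) w v" using that by (simp add: braid_class_def)
    moreover from this have "cable_word (fibre_card (sum_list ks) (dmap ks)) v = lcable ks v"
      using braid_eq_bwords cable_word_lcable fibre_card_dmap by metis
    ultimately show ?thesis using lcable_braid_eq[of ks w v] by (auto intro!: braid_class_eqI intro: braid_eq.sym)
  qed
  thus ?thesis unfolding cable_def using braid_class_self[OF assms] by auto
qed

text \<open>The fibre condition that defines \<open>push\<close> says that the fibre sizes are
  carried along the strands; uniqueness holds since a monotone map is determined by its fibre
  sizes.\<close>

lemma push_dmap:
  assumes "w \<in> bwords (length ks)"
  shows "push (sum_list ks) (length ks) (x, braid_class (length ks) w) (dmap ks) = dmap (permute w ks)"
  unfolding push_def
proof (rule the_equality)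
  let ?n = "sum_list ks" and ?m = "length ks"
  have s: "sum_list (permute w ks) = ?n" using assms by simp
  show "dmap (permute w ks) \<in> D_hom ?n ?m \<and> (\<forall>i\<in>{1..?m}. fibre_card ?n (dmap (permute w ks))
      (braid_perm (snd (x, braid_class ?m w)) i) = fibre_card ?n (dmap ks) i)"
  proof safe
    show "dmap (permute w ks) \<in> D_hom ?n ?m" using dmap_D_hom[of "permute w ks"] s by simp
    fix i assume i: "i \<in> {1..?m}"
    have "fibre_card ?n (dmap (permute w ks)) (word_perm w i) = ks ! (i - 1)"
      using fibre_card_nth[of "word_perm w i" "permute w ks"] word_perm_range[OF assms i] nth_permute[OF assms i] s by simp
    thus "fibre_card ?n (dmap (permute w ks)) (braid_perm (snd (x, braid_class ?m w)) i) = fibre_card ?n (dmap ks) i"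
      using fibre_card_nth[of i ks] i assms by (simp add: braid_perm_class)
  qed
  fix \<psi> assume \<psi>: "\<psi> \<in> D_hom ?n ?m \<and> (\<forall>i\<in>{1..?m}. fibre_card ?n \<psi> (braid_perm (snd (x, braid_class ?m w)) i) = fibre_card ?n (dmap ks) i)"
  then obtain ks' where ks': "\<psi> = dmap ks'" "?n = sum_list ks'" "?m = length ks'" using D_hom_cases by metis
  have "permute w ks = ks'"
  proof (rule nth_equalityI)
    fix j assume j: "j < length (permute w ks)"
    have "word_perm w ` {1..?m} = {1..?m}"
      using word_perm_range[OF assms] bij_word_perm[of w]
      by (intro card_subset_eq) (auto simp: card_image bij_def inj_on_def inj_def)
    moreover have "Suc j \<in> {1..?m}" using j by simp
    ultimately obtain i where i: "i \<in> {1..?m}" "word_perm w i = Suc j" by (metis imageE)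
    have "ks' ! j = fibre_card ?n \<psi> (word_perm w i)"
      using fibre_card_nth[of "Suc j" ks'] ks' i j by simp
    also have "... = ks ! (i - 1)"
      using \<psi>[THEN conjunct2, THEN bspec, OF i(1)] i(1) assms fibre_card_nth[of i ks] by (simp add: braid_perm_class)
    finally show "permute w ks ! j = ks' ! j" using nth_permute[OF assms i(1)] i(2) by simp
  qed (use ks' in simp)
  thus "\<psi> = dmap (permute w ks)" using ks' by simp
qed

section \<open>Normal forms for arrows of Q and the PROB axioms\<close>

section \<open>The category Q\<close>

text \<open>A normal form: fibre sizes, labels and a braid word. For admissible data only the word
  is ambiguous, up to braid equality, so computing in \<open>Q\<close> becomes computing with
  lists.\<close>

definition mkq :: "nat list => 'g list => bword => 'g qmor" where
  "mkq ks xs w = \<lparr>qdom = sum_list ks, qcod = length ks, qmap = dmap ks, qbr = (lab xs, braid_class (sum_list ks) w)\<rparr>"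

text \<open>The colour of the strand starting at a position, for a colouring of the target.\<close>

definition src :: "nat list => bword => 'c list => 'c list" where
  "src ks w cs = permute (inverse_word w) (rep ks cs)"

definition qok :: "('g, 'x) monoid_scheme => nat list => 'g list => bword => bool" where
  "qok G ks xs w \<longleftrightarrow> length xs = sum_list ks \<and> set xs \<subseteq> carrier G \<and> w \<in> bwords (sum_list ks)"

lemma length_src [simp]: "length cs = length ks ==> length (src ks w cs) = sum_list ks"
  by (simp add: src_def)

lemma set_src: "w \<in> bwords (sum_list ks) ==> length cs = length ks ==> set (src ks w cs) \<subseteq> set cs"
  using set_rep[of ks cs] set_permute[of "inverse_word w" "rep ks cs"] by (simp add: src_def)

lemma permute_src: "w \<in> bwords (sum_list ks) ==> length cs = length ks ==> permute w (src ks w cs) = rep ks cs"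
  by (simp add: src_def permute_inverse)

lemma src_eqI: "w \<in> bwords (sum_list ks) ==> length cs = length ks ==> length ds = sum_list ks ==> permute w ds = rep ks cs ==> src ks w cs = ds"
  unfolding src_def by (metis permute_inverse')

lemma map_src: "w \<in> bwords (sum_list ks) ==> length cs = length ks ==> map f (src ks w cs) = src ks w (map f cs)"
  by (simp add: src_def map_permute map_rep)

lemma map2_src: "w \<in> bwords (sum_list ks) ==> length cs = length ks ==> length ds = length ks ==>
    map2 f (src ks w cs) (src ks w ds) = src ks w (map2 f cs ds)"
  by (simp add: src_def map2_permute map2_rep)

text \<open>Both sides become \<open>rep (map sum_list kss) cs\<close> when moved along the strands
  of the composite, and moving lists along strands is injective.\<close>

lemma src_comp:
  assumes "w1 \<in> bwords (sum_list ks1)" "w2 \<in> bwords (length ks1)" "permute w2 ks1 = concat kss" "length cs = length kss"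
  shows "src (map sum_list kss) (lcable ks1 w2 @ w1) cs = src ks1 w1 (src (map length kss) w2 cs)"
proof -
  have l: "sum_list (map length kss) = length ks1" using assms(3) by (metis length_concat length_permute)
  have s: "sum_list (map sum_list kss) = sum_list ks1" using assms(2,3) by (metis sum_list_concat sum_list_permute)
  have "permute (lcable ks1 w2 @ w1) (src ks1 w1 (src (map length kss) w2 cs))
      = permute (lcable ks1 w2) (rep ks1 (src (map length kss) w2 cs))"
    using assms l by (simp add: permute_src)
  also have "... = rep (concat kss) (rep (map length kss) cs)"
    using assms l by (simp add: permute_rep permute_src)
  also have "... = rep (map sum_list kss) cs" using assms by (simp add: rep_concat)
  finally show ?thesis
    using assms l s bwords_lcable[of w2 ks1] by (intro src_eqI) auto
qed

lemma src_append:
  assumes "w \<in> bwords (sum_list ks)" "w' \<in> bwords (sum_list ks')" "length cs = length ks" "length cs' = length ks'"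
  shows "src (ks @ ks') (w @ shift_word (sum_list ks) w') (cs @ cs') = src ks w cs @ src ks' w' cs'"
  using assms bwords_mono[of w "sum_list ks" "sum_list (ks @ ks')"] permute_shift[of w' "src ks' w' cs'" "src ks w cs"]
    permute_left[of w "src ks w cs" "rep ks' cs'"]
  by (intro src_eqI) (simp_all add: permute_src rep_append)

lemma mkq_simps [simp]: "qdom (mkq ks xs w) = sum_list ks" "qcod (mkq ks xs w) = length ks"
  by (auto simp: mkq_def)

lemma mkq_eqI: "braid_eq (sum_list ks) v w ==> ks = ks' ==> xs = xs' ==> mkq ks xs v = mkq ks' xs' w"
  by (simp add: mkq_def braid_class_eqI)

lemma mkq_inject:
  assumes "mkq ks xs v = mkq ks' xs' w" "qok G ks xs v" "qok G ks' xs' w"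
  shows "ks = ks' \<and> xs = xs' \<and> braid_eq (sum_list ks) v w"
proof -
  have ks: "ks = ks'" using assms(1) by (intro dmap_inject) (auto simp: mkq_def)
  thus ?thesis
    using assms lab_inject[of xs xs'] braid_class_eq_iff[of v "sum_list ks" w] by (auto simp: mkq_def qok_def)
qed

lemma Arr_Q: "f \<in> Arr (Q_prob G) \<longleftrightarrow> (\<exists>ks xs w. qok G ks xs w \<and> f = mkq ks xs w)"
proof
  assume f: "f \<in> Arr (Q_prob G)"
  then obtain ks where ks: "qmap f = dmap ks" "qdom f = sum_list ks" "qcod f = length ks"
    by (auto simp: Q_prob_def elim: D_hom_cases)
  moreover obtain xs where "length xs = qdom f" "set xs \<subseteq> carrier G" "fst (qbr f) = lab xs"
    using f lab_cases[of "fst (qbr f)" "qdom f" "carrier G"] by (auto simp: Q_prob_def lbraid_group_def)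
  moreover obtain w where "w \<in> bwords (qdom f)" "snd (qbr f) = braid_class (qdom f) w"
    using f by (auto simp: Q_prob_def lbraid_group_def carrier_braid_group)
  ultimately have "qok G ks xs w \<and> f = mkq ks xs w"
    by (cases f) (auto simp: qok_def mkq_def prod_eq_iff)
  thus "\<exists>ks xs w. qok G ks xs w \<and> f = mkq ks xs w" by blast
next
  assume "\<exists>ks xs w. qok G ks xs w \<and> f = mkq ks xs w"
  then obtain ks xs w where "qok G ks xs w" "f = mkq ks xs w" by blast
  thus "f \<in> Arr (Q_prob G)"
    using dmap_D_hom[of ks] lab_PiE[of xs "carrier G"]
    by (auto simp: qok_def Q_prob_def mkq_def lbraid_group_def carrier_braid_group)
qed

lemma q_of_map_mkq: "q_of_map G (sum_list ks) (length ks) (dmap ks) = mkq ks (replicate (sum_list ks) \<one>\<^bsub>G\<^esub>) []"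
  by (simp add: q_of_map_def mkq_def lbraid_group_def braid_group_def lab_replicate)

lemma q_of_braid_mkq: "length xs = n ==> q_of_braid n (lab xs, braid_class n w) = mkq (replicate n (Suc 0)) xs w"
  by (simp add: q_of_braid_def mkq_def D_id_dmap sum_list_replicate)

lemma Q_Id: "Id (Q_prob G) n = mkq (replicate n (Suc 0)) (replicate n \<one>\<^bsub>G\<^esub>) []"
  using q_of_map_mkq[of G "replicate n (Suc 0)"] by (simp add: Q_prob_def D_id_dmap sum_list_replicate)

lemma Q_simps [simp]: "Obj (Q_prob G) = UNIV" "Dom (Q_prob G) = qdom" "Cod (Q_prob G) = qcod"
  "tobj (Q_prob G) = (+)" "tunit (Q_prob G) = 0"
  by (simp_all add: Q_prob_def)

lemma Q_braid: "braid (Q_prob G) n m = mkq (replicate (n + m) (Suc 0)) (replicate (n + m) \<one>\<^bsub>G\<^esub>) (block_word 0 n m True)"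
  using q_of_braid_mkq[of "replicate (n + m) \<one>\<^bsub>G\<^esub>" "n + m" "block_word 0 n m True"]
  by (simp add: Q_prob_def block_braid_def lab_replicate)

lemma Q_tensor:
  assumes "qok G ks xs w" "qok G ks' xs' w'"
  shows "mkq ks xs w**\<^bsub>Q_prob G\<^esub>mkq ks' xs' w' = mkq (ks @ ks') (xs @ xs') (w @ shift_word (sum_list ks) w')"
  using assms D_sum_dmap[of ks ks'] juxtapose_lab[of xs xs']
  by (simp add: Q_prob_def mkq_def qok_def lbraid_sum_def braid_sum_class)

lemma pull_mkq:
  assumes "length xs = length ks" "w \<in> bwords (length ks)"
  shows "pull (sum_list ks) (dmap ks) (lab xs, braid_class (length ks) w) = (lab (rep ks xs), braid_class (sum_list ks) (lcable ks w))"
proof -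
  have "(\<lambda>j\<in>{1..sum_list ks}. lab xs (dmap ks j)) = lab (rep ks xs)"
    using rep_lab[OF assms(1)] by (auto simp: dmap_def lab_def fun_eq_iff)
  thus ?thesis using assms by (simp add: pull_def cable_class)
qed

text \<open>The braid \<open>w2\<close> reorders the fibre sizes of the first map, and
  \<open>kss\<close> cuts the reordered list into the fibres of the second map. The cabled braid of
  the second arrow comes after the braid of the first.\<close>

lemma Q_comp:
  assumes q1: "qok G ks1 xs1 w1" and q2: "qok G (map length kss) xs2 w2" and c: "permute w2 ks1 = concat kss"
  shows "mkq (map length kss) xs2 w2 o\<^bsub>Q_prob G\<^esub> mkq ks1 xs1 w1 =
    mkq (map sum_list kss) (map2 (\<lambda>y x. y \<otimes>\<^bsub>G\<^esub> x) (src ks1 w1 xs2) xs1) (lcable ks1 w2 @ w1)"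
proof -
  let ?n = "sum_list ks1" and ?m = "length ks1"
  have m: "sum_list (map length kss) = ?m" using c by (metis length_concat length_permute)
  have w2: "w2 \<in> bwords ?m" and xs2: "length xs2 = ?m" using q2 m by (auto simp: qok_def)
  have w1: "w1 \<in> bwords ?n" and xs1: "length xs1 = ?n" using q1 by (auto simp: qok_def)
  have n: "sum_list (map sum_list kss) = ?n" using c w2 by (metis sum_list_concat sum_list_permute)
  have cw: "lcable ks1 w2 \<in> bwords ?n" using bwords_lcable[OF w2] .
  have "(\<lambda>i\<in>{1..?n}. lab (rep ks1 xs2) (word_perm w1 i) \<otimes>\<^bsub>G\<^esub> lab xs1 i) = lab (map2 (\<lambda>y x. y \<otimes>\<^bsub>G\<^esub> x) (src ks1 w1 xs2) xs1)"
  proof (rule ext)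
    fix i
    have "lab (rep ks1 xs2) (word_perm w1 i) = src ks1 w1 xs2 ! (i - 1)" if "i \<in> {1..?n}"
      using nth_permute[of w1 "src ks1 w1 xs2" i] that w1 xs2 word_perm_range[OF w1 that]
      by (simp add: permute_src lab_def)
    thus "(\<lambda>i\<in>{1..?n}. lab (rep ks1 xs2) (word_perm w1 i) \<otimes>\<^bsub>G\<^esub> lab xs1 i) i
        = lab (map2 (\<lambda>y x. y \<otimes>\<^bsub>G\<^esub> x) (src ks1 w1 xs2) xs1) i"
      using xs1 xs2 by (auto simp: lab_def)
  qed
  moreover have "push ?n ?m (lab xs2, braid_class ?m w2) (dmap ks1) = dmap (concat kss)"
    using push_dmap[OF w2] c by simp
  moreover have "compose {1..?n} (dmap (map length kss)) (dmap (concat kss)) = dmap (map sum_list kss)"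
    using compose_dmap[of "concat kss" kss] c w2 by (metis sum_list_permute)
  ultimately show ?thesis
    using pull_mkq[of xs2 ks1 w2] xs2 w2 w1 cw m n
    by (simp add: Q_prob_def mkq_def lbraid_group_def braid_perm_class braid_mult)
qed

lemma comp_chunks:
  assumes "qok G ks2 xs2 w2" "length ks1 = sum_list ks2"
  obtains kss where "permute w2 ks1 = concat kss" "ks2 = map length kss"
  using ex_chunks[of ks2 "permute w2 ks1"] assms by force

lemma qok_comp:
  assumes "group G" and q1: "qok G ks1 xs1 w1" and q2: "qok G (map length kss) xs2 w2" and c: "permute w2 ks1 = concat kss"
  shows "qok G (map sum_list kss) (map2 (\<lambda>y x. y \<otimes>\<^bsub>G\<^esub> x) (src ks1 w1 xs2) xs1) (lcable ks1 w2 @ w1)"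
proof -
  interpret group G by fact
  have m: "sum_list (map length kss) = length ks1" using c by (metis length_concat length_permute)
  have w2: "w2 \<in> bwords (length ks1)" and xs2: "length xs2 = length ks1" using q2 m by (auto simp: qok_def)
  have n: "sum_list (map sum_list kss) = sum_list ks1" using c w2 by (metis sum_list_concat sum_list_permute)
  have "set (src ks1 w1 xs2) \<subseteq> carrier G" using q1 q2 set_src[of w1 ks1 xs2] xs2 by (auto simp: qok_def)
  hence "set (map2 (\<lambda>y x. y \<otimes>\<^bsub>G\<^esub> x) (src ks1 w1 xs2) xs1) \<subseteq> carrier G"
    using q1 by (auto simp: qok_def elim!: in_set_zipE intro!: m_closed)
  thus ?thesis using q1 xs2 n bwords_lcable[OF w2] by (simp add: qok_def)
qed

lemma qok_append: "qok G ks xs w ==> qok G ks' xs' w' ==> qok G (ks @ ks') (xs @ xs') (w @ shift_word (sum_list ks) w')"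
  using bwords_mono[of w "sum_list ks" "sum_list (ks @ ks')"] by (auto simp: qok_def)

lemma src_replicate: "length ks = n ==> w \<in> bwords (sum_list ks) ==> src ks w (replicate n c) = replicate (sum_list ks) c"
proof -
  assume a: "length ks = n" "w \<in> bwords (sum_list ks)"
  have "permute v (replicate k c) = replicate k c" if "v \<in> bwords k" for v k
    using set_permute[of v "replicate k c"] that by (intro replicate_eqI) (auto split: if_splits)
  thus ?thesis using a by (simp add: src_def rep_replicate)
qed

lemma permute_replicate [simp]: "w \<in> bwords n ==> permute w (replicate n c) = replicate n c"
  using set_permute[of w "replicate n c"] by (intro replicate_eqI) (auto split: if_splits)

lemma lcable_left: "w \<in> bwords (length ks) ==> lcable (ks @ ks') w = lcable ks w"
proof (induction w)
  case (Cons l w)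
  obtain as c d bs where "permute w ks = as @ c # d # bs" "fst l = Suc (length as)"
    using Cons.prems split_two[of "fst l" "permute w ks"] by auto
  thus ?case using Cons lcable_letter[of w ks as c d bs "snd l"] lcable_letter[of w "ks @ ks'" as c d "bs @ ks'" "snd l"]
    by (cases l) (simp add: permute_left del: lcable.simps)
qed simp

lemma lcable_shift: "w \<in> bwords (length ks) ==> lcable (ks' @ ks) (shift_word (length ks') w) = shift_word (sum_list ks') (lcable ks w)"
proof (induction w)
  case (Cons l w)
  obtain as c d bs where "permute w ks = as @ c # d # bs" "fst l = Suc (length as)"
    using Cons.prems split_two[of "fst l" "permute w ks"] by auto
  thus ?case
    using Cons lcable_letter[of w ks as c d bs "snd l"]
      lcable_letter[of "shift_word (length ks') w" "ks' @ ks" "ks' @ as" c d bs "snd l"]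
    by (cases l) (simp add: permute_shift del: lcable.simps)
qed simp

lemma lcable_ones: "w \<in> bwords n ==> lcable (replicate n (Suc 0)) w = w"
proof (induction w)
  case (Cons l w)
  obtain i s where l: "l = (i, s)" by fastforce
  have "take (i - 1) (replicate n (Suc 0)) = replicate (i - 1) (Suc 0)" using Cons.prems l by (auto simp: take_replicate min_def)
  moreover have "i - 1 < n" using Cons.prems l by auto
  ultimately show ?case using Cons l by (simp add: Let_def sum_list_replicate)
qed simp

text \<open>The value of a block word in the braid category is the crossing of the total objects,
  which there is the block braid with the summed sizes.\<close>

lemma lcable_block:
  "braid_eq (sum_list ks + sum_list ks') (lcable (ks @ ks') (block_word 0 (length ks) (length ks') True))
     (block_word 0 (sum_list ks) (sum_list ks') True)"
proof -
  let ?b = "block_word 0 (length ks) (length ks') True"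
  have b: "?b \<in> bwords (length (ks @ ks'))" by simp
  have "br (sum_list (ks @ ks')) (lcable (ks @ ks') ?b) = crossing BC True (tot id ks) (tot id ks')"
    using BC.word_arr_block[of id "[]" ks ks' "[]" True] word_arr_BC[OF b]
      BC.ten_unit_left[of "crossing BC True (tot id ks) (tot id ks')"]
      BC.ten_unit_right[of "crossing BC True (tot id ks) (tot id ks')"]
      BC.crossing_arr[of True "tot id ks" "tot id ks'"] by (simp del: BC_simps)
  thus ?thesis
    using br_eqD[OF _ bwords_lcable[OF b]] by (simp add: crossing_def tot_def)
qed

lemma concat_map_concat: "concat (map concat xsss) = concat (concat xsss)" by (induction xsss) auto

context group
begin

abbreviation "Q \<equiv> Q_prob G"
abbreviation Q_Comp (infixr "\<star>" 70) where "g\<star>f \<equiv> g o\<^bsub>Q\<^esub> f"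
abbreviation Q_tarr (infixr "\<oplus>" 75) where "f\<oplus>g \<equiv> f**\<^bsub>Q\<^esub>g"
abbreviation "iok n \<equiv> qok G (replicate n (Suc 0))"
abbreviation "ones n \<equiv> replicate n \<one>"
abbreviation "qiso n xs w \<equiv> mkq (replicate n (Suc 0)) xs w"
abbreviation "dq ks \<equiv> mkq ks (ones (sum_list ks)) []"

lemma set_ones [simp]: "set (ones n) \<subseteq> carrier G"
  by auto

lemma qok_dq [simp]: "qok G ks (ones (sum_list ks)) []"
  by (auto simp: qok_def)

lemma qok_qiso: "iok n xs w \<longleftrightarrow> length xs = n \<and> set xs \<subseteq> carrier G \<and> w \<in> bwords n"
  by (auto simp: qok_def sum_list_replicate)

lemma qok_qiso_ones [simp]: "iok n (ones n) w \<longleftrightarrow> w \<in> bwords n"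
  by (auto simp: qok_qiso)

lemma map2_ones: "length ys = n ==> set ys \<subseteq> carrier G ==> map2 (\<lambda>y x. y \<otimes> x) ys (ones n) = ys"
  and map2_ones': "length ys = n ==> set ys \<subseteq> carrier G ==> map2 (\<lambda>y x. y \<otimes> x) (ones n) ys = ys"
  by (auto intro!: nth_equalityI r_one l_one intro: subsetD[OF _ nth_mem])

lemma Q_comp_right:
  assumes "qok G ks xs w" "iok (sum_list ks) ys v"
  shows "mkq ks xs w\<star>qiso (sum_list ks) ys v = mkq ks (map2 (\<lambda>y x. y \<otimes> x) (permute (inverse_word v) xs) ys) (w @ v)"
proof -
  define kss where "kss = map (\<lambda>k. replicate k (Suc 0)) ks"
  have "concat kss = replicate (sum_list ks) (Suc 0)" unfolding kss_def by (induction ks) (auto simp: replicate_add)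
  moreover have l: "map length kss = ks" "map sum_list kss = ks" by (auto simp: kss_def comp_def sum_list_replicate)
  ultimately show ?thesis
    using Q_comp[of G "replicate (sum_list ks) (Suc 0)" ys v kss xs w] assms
    by (simp add: src_def lcable_ones) (simp add: qok_def lcable_ones)
qed

lemma Q_comp_left:
  assumes "qok G ks xs w" "qok G (replicate (length ks) (Suc 0)) ys v"
  shows "qiso (length ks) ys v\<star>mkq ks xs w = mkq (permute v ks) (map2 (\<lambda>y x. y \<otimes> x) (src ks w ys) xs) (lcable ks v @ w)"
proof -
  define kss where "kss = map (\<lambda>k. [k]) (permute v ks)"
  have l: "map length kss = replicate (length ks) (Suc 0)" "map sum_list kss = permute v ks" "concat kss = permute v ks"
    by (auto simp: kss_def comp_def map_replicate_const)
  show ?thesis using Q_comp[of G ks xs w kss ys v] assms unfolding l by simp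
qed

lemma qiso_comp:
  assumes "iok n xs w" "iok n ys v"
  shows "qiso n ys v\<star>qiso n xs w = qiso n (map2 (\<lambda>y x. y \<otimes> x) (permute (inverse_word w) ys) xs) (v @ w)"
  using Q_comp_right[of "replicate n (Suc 0)" ys v xs w] assms by (simp add: sum_list_replicate)

lemma qiso_ones_comp: "v \<in> bwords n ==> w \<in> bwords n ==> qiso n (ones n) v\<star>qiso n (ones n) w = qiso n (ones n) (v @ w)"
  by (simp add: qiso_comp map2_ones)

lemma qiso_ones_tensor: "v \<in> bwords n ==> w \<in> bwords m ==>
    qiso n (ones n) v\<oplus>qiso m (ones m) w = qiso (n + m) (ones (n + m)) (v @ shift_word n w)"
  using Q_tensor[of G "replicate n (Suc 0)" "ones n" v "replicate m (Suc 0)" "ones m" w]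
  by (simp add: replicate_add sum_list_replicate)

text \<open>The labels agree by associativity of \<open>G\<close> and because strands can be traced
  back in two steps; the braids agree because cabling can be done in two steps.\<close>

lemma Q_comp_assoc:
  assumes "qok G ks1 xs1 w1" "qok G ks2 xs2 w2" "qok G ks3 xs3 w3" "length ks1 = sum_list ks2" "length ks2 = sum_list ks3"
  shows "(mkq ks3 xs3 w3\<star>mkq ks2 xs2 w2)\<star>mkq ks1 xs1 w1 = mkq ks3 xs3 w3\<star>mkq ks2 xs2 w2\<star>mkq ks1 xs1 w1"
proof -
  obtain kss where kss: "permute w2 ks1 = concat kss" "ks2 = map length kss" using comp_chunks assms by metis
  have w2: "w2 \<in> bwords (length ks1)" and w3: "w3 \<in> bwords (length kss)" and w1: "w1 \<in> bwords (sum_list ks1)"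
    using assms kss by (auto simp: qok_def)
  \<comment> \<open>A third level of grouping: \<open>ksss\<close> sorts the groups in
    \<open>kss\<close> by the fibres of the last map, so the fibre sizes of all composites are
    lengths or sums over it.\<close>
  obtain ksss where ksss': "concat ksss = permute w3 kss" "map length ksss = ks3"
    using ex_chunks[of ks3 "permute w3 kss"] assms(5) kss by auto
  note ksss = ksss'[symmetric]
  let ?m = "map2 (\<lambda>y x. y \<otimes> x)"
  have p32: "permute w3 ks2 = concat (map (map length) ksss)"
    using map_permute[of w3 kss length] w3 kss ksss by (simp add: map_concat)
  have c32: "mkq ks3 xs3 w3\<star>mkq ks2 xs2 w2 = mkq (map sum_list (map (map length) ksss)) (?m (src ks2 w2 xs3) xs2) (lcable ks2 w3 @ w2)"
    using Q_comp[of G ks2 xs2 w2 "map (map length) ksss" xs3 w3] p32 ksss assms by (simp add: comp_def)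
  have q32: "qok G (map sum_list (map (map length) ksss)) (?m (src ks2 w2 xs3) xs2) (lcable ks2 w3 @ w2)"
    using qok_comp[of G ks2 xs2 w2 "map (map length) ksss" xs3 w3] p32 ksss assms is_group by (simp add: comp_def)
  have l32: "map sum_list (map (map length) ksss) = map length (map concat ksss)" by (simp add: comp_def length_concat)
  have p321: "permute (lcable ks2 w3 @ w2) ks1 = concat (map concat ksss)"
    using permute_lcable[of w3 kss] w3 kss ksss by (simp add: concat_map_concat)
  have c321: "(mkq ks3 xs3 w3\<star>mkq ks2 xs2 w2)\<star>mkq ks1 xs1 w1 =
      mkq (map sum_list (map concat ksss)) (?m (src ks1 w1 (?m (src ks2 w2 xs3) xs2)) xs1) (lcable ks1 (lcable ks2 w3 @ w2) @ w1)"
    using Q_comp[OF assms(1) _ p321, of "?m (src ks2 w2 xs3) xs2"] q32 unfolding c32 l32 by simp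
  let ?ks = "map sum_list kss"
  have c21: "mkq ks2 xs2 w2\<star>mkq ks1 xs1 w1 = mkq ?ks (?m (src ks1 w1 xs2) xs1) (lcable ks1 w2 @ w1)"
    using Q_comp[OF assms(1) _ kss(1), of xs2] assms kss by simp
  have q21: "qok G ?ks (?m (src ks1 w1 xs2) xs1) (lcable ks1 w2 @ w1)"
    using qok_comp[OF is_group assms(1) _ kss(1), of xs2] assms kss by simp
  have p: "permute w3 ?ks = concat (map (map sum_list) ksss)"
    using map_permute[of w3 kss sum_list] w3 ksss by (simp add: map_concat)
  have l3: "ks3 = map length (map (map sum_list) ksss)" using ksss by (simp add: comp_def)
  have c: "mkq ks3 xs3 w3\<star>mkq ks2 xs2 w2\<star>mkq ks1 xs1 w1 = mkq (map sum_list (map (map sum_list) ksss))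
      (?m (src ?ks (lcable ks1 w2 @ w1) xs3) (?m (src ks1 w1 xs2) xs1)) (lcable ?ks w3 @ lcable ks1 w2 @ w1)"
    using Q_comp[OF q21 _ p, of xs3] assms(3) unfolding c21 l3 by simp
  have x2: "length xs2 = length ks1" "set xs2 \<subseteq> carrier G" and x1: "length xs1 = sum_list ks1" "set xs1 \<subseteq> carrier G"
    and x3: "length xs3 = length kss" "set xs3 \<subseteq> carrier G" using assms kss by (auto simp: qok_def)
  have kl: "sum_list (map length kss) = length ks1" "w2 \<in> bwords (sum_list (map length kss))" using assms kss w2 by auto
  have "?m (src ks1 w1 (?m (src ks2 w2 xs3) xs2)) xs1 = ?m (src ?ks (lcable ks1 w2 @ w1) xs3) (?m (src ks1 w1 xs2) xs1)"
  proof -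
    have s: "src ?ks (lcable ks1 w2 @ w1) xs3 = src ks1 w1 (src ks2 w2 xs3)"
      using src_comp[OF w1 w2 kss(1)] x3 kss by simp
    have "src ks1 w1 (?m (src ks2 w2 xs3) xs2) = ?m (src ks1 w1 (src ks2 w2 xs3)) (src ks1 w1 xs2)"
      using map2_src[OF w1, of "src ks2 w2 xs3" xs2 "\<lambda>y x. y \<otimes> x"] x2 x3 kss kl by simp
    moreover have "set (src ks1 w1 (src ks2 w2 xs3)) \<subseteq> carrier G" "set (src ks1 w1 xs2) \<subseteq> carrier G"
      using set_src[OF w1, of "src ks2 w2 xs3"] set_src[of w2 ks2 xs3] set_src[OF w1, of xs2] x2 x3 kss kl by auto
    ultimately show ?thesis unfolding s
      using x1 x2 x3 kss kl by (auto intro!: nth_equalityI m_assoc simp: subset_iff)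
  qed
  moreover have "braid_eq (sum_list ks1) (lcable ks1 (lcable ks2 w3 @ w2) @ w1) (lcable ?ks w3 @ lcable ks1 w2 @ w1)"
  proof -
    have "braid_eq (sum_list ks1) (lcable (concat kss) (lcable ks2 w3)) (lcable ?ks w3)"
      using lcable_lcable[OF w3] kss w2 sum_list_permute[OF w2] by metis
    hence "braid_eq (sum_list ks1) (lcable (concat kss) (lcable ks2 w3) @ (lcable ks1 w2 @ w1)) (lcable ?ks w3 @ lcable ks1 w2 @ w1)"
      using w1 bwords_lcable[OF w2] by (intro braid_eq_append braid_eq.refl) auto
    thus ?thesis using kss by (simp add: lcable_append)
  qed
  moreover have "sum_list (map sum_list (map concat ksss)) = sum_list ks1"
    using p321 kss w2 w3 bwords_lcable[of w3 ks2] assms(4) by (metis bwords_append length_map sum_list_concat sum_list_permute)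
  ultimately show ?thesis unfolding c321 c by (intro mkq_eqI) (simp_all add: sum_list_concat comp_def)
qed

text \<open>The two sides differ in the order of \<open>w1\<close> and the shifted cable of
  \<open>w2'\<close>, which act on disjoint strands.\<close>

lemma Q_tensor_comp:
  assumes q: "qok G ks1 xs1 w1" "qok G ks2 xs2 w2" "length ks1 = sum_list ks2"
    and q': "qok G ks1' xs1' w1'" "qok G ks2' xs2' w2'" "length ks1' = sum_list ks2'"
  shows "(mkq ks2 xs2 w2\<oplus>mkq ks2' xs2' w2')\<star>(mkq ks1 xs1 w1\<oplus>mkq ks1' xs1' w1') =
    (mkq ks2 xs2 w2\<star>mkq ks1 xs1 w1)\<oplus>(mkq ks2' xs2' w2'\<star>mkq ks1' xs1' w1')"
proof -
  obtain kss where kss: "permute w2 ks1 = concat kss" "ks2 = map length kss" using comp_chunks q by metis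
  obtain kss' where kss': "permute w2' ks1' = concat kss'" "ks2' = map length kss'" using comp_chunks q' by metis
  let ?m = "map2 (\<lambda>y x. y \<otimes> x)"
  have b: "w1 \<in> bwords (sum_list ks1)" "w2 \<in> bwords (length ks1)" "w1' \<in> bwords (sum_list ks1')" "w2' \<in> bwords (length ks1')"
    and x: "length xs1 = sum_list ks1" "length xs2 = length ks1" "length xs1' = sum_list ks1'" "length xs2' = length ks1'"
    using q q' by (auto simp: qok_def)
  have p: "permute (w2 @ shift_word (sum_list ks2) w2') (ks1 @ ks1') = concat (kss @ kss')"
    unfolding q(3)[symmetric] using b kss(1) kss'(1) by (simp add: permute_shift permute_left)
  have s1: "sum_list (map sum_list kss) = sum_list ks1" using kss b by (metis sum_list_concat sum_list_permute)
  have lc: "lcable (ks1 @ ks1') (w2 @ shift_word (sum_list ks2) w2') = lcable ks1 w2 @ shift_word (sum_list ks1) (lcable ks1' w2')"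
    unfolding q(3)[symmetric] using b by (simp add: lcable_append permute_shift lcable_left lcable_shift)
  have "(mkq ks2 xs2 w2\<oplus>mkq ks2' xs2' w2')\<star>(mkq ks1 xs1 w1\<oplus>mkq ks1' xs1' w1') =
      mkq (map sum_list (kss @ kss')) (?m (src ks1 w1 xs2 @ src ks1' w1' xs2') (xs1 @ xs1'))
      ((lcable ks1 w2 @ shift_word (sum_list ks1) (lcable ks1' w2')) @ w1 @ shift_word (sum_list ks1) w1')"
    using Q_comp[OF qok_append[OF q(1) q'(1)] _ p, of "xs2 @ xs2'"] qok_append[OF q(2) q'(2)] Q_tensor[OF q(1) q'(1)] Q_tensor[OF q(2) q'(2)]
      kss(2) kss'(2) lc src_append[OF b(1,3), of xs2 xs2'] x by simp
  also have "... = mkq (map sum_list kss @ map sum_list kss') (?m (src ks1 w1 xs2) xs1 @ ?m (src ks1' w1' xs2') xs1')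
      ((lcable ks1 w2 @ w1) @ shift_word (sum_list ks1) (lcable ks1' w2' @ w1'))"
  proof (rule mkq_eqI)
    let ?N = "sum_list ks1 + sum_list ks1'"
    have s1': "sum_list (map sum_list kss') = sum_list ks1'" using kss' b by (metis sum_list_concat sum_list_permute)
    have "braid_eq ?N (lcable ks1 w2 @ (shift_word (sum_list ks1) (lcable ks1' w2') @ w1) @ shift_word (sum_list ks1) w1')
        (lcable ks1 w2 @ (w1 @ shift_word (sum_list ks1) (lcable ks1' w2')) @ shift_word (sum_list ks1) w1')"
      using b bwords_lcable[of w2 ks1] bwords_lcable[of w2' ks1'] far_sum[of w1 "sum_list ks1" "lcable ks1' w2'" "sum_list ks1'"]
      by (intro braid_eq.cong) (auto intro: braid_eq.sym bwords_mono)
    thus "braid_eq (sum_list (map sum_list (kss @ kss'))) ((lcable ks1 w2 @ shift_word (sum_list ks1) (lcable ks1' w2')) @ w1 @ shift_word (sum_list ks1) w1')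
       ((lcable ks1 w2 @ w1) @ shift_word (sum_list ks1) (lcable ks1' w2' @ w1'))" using s1 s1' by simp
  qed (use x in simp_all)
  also have "... = (mkq ks2 xs2 w2\<star>mkq ks1 xs1 w1)\<oplus>(mkq ks2' xs2' w2'\<star>mkq ks1' xs1' w1')"
    using Q_comp[OF q(1) _ kss(1), of xs2] Q_comp[OF q'(1) _ kss'(1), of xs2'] q(2) q'(2) kss(2) kss'(2) s1
      Q_tensor[OF qok_comp[OF is_group q(1) _ kss(1), of xs2] qok_comp[OF is_group q'(1) _ kss'(1), of xs2']] by simp
  finally show ?thesis .
qed

text \<open>Moving the order-preserving parts through the braiding cables the block braid into a
  larger block braid; the rest is naturality of block words.\<close>

lemma Q_braid_nat:
  assumes q: "qok G ks xs w" and q': "qok G ks' xs' w'"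
  shows "braid Q (length ks) (length ks')\<star>(mkq ks xs w\<oplus>mkq ks' xs' w') =
     (mkq ks' xs' w'\<oplus>mkq ks xs w)\<star>braid Q (sum_list ks) (sum_list ks')"
proof -
  let ?n = "sum_list ks" and ?n' = "sum_list ks'" and ?b = "block_word 0 (length ks) (length ks') True"
  have b: "w \<in> bwords ?n" "w' \<in> bwords ?n'" and x: "length xs = ?n" "length xs' = ?n'"
    and c: "set xs \<subseteq> carrier G" "set xs' \<subseteq> carrier G" using q q' by (auto simp: qok_def)
  have pb: "permute ?b (ks @ ks') = ks' @ ks" using permute_block[of "[]" ks ks' True "[]"] by simp
  have "braid Q (length ks) (length ks')\<star>(mkq ks xs w\<oplus>mkq ks' xs' w') =
     mkq (ks' @ ks) (xs @ xs') (lcable (ks @ ks') ?b @ w @ shift_word ?n w')"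
    using Q_comp_left[OF qok_append[OF q q'], of "ones (length ks + length ks')" ?b] pb x c b
      src_replicate[of "ks @ ks'" "length ks + length ks'" "w @ shift_word ?n w'" \<one>] qok_append[OF q q']
    by (simp add: Q_braid Q_tensor[OF q q'] map2_ones' qok_def sum_list_replicate)
  also have "... = mkq (ks' @ ks) (xs @ xs') ((w' @ shift_word ?n' w) @ block_word 0 ?n ?n' True)"
  proof (rule mkq_eqI)
    have "braid_eq (?n + ?n') (lcable (ks @ ks') ?b @ w @ shift_word ?n w') (block_word 0 ?n ?n' True @ w @ shift_word ?n w')"
      using b by (intro braid_eq_append[OF lcable_block] braid_eq.refl) (auto intro: bwords_mono)
    from braid_eq.trans[OF this block_word_natural[OF b]]
    show "braid_eq (sum_list (ks' @ ks)) (lcable (ks @ ks') ?b @ w @ shift_word ?n w') ((w' @ shift_word ?n' w) @ block_word 0 ?n ?n' True)"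
      by (simp add: add.commute)
  qed auto
  also have "... = (mkq ks' xs' w'\<oplus>mkq ks xs w)\<star>braid Q ?n ?n'"
  proof -
    have "permute (block_word 0 ?n ?n' True) (xs @ xs') = xs' @ xs" using permute_block[of "[]" xs xs' True "[]"] x by simp
    hence "permute (inverse_word (block_word 0 ?n ?n' True)) (xs' @ xs) = xs @ xs'"
      using permute_inverse'[of "block_word 0 ?n ?n' True" "xs @ xs'"] x by simp
    thus ?thesis
      using Q_comp_right[OF qok_append[OF q' q], of "ones (?n + ?n')" "block_word 0 ?n ?n' True"] x c
      by (simp add: Q_braid Q_tensor[OF q' q] map2_ones add.commute[of ?n' ?n])
  qed
  finally show ?thesis .
qed

lemma Q_inverse:
  assumes "w \<in> bwords n"
  shows "inverse_arrows Q (qiso n (ones n) w) (qiso n (ones n) (inverse_word w))"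
  using assms qok_qiso_ones[of n w] qok_qiso_ones[of n "inverse_word w"]
  by (auto simp: inverse_arrows_def Hom_def Arr_Q Q_Id qiso_ones_comp sum_list_replicate simp del: qok_qiso_ones
      intro!: mkq_eqI braid_eq_inverse braid_eq_inverse')

lemma Q_hom_cases:
  assumes "f \<in> Hom Q n m"
  obtains ks xs w where "f = mkq ks xs w" "qok G ks xs w" "n = sum_list ks" "m = length ks"
  using assms by (auto simp: Hom_def Arr_Q)

lemma Q_comp_arr:
  assumes "qok G ks1 xs1 w1" "qok G ks2 xs2 w2" "length ks1 = sum_list ks2"
  shows "mkq ks2 xs2 w2\<star>mkq ks1 xs1 w1 \<in> Hom Q (sum_list ks1) (length ks2)"
proof -
  obtain kss where kss: "permute w2 ks1 = concat kss" "ks2 = map length kss" using comp_chunks assms by metis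
  have "sum_list (map sum_list kss) = sum_list ks1"
    using kss assms by (metis qok_def sum_list_concat sum_list_permute)
  thus ?thesis
    using Q_comp[OF assms(1) _ kss(1), of xs2] qok_comp[OF is_group assms(1) _ kss(1), of xs2] assms(2) kss(2)
    by (auto simp: Hom_def Arr_Q)
qed

lemma prob_Q: "prob Q"
proof
  fix f g h :: "'a qmor" and n m k l
  assume f: "f \<in> Hom Q n m"
  obtain ks1 xs1 w1 where 1: "f = mkq ks1 xs1 w1" "qok G ks1 xs1 w1" "n = sum_list ks1" "m = length ks1"
    using Q_hom_cases[OF f] .
  show "f\<star>Id Q n = f"
    using 1 Q_comp_right[OF 1(2), of "ones n" "[]"] by (simp add: Q_Id map2_ones qok_def sum_list_replicate)
  show "Id Q m\<star>f = f"
    using 1 Q_comp_left[OF 1(2), of "ones m" "[]"] src_replicate[of ks1 m w1 \<one>] by (simp add: Q_Id map2_ones' qok_def sum_list_replicate)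
  assume g: "g \<in> Hom Q m k"
  obtain ks2 xs2 w2 where 2: "g = mkq ks2 xs2 w2" "qok G ks2 xs2 w2" "m = sum_list ks2" "k = length ks2"
    using Q_hom_cases[OF g] .
  show "g\<star>f \<in> Hom Q n k" using Q_comp_arr[OF 1(2) 2(2)] 1 2 by simp
  assume h: "h \<in> Hom Q k l"
  obtain ks3 xs3 w3 where 3: "h = mkq ks3 xs3 w3" "qok G ks3 xs3 w3" "k = sum_list ks3" "l = length ks3"
    using Q_hom_cases[OF h] .
  show "(h\<star>g)\<star>f = h\<star>g\<star>f" using Q_comp_assoc[OF 1(2) 2(2) 3(2)] 1 2 3 by simp
next
  fix f g h :: "'a qmor" assume f: "f \<in> Arr Q" and g: "g \<in> Arr Q"
  obtain ks xs w where 1: "f = mkq ks xs w" "qok G ks xs w" using f by (auto simp: Arr_Q)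
  obtain ks' xs' w' where 2: "g = mkq ks' xs' w'" "qok G ks' xs' w'" using g by (auto simp: Arr_Q)
  show "f\<oplus>g \<in> Arr Q" using Q_tensor[OF 1(2) 2(2)] qok_append[OF 1(2) 2(2)] 1 2 by (auto simp: Arr_Q)
  show "Dom Q (f\<oplus>g) = Dom Q f + Dom Q g" "Cod Q (f\<oplus>g) = Cod Q f + Cod Q g"
    using Q_tensor[OF 1(2) 2(2)] 1 2 by auto
  show "braid Q (Cod Q f) (Cod Q g)\<star>(f\<oplus>g) = (g\<oplus>f)\<star>braid Q (Dom Q f) (Dom Q g)"
    using Q_braid_nat[OF 1(2) 2(2)] 1 2 by simp
  have e: "qok G [] [] []" by (auto simp: qok_def)
  show "Id Q 0\<oplus>f = f" "f\<oplus>Id Q 0 = f"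
    using Q_tensor[OF e 1(2)] Q_tensor[OF 1(2) e] 1 by (simp_all add: Q_Id)
  assume h: "h \<in> Arr Q"
  obtain ks'' xs'' w'' where 3: "h = mkq ks'' xs'' w''" "qok G ks'' xs'' w''" using h by (auto simp: Arr_Q)
  show "(f\<oplus>g)\<oplus>h = f\<oplus>g\<oplus>h"
    using 1 2 3 Q_tensor[OF 1(2) 2(2)] Q_tensor[OF 2(2) 3(2)] Q_tensor[OF qok_append[OF 1(2) 2(2)] 3(2)] Q_tensor[OF 1(2) qok_append[OF 2(2) 3(2)]]
    by simp
next
  fix f f' g g' :: "'a qmor"
  assume "f \<in> Arr Q" "f' \<in> Arr Q" "g \<in> Arr Q" "g' \<in> Arr Q" "Cod Q f = Dom Q g" "Cod Q f' = Dom Q g'"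
  thus "(g\<oplus>g')\<star>(f\<oplus>f') = (g\<star>f)\<oplus>(g'\<star>f')"
    by (auto simp: Arr_Q Q_tensor_comp)
next
  fix n m k
  show "Id Q n\<oplus>Id Q m = Id Q (n + m)" by (simp add: Q_Id qiso_ones_tensor)
  have "block_word 0 n m True \<in> bwords (n + m)" by simp
  from Q_inverse[OF this] show "is_iso Q (braid Q n m)" by (auto simp: is_iso_def Q_braid)
  show "braid Q n m \<in> Hom Q (n + m) (m + n)"
    using qok_qiso_ones[of "n + m" "block_word 0 n m True"]
    by (auto simp: Hom_def Q_braid Arr_Q sum_list_replicate simp del: qok_qiso_ones)
  show "braid Q n (m + k) = (Id Q m\<oplus>braid Q n k)\<star>(braid Q n m\<oplus>Id Q k)"
    using block_word_add_right[of 0 n m k "n + (m + k)"]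
    by (simp add: Q_braid Q_Id qiso_ones_tensor qiso_ones_comp add.left_commute[of m n k] add.assoc mkq_eqI sum_list_replicate)
  show "braid Q (n + m) k = (braid Q n k\<oplus>Id Q m)\<star>(Id Q n\<oplus>braid Q m k)"
    using block_word_add[of 0 n m k True] by (simp add: Q_braid Q_Id qiso_ones_tensor qiso_ones_comp ac_simps)
  show "Id Q n \<in> Hom Q n n"
    using qok_qiso_ones[of n "[]"] by (auto simp: Hom_def Arr_Q Q_Id sum_list_replicate simp del: qok_qiso_ones)
qed auto

end

section \<open>Generators of Q and its isomorphisms\<close>

subsection \<open>Generators and isomorphisms of Q\<close>

sublocale group \<subseteq> Q: prob "Q_prob G"
  by (rule prob_Q)

context group
begin

lemma mkq_Arr: "qok G ks xs w ==> mkq ks xs w \<in> Arr Q"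
  by (auto simp: Arr_Q)

lemma mkq_decomp: "qok G ks xs w ==> mkq ks xs w = dq ks\<star>qiso (sum_list ks) xs w"
  using Q_comp_right[of ks "ones (sum_list ks)" "[]" xs w] by (simp add: qok_def sum_list_replicate map2_ones')

lemma qiso_decomp: "iok n xs w ==> qiso n xs w = qiso n (ones n) w\<star>qiso n xs []"
  by (simp add: qiso_comp qok_qiso map2_ones')

lemma dq_Id: "dq (replicate n (Suc 0)) = Id Q n"
  by (simp add: Q_Id sum_list_replicate)

lemma dq_append: "dq (ks @ ks') = dq ks\<oplus>dq ks'"
  by (simp add: Q_tensor replicate_add)

lemma dq_Arr [simp]: "dq ks \<in> Arr Q"
  by (rule mkq_Arr) simp

lemma dq1_Arr [simp]: "mkq [k] (ones k) [] \<in> Arr Q"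
  using dq_Arr[of "[k]"] by simp

lemmas Q_typing [simp] = Q.ten_dom[unfolded Q_simps] Q.ten_cod[unfolded Q_simps] Q.comp_dom[unfolded Q_simps]
  Q.comp_cod[unfolded Q_simps] Q.id_dom[unfolded Q_simps] Q.id_cod[unfolded Q_simps] Q.braid_dom[unfolded Q_simps]
  Q.braid_cod[unfolded Q_simps] Q.binv_dom[unfolded Q_simps] Q.binv_cod[unfolded Q_simps]

lemma dq_comp: "dq (map length kss)\<star>dq (concat kss) = dq (map sum_list kss)"
proof -
  have "src (concat kss) [] (ones (sum_list (map length kss))) = ones (sum_list (concat kss))"
    by (rule src_replicate) (simp_all add: length_concat)
  thus ?thesis
    using Q_comp[OF qok_dq[of "concat kss"] qok_dq[of "map length kss"]] by (simp add: map2_ones flip: sum_list_concat)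
qed

lemma q_m_dq: "q_m G = dq [2]"
proof -
  have "dmap [2] = (\<lambda>i\<in>{1..2}. 1)"
    by (auto simp: dmap_def dlist_def lab_def fun_eq_iff upt_Suc numeral_2_eq_2 less_Suc_eq nth_Cons')
  thus ?thesis using q_of_map_mkq[of G "[2]"] by (simp add: q_m_def)
qed

lemma q_u_dq: "q_u G = dq [0]"
proof -
  have "dmap [0] = (\<lambda>i\<in>{1..0}. 1)"
    by (auto simp: dmap_def dlist_def lab_def fun_eq_iff upt_Suc)
  thus ?thesis using q_of_map_mkq[of G "[0]"] by (simp add: q_u_def)
qed

lemma dq_Suc: "dq [Suc k] = q_m G\<star>(Id Q 1\<oplus>dq [k])"
  using dq_comp[of "[[1, k]]"] dq_append[of "[1]" "[k]"] dq_Id[of 1] by (simp add: q_m_dq numeral_2_eq_2)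

lemma q_sigma_qiso: "q_sigma G = qiso 2 (ones 2) [(1, True)]"
  using q_of_braid_mkq[of "ones 2" 2] by (simp add: q_sigma_def lab_replicate)

lemma qiso_letter:
  assumes "1 \<le> i" "i < n"
  shows "qiso n (ones n) [(i, s)] = Id Q (i - 1)\<oplus>qiso 2 (ones 2) [(1, s)]\<oplus>Id Q (n - i - 1)"
proof -
  have "Id Q (i - 1)\<oplus>qiso 2 (ones 2) [(1, s)]\<oplus>Id Q (n - i - 1)
      = qiso (i - 1 + (2 + (n - i - 1))) (ones (i - 1 + (2 + (n - i - 1)))) [(i, s)]" (is "?l = _")
    using assms qiso_ones_tensor[of "[(1, s)]" 2 "[]" "n - i - 1"] qiso_ones_tensor[of "[]" "i - 1" "[(1, s)]" "2 + (n - i - 1)"]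
    by (simp add: Q_Id del: replicate_Suc add_2_eq_Suc add_2_eq_Suc')
  moreover have "i - 1 + (2 + (n - i - 1)) = n" using assms by simp
  ultimately show ?thesis by (simp only:)
qed

lemma qiso_labels: "set xs \<subseteq> carrier G ==> x \<in> carrier G ==>
    qiso (Suc (length xs)) (x # xs) [] = qiso 1 [x] []\<oplus>qiso (length xs) xs []"
  using Q_tensor[of G "[Suc 0]" "[x]" "[]" "replicate (length xs) (Suc 0)" xs "[]"] by (simp add: qok_def sum_list_replicate)

text \<open>Labelled braids are generated by elementary crossings of both signs and single labels;
  both signs appear because the rules contain no closure under inverses.\<close>

lemma qiso_induct [consumes 1, case_names Id comp tensor swap label]:
  assumes q: "iok n xs w"
    and Id: "\<And>n. P (Id Q n)"
    and comp: "\<And>f g. f \<in> Arr Q ==> g \<in> Arr Q ==> qcod f = qdom g ==> P f ==> P g ==> P (g\<star>f)"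
    and tensor: "\<And>f g. f \<in> Arr Q ==> g \<in> Arr Q ==> P f ==> P g ==> P (f\<oplus>g)"
    and swap: "\<And>s. P (qiso 2 (ones 2) [(1, s)])" and label: "\<And>x. x \<in> carrier G ==> P (qiso 1 [x] [])"
  shows "P (qiso n xs w)"
proof -
  have sw: "qiso 2 (ones 2) [(1, s)] \<in> Arr Q" for s by (rule mkq_Arr) (simp add: qok_qiso)
  have w: "P (qiso n (ones n) w)" if "w \<in> bwords n" for w n
    using that
  proof (induction w)
    case Nil thus ?case using Id[of n] by (simp add: Q_Id)
  next
    case (Cons l w)
    obtain i s where l: "l = (i, s)" by fastforce
    have "P (qiso n (ones n) [l])"
      using Cons.prems unfolding l
      by (subst qiso_letter) (auto intro!: tensor Id Q.ten_arr swap[unfolded One_nat_def] sw[unfolded One_nat_def])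
    hence "P (qiso n (ones n) [l]\<star>qiso n (ones n) w)"
      using Cons by (intro comp mkq_Arr) (auto simp: sum_list_replicate)
    thus ?case using Cons.prems by (simp add: qiso_ones_comp)
  qed
  have l: "P (qiso (length xs) xs [])" if "set xs \<subseteq> carrier G" for xs
    using that
  proof (induction xs)
    case Nil thus ?case using Id[of 0] by (simp add: Q_Id)
  next
    case (Cons x xs)
    thus ?case
      using qiso_labels[of xs x] by (auto intro!: tensor label[simplified] mkq_Arr simp: qok_def sum_list_replicate)
  qed
  show ?thesis
    unfolding qiso_decomp[OF q]
    using q l[of xs] w[of w n] by (intro comp mkq_Arr) (auto simp: qok_def sum_list_replicate)
qed

text \<open>A fibre of size \<open>k\<close> is an iterated multiplication, so the monoid structure,
  the crossings and the labels generate \<open>Q\<close>. Identities between functorial expressions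
  can then be checked on these.\<close>

lemma Q_induct [consumes 1, case_names Id comp tensor mult unit swap label]:
  assumes f: "f \<in> Arr Q"
    and Id: "\<And>n. P (Id Q n)"
    and comp: "\<And>f g. f \<in> Arr Q ==> g \<in> Arr Q ==> qcod f = qdom g ==> P f ==> P g ==> P (g\<star>f)"
    and tensor: "\<And>f g. f \<in> Arr Q ==> g \<in> Arr Q ==> P f ==> P g ==> P (f\<oplus>g)"
    and m: "P (q_m G)" and u: "P (q_u G)"
    and swap: "\<And>s. P (qiso 2 (ones 2) [(1, s)])" and label: "\<And>x. x \<in> carrier G ==> P (qiso 1 [x] [])"
  shows "P f"
proof -
  obtain ks xs w where f: "f = mkq ks xs w" and q: "qok G ks xs w" using f by (auto simp: Arr_Q)
  have dq1: "P (dq [k])" for k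
  proof (induction k)
    case 0 thus ?case using u by (simp add: q_u_dq)
  next
    case (Suc k)
    show ?case unfolding dq_Suc
      by (rule comp) (use Suc m in \<open>auto simp: q_m_dq intro!: tensor Id\<close>)
  qed
  have dq: "P (dq ks)"
  proof (induction ks)
    case Nil thus ?case using Id[of 0] by (simp add: Q_Id)
  next
    case (Cons k ks) thus ?case using dq_append[of "[k]" ks] tensor[OF _ _ dq1[of k] Cons.IH] by simp
  qed
  have q': "iok (sum_list ks) xs w" using q by (auto simp: qok_def sum_list_replicate)
  have "P (qiso (sum_list ks) xs w)"
    using q' Id comp tensor swap label by (rule qiso_induct)
  thus ?thesis
    unfolding f mkq_decomp[OF q] using dq q' by (intro comp mkq_Arr) (auto simp: sum_list_replicate)
qed

text \<open>The inverse strand starts where the original one ends, hence the inverted labels are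
  listed after transport along \<open>w\<close>.\<close>

lemma inverse_qiso:
  assumes "iok n xs w"
  shows "inverse_arrows Q (qiso n xs w) (qiso n (map (m_inv G) (permute w xs)) (inverse_word w))"
proof -
  have xs: "length xs = n" "set xs \<subseteq> carrier G" and w: "w \<in> bwords n" using assms by (auto simp: qok_qiso)
  have p: "set (permute w xs) \<subseteq> carrier G" using set_permute[of w xs] xs w by simp
  let ?ys = "map (m_inv G) (permute w xs)"
  have q: "iok n ?ys (inverse_word w)" using xs w p by (auto simp: qok_qiso)
  have "permute (inverse_word w) ?ys = map (m_inv G) xs"
    using map_permute[of "inverse_word w" "permute w xs" "m_inv G"] xs w by (simp add: permute_inverse')
  hence 1: "map2 (\<lambda>y x. y \<otimes> x) (permute (inverse_word w) ?ys) xs = ones n"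
    using xs by (auto intro!: nth_equalityI l_inv intro: subsetD[OF _ nth_mem])
  have 2: "map2 (\<lambda>y x. y \<otimes> x) (permute w xs) ?ys = ones n"
    using xs by (auto intro!: nth_equalityI r_inv subsetD[OF p nth_mem])
  show ?thesis
    using qiso_comp[OF assms q] qiso_comp[OF q assms] 1 2 mkq_Arr[OF assms] mkq_Arr[OF q] w
    by (auto simp: inverse_arrows_def Hom_def Q_Id sum_list_replicate intro!: mkq_eqI braid_eq_inverse braid_eq_inverse')
qed

lemma distinct_replicate_iff: "distinct (replicate k c) \<longleftrightarrow> k \<le> Suc 0"
  by (induction k) auto

lemma distinct_rep: "distinct (rep ks cs) ==> length cs = length ks ==> k \<in> set ks ==> k \<le> 1"
proof (induction ks arbitrary: cs)
  case (Cons l ks)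
  thus ?case by (cases cs) (auto simp: distinct_replicate_iff)
qed simp

lemma sum_list_le_length: "\<forall>k\<in>set ks. k \<le> 1 ==> sum_list ks \<le> length (ks :: nat list)"
  by (induction ks) auto

lemma sum_list_eq_length: "\<forall>k\<in>set ks. k \<le> 1 ==> sum_list ks = length (ks :: nat list) ==> ks = replicate (length ks) (Suc 0)"
proof (induction ks)
  case (Cons k ks)
  thus ?case using sum_list_le_length[of ks] by (cases "k = 1") auto
qed simp

text \<open>Pull pairwise distinct colours back through the composite: they return unchanged,
  whereas a fibre with two or more strands would repeat a colour.\<close>

lemma Q_left_inverse:
  assumes "qok G ks xs w" "qok G ks2 xs2 w2" "sum_list ks2 = length ks" "length ks2 = sum_list ks"
    "mkq ks2 xs2 w2\<star>mkq ks xs w = Id Q (sum_list ks)"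
  shows "\<forall>k\<in>set ks. k \<le> 1"
proof
  fix k assume k: "k \<in> set ks"
  obtain kss where kss: "permute w2 ks = concat kss" "ks2 = map length kss" using comp_chunks[OF assms(2)] assms(3) by metis
  let ?cs = "[0..<sum_list ks]"
  have w: "w \<in> bwords (sum_list ks)" "w2 \<in> bwords (length ks)" using assms by (auto simp: qok_def)
  have q: "qok G (map length kss) xs2 w2" using assms kss by simp
  have "mkq (map sum_list kss) (map2 (\<lambda>y x. y \<otimes> x) (src ks w xs2) xs) (lcable ks w2 @ w) =
      mkq (replicate (sum_list ks) (Suc 0)) (ones (sum_list ks)) []"
    using Q_comp[OF assms(1) q kss(1)] assms(5) kss(2) by (simp add: Q_Id)
  from mkq_inject[OF this qok_comp[OF is_group assms(1) q kss(1)]]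
  have e: "map sum_list kss = replicate (sum_list ks) (Suc 0)" "braid_eq (sum_list (map sum_list kss)) (lcable ks w2 @ w) []"
    by auto
  hence be: "braid_eq (sum_list ks) (lcable ks w2 @ w) []" by (simp add: sum_list_replicate)
  have "length kss = sum_list ks" using kss(2) assms(4) by simp
  hence "src (replicate (sum_list ks) (Suc 0)) (lcable ks w2 @ w) ?cs = src ks w (src ks2 w2 ?cs)"
    using src_comp[OF w kss(1), of ?cs] e(1) kss(2) by simp
  moreover have "src (replicate (sum_list ks) (Suc 0)) (lcable ks w2 @ w) ?cs = ?cs"
    using permute_braid_eq[OF be, of ?cs] w bwords_lcable[OF w(2)] by (intro src_eqI) (auto simp: sum_list_replicate)
  ultimately have "mset (rep ks (src ks2 w2 ?cs)) = mset ?cs"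
    using mset_permute[of "inverse_word w" "rep ks (src ks2 w2 ?cs)"] w assms(3,4) by (simp add: src_def[of ks])
  hence "distinct (rep ks (src ks2 w2 ?cs))" by (metis distinct_upt mset_eq_imp_distinct_iff)
  thus "k \<le> 1" using distinct_rep[of ks "src ks2 w2 ?cs" k] k assms(3,4) by simp
qed

text \<open>An isomorphism and its inverse both have fibres of size at most one; comparing the
  numbers of points then forces all fibres to be singletons.\<close>

lemma Q_iso_cases:
  assumes "is_iso Q k"
  obtains n xs w where "k = qiso n xs w" "iok n xs w"
proof -
  obtain g where g: "inverse_arrows Q k g" using assms by (auto simp: is_iso_def)
  then obtain ks xs w ks2 xs2 w2 where k: "k = mkq ks xs w" "qok G ks xs w" and g': "g = mkq ks2 xs2 w2" "qok G ks2 xs2 w2"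
    by (auto simp: inverse_arrows_def Hom_def Arr_Q)
  have l: "sum_list ks2 = length ks" "length ks2 = sum_list ks" and
    e: "g\<star>k = Id Q (sum_list ks)" "k\<star>g = Id Q (length ks)"
    using g k(1) g'(1) by (auto simp: inverse_arrows_def Hom_def)
  have 1: "\<forall>k\<in>set ks. k \<le> 1" using Q_left_inverse[OF k(2) g'(2) l] e k g' by simp
  have 2: "\<forall>k\<in>set ks2. k \<le> 1" using Q_left_inverse[OF g'(2) k(2)] l e k g' by simp
  have "ks = replicate (length ks) (Suc 0)"
    using sum_list_eq_length[OF 1] sum_list_le_length[OF 1] sum_list_le_length[OF 2] l by simp
  thus ?thesis using that k by metis
qed

end

section \<open>Values of arrows of Q at families of monoids with an action of G\<close>

section \<open>Coloured functors on Q\<close>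

definition gmonoid :: "('g, 'x) monoid_scheme => (nat, 'a, 'z) bmcat_scheme => nat => 'a => 'a => ('g => 'a) => bool" where
  "gmonoid G C A m u r \<longleftrightarrow> m \<in> Hom C (A + A) A \<and> u \<in> Hom C 0 A \<and> (\<forall>x\<in>carrier G. r x \<in> Hom C A A) \<and>
     m o\<^bsub>C\<^esub> (m**\<^bsub>C\<^esub>Id C A) = m o\<^bsub>C\<^esub> (Id C A**\<^bsub>C\<^esub>m) \<and>
     m o\<^bsub>C\<^esub> (u**\<^bsub>C\<^esub>Id C A) = Id C A \<and> m o\<^bsub>C\<^esub> (Id C A**\<^bsub>C\<^esub>u) = Id C A \<and>
     r \<one>\<^bsub>G\<^esub> = Id C A \<and> (\<forall>x\<in>carrier G. \<forall>y\<in>carrier G. r (x \<otimes>\<^bsub>G\<^esub> y) = r x o\<^bsub>C\<^esub> r y) \<and>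
     (\<forall>x\<in>carrier G. r x o\<^bsub>C\<^esub> m = m o\<^bsub>C\<^esub> (r x**\<^bsub>C\<^esub>r x) \<and> r x o\<^bsub>C\<^esub> u = u)"

text \<open>One monoid with an action of \<open>G\<close> for each colour. The strands of a fibre
  receive the colour of the point they map to, so only copies of the same monoid are ever
  multiplied.\<close>

locale gmonoids = prob C + G: group G
  for C :: "(nat, 'a, 'z) bmcat_scheme" (structure) and G :: "('g, 'x) monoid_scheme" +
  fixes M :: "'c => nat" and mu eta :: "'c => 'a" and rho :: "'c => 'g => 'a"
  assumes gmonoid: "gmonoid G C (M c) (mu c) (eta c) (rho c)"
begin

lemma mu_arr [simp]: "mu c \<in> Arr C" "Dom C (mu c) = M c + M c" "Cod C (mu c) = M c"
  and eta_arr [simp]: "eta c \<in> Arr C" "Dom C (eta c) = 0" "Cod C (eta c) = M c"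
  and rho_arr [simp]: "x \<in> carrier G ==> rho c x \<in> Arr C" "x \<in> carrier G ==> Dom C (rho c x) = M c" "x \<in> carrier G ==> Cod C (rho c x) = M c"
  and mu_assoc: "mu c o (mu c**Id C (M c)) = mu c o (Id C (M c)**mu c)"
  and mu_unit: "mu c o (eta c**Id C (M c)) = Id C (M c)" "mu c o (Id C (M c)**eta c) = Id C (M c)"
  and rho_one [simp]: "rho c \<one>\<^bsub>G\<^esub> = Id C (M c)"
  and rho_mult: "x \<in> carrier G ==> y \<in> carrier G ==> rho c (x \<otimes>\<^bsub>G\<^esub> y) = rho c x o rho c y"
  and rho_mu: "x \<in> carrier G ==> rho c x o mu c = mu c o (rho c x**rho c x)"
  and rho_eta: "x \<in> carrier G ==> rho c x o eta c = eta c"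
  using gmonoid[of c] by (auto simp: gmonoid_def Hom_def)

fun mupow :: "'c => nat => 'a" where
  "mupow c 0 = eta c"
| "mupow c (Suc k) = mu c o (Id C (M c)**mupow c k)"

fun mus :: "nat list => 'c list => 'a" where
  "mus (k # ks) (c # cs) = mupow c k**mus ks cs"
| "mus _ _ = Id C 0"

fun rhos :: "'c list => 'g list => 'a" where
  "rhos (c # cs) (x # xs) = rho c x**rhos cs xs"
| "rhos _ _ = Id C 0"

lemma tot_replicate [simp]: "tot M (replicate k c) = k * M c"
  by (simp add: tot_def sum_list_replicate)

lemma mupow_arr [simp]: "mupow c k \<in> Arr C \<and> Dom C (mupow c k) = k * M c \<and> Cod C (mupow c k) = M c"
  by (induction k) auto

lemma mus_arr [simp]: "length ks = length cs ==> mus ks cs \<in> Arr C" "length ks = length cs ==> Dom C (mus ks cs) = tot M (rep ks cs)"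
  "length ks = length cs ==> Cod C (mus ks cs) = tot M cs"
  by (induction ks cs rule: list_induct2) auto

lemma rhos_arr [simp]: "length cs = length xs ==> set xs \<subseteq> carrier G ==> rhos cs xs \<in> Arr C"
  "length cs = length xs ==> set xs \<subseteq> carrier G ==> Dom C (rhos cs xs) = tot M cs"
  "length cs = length xs ==> set xs \<subseteq> carrier G ==> Cod C (rhos cs xs) = tot M cs"
  by (induction cs xs rule: list_induct2) auto

lemma mus_append: "length ks = length cs ==> length ks' = length cs' ==> mus (ks @ ks') (cs @ cs') = mus ks cs**mus ks' cs'"
  by (induction ks cs rule: list_induct2) (auto simp: ten_assoc)

lemma rhos_append: "length cs = length xs ==> length cs' = length xs' ==> set xs \<subseteq> carrier G ==> set xs' \<subseteq> carrier G ==>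
    rhos (cs @ cs') (xs @ xs') = rhos cs xs**rhos cs' xs'"
  by (induction cs xs rule: list_induct2) (auto simp: ten_assoc)

lemma rhos_ones [simp]: "length cs = n ==> rhos cs (G.ones n) = Id C (tot M cs)"
  by (induction cs arbitrary: n) (auto simp: ten_id)

lemma mus_ones [simp]: "length cs = n ==> mus (replicate n (Suc 0)) cs = Id C (tot M cs)"
  by (induction cs arbitrary: n) (auto simp: ten_id mu_unit)

lemma rhos_mult: "length cs = length xs ==> length ys = length xs ==> set xs \<subseteq> carrier G ==> set ys \<subseteq> carrier G ==>
    rhos cs (map2 (\<lambda>y x. y \<otimes>\<^bsub>G\<^esub> x) ys xs) = rhos cs ys o rhos cs xs"
  by (induction cs xs arbitrary: ys rule: list_induct2) (auto simp: length_Suc_conv rho_mult ten_comp)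

text \<open>Naturality of each crossing carries the labels along with their strands.\<close>

lemma word_rhos: "w \<in> bwords (length cs) ==> length cs = length xs ==> set xs \<subseteq> carrier G ==>
    word_arr C M cs w o rhos cs xs = rhos (permute w cs) (permute w xs) o word_arr C M cs w"
proof (induction w)
  case (Cons l w)
  obtain as c d bs where 1: "permute w cs = as @ c # d # bs" "fst l = Suc (length as)"
    using Cons.prems split_two[of "fst l" "permute w cs"] by auto
  obtain as' x y bs' where 2: "permute w xs = as' @ x # y # bs'" "fst l = Suc (length as')"
    using Cons.prems split_two[of "fst l" "permute w xs"] by auto
  have l: "length as = length as'" "length bs = length bs'"
    using 1 2 Cons.prems length_permute[of w cs] length_permute[of w xs] by auto
  have c: "set as' \<subseteq> carrier G" "set bs' \<subseteq> carrier G" "x \<in> carrier G" "y \<in> carrier G" "set (permute w xs) \<subseteq> carrier G"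
    using set_permute[of w xs] Cons.prems 2 by auto
  have L: "letter_arr C M (permute w cs) l o rhos (permute w cs) (permute w xs)
      = rhos (permute (l # w) cs) (permute (l # w) xs) o letter_arr C M (permute w cs) l"
  proof -
    have *: "crossing C (snd l) (M c) (M d) o (rho c x**rho d y) = (rho d y**rho c x) o crossing C (snd l) (M c) (M d)"
      using crossing_nat[of "rho c x" "rho d y" "snd l"] c by simp
    have r: "rhos (as @ e # f # bs) (as' @ z # t # bs') = rhos as as'**(rho e z**rho f t)**rhos bs bs'"
      if "z \<in> carrier G" "t \<in> carrier G" for e f z t
      using l c that by (simp add: rhos_append ten_assoc)
    have s: "permute (l # w) cs = as @ d # c # bs" "permute (l # w) xs = as' @ y # x # bs'"
      using 1 2 swap_at_split[of as' x y bs'] by auto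
    have e: "letter_arr C M (permute w cs) l = Id C (tot M as)**crossing C (snd l) (M c) (M d)**Id C (tot M bs)"
      using letter_arr_split[of M as c d bs "snd l"] 1 by (cases l) simp
    show ?thesis unfolding e s using l c by (simp add: 1(1) 2(1) r ten_comp *)
  qed
  have t: "length (permute w cs) = length (permute w xs)" using Cons.prems by simp
  have "word_arr C M cs (l # w) o rhos cs xs = letter_arr C M (permute w cs) l o rhos (permute w cs) (permute w xs) o word_arr C M cs w"
    using Cons letter_arr_arr[of l "permute w cs" M] by (simp add: comp_assoc)
  also have "... = (rhos (permute (l # w) cs) (permute (l # w) xs) o letter_arr C M (permute w cs) l) o word_arr C M cs w"
    unfolding L[symmetric] using Cons.prems c t letter_arr_arr[of l "permute w cs" M] by (simp add: comp_assoc)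
  also have "... = rhos (permute (l # w) cs) (permute (l # w) xs) o word_arr C M cs (l # w)"
  proof -
    have sx: "set (permute (l # w) xs) \<subseteq> carrier G" using set_permute[of "l # w" xs] Cons.prems by simp
    have ts: "tot M (swap_at (fst l) (permute w cs)) = tot M cs" using tot_permute[of "l # w" cs M] Cons.prems by simp
    show ?thesis using Cons.prems c t sx ts letter_arr_arr[of l "permute w cs" M] by (simp add: comp_assoc)
  qed
  finally show ?case .
qed simp

lemma rho_mupow: "x \<in> carrier G ==> rho c x o mupow c k = mupow c k o rhos (replicate k c) (replicate k x)"
proof (induction k)
  case (Suc k)
  have s: "set (replicate k x) \<subseteq> carrier G" using Suc.prems by auto
  have "rho c x o mupow c (Suc k) = (rho c x o mu c) o (Id C (M c)**mupow c k)"
    using Suc.prems by (simp add: comp_assoc)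
  also have "... = mu c o (rho c x**(rho c x o mupow c k))"
    using Suc.prems by (simp add: rho_mu comp_assoc ten_comp)
  also have "... = mupow c (Suc k) o rhos (replicate (Suc k) c) (replicate (Suc k) x)"
    using Suc s by (simp add: comp_assoc ten_comp)
  finally show ?case .
qed (simp add: rho_eta)

lemma rhos_mus: "length ks = length cs ==> length xs = length cs ==> set xs \<subseteq> carrier G ==>
    rhos cs xs o mus ks cs = mus ks cs o rhos (rep ks cs) (rep ks xs)"
proof (induction ks cs arbitrary: xs rule: list_induct2)
  case (Cons k ks c cs)
  then obtain x xs' where xs: "xs = x # xs'" by (cases xs) auto
  have s: "set (replicate k x) \<subseteq> carrier G" "set (rep ks xs') \<subseteq> carrier G"
    using Cons.prems xs set_rep[of ks xs'] by auto
  show ?case using Cons xs s by (simp add: ten_comp rhos_append rho_mupow)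
qed simp

lemma mupow_add: "mupow c (k + l) = mu c o (mupow c k**mupow c l)"
proof (induction k)
  case 0
  have "eta c**mupow c l = (eta c**Id C (M c)) o mupow c l" using ten_split[of "eta c" "mupow c l"] by simp
  hence "mu c o (eta c**mupow c l) = (mu c o (eta c**Id C (M c))) o mupow c l" by (simp add: comp_assoc)
  thus ?case by (simp add: mu_unit)
next
  case (Suc k)
  have "mupow c (Suc k + l) = (mu c o (Id C (M c)**mu c)) o (Id C (M c)**mupow c k**mupow c l)"
    using Suc by (simp add: comp_assoc ten_comp)
  also have "... = mu c o (mu c**Id C (M c)) o ((Id C (M c)**mupow c k)**mupow c l)"
    by (simp add: mu_assoc[symmetric] comp_assoc ten_assoc add.assoc)
  also have "... = mu c o (mupow c (Suc k)**mupow c l)" by (simp add: ten_comp)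
  finally show ?case .
qed

lemma mupow_sum_list: "mupow c (sum_list ks) = mupow c (length ks) o mus ks (replicate (length ks) c)"
  by (induction ks) (auto simp: mupow_add comp_assoc ten_comp rep_replicate)

text \<open>General associativity: a fibre may be multiplied all at once or first within
  groups.\<close>

lemma mus_sum_list: "length kss = length cs ==>
    mus (map sum_list kss) cs = mus (map length kss) cs o mus (concat kss) (rep (map length kss) cs)"
  by (induction kss cs rule: list_induct2)
    (auto simp: mus_append mupow_sum_list ten_comp length_concat rep_replicate rep_concat)

text \<open>Naturality pulls the multiplications through a crossing, which becomes a crossing
  between whole fibres; in terms of words this is the cabled letter.\<close>

lemma word_mus: "w \<in> bwords (length ks) ==> length ks = length cs ==>
    word_arr C M cs w o mus ks cs = mus (permute w ks) (permute w cs) o word_arr C M (rep ks cs) (lcable ks w)"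
proof (induction w)
  case (Cons l w)
  obtain as c d bs where 1: "permute w cs = as @ c # d # bs" "fst l = Suc (length as)"
    using Cons.prems split_two[of "fst l" "permute w cs"] by auto
  obtain as' x y bs' where 2: "permute w ks = as' @ x # y # bs'" "fst l = Suc (length as')"
    using Cons.prems split_two[of "fst l" "permute w ks"] by auto
  have l: "length as' = length as" "length bs' = length bs"
    using 1 2 Cons.prems length_permute[of w cs] length_permute[of w ks] by auto
  let ?B = "block_word (sum_list as') x y (snd l)"
  have lc: "lcable ks (l # w) = ?B @ lcable ks w" using lcable_letter[OF 2(1), of "snd l"] 2(2) by (cases l) simp
  have e: "letter_arr C M (permute w cs) l = Id C (tot M as)**crossing C (snd l) (M c) (M d)**Id C (tot M bs)"
    using letter_arr_split[of M as c d bs "snd l"] 1 by (cases l) simp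
  have r: "rep (permute w ks) (permute w cs) = rep as' as @ replicate x c @ replicate y d @ rep bs' bs"
    using 1 2 l by (simp add: rep_append)
  have B: "word_arr C M (rep (permute w ks) (permute w cs)) ?B =
      Id C (tot M (rep as' as))**crossing C (snd l) (x * M c) (y * M d)**Id C (tot M (rep bs' bs))"
    using word_arr_block[of M "rep as' as" "replicate x c" "replicate y d" "rep bs' bs" "snd l"] l unfolding r by simp
  have m: "mus (as' @ z # t # bs') (as @ e # f # bs) = mus as' as**(mupow e z**mupow f t)**mus bs' bs" for z t e f
    using l by (simp add: mus_append ten_assoc)
  have *: "crossing C (snd l) (M c) (M d) o (mupow c x**mupow d y) = (mupow d y**mupow c x) o crossing C (snd l) (x * M c) (y * M d)"
    using crossing_nat[of "mupow c x" "mupow d y" "snd l"] by simp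
  have L: "letter_arr C M (permute w cs) l o mus (permute w ks) (permute w cs)
      = mus (permute (l # w) ks) (permute (l # w) cs) o word_arr C M (rep (permute w ks) (permute w cs)) ?B"
  proof -
    have s: "permute (l # w) cs = as @ d # c # bs" "permute (l # w) ks = as' @ y # x # bs'"
      using 1 2 swap_at_split[of as' x y bs'] by auto
    show ?thesis unfolding e s B using l by (simp add: 1(1) 2(1) m ten_comp *)
  qed
  have w: "w \<in> bwords (length cs)" "w \<in> bwords (length ks)" using Cons.prems by auto
  have lw: "lcable ks (l # w) \<in> bwords (sum_list ks)" by (rule bwords_lcable[OF Cons.prems(1)])
  have p: "permute (lcable ks w) (rep ks cs) = rep (permute w ks) (permute w cs)"
    by (rule permute_rep[OF w(2)]) (simp add: Cons.prems)
  have la: "letter_arr C M (permute w cs) l \<in> Arr C" "Dom C (letter_arr C M (permute w cs) l) = tot M cs"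
    using letter_arr_arr[of l "permute w cs" M] Cons.prems by auto
  have lr: "lcable ks w \<in> bwords (length (rep ks cs))" "lcable ks (l # w) \<in> bwords (length (rep ks cs))"
    unfolding length_rep[OF Cons.prems(2)] by (rule bwords_lcable[OF w(2)], rule lw)
  have tr: "tot M (rep (permute w ks) (permute w cs)) = tot M (rep ks cs)"
    unfolding p[symmetric] by (rule tot_permute[OF lr(1)])
  have tr': "tot M (rep (permute (l # w) ks) (permute (l # w) cs)) = tot M (rep ks cs)"
    unfolding permute_rep[OF Cons.prems(1) Cons.prems(2)[symmetric], symmetric] by (rule tot_permute[OF lr(2)])
  have Bb: "?B \<in> bwords (length (rep (permute w ks) (permute w cs)))"
    using lw lc w Cons.prems by simp
  have "word_arr C M cs (l # w) o mus ks cs = letter_arr C M (permute w cs) l o mus (permute w ks) (permute w cs) o word_arr C M (rep ks cs) (lcable ks w)"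
    using Cons w la by (simp add: comp_assoc)
  also have "... = (letter_arr C M (permute w cs) l o mus (permute w ks) (permute w cs)) o word_arr C M (rep ks cs) (lcable ks w)"
    using w la Cons.prems bwords_lcable[OF w(2)] tr by (intro comp_assoc[symmetric]) auto
  also have "... = mus (permute (l # w) ks) (permute (l # w) cs) o word_arr C M (rep (permute w ks) (permute w cs)) ?B o word_arr C M (rep ks cs) (lcable ks w)"
    unfolding L using w Bb tr tr' Cons.prems bwords_lcable[OF w(2)] by (intro comp_assoc) auto
  also have "... = mus (permute (l # w) ks) (permute (l # w) cs) o word_arr C M (rep ks cs) (lcable ks (l # w))"
    unfolding lc using word_arr_append[of ?B "rep ks cs" "lcable ks w" M] lw lc p Cons.prems by simp
  finally show ?case .
qed simp

end

text \<open>An arrow stores a braid class, so a representing word is chosen. The operations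
  \<open>col\<close> and \<open>ev\<close> do not depend on it, since colours and values are
  invariant under braid equality.\<close>

definition qrep :: "('g, 'x) monoid_scheme => 'g qmor => nat list \<times> 'g list \<times> bword" where
  "qrep G f = (SOME (ks, xs, w). qok G ks xs w \<and> f = mkq ks xs w)"

definition col :: "('g, 'x) monoid_scheme => 'c list => 'g qmor => 'c list" where
  "col G cs f = (case qrep G f of (ks, xs, w) => src ks w cs)"

lemma qrep_mkq:
  assumes "qok G ks xs w"
  obtains v where "qrep G (mkq ks xs w) = (ks, xs, v)" "qok G ks xs v" "braid_eq (sum_list ks) v w"
proof -
  obtain ks' xs' v where r: "qrep G (mkq ks xs w) = (ks', xs', v)" by (metis prod_cases3)
  have "case qrep G (mkq ks xs w) of (ks', xs', v) => qok G ks' xs' v \<and> mkq ks xs w = mkq ks' xs' v"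
    unfolding qrep_def by (rule someI[of _ "(ks, xs, w)"]) (use assms in auto)
  hence "qok G ks' xs' v" "mkq ks xs w = mkq ks' xs' v" using r by auto
  thus ?thesis using mkq_inject[OF _ assms, of ks' xs' v] r that braid_eq.sym by metis
qed

lemma src_braid_eq: "braid_eq (sum_list ks) v w ==> length cs = length ks ==> src ks v cs = src ks w cs"
  using braid_eq_bwords[of "sum_list ks" v w] permute_braid_eq[of "sum_list ks" v w "src ks w cs"]
  by (intro src_eqI) (auto simp: permute_src)

lemma col_mkq: "qok G ks xs w ==> length cs = length ks ==> col G cs (mkq ks xs w) = src ks w cs"
  by (erule qrep_mkq) (simp add: col_def src_braid_eq)

context group
begin

lemma length_col [simp]: "f \<in> Arr Q ==> length cs = qcod f ==> length (col G cs f) = qdom f"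
  by (auto simp: Arr_Q col_mkq)

lemma map_col: "f \<in> Arr Q ==> length cs = qcod f ==> map h (col G cs f) = col G (map h cs) f"
  by (auto simp: Arr_Q col_mkq map_src qok_def)

lemma col_comp:
  assumes f: "f \<in> Arr Q" and g: "g \<in> Arr Q" and fg: "qcod f = qdom g" and cs: "length cs = qcod g"
  shows "col G cs (g\<star>f) = col G (col G cs g) f"
proof -
  obtain ks xs w where 1: "f = mkq ks xs w" "qok G ks xs w" using f by (auto simp: Arr_Q)
  obtain ks2 xs2 w2 where 2: "g = mkq ks2 xs2 w2" "qok G ks2 xs2 w2" using g by (auto simp: Arr_Q)
  obtain kss where kss: "permute w2 ks = concat kss" "ks2 = map length kss"
    using comp_chunks[OF 2(2), of ks] fg 1 2 by auto
  have q: "qok G (map length kss) xs2 w2" using 2 kss by simp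
  have b: "w \<in> bwords (sum_list ks)" "w2 \<in> bwords (length ks)" using 1 2 fg by (auto simp: qok_def)
  show ?thesis
    using Q_comp[OF 1(2) q kss(1)] col_mkq[OF qok_comp[OF is_group 1(2) q kss(1)], of cs] src_comp[OF b kss(1), of cs]
      col_mkq[OF 1(2), of "src ks2 w2 cs"] col_mkq[OF 2(2), of cs] 1 2 kss(2) cs fg by simp
qed

lemma col_tensor:
  assumes f: "f \<in> Arr Q" and g: "g \<in> Arr Q" and cs: "length cs = qcod f" "length ds = qcod g"
  shows "col G (cs @ ds) (f\<oplus>g) = col G cs f @ col G ds g"
proof -
  obtain ks xs w where 1: "f = mkq ks xs w" "qok G ks xs w" using f by (auto simp: Arr_Q)
  obtain ks2 xs2 w2 where 2: "g = mkq ks2 xs2 w2" "qok G ks2 xs2 w2" using g by (auto simp: Arr_Q)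
  show ?thesis
    using Q_tensor[OF 1(2) 2(2)] col_mkq[OF qok_append[OF 1(2) 2(2)], of "cs @ ds"] col_mkq[OF 1(2), of cs]
      col_mkq[OF 2(2), of ds] 1 2 cs src_append[of w ks w2 ks2 cs ds] by (simp add: qok_def)
qed

lemma col_qiso:
  assumes "iok n xs w" "length cs = n"
  shows "col G cs (qiso n xs w) = permute (inverse_word w) cs"
  using col_mkq[OF assms(1), of cs] assms(2) by (simp add: src_def)

lemma col_Id [simp]: "length cs = n ==> col G cs (Id Q n) = cs"
  using col_qiso[of n "ones n" "[]" cs] by (simp add: Q_Id)

lemma col_inverse:
  assumes "inverse_arrows Q f g" "length cs = qdom f"
  shows "col G (col G cs g) f = cs"
proof -
  have fg: "f \<in> Arr Q" "g \<in> Arr Q" "qdom g = qcod f" "qcod g = qdom f" "g\<star>f = Id Q (qdom f)"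
    using assms(1) by (auto simp: inverse_arrows_def Hom_def)
  thus ?thesis using col_comp[of f g cs] assms(2) by simp
qed

lemma col_braid: "length cs = n ==> length ds = m ==> col G (ds @ cs) (braid Q n m) = cs @ ds"
proof -
  assume l: "length cs = n" "length ds = m"
  have "permute (block_word 0 n m True) (cs @ ds) = ds @ cs" using permute_block[of "[]" cs ds True "[]"] l by simp
  hence "permute (inverse_word (block_word 0 n m True)) (ds @ cs) = cs @ ds"
    using permute_inverse'[of "block_word 0 n m True" "cs @ ds"] l by simp
  thus ?thesis using l by (simp add: Q_braid col_qiso)
qed

lemma col_binv: "length cs = n ==> length ds = m ==> col G (cs @ ds) (binv Q n m) = ds @ cs"
  using col_inverse[OF Q.inverse_arrows_sym[OF Q.inverse_braid[of n m]], of "ds @ cs"] by (simp add: col_braid)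

lemma col_dq: "length cs = length ks ==> col G cs (dq ks) = rep ks cs"
  by (simp add: col_mkq src_def)

lemma col_label: "x \<in> carrier G ==> col G [c] (qiso 1 [x] []) = [c]"
  using col_qiso[of 1 "[x]" "[]" "[c]"] by (simp add: qok_def)

lemma col_swap: "col G [d, c] (qiso 2 (ones 2) [(1, s)]) = [c, d]"
  using col_qiso[of 2 "ones 2" "[(1, s)]" "[d, c]"] by (simp add: swap_at_def)

end

context gmonoids
begin

text \<open>First the labels act, then the strands are braided, then each fibre is multiplied, with
  all colours traced back from the target.\<close>

definition ev :: "'c list => 'g qmor => 'a" where
  "ev cs f = (case qrep G f of (ks, xs, w) =>
     mus ks cs o word_arr C M (src ks w cs) w o rhos (src ks w cs) xs)"

lemma ev_mkq: "qok G ks xs w ==> length cs = length ks ==>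
    ev cs (mkq ks xs w) = mus ks cs o word_arr C M (src ks w cs) w o rhos (src ks w cs) xs"
  by (erule qrep_mkq) (simp add: ev_def src_braid_eq word_arr_braid_eq[of "sum_list ks"])

lemma tot_src: "w \<in> bwords (sum_list ks) ==> length cs = length ks ==> tot M (src ks w cs) = tot M (rep ks cs)"
  using tot_permute[of w "src ks w cs" M] by (simp add: permute_src)

lemma ev_arr [simp]:
  assumes "f \<in> Arr G.Q" "length cs = qcod f"
  shows "ev cs f \<in> Arr C" "Dom C (ev cs f) = tot M (col G cs f)" "Cod C (ev cs f) = tot M cs"
proof -
  obtain ks xs w where 1: "f = mkq ks xs w" "qok G ks xs w" using assms by (auto simp: Arr_Q)
  hence "w \<in> bwords (sum_list ks)" "length xs = sum_list ks" "set xs \<subseteq> carrier G" by (auto simp: qok_def)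
  thus "ev cs f \<in> Arr C" "Dom C (ev cs f) = tot M (col G cs f)" "Cod C (ev cs f) = tot M cs"
    using 1 assms(2) by (simp_all add: ev_mkq col_mkq tot_src)
qed

text \<open>The normal form of the composite has all labels first and all multiplications last. The
  exchange rules sort this into the two factors: the labels of \<open>g\<close> pass the braid and
  the multiplications of \<open>f\<close>, and the multiplications of \<open>f\<close> pass the
  braid of \<open>g\<close>.\<close>

lemma ev_comp:
  assumes f: "f \<in> Arr G.Q" and g: "g \<in> Arr G.Q" and fg: "qcod f = qdom g" and cs: "length cs = qcod g"
  shows "ev cs (g\<star>f) = ev cs g o ev (col G cs g) f"
proof -
  obtain ks xs w where 1: "f = mkq ks xs w" "qok G ks xs w" using f by (auto simp: Arr_Q)
  obtain ks2 xs2 w2 where 2: "g = mkq ks2 xs2 w2" "qok G ks2 xs2 w2" using g by (auto simp: Arr_Q)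
  obtain kss where kss: "permute w2 ks = concat kss" "ks2 = map length kss"
    using comp_chunks[OF 2(2), of ks] fg 1 2 by auto
  have q: "qok G (map length kss) xs2 w2" using 2 kss by simp
  have b: "w \<in> bwords (sum_list ks)" "w2 \<in> bwords (length ks)" and b2: "w2 \<in> bwords (sum_list ks2)"
    and x: "length xs = sum_list ks" "length xs2 = length ks" "set xs \<subseteq> carrier G" "set xs2 \<subseteq> carrier G"
    and l: "length ks = sum_list ks2" "length cs = length ks2"
    using 1 2 fg cs kss by (auto simp: qok_def)
  have l3: "length cs = length kss" using l kss(2) by simp
  define s2 where "s2 = src ks2 w2 cs"
  define s1 where "s1 = src ks w s2"
  have ls: "length s2 = length ks" "length s1 = sum_list ks" using l by (simp_all add: s2_def s1_def)
  have bl: "lcable ks w2 \<in> bwords (sum_list ks)" using bwords_lcable[OF b(2)] .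
  have sk: "sum_list (map sum_list kss) = sum_list ks" using kss(1) b(2) by (metis sum_list_concat sum_list_permute)
  have s1': "src (map sum_list kss) (lcable ks w2 @ w) cs = s1"
    unfolding s1_def s2_def kss(2) by (rule src_comp[OF b kss(1) l3])
  have xx: "set (src ks w xs2) \<subseteq> carrier G" "length (src ks w xs2) = sum_list ks" "set (rep ks xs2) \<subseteq> carrier G"
    using set_src[OF b(1), of xs2] x set_rep[of ks xs2] by auto
  have p1: "permute w s1 = rep ks s2" using b ls by (simp add: s1_def permute_src)
  have p2: "permute w2 s2 = rep ks2 cs" using b2 l by (simp add: s2_def permute_src)
  have t1: "tot M (rep ks s2) = tot M s1" using tot_src[OF b(1), of s2] ls by (simp add: s1_def)
  have t2: "tot M (rep ks2 cs) = tot M s2" using tot_src[OF b2, of cs] l by (simp add: s2_def)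
  have lr: "length (concat kss) = length (rep ks2 cs)"
    unfolding length_concat kss(2)[symmetric] by (rule length_rep[symmetric]) (simp only: l)
  have t3: "tot M (rep (concat kss) (rep ks2 cs)) = tot M s1"
  proof -
    have "rep (concat kss) (rep ks2 cs) = permute (lcable ks w2) (rep ks s2)"
      using permute_rep[OF b(2) ls(1)] kss(1) p2 by simp
    moreover have "lcable ks w2 \<in> bwords (length (rep ks s2))" using bl ls by simp
    ultimately show ?thesis using t1 by simp
  qed
  let ?W = "word_arr C M"
  have "ev cs (g\<star>f) = mus (map sum_list kss) cs o ?W s1 (lcable ks w2 @ w) o rhos s1 (map2 (\<lambda>y x. y \<otimes>\<^bsub>G\<^esub> x) (src ks w xs2) xs)"
    unfolding 1(1) 2(1) kss(2) Q_comp[OF 1(2) q kss(1)]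
    using ev_mkq[OF qok_comp[OF G.is_group 1(2) q kss(1)], of cs] l3 s1' by simp
  also have "... = (mus ks2 cs o mus (concat kss) (rep ks2 cs)) o (?W (rep ks s2) (lcable ks w2) o ?W s1 w) o rhos s1 (src ks w xs2) o rhos s1 xs"
    using mus_sum_list[of kss cs, folded kss(2)] l3 rhos_mult[of s1 xs "src ks w xs2"] ls xx x word_arr_append[of "lcable ks w2" s1 w M] bl b p1 by simp
  also have "... = mus ks2 cs o (mus (concat kss) (rep ks2 cs) o ?W (rep ks s2) (lcable ks w2)) o (?W s1 w o rhos s1 (src ks w xs2)) o rhos s1 xs"
    using ls xx x bl b t1 t2 t3 lr l by (simp add: comp_assoc)
  also have "?W s1 w o rhos s1 (src ks w xs2) = rhos (rep ks s2) (rep ks xs2) o ?W s1 w"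
    using word_rhos[of w s1 "src ks w xs2"] b ls xx p1 x by (simp add: permute_src)
  also have "mus (concat kss) (rep ks2 cs) o ?W (rep ks s2) (lcable ks w2) = ?W s2 w2 o mus ks s2"
    using word_mus[OF b(2) ls(1)[symmetric]] unfolding kss(1) p2 by (simp only:)
  also have "mus ks2 cs o (?W s2 w2 o mus ks s2) o (rhos (rep ks s2) (rep ks xs2) o ?W s1 w) o rhos s1 xs
      = mus ks2 cs o ?W s2 w2 o (mus ks s2 o rhos (rep ks s2) (rep ks xs2)) o ?W s1 w o rhos s1 xs"
    using ls xx x b t1 t2 l by (simp add: comp_assoc)
  also have "mus ks s2 o rhos (rep ks s2) (rep ks xs2) = rhos s2 xs2 o mus ks s2"
    using rhos_mus[of ks s2 xs2] ls x by simp
  also have "mus ks2 cs o ?W s2 w2 o (rhos s2 xs2 o mus ks s2) o ?W s1 w o rhos s1 xs =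
      (mus ks2 cs o ?W s2 w2 o rhos s2 xs2) o (mus ks s2 o ?W s1 w o rhos s1 xs)"
    using ls xx x b t1 t2 l by (simp add: comp_assoc)
  also have "... = ev cs g o ev (col G cs g) f"
    using ev_mkq[OF 2(2), of cs] ev_mkq[OF 1(2), of s2] col_mkq[OF 2(2), of cs] 1(1) 2(1) l ls
    by (simp add: s1_def s2_def)
  finally show ?thesis .
qed

lemma ev_tensor:
  assumes f: "f \<in> Arr G.Q" and g: "g \<in> Arr G.Q" and cs: "length cs = qcod f" "length ds = qcod g"
  shows "ev (cs @ ds) (f\<oplus>g) = ev cs f**ev ds g"
proof -
  obtain ks xs w where 1: "f = mkq ks xs w" "qok G ks xs w" using f by (auto simp: Arr_Q)
  obtain ks2 xs2 w2 where 2: "g = mkq ks2 xs2 w2" "qok G ks2 xs2 w2" using g by (auto simp: Arr_Q)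
  have b: "w \<in> bwords (sum_list ks)" "w2 \<in> bwords (sum_list ks2)" "length xs = sum_list ks" "length xs2 = sum_list ks2"
    "set xs \<subseteq> carrier G" "set xs2 \<subseteq> carrier G" using 1 2 by (auto simp: qok_def)
  have s: "src (ks @ ks2) (w @ shift_word (sum_list ks) w2) (cs @ ds) = src ks w cs @ src ks2 w2 ds"
    using src_append[of w ks w2 ks2 cs ds] b cs 1 2 by simp
  have "word_arr C M (src ks w cs @ src ks2 w2 ds) (w @ shift_word (sum_list ks) w2) =
      word_arr C M (src ks w cs) w**word_arr C M (src ks2 w2 ds) w2"
    using word_arr_sum[of w "src ks w cs" w2 "src ks2 w2 ds" M] b cs 1 2 by simp
  thus ?thesis
    using Q_tensor[OF 1(2) 2(2)] ev_mkq[OF qok_append[OF 1(2) 2(2)], of "cs @ ds"] ev_mkq[OF 1(2), of cs]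
      ev_mkq[OF 2(2), of ds] 1 2 cs b s by (simp add: mus_append rhos_append ten_comp tot_src)
qed

lemma ev_qiso_ones:
  assumes "w \<in> bwords n" "length cs = n"
  shows "ev cs (G.qiso n (G.ones n) w) = word_arr C M (permute (inverse_word w) cs) w"
  using ev_mkq[of "replicate n (Suc 0)" "G.ones n" w cs] assms tot_permute[of "inverse_word w" cs M] by (simp add: src_def)

lemma ev_Id [simp]: "length cs = n ==> ev cs (Id G.Q n) = Id C (tot M cs)"
  using ev_qiso_ones[of "[]" n cs] by (simp add: Q_Id)

lemma ev_inverse:
  assumes "inverse_arrows G.Q f g" "length cs = qcod f"
  shows "inverse_arrows C (ev cs f) (ev (col G cs f) g)"
proof -
  have fg: "f \<in> Arr G.Q" "g \<in> Arr G.Q" "qdom g = qcod f" "qcod g = qdom f" "g\<star>f = Id G.Q (qdom f)"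
    "f\<star>g = Id G.Q (qcod f)"
    using assms(1) by (auto simp: inverse_arrows_def Hom_def)
  have c: "col G (col G cs f) g = cs" using G.col_inverse[OF G.Q.inverse_arrows_sym[OF assms(1)], of cs] fg assms(2) by simp
  have "ev cs f o ev (col G cs f) g = Id C (tot M cs)"
    using ev_comp[of g f cs] fg assms(2) by simp
  moreover have "ev (col G cs f) g o ev cs f = Id C (tot M (col G cs f))"
    using ev_comp[of f g "col G cs f"] fg assms(2) c by simp
  ultimately show ?thesis using fg c assms(2) by (simp add: inverse_arrows_def Hom_def)
qed

text \<open>Colours are given at the target, hence the order \<open>ds @ cs\<close>.\<close>

lemma ev_braid: "length cs = n ==> length ds = m ==> ev (ds @ cs) (braid G.Q n m) = braid C (tot M cs) (tot M ds)"
proof -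
  assume l: "length cs = n" "length ds = m"
  have "permute (block_word 0 n m True) (cs @ ds) = ds @ cs" using permute_block[of "[]" cs ds True "[]"] l by simp
  hence "permute (inverse_word (block_word 0 n m True)) (ds @ cs) = cs @ ds"
    using permute_inverse'[of "block_word 0 n m True" "cs @ ds"] l by simp
  thus ?thesis using l word_arr_block[of M "[]" cs ds "[]" True]
    by (simp add: Q_braid ev_qiso_ones crossing_def)
qed

lemma ev_binv: "length cs = n ==> length ds = m ==> ev (cs @ ds) (binv G.Q n m) = binv C (tot M cs) (tot M ds)"
  using ev_inverse[OF G.Q.inverse_braid[of n m], of "ds @ cs"]
  by (simp add: ev_braid G.col_braid binv_def inv_arr_eq)

lemma ev_label: "x \<in> carrier G ==> ev [c] (G.qiso 1 [x] []) = rho c x"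
  using ev_mkq[of "[Suc 0]" "[x]" "[]" "[c]"] by (simp add: qok_def src_def mu_unit)

lemma ev_m: "ev [c] (q_m G) = mu c"
  using ev_mkq[of "[2]" "G.ones 2" "[]" "[c]"] by (simp add: G.q_m_dq qok_def src_def numeral_2_eq_2 mu_unit ten_id)

lemma ev_u: "ev [c] (q_u G) = eta c"
  using ev_mkq[of "[0]" "G.ones 0" "[]" "[c]"] by (simp add: G.q_u_dq qok_def src_def)

lemma ev_swap: "ev [d, c] (G.qiso 2 (G.ones 2) [(1, s)]) = crossing C s (M c) (M d)"
  using ev_qiso_ones[of "[(1, s)]" 2 "[d, c]"] letter_arr_split[of M "[]" c d "[]" s] by (simp add: swap_at_def)

end

section \<open>Tensor products of monoids in a strict braided category\<close>

section \<open>Tensor products of monoids\<close>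

text \<open>The middle factors are exchanged by the inverse crossing. The sign is forced by the rule
  for two multiplications: moving its \<open>q_sigma23\<close> from the left leg of the span to the
  right one inverts it.\<close>

definition tmul :: "(nat, 'a, 'z) bmcat_scheme => nat => 'a => nat => 'a => 'a" where
  "tmul C A m B n = (m**\<^bsub>C\<^esub>n) o\<^bsub>C\<^esub> (Id C A**\<^bsub>C\<^esub>binv C A B**\<^bsub>C\<^esub>Id C B)"

context prob
begin

lemma tmul_0_left: "n \<in> Arr C ==> Dom C n = B + B ==> tmul C 0 (Id C 0) B n = n"
  and tmul_0_right: "m \<in> Arr C ==> Dom C m = A + A ==> tmul C A m 0 (Id C 0) = m"
  by (simp_all add: tmul_def ten_id)

text \<open>Both sides are \<open>m\<close>, \<open>n\<close> and \<open>l\<close> in parallel after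
  an arrow that sorts six factors. The hexagons write this arrow in two ways, which agree by
  interchanging the independent crossings \<open>?x\<close> and \<open>?y\<close>.\<close>

lemma tmul_assoc:
  assumes m: "m \<in> Arr C" "Dom C m = A + A" and n: "n \<in> Arr C" "Dom C n = B + B" and l: "l \<in> Arr C" "Dom C l = D + D"
  shows "tmul C (A + B) (tmul C A m B n) D l = tmul C A m (B + D) (tmul C B n D l)"
proof -
  let ?x = "binv C A B" and ?y = "binv C B D" and ?z = "binv C A D"
  let ?R = "Id C (A + B)**?z**Id C (B + D)"
  let ?S = "Id C A**?x**?y**Id C D"
  note s = m n l
  have 1: "tmul C A m B n**l = (m**n**l) o (Id C A**?x**Id C (B + (D + D)))"
  proof -
    have "tmul C A m B n**l = ((m**n)**l) o ((Id C A**?x**Id C B)**Id C (D + D))"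
      using s by (simp add: tmul_def ten_comp)
    thus ?thesis using s by (simp add: ten_assoc ten_id)
  qed
  have 2: "m**tmul C B n D l = (m**n**l) o (Id C ((A + A) + B)**?y**Id C D)"
  proof -
    have "m**tmul C B n D l = (m**n**l) o (Id C (A + A)**Id C B**?y**Id C D)"
      using s by (simp add: tmul_def ten_comp)
    thus ?thesis using s by (simp add: ten_assoc flip: ten_id)
  qed
  have 3: "Id C (A + B)**binv C (A + B) D**Id C D = (Id C (A + B + A)**?y**Id C D) o ?R"
  proof -
    have "Id C (A + B)**binv C (A + B) D**Id C D =
       (Id C (A + B)**(Id C A**?y)**Id C D) o (Id C (A + B)**(?z**Id C B)**Id C D)"
      by (simp add: binv_hex2 ten_comp)
    thus ?thesis by (simp add: ten_assoc flip: ten_id)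
  qed
  have 4: "Id C A**binv C A (B + D)**Id C (B + D) = (Id C A**?x**Id C (D + (B + D))) o ?R"
  proof -
    have "Id C A**binv C A (B + D)**Id C (B + D) =
       (Id C A**(?x**Id C D)**Id C (B + D)) o (Id C A**(Id C B**?z)**Id C (B + D))"
      by (simp add: binv_hex1 ten_comp)
    thus ?thesis by (simp add: ten_assoc flip: ten_id)
  qed
  have 5: "(Id C A**?x**Id C (B + (D + D))) o (Id C (A + B + A)**?y**Id C D) = ?S"
  proof -
    have "(Id C A**?x**Id C (B + D)**Id C D) o (Id C A**Id C (B + A)**?y**Id C D) = ?S"
      by (simp add: ten_comp)
    thus ?thesis by (simp add: ten_assoc flip: ten_id)
  qed
  have 6: "(Id C ((A + A) + B)**?y**Id C D) o (Id C A**?x**Id C (D + (B + D))) = ?S"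
  proof -
    have "(Id C A**Id C (A + B)**?y**Id C D) o (Id C A**?x**Id C (D + B)**Id C D) = ?S"
      by (simp add: ten_comp)
    thus ?thesis by (simp add: ten_assoc flip: ten_id)
  qed
  have "tmul C (A + B) (tmul C A m B n) D l = ((m**n**l) o (Id C A**?x**Id C (B + (D + D)))) o (Id C (A + B + A)**?y**Id C D) o ?R"
    unfolding tmul_def[of C "A + B"] 1 3 ..
  also have "... = (m**n**l) o ((Id C A**?x**Id C (B + (D + D))) o (Id C (A + B + A)**?y**Id C D)) o ?R"
    using s by (simp add: comp_assoc)
  also have "... = (m**n**l) o ((Id C ((A + A) + B)**?y**Id C D) o (Id C A**?x**Id C (D + (B + D)))) o ?R"
    unfolding 5 6 ..
  also have "... = ((m**n**l) o (Id C ((A + A) + B)**?y**Id C D)) o (Id C A**?x**Id C (D + (B + D))) o ?R"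
    using s by (simp add: comp_assoc)
  also have "... = tmul C A m (B + D) (tmul C B n D l)"
    unfolding tmul_def[of C A _ "B + D"] 2 4 ..
  finally show ?thesis .
qed

text \<open>Naturality moves the multiplications past the crossings by \<open>xn\<close> and
  \<open>xm\<close>. What remains on both sides is the same sorting of six factors, followed by
  associativity of \<open>m\<close> and of \<open>n\<close>.\<close>

lemma tmul_associative:
  assumes m: "m \<in> Hom C (A + A) A" "m o (m**Id C A) = m o (Id C A**m)"
    and n: "n \<in> Hom C (B + B) B" "n o (n**Id C B) = n o (Id C B**n)"
  shows "tmul C A m B n o (tmul C A m B n**Id C (A + B)) = tmul C A m B n o (Id C (A + B)**tmul C A m B n)"
proof -
  have s: "m \<in> Arr C" "Dom C m = A + A" "Cod C m = A" "n \<in> Arr C" "Dom C n = B + B" "Cod C n = B"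
    using m n by (auto simp: Hom_def)
  let ?x = "binv C A B" and ?a = "Id C A" and ?b = "Id C B" and ?T = "tmul C A m B n"
  let ?X = "?a**?x**?b"
  let ?S = "?a**?x**?x**?b"
  let ?Y = "Id C (A + A)**?x**Id C (B + B)"
  have xn: "?x o (n**?a) = (?a**n) o (?x**?b) o (?b**?x)"
    using binv_nat[of ?a n] s by (simp add: binv_hex1)
  have xm: "?x o (?b**m) = (m**?b) o (?a**?x) o (?x**?a)"
    using binv_nat[of m ?b] s by (simp add: binv_hex2)
  have "?T o (?T**Id C (A + B)) = (m**n) o (?X o (m**(n**?a)**?b)) o (?X**Id C (A + B))"
  proof -
    have "?T**Id C (A + B) = ((m**n)**Id C (A + B)) o (?X**Id C (A + B))"
      using s by (simp add: tmul_def ten_comp)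
    also have "(m**n)**Id C (A + B) = m**(n**?a)**?b"
      using s by (simp add: ten_assoc flip: ten_id)
    finally show ?thesis using s by (simp add: tmul_def comp_assoc add.assoc)
  qed
  also have "?X o (m**(n**?a)**?b) = (m**(?a**n)**?b) o (Id C (A + A)**((?x**?b) o (?b**?x))**?b)"
    using s by (simp add: ten_comp xn)
  also have "Id C (A + A)**((?x**?b) o (?b**?x))**?b = ?Y o (Id C (A + (A + B))**?x**?b)"
  proof -
    have "Id C (A + A)**((?x**?b) o (?b**?x))**?b = (Id C (A + A)**(?x**?b)**?b) o (Id C (A + A)**(?b**?x)**?b)"
      by (simp add: ten_comp)
    thus ?thesis by (simp add: ten_assoc flip: ten_id)
  qed
  also have "(m**n) o ((m**(?a**n)**?b) o ?Y o (Id C (A + (A + B))**?x**?b)) o (?X**Id C (A + B))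
      = ((m**n) o ((m**?a)**(n**?b))) o ?Y o ((Id C (A + (A + B))**?x**?b) o (?X**Id C (A + B)))"
    using s by (simp add: comp_assoc ten_assoc add.assoc)
  also have "(Id C (A + (A + B))**?x**?b) o (?X**Id C (A + B)) = ?S"
  proof -
    have "(?a**Id C (A + B)**?x**?b) o (?a**?x**Id C (B + A)**?b) = ?S" by (simp add: ten_comp)
    thus ?thesis by (simp add: ten_assoc flip: ten_id)
  qed
  also have "(m**n) o ((m**?a)**(n**?b)) = (m**n) o ((?a**m)**(?b**n))"
    using s m n by (simp add: ten_comp)
  finally have L: "?T o (?T**Id C (A + B)) = ((m**n) o ((?a**m)**(?b**n))) o ?Y o ?S" .
  have "?T o (Id C (A + B)**?T) = (m**n) o (?X o (?a**(?b**m)**n)) o (Id C (A + B)**?X)"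
  proof -
    have "Id C (A + B)**?T = (Id C (A + B)**(m**n)) o (Id C (A + B)**?X)"
      using s by (simp add: tmul_def ten_comp)
    also have "Id C (A + B)**(m**n) = ?a**(?b**m)**n"
      using s by (simp add: ten_assoc flip: ten_id)
    finally show ?thesis using s by (simp add: tmul_def comp_assoc add.assoc)
  qed
  also have "?X o (?a**(?b**m)**n) = (?a**(m**?b)**n) o (?a**((?a**?x) o (?x**?a))**Id C (B + B))"
    using s by (simp add: ten_comp xm)
  also have "?a**((?a**?x) o (?x**?a))**Id C (B + B) = ?Y o (?a**?x**Id C (A + (B + B)))"
  proof -
    have "?a**((?a**?x) o (?x**?a))**Id C (B + B) = (?a**(?a**?x)**Id C (B + B)) o (?a**(?x**?a)**Id C (B + B))"
      by (simp add: ten_comp)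
    thus ?thesis by (simp add: ten_assoc flip: ten_id)
  qed
  also have "(m**n) o ((?a**(m**?b)**n) o ?Y o (?a**?x**Id C (A + (B + B)))) o (Id C (A + B)**?X)
      = ((m**n) o ((?a**m)**(?b**n))) o ?Y o ((?a**?x**Id C (A + (B + B))) o (Id C (A + B)**?X))"
    using s by (simp add: comp_assoc ten_assoc add.assoc)
  also have "(?a**?x**Id C (A + (B + B))) o (Id C (A + B)**?X) = ?S"
  proof -
    have "(?a**?x**Id C (A + B)**?b) o (?a**Id C (B + A)**?x**?b) = ?S" by (simp add: ten_comp)
    thus ?thesis by (simp add: ten_assoc flip: ten_id)
  qed
  finally show ?thesis unfolding L ..
qed

lemma gmonoid_unit: "gmonoid G C 0 (Id C 0) (Id C 0) (\<lambda>_. Id C 0)"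
  by (simp add: gmonoid_def Hom_def)

lemma gmonoid_tensor:
  assumes "gmonoid G C A m u r" "gmonoid G C B n v t"
  shows "gmonoid G C (A + B) (tmul C A m B n) (u**v) (\<lambda>x. r x**t x)"
proof -
  have s: "m \<in> Arr C" "Dom C m = A + A" "Cod C m = A" "n \<in> Arr C" "Dom C n = B + B" "Cod C n = B"
    "u \<in> Arr C" "Dom C u = 0" "Cod C u = A" "v \<in> Arr C" "Dom C v = 0" "Cod C v = B"
    using assms by (auto simp: gmonoid_def Hom_def)
  have st: "r x \<in> Arr C" "Dom C (r x) = A" "Cod C (r x) = A" "t x \<in> Arr C" "Dom C (t x) = B" "Cod C (t x) = B" if "x \<in> carrier G" for x
    using assms that by (auto simp: gmonoid_def Hom_def)
  let ?x = "binv C A B" and ?a = "Id C A" and ?b = "Id C B" and ?T = "tmul C A m B n"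
  have T: "?T \<in> Hom C (A + B + (A + B)) (A + B)" using s by (simp add: tmul_def Hom_def add.assoc)
  have ass: "?T o (?T**Id C (A + B)) = ?T o (Id C (A + B)**?T)"
    using assms by (intro tmul_associative) (auto simp: gmonoid_def)
  have xv: "?x o (v**?a) = ?a**v" using binv_nat[of ?a v] s by simp
  have xu: "?x o (?b**u) = u**?b" using binv_nat[of u ?b] s by simp
  have u1: "?T o ((u**v)**Id C (A + B)) = Id C (A + B)"
  proof -
    have "(u**v)**Id C (A + B) = u**(v**?a)**?b" using s by (simp add: ten_assoc flip: ten_id)
    hence "?T o ((u**v)**Id C (A + B)) = (m**n) o (u**(?a**v)**?b)"
      using s by (simp add: tmul_def comp_assoc ten_comp xv)
    also have "u**(?a**v)**?b = (u**?a)**(v**?b)" using s by (simp add: ten_assoc)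
    finally show ?thesis using s assms by (simp add: ten_comp ten_id gmonoid_def)
  qed
  have u2: "?T o (Id C (A + B)**(u**v)) = Id C (A + B)"
  proof -
    have "Id C (A + B)**(u**v) = ?a**(?b**u)**v" using s by (simp add: ten_assoc flip: ten_id)
    hence "?T o (Id C (A + B)**(u**v)) = (m**n) o (?a**(u**?b)**v)"
      using s by (simp add: tmul_def comp_assoc ten_comp xu)
    also have "?a**(u**?b)**v = (?a**u)**(?b**v)" using s by (simp add: ten_assoc)
    finally show ?thesis using s assms by (simp add: ten_comp ten_id gmonoid_def)
  qed
  have act: "(r x**t x) o ?T = ?T o ((r x**t x)**(r x**t x))" if x: "x \<in> carrier G" for x
  proof -
    have xr: "?x o (t x**r x) = (r x**t x) o ?x" using binv_nat[of "r x" "t x"] st[OF x] by simp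
    have "?T o ((r x**t x)**(r x**t x)) = (m**n) o (?a**?x**?b) o (r x**(t x**r x)**t x)"
      using s st[OF x] by (simp add: tmul_def comp_assoc ten_assoc add.assoc)
    also have "... = (m**n) o (r x**(r x**t x)**t x) o (?a**?x**?b)"
      using st[OF x] by (simp add: ten_comp xr)
    also have "r x**(r x**t x)**t x = (r x**r x)**(t x**t x)" using st[OF x] by (simp add: ten_assoc)
    also have "(m**n) o ((r x**r x)**(t x**t x)) o (?a**?x**?b) = ((r x o m)**(t x o n)) o (?a**?x**?b)"
      using s st[OF x] assms x by (simp add: ten_comp_assoc gmonoid_def add.assoc)
    also have "... = (r x**t x) o ?T" using s st[OF x] by (simp add: tmul_def ten_comp_assoc add.assoc)
    finally show ?thesis ..
  qed
  have e: "(r x**t x) o (u**v) = u**v" if x: "x \<in> carrier G" for x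
    using s st[OF x] assms x by (simp add: ten_comp gmonoid_def)
  have mult: "r (x \<otimes>\<^bsub>G\<^esub> y)**t (x \<otimes>\<^bsub>G\<^esub> y) = (r x**t x) o (r y**t y)" if "x \<in> carrier G" "y \<in> carrier G" for x y
    using st[OF that(1)] st[OF that(2)] assms that by (simp add: ten_comp gmonoid_def)
  have one: "r \<one>\<^bsub>G\<^esub>**t \<one>\<^bsub>G\<^esub> = Id C (A + B)" using assms by (simp add: gmonoid_def ten_id)
  show ?thesis unfolding gmonoid_def using T ass u1 u2 act e mult one s st by (simp add: Hom_def)
qed

end

context gmonoids
begin

text \<open>The tensor product of the monoids in a list, bracketed to the right;
  \<open>lmu_append\<close> shows that the bracketing is immaterial.\<close>

fun lmu :: "'c list => 'a" where
  "lmu [] = Id C 0"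
| "lmu (c # cs) = tmul C (M c) (mu c) (tot M cs) (lmu cs)"

fun leta :: "'c list => 'a" where
  "leta [] = Id C 0"
| "leta (c # cs) = eta c**leta cs"

fun lrho :: "'c list => 'g => 'a" where
  "lrho [] x = Id C 0"
| "lrho (c # cs) x = rho c x**lrho cs x"

lemma gmonoid_list: "gmonoid G C (tot M cs) (lmu cs) (leta cs) (lrho cs)"
proof (induction cs)
  case Nil
  have "lrho [] = (\<lambda>_. Id C 0)" by auto
  thus ?case using gmonoid_unit by simp
next
  case (Cons c cs)
  have "lrho (c # cs) = (\<lambda>x. rho c x**lrho cs x)" by auto
  thus ?case using gmonoid_tensor[OF gmonoid[of c] Cons] by simp
qed

lemma lmu_arr [simp]: "lmu cs \<in> Arr C" "Dom C (lmu cs) = tot M cs + tot M cs" "Cod C (lmu cs) = tot M cs"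
  and leta_arr [simp]: "leta cs \<in> Arr C" "Dom C (leta cs) = 0" "Cod C (leta cs) = tot M cs"
  and lrho_arr [simp]: "x \<in> carrier G ==> lrho cs x \<in> Arr C" "x \<in> carrier G ==> Dom C (lrho cs x) = tot M cs"
    "x \<in> carrier G ==> Cod C (lrho cs x) = tot M cs"
  using gmonoid_list[of cs] by (auto simp: gmonoid_def Hom_def)

lemma lmu_append: "lmu (cs @ ds) = tmul C (tot M cs) (lmu cs) (tot M ds) (lmu ds)"
  by (induction cs) (simp_all add: tmul_0_left tmul_assoc)

lemma leta_append: "leta (cs @ ds) = leta cs**leta ds"
  by (induction cs) (simp_all add: ten_assoc)

lemma lrho_append: "x \<in> carrier G ==> lrho (cs @ ds) x = lrho cs x**lrho ds x"
  by (induction cs) (simp_all add: ten_assoc)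

lemma gmonoids_list: "gmonoids C G (tot M) lmu leta lrho"
  by (unfold_locales) (rule gmonoid_list)

text \<open>The actions are compared on the carrier of \<open>G\<close> only, because that is where
  the action on a sum of powers is known to be the action on the total power.\<close>

lemma ev_reindex:
  assumes "f \<in> Arr G.Q" "length ds = qcod f" and H: "gmonoids C G M' mu' eta' rho'"
    and eq: "\<And>d. M' d = M (h d)" "\<And>d. mu' d = mu (h d)" "\<And>d. eta' d = eta (h d)" "\<And>d x. x \<in> carrier G ==> rho' d x = rho (h d) x"
  shows "gmonoids.ev C G M' mu' eta' rho' ds f = ev (map h ds) f"
proof -
  have eqs: "M' = (\<lambda>d. M (h d))" "mu' = (\<lambda>d. mu (h d))" "eta' = (\<lambda>d. eta (h d))" using eq by auto
  interpret H: gmonoids C G "\<lambda>d. M (h d)" "\<lambda>d. mu (h d)" "\<lambda>d. eta (h d)" rho' using H unfolding eqs .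
  obtain ks xs w where f: "f = mkq ks xs w" "qok G ks xs w" using assms by (auto simp: Arr_Q)
  have m: "H.mupow d k = mupow (h d) k" for d k by (induction k) simp_all
  have ms: "length ks = length ds ==> H.mus ks ds = mus ks (map h ds)" for ks ds
    by (induction ks ds rule: list_induct2) (simp_all add: m)
  have rs: "length ds = length xs ==> set xs \<subseteq> carrier G ==> H.rhos ds xs = rhos (map h ds) xs" for ds xs
    by (induction ds xs rule: list_induct2) (simp_all add: eq(4))
  show ?thesis
    unfolding eqs using f assms(2) H.ev_mkq[of ks xs w ds] ev_mkq[of ks xs w "map h ds"] map_src[of w ks ds h]
      word_arr_map[of w "src ks w ds" M h] ms[of ks ds] rs[of "src ks w ds" xs]
    by (simp add: qok_def)
qed

end

section \<open>Tensor powers of the generating monoid of Q\<close>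

section \<open>Powers of the generating monoid\<close>

context group
begin

lemma dq0_Arr [simp]: "mkq [0] [] [] \<in> Arr Q"
  using dq_Arr[of "[0]"] by simp

lemma label_dq: "x \<in> carrier G ==> qiso 1 [x] []\<star>dq [k] = dq [k]\<star>qiso k (replicate k x) []"
proof -
  assume x: "x \<in> carrier G"
  have "set (replicate k x) \<subseteq> carrier G" using x by auto
  thus ?thesis
    using Q_comp_left[of "[k]" "ones k" "[]" "[x]" "[]"] Q_comp_right[of "[k]" "ones k" "[]" "replicate k x" "[]"] x
    by (simp add: qok_def sum_list_replicate src_def map2_ones map2_ones')
qed

lemma base_gmonoid: "gmonoid G Q 1 (q_m G) (q_u G) (\<lambda>x. qiso 1 [x] [])"
proof -
  have lab: "qiso 1 [x] [] \<in> Hom Q 1 1" if "x \<in> carrier G" for x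
    using that mkq_Arr[of "[Suc 0]" "[x]" "[]"] by (simp add: Hom_def qok_def)
  have 1: "dq [2]\<star>(dq [2]\<oplus>Id Q 1) = dq [3]" "dq [2]\<star>(Id Q 1\<oplus>dq [2]) = dq [3]"
    "dq [2]\<star>(dq [0]\<oplus>Id Q 1) = Id Q 1" "dq [2]\<star>(Id Q 1\<oplus>dq [0]) = Id Q 1"
    using dq_comp[of "[[2, 1]]"] dq_append[of "[2]" "[1]"] dq_comp[of "[[1, 2]]"] dq_append[of "[1]" "[2]"]
      dq_comp[of "[[0, 1]]"] dq_append[of "[0]" "[1]"] dq_comp[of "[[1, 0]]"] dq_append[of "[1]" "[0]"] dq_Id[of 1]
    by (simp_all add: numeral_2_eq_2 numeral_3_eq_3)
  have 2: "qiso 1 [x \<otimes> y] [] = qiso 1 [x] []\<star>qiso 1 [y] []" if "x \<in> carrier G" "y \<in> carrier G" for x y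
    using qiso_comp[of 1 "[y]" "[]" "[x]" "[]"] that by (simp add: qok_def)
  have 3: "qiso 1 [x] []\<star>dq [2] = dq [2]\<star>(qiso 1 [x] []\<oplus>qiso 1 [x] [])" if "x \<in> carrier G" for x
    using label_dq[OF that, of 2] qiso_labels[of "[x]" x] that by (simp add: numeral_2_eq_2)
  have 4: "qiso 1 [x] []\<star>dq [0] = dq [0]" if "x \<in> carrier G" for x
    using label_dq[OF that, of 0] Q.comp_id_right[of "dq [0]" 0] by (simp add: Q_Id)
  show ?thesis unfolding gmonoid_def q_m_dq q_u_dq
    using lab 1 2 3 4 dq_Arr[of "[2]"] dq_Arr[of "[0]"] by (simp add: Hom_def Q_Id)
qed

end

sublocale group \<subseteq> base: gmonoids "Q_prob G" G "\<lambda>_::unit. Suc 0" "\<lambda>_. q_m G" "\<lambda>_. q_u G" "\<lambda>_ x. mkq [Suc 0] [x] []"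
  by unfold_locales (use base_gmonoid in simp)

context group
begin

definition pmu :: "nat => 'a qmor" where "pmu l = base.lmu (replicate l ())"
definition peta :: "nat => 'a qmor" where "peta l = base.leta (replicate l ())"
definition prho :: "nat => 'a => 'a qmor" where "prho l = base.lrho (replicate l ())"

end

text \<open>Here the colour \<open>l\<close> stands for the power \<open>l\<close> of the generating
  monoid. Evaluating an arrow of \<open>Q\<close> in \<open>Q\<close> itself at such colours is the
  operation \<open>pull_back\<close>.\<close>

sublocale group \<subseteq> pow: gmonoids "Q_prob G" G "\<lambda>l::nat. l" pmu peta prho
proof unfold_locales
  fix l show "gmonoid G Q l (pmu l) (peta l) (prho l)"
    using base.gmonoid_list[of "replicate l ()"] by (simp add: pmu_def peta_def prho_def base.tot_replicate)
qed

context group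
begin

lemma Q_Arr_typing [simp]:
  "pmu l \<in> Arr Q" "qdom (pmu l) = l + l" "qcod (pmu l) = l" "peta l \<in> Arr Q" "qdom (peta l) = 0" "qcod (peta l) = l"
  "q_m G \<in> Arr Q" "qdom (q_m G) = 2" "qcod (q_m G) = 1" "q_u G \<in> Arr Q" "qdom (q_u G) = 0" "qcod (q_u G) = 1"
  using pow.mu_arr[of l] pow.eta_arr[of l] by (auto simp: q_m_dq q_u_dq)

lemma prho_typing [simp]: "x \<in> carrier G ==> prho l x \<in> Arr Q" "x \<in> carrier G ==> qdom (prho l x) = l"
  "x \<in> carrier G ==> qcod (prho l x) = l"
  using pow.rho_arr[of x l] by auto

lemma pmu_add: "pmu (k + l) = tmul Q k (pmu k) l (pmu l)"
  by (simp add: pmu_def replicate_add base.lmu_append base.tot_replicate)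

lemma peta_add: "peta (k + l) = peta k\<oplus>peta l"
  by (simp add: peta_def replicate_add base.leta_append)

lemma prho_add: "x \<in> carrier G ==> prho (k + l) x = prho k x\<oplus>prho l x"
  by (simp add: prho_def replicate_add base.lrho_append)

lemma pmu_0 [simp]: "pmu 0 = Id Q 0" "peta 0 = Id Q 0" "prho 0 x = Id Q 0"
  by (simp_all add: pmu_def peta_def prho_def)

lemma pmu_Suc: "pmu (Suc l) = tmul Q 1 (q_m G) l (pmu l)" "peta (Suc l) = q_u G\<oplus>peta l"
  "prho (Suc l) x = qiso 1 [x] []\<oplus>prho l x"
  by (simp_all add: pmu_def peta_def prho_def base.tot_replicate)

lemma pmu_1: "pmu 1 = q_m G" "peta 1 = q_u G" "x \<in> carrier G ==> prho 1 x = qiso 1 [x] []"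
proof -
  show "pmu 1 = q_m G" using pmu_Suc(1)[of 0] Q.tmul_0_right[of "q_m G" 1] by simp
  show "peta 1 = q_u G" using pmu_Suc(2)[of 0] by simp
  show "x \<in> carrier G ==> prho 1 x = qiso 1 [x] []"
    using pmu_Suc(3)[of 0 x] mkq_Arr[of "[Suc 0]" "[x]" "[]"] by (simp add: qok_def)
qed

lemma pow_lmu: "pow.lmu ks = pmu (sum_list ks)" "pow.leta ks = peta (sum_list ks)"
  "x \<in> carrier G ==> pow.lrho ks x = prho (sum_list ks) x"
  by (induction ks) (simp_all add: pmu_add peta_add prho_add tot_def)

lemma tot_id: "tot (\<lambda>l. l) ks = sum_list ks"
  by (simp add: tot_def)

abbreviation "pull_back \<equiv> pow.ev"

lemma pull_back_arr [simp]: "f \<in> Arr Q ==> length ls = qcod f ==> pull_back ls f \<in> Arr Q"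
  "f \<in> Arr Q ==> length ls = qcod f ==> qdom (pull_back ls f) = sum_list (col G ls f)"
  "f \<in> Arr Q ==> length ls = qcod f ==> qcod (pull_back ls f) = sum_list ls"
  using pow.ev_arr[of f ls] by (simp_all add: tot_id)

lemma crossing_Q_1: "crossing Q s 1 1 = qiso 2 (ones 2) [(1, s)]"
proof -
  have T: "braid Q 1 1 = qiso 2 (ones 2) [(1, True)]" by (simp add: Q_braid numeral_2_eq_2)
  have "inverse_arrows Q (qiso 2 (ones 2) [(1, True)]) (qiso 2 (ones 2) [(1, False)])"
    using Q_inverse[of "[(1, True)]" 2] by simp
  hence "binv Q 1 1 = qiso 2 (ones 2) [(1, False)]"
    unfolding binv_def T by (rule Q.inv_arr_eq)
  thus ?thesis using T by (cases s) (simp_all add: crossing_def)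
qed

end

context gmonoids
begin

lemma ev_crossing: "ev (ds @ cs) (crossing G.Q s (length cs) (length ds)) = crossing C s (tot M cs) (tot M ds)"
  "col G (ds @ cs) (crossing G.Q s (length cs) (length ds)) = cs @ ds"
  by (auto simp: crossing_def ev_braid ev_binv G.col_braid G.col_binv)

lemma col_m: "col G [c] (q_m G) = [c, c]" and col_u: "col G [c] (q_u G) = []"
  using G.col_dq[of "[c]" "[2]"] G.col_dq[of "[c]" "[0]"] by (simp_all add: G.q_m_dq G.q_u_dq numeral_2_eq_2)

text \<open>The product on a power is assembled from \<open>q_m\<close> and inverse crossings
  exactly as \<open>lmu\<close> is from its factors, so evaluation turns one into the other.\<close>

lemma ev_pmu: "ev cs (G.pmu (length cs)) = lmu cs \<and> col G cs (G.pmu (length cs)) = cs @ cs"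
proof (induction cs)
  case Nil thus ?case using ev_Id[of "[]" 0] by simp
next
  case (Cons c cs)
  let ?l = "length cs"
  let ?S = "Id G.Q 1\<oplus>binv G.Q 1 ?l\<oplus>Id G.Q ?l"
  have 1: "ev (c # cs) (q_m G\<oplus>G.pmu ?l) = mu c**lmu cs"
    "col G (c # cs) (q_m G\<oplus>G.pmu ?l) = [c, c] @ cs @ cs"
    using ev_tensor[of "q_m G" "G.pmu ?l" "[c]" cs] G.col_tensor[of "q_m G" "G.pmu ?l" "[c]" cs] Cons ev_m[of c] col_m[of c] by simp_all
  have 2: "ev ([c] @ ([c] @ cs) @ cs) ?S = Id C (M c)**binv C (M c) (tot M cs)**Id C (tot M cs)"
    "col G ([c] @ ([c] @ cs) @ cs) ?S = [c] @ (cs @ [c]) @ cs"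
    using ev_tensor[of "Id G.Q 1" "binv G.Q 1 ?l\<oplus>Id G.Q ?l" "[c]" "([c] @ cs) @ cs"]
      ev_tensor[of "binv G.Q 1 ?l" "Id G.Q ?l" "[c] @ cs" cs] ev_binv[of "[c]" 1 cs ?l]
      G.col_tensor[of "Id G.Q 1" "binv G.Q 1 ?l\<oplus>Id G.Q ?l" "[c]" "([c] @ cs) @ cs"]
      G.col_tensor[of "binv G.Q 1 ?l" "Id G.Q ?l" "[c] @ cs" cs] G.col_binv[of "[c]" 1 cs ?l]
    by (simp_all add: G.Q.ten_arr)
  have t: "q_m G\<oplus>G.pmu ?l \<in> Arr G.Q" "?S \<in> Arr G.Q" "qcod ?S = qdom (q_m G\<oplus>G.pmu ?l)"
    "length (c # cs) = qcod (q_m G\<oplus>G.pmu ?l)"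
    by (simp_all add: G.Q.ten_arr)
  show ?case
    using ev_comp[OF t(2,1,3,4)] G.col_comp[OF t(2,1,3,4)] 1 2 by (simp add: G.pmu_Suc tmul_def)
qed

lemma ev_peta: "ev cs (G.peta (length cs)) = leta cs \<and> col G cs (G.peta (length cs)) = []"
proof (induction cs)
  case Nil thus ?case using ev_Id[of "[]" 0] by simp
next
  case (Cons c cs)
  thus ?case
    using ev_tensor[of "q_u G" "G.peta (length cs)" "[c]" cs] G.col_tensor[of "q_u G" "G.peta (length cs)" "[c]" cs]
      ev_u[of c] col_u[of c] by (simp add: G.pmu_Suc)
qed

lemma ev_prho: "x \<in> carrier G ==> ev cs (G.prho (length cs) x) = lrho cs x \<and> col G cs (G.prho (length cs) x) = cs"
proof (induction cs)
  case Nil thus ?case using ev_Id[of "[]" 0] by simp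
next
  case (Cons c cs)
  have "mkq (replicate 1 (Suc 0)) [x] [] \<in> Arr G.Q" using Cons.prems by (intro G.mkq_Arr) (simp add: qok_def)
  thus ?case
    using Cons ev_tensor[of "mkq (replicate 1 (Suc 0)) [x] []" "G.prho (length cs) x" "[c]" cs]
      G.col_tensor[of "mkq (replicate 1 (Suc 0)) [x] []" "G.prho (length cs) x" "[c]" cs]
      ev_label[of x c] G.col_label[of x c] by (simp add: G.pmu_Suc)
qed

lemma tot_concat: "tot M (concat css) = tot (tot M) css"
  by (induction css) auto

lemma split_length: "length xs = a + b ==> \<exists>ys zs. xs = ys @ zs \<and> length ys = a \<and> length zs = b"
  by (rule exI[of _ "take a xs"], rule exI[of _ "drop a xs"]) simp

text \<open>Pulling back replaces a generator by its version on powers, and evaluating that gives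
  the structure of a tensor product of the given monoids. Both operations respect composition and
  tensor products, so generators suffice.\<close>

lemma ev_pull_back:
  assumes "f \<in> Arr G.Q" "length css = qcod f"
  shows "col G (concat css) (G.pull_back (map length css) f) = concat (col G css f) \<and>
    ev (concat css) (G.pull_back (map length css) f) = gmonoids.ev C G (tot M) lmu leta lrho css f"
proof -
  interpret L: gmonoids C G "tot M" lmu leta lrho by (rule gmonoids_list)
  show ?thesis using assms
  proof (induction f arbitrary: css rule: G.Q_induct)
    case (Id n)
    thus ?case by (simp add: length_concat G.tot_id tot_concat)
  next
    case (comp f g)
    have css: "length css = qcod g" using comp by simp
    have l: "map length (col G css g) = col G (map length css) g" using comp css by (simp add: G.map_col)
    have len: "length (concat css) = qcod (G.pull_back (map length css) g)" using comp css by (simp add: length_concat)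
    have IH: "col G (concat css) (G.pull_back (map length css) g) = concat (col G css g)"
      "ev (concat css) (G.pull_back (map length css) g) = L.ev css g"
      "col G (concat (col G css g)) (G.pull_back (col G (map length css) g) f) = concat (col G (col G css g) f)"
      "ev (concat (col G css g)) (G.pull_back (col G (map length css) g) f) = L.ev (col G css g) f"
      using comp.IH(1)[of "col G css g"] comp.IH(2)[of css] comp.hyps css l by simp_all
    have t: "G.pull_back (map length css) g \<in> Arr G.Q" "G.pull_back (col G (map length css) g) f \<in> Arr G.Q"
      "qcod (G.pull_back (col G (map length css) g) f) = qdom (G.pull_back (map length css) g)"
      using comp.hyps css by simp_all
    show ?case
      using comp.hyps css IH ev_comp[OF t(2,1,3) len] G.col_comp[OF t(2,1,3) len]
        L.ev_comp[of f g css] G.pow.ev_comp[of f g "map length css"] G.col_comp[of f g css] by simp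
  next
    case (tensor f g)
    then obtain as bs where css: "css = as @ bs" "length as = qcod f" "length bs = qcod g"
      using split_length[of css "qcod f" "qcod g"] by auto
    have t: "G.pull_back (map length as) f \<in> Arr G.Q" "G.pull_back (map length bs) g \<in> Arr G.Q"
      "length (concat as) = qcod (G.pull_back (map length as) f)" "length (concat bs) = qcod (G.pull_back (map length bs) g)"
      using tensor.hyps css by (simp_all add: length_concat)
    show ?case
      using tensor.hyps css tensor.IH(1)[of as] tensor.IH(2)[of bs] ev_tensor[OF t] G.col_tensor[OF t]
        L.ev_tensor[of f g as bs] G.col_tensor[of f g as bs] G.pow.ev_tensor[of f g "map length as" "map length bs"] by simp
  next
    case mult
    then obtain cs where css: "css = [cs]" by (auto simp: length_Suc_conv)
    show ?case using ev_pmu[of cs] by (simp add: css G.pow.ev_m L.ev_m col_m)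
  next
    case unit
    then obtain cs where css: "css = [cs]" by (auto simp: length_Suc_conv)
    show ?case using ev_peta[of cs] by (simp add: css G.pow.ev_u L.ev_u col_u)
  next
    case (swap s)
    then obtain ds cs where css: "css = [ds, cs]" by (auto simp: length_Suc_conv numeral_2_eq_2)
    show ?case
      using ev_crossing[of ds cs s] G.pow.ev_swap[of "length ds" "length cs" s] L.ev_swap[of ds cs s] G.col_swap[of ds cs s]
      by (simp add: css)
  next
    case (label x)
    then obtain cs where css: "css = [cs]" by (auto simp: length_Suc_conv)
    show ?case
      using label ev_prho[of x cs] G.pow.ev_label[of x "length cs"] L.ev_label[of x cs] G.col_label[of x cs] by (simp add: css)
  qed
qed

end

context group
begin

text \<open>The tensor product of the powers \<open>k\<close> and \<open>l\<close> is the power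
  \<open>k + l\<close>, so evaluation at powers of powers is evaluation at powers. This gives
  compatibility of the law with composites in the second leg.\<close>

lemma pull_back_concat:
  assumes "f \<in> Arr Q" "length kss = qcod f"
  shows "pull_back (concat kss) (pull_back (map length kss) f) = pull_back (map sum_list kss) f"
proof -
  have "pull_back (concat kss) (pull_back (map length kss) f) =
      gmonoids.ev Q G (tot (\<lambda>l. l)) pow.lmu pow.leta pow.lrho kss f"
    using pow.ev_pull_back[OF assms] by simp
  also have "... = pull_back (map sum_list kss) f"
    using assms pow.gmonoids_list by (intro pow.ev_reindex) (simp_all add: tot_id pow_lmu)
  finally show ?thesis .
qed

lemma col_pull_back:
  fixes kss :: "nat list list"
  assumes "f \<in> Arr Q" "length kss = qcod f"
  shows "col G (concat kss) (pull_back (map length kss) f) = concat (col G kss f)"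
  using pow.ev_pull_back[OF assms] by simp

text \<open>The first power is the generating monoid, so every generator is its own
  pull-back.\<close>

lemma pull_back_ones: "f \<in> Arr Q ==> pull_back (replicate (qcod f) 1) f = f"
proof (induction f rule: Q_induct)
  case (comp f g)
  have "col G (replicate (qcod g) (1::nat)) g = replicate (qdom g) 1"
    using comp.hyps by (auto simp: Arr_Q col_mkq src_replicate qok_def)
  thus ?case using comp pow.ev_comp[of f g "replicate (qcod g) 1"] by simp
next
  case (tensor f g)
  thus ?case using pow.ev_tensor[of f g "replicate (qcod f) 1" "replicate (qcod g) 1"] by (simp add: replicate_add)
next
  case (swap s)
  thus ?case using pow.ev_swap[of 1 1 s] crossing_Q_1[of s] by (simp add: numeral_2_eq_2)
next
  case (label x)
  thus ?case using pow.ev_label[of x 1] pmu_1 by simp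
qed (use pow.ev_m[of 1] pow.ev_u[of 1] pmu_1 in \<open>simp_all add: tot_def sum_list_replicate\<close>)

text \<open>Invertible arrows commute with the order-preserving maps; a general arrow does not, since the
  multiplication is not commutative.\<close>

lemma pull_back_iso:
  assumes "iok n xs w" "length ls = n"
  shows "dq ls\<star>pull_back ls (qiso n xs w) = qiso n xs w\<star>dq (col G ls (qiso n xs w))"
proof -
  have "\<forall>ls. length ls = qcod (qiso n xs w) \<longrightarrow>
      dq ls\<star>pull_back ls (qiso n xs w) = qiso n xs w\<star>dq (col G ls (qiso n xs w))"
    using assms(1)
  proof (induction rule: qiso_induct)
    case (Id n)
    thus ?case by (auto simp: tot_id)
  next
    case (comp f g)
    show ?case
    proof (intro allI impI)
      fix ls :: "nat list" assume "length ls = qcod (g\<star>f)"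
      hence ls: "length ls = qcod g" using comp.hyps by simp
      have 1: "dq ls\<star>pull_back ls g = g\<star>dq (col G ls g)"
        and 2: "dq (col G ls g)\<star>pull_back (col G ls g) f = f\<star>dq (col G (col G ls g) f)"
        using comp ls by simp_all
      have "dq ls\<star>pull_back ls (g\<star>f) = (dq ls\<star>pull_back ls g)\<star>pull_back (col G ls g) f"
        using comp.hyps ls pow.ev_comp[of f g ls] by (simp add: Q.comp_assoc)
      also have "... = g\<star>(dq (col G ls g)\<star>pull_back (col G ls g) f)"
        unfolding 1 using comp.hyps ls by (simp add: Q.comp_assoc)
      also have "... = (g\<star>f)\<star>dq (col G ls (g\<star>f))"
        unfolding 2 using comp.hyps ls by (simp add: Q.comp_assoc col_comp)
      finally show "dq ls\<star>pull_back ls (g\<star>f) = (g\<star>f)\<star>dq (col G ls (g\<star>f))" .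
    qed
  next
    case (tensor f g)
    show ?case
    proof (intro allI impI)
      fix ls :: "nat list" assume "length ls = qcod (f\<oplus>g)"
      then obtain as bs where ls: "ls = as @ bs" "length as = qcod f" "length bs = qcod g"
        using pow.split_length[of ls "qcod f" "qcod g"] tensor.hyps by auto
      have IH: "dq as\<star>pull_back as f = f\<star>dq (col G as f)" "dq bs\<star>pull_back bs g = g\<star>dq (col G bs g)"
        using tensor ls by auto
      thus "dq ls\<star>pull_back ls (f\<oplus>g) = (f\<oplus>g)\<star>dq (col G ls (f\<oplus>g))"
        unfolding ls(1) dq_append pow.ev_tensor[OF tensor.hyps ls(2,3)] col_tensor[OF tensor.hyps ls(2,3)]
        using tensor.hyps ls(2,3) by (simp only: Q.ten_comp dq_Arr pull_back_arr Q_simps mkq_simps length_col)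
    qed
  next
    case (swap s)
    have sw: "dq [d, c]\<star>crossing Q s c d = crossing Q s 1 1\<star>dq [c, d]" for c d
      using Q.crossing_nat[of "dq [c]" "dq [d]" s] dq_append[of "[d]" "[c]"] dq_append[of "[c]" "[d]"] by simp
    show ?case
    proof (intro allI impI)
      fix ls :: "nat list" assume "length ls = qcod (qiso 2 (ones 2) [(1, s)])"
      then obtain d c where ls: "ls = [d, c]" by (auto simp: length_Suc_conv numeral_2_eq_2)
      show "dq ls\<star>pull_back ls (qiso 2 (ones 2) [(1, s)]) = qiso 2 (ones 2) [(1, s)]\<star>dq (col G ls (qiso 2 (ones 2) [(1, s)]))"
        unfolding ls col_swap pow.ev_swap using sw[of d c] by (simp only: crossing_Q_1)
    qed
  next
    case (label x)
    have "dq [k]\<star>prho k x = qiso 1 [x] []\<star>dq [k]" for k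
    proof -
      have "prho k x = qiso k (replicate k x) []"
      proof (induction k)
        case 0 thus ?case by (simp add: Q_Id)
      next
        case (Suc k)
        have "set (replicate k x) \<subseteq> carrier G" using label by auto
        thus ?case using Suc label qiso_labels[of "replicate k x" x] by (simp add: pmu_Suc)
      qed
      thus ?thesis using label_dq[OF label, of k] by simp
    qed
    thus ?case
      using label col_label[of x "c :: nat" for c] pow.ev_label[of x] by (auto simp: length_Suc_conv)
  qed
  thus ?thesis using assms(2) by (simp add: sum_list_replicate)
qed

end

section \<open>Construction of the distributive law\<close>

section \<open>The distributive law\<close>

context category
begin

lemma iso_Hom: "is_iso C k ==> \<exists>k'. inverse_arrows C k k' \<and> k \<in> Arr C \<and> k' \<in> Arr C \<and> Dom C k' = Cod C k \<and> Cod C k' = Dom C k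
    \<and> k' o k = Id C (Dom C k) \<and> k o k' = Id C (Cod C k)"
  by (auto simp: is_iso_def inverse_arrows_def Hom_def)

lemma is_iso_Comp: "is_iso C f ==> is_iso C g ==> Cod C f = Dom C g ==> is_iso C (g o f)"
  unfolding is_iso_def using inverse_arrows_Comp by blast

lemma is_iso_Id: "X \<in> Obj C ==> is_iso C (Id C X)"
  using inverse_arrows_Id by (auto simp: is_iso_def)

lemma span_class_iso:
  assumes "is_iso C k" "a \<in> Arr C" "b \<in> Arr C" "Dom C a = Dom C b" "Cod C k = Dom C a"
  shows "span_class C (a o k) (b o k) = span_class C a b"
proof -
  obtain k' where k: "inverse_arrows C k k'" "k \<in> Arr C" "k' \<in> Arr C" "Dom C k' = Cod C k" "Cod C k' = Dom C k" "k o k' = Id C (Cod C k)"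
    using iso_Hom[OF assms(1)] by blast
  have ik': "is_iso C k'" using inverse_arrows_sym[OF k(1)] by (auto simp: is_iso_def)
  show ?thesis
  proof (intro equalityI subrelI)
    fix x y assume "(x, y) \<in> span_class C (a o k) (b o k)"
    then obtain l where l: "x = (a o k) o l" "y = (b o k) o l" "is_iso C l" "Cod C l = Dom C (a o k)"
      by (auto simp: span_class_def)
    have la: "l \<in> Arr C" "Cod C l = Dom C k" using iso_Hom[OF l(3)] l(4) k assms by (auto simp: comp_dom)
    have "x = a o k o l" "y = b o k o l" using l la k assms by (simp_all add: comp_assoc)
    moreover have "is_iso C (k o l)" "Cod C (k o l) = Dom C a"
      using is_iso_Comp[OF l(3) assms(1)] la k assms by (simp_all add: comp_cod)
    ultimately show "(x, y) \<in> span_class C a b" by (auto simp: span_class_def)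
  next
    fix x y assume "(x, y) \<in> span_class C a b"
    then obtain l where l: "x = a o l" "y = b o l" "is_iso C l" "Cod C l = Dom C a" by (auto simp: span_class_def)
    have la: "l \<in> Arr C" using iso_Hom[OF l(3)] by blast
    have "k o k' o l = l" using comp_assoc[of l k' k] k l(4) la assms(5) comp_id_left[of l "Cod C k"] by simp
    hence "x = (a o k) o k' o l" "y = (b o k) o k' o l"
      using l la k assms by (simp_all add: comp_assoc comp_arr comp_dom comp_cod)
    moreover have "is_iso C (k' o l)" "Cod C (k' o l) = Dom C (a o k)"
      using is_iso_Comp[OF l(3) ik'] la k l(4) assms by (simp_all add: comp_cod comp_dom)
    ultimately show "(x, y) \<in> span_class C (a o k) (b o k)" by (auto simp: span_class_def)
  qed
qed

lemma span_class_self: "a \<in> Arr C ==> b \<in> Arr C ==> Dom C a = Dom C b ==> (a, b) \<in> span_class C a b"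
  using is_iso_Id[OF Dom_Obj, of a] Id_Hom[OF Dom_Obj, of a]
  by (auto simp: span_class_def Hom_def comp_id_right intro!: exI[of _ "Id C (Dom C a)"])

lemma cospan_class_self: "f \<in> Arr C ==> g \<in> Arr C ==> Cod C f = Cod C g ==> (f, g) \<in> cospan_class C f g"
  using is_iso_Id[OF Cod_Obj, of f] Id_Hom[OF Cod_Obj, of f]
  by (auto simp: cospan_class_def Hom_def comp_id_left intro!: exI[of _ "Id C (Cod C f)"])

end

context group
begin

lemma dq_append_Arr [simp]: "mkq (ks @ ks') (ones (sum_list ks + sum_list ks')) [] \<in> Arr Q"
  using dq_Arr[of "ks @ ks'"] by simp

text \<open>Factorisation as an isomorphism followed by an order-preserving map. Uniqueness, shown
  in \<open>decomp_unique\<close>, allows the law to be defined through it.\<close>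

definition decomp :: "'a qmor => nat list => 'a qmor => 'a qmor => bool" where
  "decomp g ks c c' \<longleftrightarrow> inverse_arrows Q c c' \<and> qcod c = sum_list ks \<and> g = dq ks\<star>c"

lemma inverse_arrows_Q: "inverse_arrows Q c c' \<longleftrightarrow> c \<in> Arr Q \<and> c' \<in> Arr Q \<and> qdom c' = qcod c \<and> qcod c' = qdom c \<and>
    c'\<star>c = Id Q (qdom c) \<and> c\<star>c' = Id Q (qcod c)"
  by (auto simp: inverse_arrows_def Hom_def)

lemma decompD:
  assumes "decomp g ks c c'"
  shows "inverse_arrows Q c c'" "c \<in> Arr Q" "c' \<in> Arr Q" "qdom c' = sum_list ks" "qcod c = sum_list ks" "qdom c = qdom g"
    "qcod c' = qdom g" "qcod g = length ks" "g \<in> Arr Q" "g = dq ks\<star>c" "c'\<star>c = Id Q (qdom g)" "c\<star>c' = Id Q (sum_list ks)"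
proof -
  show i: "inverse_arrows Q c c'" and g: "g = dq ks\<star>c" and s: "qcod c = sum_list ks"
    using assms by (auto simp: decomp_def)
  show "c \<in> Arr Q" "c' \<in> Arr Q" "qdom c' = sum_list ks" using i s by (auto simp: inverse_arrows_Q)
  thus "g \<in> Arr Q" "qcod g = length ks" using g s by simp_all
  show "qdom c = qdom g" using g s \<open>c \<in> Arr Q\<close> by simp
  thus "qcod c' = qdom g" "c'\<star>c = Id Q (qdom g)" "c\<star>c' = Id Q (sum_list ks)"
    using i s by (auto simp: inverse_arrows_Q)
qed

lemma decomp_exists:
  assumes "g \<in> Arr Q" obtains ks c c' where "decomp g ks c c'"
proof -
  obtain ks xs w where g: "g = mkq ks xs w" "qok G ks xs w" using assms by (auto simp: Arr_Q)
  have q: "iok (sum_list ks) xs w" using g by (simp add: qok_def sum_list_replicate)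
  show ?thesis using that[of ks "qiso (sum_list ks) xs w"] mkq_decomp[OF g(2)] inverse_qiso[OF q] g(1) by (simp add: decomp_def sum_list_replicate)
qed

lemma decomp_unique:
  assumes "decomp g ks c c'" "decomp g ks2 d d'"
  shows "ks = ks2 \<and> c = d \<and> c' = d'"
proof -
  have ic: "is_iso Q c" and id: "is_iso Q d" using assms by (auto simp: decomp_def is_iso_def)
  obtain n xs w where c: "c = qiso n xs w" "iok n xs w" using Q_iso_cases[OF ic] .
  obtain m ys v where d: "d = qiso m ys v" "iok m ys v" using Q_iso_cases[OF id] .
  have n: "n = sum_list ks" "m = sum_list ks2" using assms c d by (auto simp: decomp_def)
  have q: "qok G ks xs w" "qok G ks2 ys v" using c d n by (auto simp: qok_def sum_list_replicate)
  have "mkq ks xs w = mkq ks2 ys v"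
    using assms mkq_decomp[OF q(1)] mkq_decomp[OF q(2)] c d n by (simp add: decomp_def)
  from mkq_inject[OF this q] have e: "ks = ks2" "xs = ys" "braid_eq (sum_list ks) w v" by auto
  hence "c = d" using c d n by (simp add: mkq_eqI sum_list_replicate)
  thus ?thesis using e Q.inverse_arrows_unique assms by (auto simp: decomp_def)
qed

text \<open>The isomorphism in the second leg is moved to the other side as \<open>c'\<close>. Then
  \<open>f\<close> acts on the powers \<open>ks\<close>, and the colours at its source are the fibre
  sizes of the new left leg. The resulting square need not commute in \<open>Q\<close>.\<close>

definition law0 :: "'a qmor => 'a qmor => ('a qmor \<times> 'a qmor) set" where
  "law0 f g = (case SOME (ks, c, c'). decomp g ks c c' of (ks, c, c') =>
     span_class Q (dq (col G ks f)) (c'\<star>pull_back ks f))"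

text \<open>\<open>law0\<close> is constant on the members of a cospan class, so the union is a
  single value.\<close>

definition law :: "('a qmor \<times> 'a qmor) set => ('a qmor \<times> 'a qmor) set" where
  "law S = (\<Union>(f, g)\<in>S. law0 f g)"

lemma law0_eq:
  assumes "decomp g ks c c'"
  shows "law0 f g = span_class Q (dq (col G ks f)) (c'\<star>pull_back ks f)"
proof -
  have "(SOME (ks, c, c'). decomp g ks c c') = (ks, c, c')"
    by (rule some_equality) (use assms decomp_unique in auto)
  thus ?thesis by (simp add: law0_def)
qed

lemma pull_back_inverse:
  assumes "inverse_arrows Q c c'" "length ls = qcod c"
  shows "dq ls\<star>pull_back ls c = c\<star>dq (col G ls c)"
    "inverse_arrows Q (pull_back ls c) (pull_back (col G ls c) c')"
proof -
  have "is_iso Q c" using assms by (auto simp: is_iso_def)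
  then obtain n xs w where c: "c = qiso n xs w" "iok n xs w" by (rule Q_iso_cases)
  show "dq ls\<star>pull_back ls c = c\<star>dq (col G ls c)" using pull_back_iso[OF c(2), of ls] assms c by simp
  show "inverse_arrows Q (pull_back ls c) (pull_back (col G ls c) c')" using pow.ev_inverse[OF assms] .
qed

text \<open>Composition with \<open>k\<close> changes the fibre sizes \<open>ks\<close> into
  \<open>ls\<close>, the same sizes carried along \<open>k\<close>. The pull-back of
  \<open>k\<close> enters once with \<open>f\<close> and once, inverted, with \<open>g\<close>, and
  cancels.\<close>

lemma law0_iso:
  assumes fg: "f \<in> Arr Q" "g \<in> Arr Q" "qcod f = qcod g" and k: "inverse_arrows Q k k'" "qdom k = qcod f"
  shows "law0 (k\<star>f) (k\<star>g) = law0 f g"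
proof -
  obtain ks c c' where d: "decomp g ks c c'" using decomp_exists fg by blast
  note D = decompD[OF d]
  have ka: "k \<in> Arr Q" "k' \<in> Arr Q" "qdom k' = qcod k" "qcod k' = qdom k" using k by (auto simp: inverse_arrows_Q)
  define ls where "ls = col G ks k'"
  have lk: "length ks = qcod k'" using D fg k ka by simp
  have ls: "length ls = qcod k" "col G ls k = ks"
    using ka lk col_inverse[OF k(1), of ks] D fg k by (auto simp: ls_def)
  have i: "inverse_arrows Q (pull_back ls k) (pull_back ks k')" "dq ls\<star>pull_back ls k = k\<star>dq ks"
    using pull_back_inverse[OF k(1) ls(1)] ls by simp_all
  have p: "pull_back ls k \<in> Arr Q" "qdom (pull_back ls k) = sum_list ks" "qcod (pull_back ls k) = sum_list ls"
    "pull_back ks k' \<in> Arr Q" "qdom (pull_back ks k') = sum_list ls" "qcod (pull_back ks k') = sum_list ks"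
    using ls ka lk by (auto simp: ls_def)
  have "k\<star>g = (k\<star>dq ks)\<star>c"
    unfolding D(10) using D ka fg k by (simp add: Q.comp_assoc del: D(10))
  also have "... = dq ls\<star>(pull_back ls k\<star>c)"
    unfolding i(2)[symmetric] using D(1-9) p by (simp add: Q.comp_assoc)
  finally have kg: "k\<star>g = dq ls\<star>(pull_back ls k\<star>c)" .
  have "inverse_arrows Q (pull_back ls k\<star>c) (c'\<star>pull_back ks k')"
    using Q.inverse_arrows_Comp[OF D(1) i(1)] D p by simp
  hence "decomp (k\<star>g) ls (pull_back ls k\<star>c) (c'\<star>pull_back ks k')"
    using kg D(1-9) p by (simp add: decomp_def)
  hence "law0 (k\<star>f) (k\<star>g) = span_class Q (dq (col G ls (k\<star>f))) ((c'\<star>pull_back ks k')\<star>pull_back ls (k\<star>f))"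
    by (rule law0_eq)
  also have "col G ls (k\<star>f) = col G ks f" using col_comp[of f k ls] fg ka k ls by simp
  also have "(c'\<star>pull_back ks k')\<star>pull_back ls (k\<star>f) = c'\<star>(pull_back ks k'\<star>pull_back ls k)\<star>pull_back ks f"
    using pow.ev_comp[of f k ls] fg ka k ls p D(1-9) by (simp add: Q.comp_assoc)
  also have "pull_back ks k'\<star>pull_back ls k = Id Q (sum_list ks)" using i(1) p by (simp add: inverse_arrows_Q)
  also have "Id Q (sum_list ks)\<star>pull_back ks f = pull_back ks f" using D(1-9) fg by simp
  finally show ?thesis using law0_eq[OF d] by simp
qed

lemma law_cospan:
  assumes "f \<in> Arr Q" "g \<in> Arr Q" "qcod f = qcod g"
  shows "law (cospan_class Q f g) = law0 f g"
proof -
  have "law0 (k\<star>f) (k\<star>g) = law0 f g" if "is_iso Q k" "Dom Q k = Cod Q f" for k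
    using law0_iso[OF assms] that by (auto simp: is_iso_def)
  hence eq: "(case p of (f', g') => law0 f' g') = law0 f g" if "p \<in> cospan_class Q f g" for p
    using that by (cases p) (auto simp: cospan_class_def)
  have "law (cospan_class Q f g) = (\<Union>p\<in>cospan_class Q f g. law0 f g)"
    unfolding law_def by (rule SUP_cong) (simp_all add: eq)
  moreover have "cospan_class Q f g \<noteq> {}" using Q.cospan_class_self[of f g] assms by auto
  ultimately show ?thesis by simp
qed

lemma law_comp_right:
  assumes d: "decomp g ks c c'" and f: "f \<in> Arr Q" "qcod f = length ks"
    and ab: "(a, b) \<in> law0 f g"
  obtains k k' where "inverse_arrows Q k k'" "qcod k = sum_list (col G ks f)" "k \<in> Arr Q" "is_iso Q k" "qdom a = qdom k" "qdom b = qdom k" "a \<in> Arr Q" "b \<in> Arr Q"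
    "a = dq (col G ks f)\<star>k" "b = (c'\<star>pull_back ks f)\<star>k" "qcod a = qdom f" "qcod b = qdom g"
proof -
  note D = decompD[OF d]
  obtain k where k: "is_iso Q k" "qcod k = sum_list (col G ks f)" "a = dq (col G ks f)\<star>k" "b = (c'\<star>pull_back ks f)\<star>k"
    using ab unfolding law0_eq[OF d] by (auto simp: span_class_def)
  then obtain k' where k': "inverse_arrows Q k k'" "k \<in> Arr Q" by (auto simp: is_iso_def inverse_arrows_def)
  show ?thesis using that[of k k'] k k' D(1-9) f by simp
qed

text \<open>This is functoriality of \<open>pull_back\<close>. The isomorphism \<open>k\<close> by
  which \<open>a2\<close> and \<open>b2\<close> differ from the standard representatives cancels
  against its inverse in the next step.\<close>

lemma law_mult_left:
  assumes f: "f1 \<in> Arr Q" "f2 \<in> Arr Q" "qcod f1 = qdom f2" and g: "g \<in> Arr Q" "qcod f2 = qcod g"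
    and ab2: "(a2, b2) \<in> law0 f2 g" and ab1: "(a1, b1) \<in> law0 f1 a2"
  shows "law0 (f2\<star>f1) g = span_class Q a1 (b2\<star>b1)"
proof -
  obtain ks c c' where d: "decomp g ks c c'" using decomp_exists g by blast
  note D = decompD[OF d]
  have l: "qcod f2 = length ks" using D g by simp
  obtain k k' where k: "inverse_arrows Q k k'" "qcod k = sum_list (col G ks f2)" "k \<in> Arr Q"
    "a2 = dq (col G ks f2)\<star>k" "b2 = (c'\<star>pull_back ks f2)\<star>k"
    using law_comp_right[OF d f(2) l ab2] by metis
  have d2: "decomp a2 (col G ks f2) k k'" using k by (simp add: decomp_def)
  have l2: "qcod f1 = length (col G ks f2)" using f l by simp
  obtain k2 where k2: "is_iso Q k2" "qcod k2 = sum_list (col G (col G ks f2) f1)" "k2 \<in> Arr Q"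
    "a1 = dq (col G (col G ks f2) f1)\<star>k2" "b1 = (k'\<star>pull_back (col G ks f2) f1)\<star>k2"
    using law_comp_right[OF d2 f(1) l2 ab1] by metis
  have kk: "k' \<in> Arr Q" "qdom k' = qcod k" "qcod k' = qdom k" "k\<star>k' = Id Q (qcod k)" using k(1) by (auto simp: inverse_arrows_Q)
  have "b2\<star>b1 = c'\<star>pull_back ks f2\<star>(k\<star>k')\<star>pull_back (col G ks f2) f1\<star>k2"
    unfolding k(5) k2(5) using D(1-9) f l l2 k(2,3) k2(2,3) kk(1-3) by (simp add: Q.comp_assoc)
  also have "... = (c'\<star>pull_back ks (f2\<star>f1))\<star>k2"
    using pow.ev_comp[of f1 f2 ks] D(1-9) f l l2 k(2,3) k2(2,3) kk by (simp add: Q.comp_assoc)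
  finally have b: "b2\<star>b1 = (c'\<star>pull_back ks (f2\<star>f1))\<star>k2" .
  have co: "col G (col G ks f2) f1 = col G ks (f2\<star>f1)" using f l col_comp[of f1 f2 ks] by simp
  show ?thesis
    unfolding law0_eq[OF d] b k2(4) co
    by (rule Q.span_class_iso[symmetric]) (use k2 co D(1-9) f l in simp_all)
qed

text \<open>Here \<open>f\<close> is pulled back along \<open>g2\<close> and the result along
  \<open>g1\<close>. Grouping the fibre sizes by \<open>kss\<close> turns this into one pull-back
  along the fibre sizes of the composite.\<close>

lemma law_mult_right:
  assumes g: "g1 \<in> Arr Q" "g2 \<in> Arr Q" "qcod g1 = qdom g2" and f: "f \<in> Arr Q" "qcod f = qcod g2"
    and ab2: "(a2, b2) \<in> law0 f g2" and ab1: "(a1, b1) \<in> law0 b2 g1"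
  shows "law0 f (g2\<star>g1) = span_class Q (a2\<star>a1) b1"
proof -
  obtain ks2 c2 c2' where d2: "decomp g2 ks2 c2 c2'" using decomp_exists g by blast
  obtain ks1 c1 c1' where d1: "decomp g1 ks1 c1 c1'" using decomp_exists g by blast
  note D1 = decompD[OF d1] and D2 = decompD[OF d2]
  have l: "qcod f = length ks2" using D2 f by simp
  obtain k k' where k: "inverse_arrows Q k k'" "qcod k = sum_list (col G ks2 f)" "k \<in> Arr Q" "is_iso Q k"
    "a2 = dq (col G ks2 f)\<star>k" "b2 = (c2'\<star>pull_back ks2 f)\<star>k" "b2 \<in> Arr Q" "qcod b2 = qdom g2"
    using law_comp_right[OF d2 f(1) l ab2] by metis
  have lb: "qcod b2 = length ks1" using k(8) g D1 by simp
  obtain k2 where k2: "is_iso Q k2" "qcod k2 = sum_list (col G ks1 b2)" "k2 \<in> Arr Q"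
    "a1 = dq (col G ks1 b2)\<star>k2" "b1 = (c1'\<star>pull_back ks1 b2)\<star>k2"
    using law_comp_right[OF d1 k(7) lb ab1] by metis
  \<comment> \<open>\<open>ls\<close> lists the fibre sizes of \<open>g1\<close> in the order in
    which the inner isomorphism \<open>c2\<close> delivers them to \<open>dq ks2\<close>.\<close>
  define ls where "ls = col G ks1 c2'"
  have lk: "length ks1 = qcod c2'" using D1 D2 g by simp
  have ls: "length ls = sum_list ks2" "length ls = qcod c2" "col G ls c2 = ks1"
    using D2 lk col_inverse[OF D2(1), of ks1] by (auto simp: ls_def)
  obtain kss where kss: "ls = concat kss" "ks2 = map length kss"
    using ex_chunks[of ks2 ls] ls(1) by metis
  have lkss: "length kss = qcod f" using l kss(2) by simp
  define e where "e = concat (col G kss f)"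
  have e: "col G ls (pull_back ks2 f) = e" using col_pull_back[OF f(1) lkss] kss by (simp add: e_def)
  have i: "inverse_arrows Q (pull_back ls c2) (pull_back ks1 c2')" "dq ls\<star>pull_back ls c2 = c2\<star>dq ks1"
    using pull_back_inverse[OF D2(1) ls(2)] ls by simp_all
  have p: "pull_back ls c2 \<in> Arr Q" "qdom (pull_back ls c2) = sum_list ks1" "qcod (pull_back ls c2) = sum_list ls"
    "pull_back ks1 c2' \<in> Arr Q" "qdom (pull_back ks1 c2') = sum_list ls" "qcod (pull_back ks1 c2') = sum_list ks1"
    using ls lk D2(1-9) by (auto simp: ls_def)
  have q: "pull_back ks2 f \<in> Arr Q" "qdom (pull_back ks2 f) = sum_list (col G ks2 f)" "qcod (pull_back ks2 f) = sum_list ks2"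
    using f l by simp_all
  have "g2\<star>g1 = dq ks2\<star>(c2\<star>dq ks1)\<star>c1"
    unfolding D1(10) D2(10) using D1(1-9) D2(1-9) g by (simp add: Q.comp_assoc)
  also have "... = (dq ks2\<star>dq ls)\<star>(pull_back ls c2\<star>c1)"
    unfolding i(2)[symmetric] using D1(1-9) D2(1-9) g p ls by (simp add: Q.comp_assoc)
  also have "dq ks2\<star>dq ls = dq (map sum_list kss)" unfolding kss by (rule dq_comp)
  finally have gg: "g2\<star>g1 = dq (map sum_list kss)\<star>(pull_back ls c2\<star>c1)" .
  have "inverse_arrows Q (pull_back ls c2\<star>c1) (c1'\<star>pull_back ks1 c2')"
    using Q.inverse_arrows_Comp[OF D1(1) i(1)] D1 p by simp
  moreover have "qcod (pull_back ls c2\<star>c1) = sum_list (map sum_list kss)"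
    using p D1(1-9) kss by (simp add: sum_list_concat)
  ultimately have d: "decomp (g2\<star>g1) (map sum_list kss) (pull_back ls c2\<star>c1) (c1'\<star>pull_back ks1 c2')"
    using gg by (simp add: decomp_def)
  have pe: "pull_back (map sum_list kss) f = pull_back ls (pull_back ks2 f)" unfolding kss using pull_back_concat[OF f(1) lkss] by simp
  have m: "col G (map sum_list kss) f = map sum_list (col G kss f)" "col G ks2 f = map length (col G kss f)"
    using map_col[OF f(1) lkss, of sum_list] map_col[OF f(1) lkss, of length] kss(2) by simp_all
  have L: "law0 f (g2\<star>g1) = span_class Q (dq (map sum_list (col G kss f))) ((c1'\<star>pull_back ks1 c2')\<star>pull_back ls (pull_back ks2 f))"
    unfolding law0_eq[OF d] pe m(1) ..
  have le: "length e = sum_list (col G ks2 f)" using e q ls by (metis length_col)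
  have cb: "col G ks1 b2 = col G e k"
    using col_comp[of k "c2'\<star>pull_back ks2 f" ks1] col_comp[of "pull_back ks2 f" c2' ks1] k(2,3,6) D2(1-9) q lk e
    by (simp add: ls_def)
  have pb: "pull_back ks1 b2 = pull_back ks1 c2'\<star>pull_back ls (pull_back ks2 f)\<star>pull_back e k"
  proof -
    have "pull_back ks1 b2 = pull_back ks1 (c2'\<star>pull_back ks2 f)\<star>pull_back e k"
      unfolding k(6) using pow.ev_comp[of k "c2'\<star>pull_back ks2 f" ks1] col_comp[of "pull_back ks2 f" c2' ks1] k(2,3) D2(1-9) q lk e
      by (simp add: ls_def)
    also have "pull_back ks1 (c2'\<star>pull_back ks2 f) = pull_back ks1 c2'\<star>pull_back ls (pull_back ks2 f)"
      using pow.ev_comp[of "pull_back ks2 f" c2' ks1] D2(1-9) q lk by (simp add: ls_def)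
    finally show ?thesis using p q ls e le k(2,3) by (simp add: Q.comp_assoc)
  qed
  have lek: "length e = qcod k" using le k(2) by simp
  have ik: "inverse_arrows Q (pull_back e k) (pull_back (col G e k) k')" "dq e\<star>pull_back e k = k\<star>dq (col G e k)"
    using pull_back_inverse[OF k(1) lek] by simp_all
  have pk: "pull_back e k \<in> Arr Q" "qdom (pull_back e k) = sum_list (col G e k)" "qcod (pull_back e k) = sum_list e"
    using k(3) lek by simp_all
  \<comment> \<open>The isomorphism from the given representatives of the span to the standard ones.
    The ambiguity \<open>k\<close> of the first step sits below a pull-back in the second, so it
    occurs here pulled back along \<open>e\<close>.\<close>
  let ?K = "pull_back e k\<star>k2"
  have K: "is_iso Q ?K" using ik(1) k2 cb pk by (intro Q.is_iso_Comp) (auto simp: is_iso_def)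
  have K': "qcod ?K = sum_list e" using pk k2 cb by simp
  have "a2\<star>a1 = dq (col G ks2 f)\<star>(k\<star>dq (col G e k))\<star>k2"
    unfolding k(5) k2(4) cb using k(2,3) k2(2,3) cb lek by (simp add: Q.comp_assoc)
  also have "... = (dq (col G ks2 f)\<star>dq e)\<star>?K"
    unfolding ik(2)[symmetric] using pk k2(2,3) cb le by (simp add: Q.comp_assoc)
  also have "dq (col G ks2 f)\<star>dq e = dq (map sum_list (col G kss f))" unfolding m(2) e_def by (rule dq_comp)
  finally have A: "a2\<star>a1 = dq (map sum_list (col G kss f))\<star>?K" .
  have B: "b1 = ((c1'\<star>pull_back ks1 c2')\<star>pull_back ls (pull_back ks2 f))\<star>?K"
    unfolding k2(5) pb using D1(1-9) p q ls e le pk k2(2,3) cb by (simp add: Q.comp_assoc)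
  show ?thesis
    unfolding L A B
    by (rule Q.span_class_iso[symmetric]) (use K K' D1(1-9) p q ls e in \<open>simp_all add: e_def sum_list_concat\<close>)
qed

lemma law_tensor:
  assumes f: "f \<in> Arr Q" "g \<in> Arr Q" "qcod f = qcod g" and f': "f' \<in> Arr Q" "g' \<in> Arr Q" "qcod f' = qcod g'"
    and ab: "(a, b) \<in> law0 f g" and ab': "(a', b') \<in> law0 f' g'"
  shows "law0 (f\<oplus>f') (g\<oplus>g') = span_class Q (a\<oplus>a') (b\<oplus>b')"
proof -
  obtain ks c i where d: "decomp g ks c i" using decomp_exists f by blast
  obtain ks' c' i' where d': "decomp g' ks' c' i'" using decomp_exists f' by blast
  note D = decompD[OF d] and D' = decompD[OF d']
  have l: "qcod f = length ks" "qcod f' = length ks'" using D D' f f' by simp_all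
  obtain k where k: "qcod k = sum_list (col G ks f)" "k \<in> Arr Q" "is_iso Q k"
    "a = dq (col G ks f)\<star>k" "b = (i\<star>pull_back ks f)\<star>k"
    using law_comp_right[OF d f(1) l(1) ab] by metis
  obtain k' where k': "qcod k' = sum_list (col G ks' f')" "k' \<in> Arr Q" "is_iso Q k'"
    "a' = dq (col G ks' f')\<star>k'" "b' = (i'\<star>pull_back ks' f')\<star>k'"
    using law_comp_right[OF d' f'(1) l(2) ab'] by metis
  have "g\<oplus>g' = dq (ks @ ks')\<star>(c\<oplus>c')"
    unfolding D(10) D'(10) dq_append using D(1-9) D'(1-9) by (simp add: Q.ten_comp)
  hence dd: "decomp (g\<oplus>g') (ks @ ks') (c\<oplus>c') (i\<oplus>i')"
    using Q.inverse_ten[OF D(1) D'(1)] D(1-9) D'(1-9) by (simp add: decomp_def)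
  have t: "col G (ks @ ks') (f\<oplus>f') = col G ks f @ col G ks' f'"
    "pull_back (ks @ ks') (f\<oplus>f') = pull_back ks f\<oplus>pull_back ks' f'"
    using col_tensor[of f f' ks ks'] pow.ev_tensor[of f f' ks ks'] f f' l by simp_all
  have ik: "is_iso Q (k\<oplus>k')" using k(3) k'(3) Q.inverse_ten unfolding is_iso_def by blast
  have A: "a\<oplus>a' = dq (col G ks f @ col G ks' f')\<star>(k\<oplus>k')"
    unfolding dq_append k(4) k'(4) using k(1,2) k'(1,2) by (simp add: Q.ten_comp)
  have B: "b\<oplus>b' = ((i\<oplus>i')\<star>(pull_back ks f\<oplus>pull_back ks' f'))\<star>(k\<oplus>k')"
    unfolding k(5) k'(5) using k(1,2) k'(1,2) D(1-9) D'(1-9) f f' l by (simp add: Q.ten_comp)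
  show ?thesis
    unfolding law0_eq[OF dd] t A B
    by (rule Q.span_class_iso[symmetric]) (use ik k(1,2) k'(1,2) D(1-9) D'(1-9) f f' l in simp_all)
qed

lemma decomp_iso: "inverse_arrows Q c c' ==> decomp c (replicate (qcod c) (Suc 0)) c c'"
  unfolding decomp_def dq_Id by (simp add: inverse_arrows_Q sum_list_replicate)

text \<open>An isomorphism has singleton fibres only, and pulling back at first powers changes
  nothing.\<close>

lemma law0_iso_right:
  assumes "inverse_arrows Q c c'" "f \<in> Arr Q" "qcod f = qcod c"
  shows "law0 f c = span_class Q (Id Q (qdom f)) (c'\<star>f)"
proof -
  have "col G (replicate (qcod f) (Suc 0)) f = replicate (qdom f) (Suc 0)"
    using assms by (auto simp: Arr_Q col_mkq src_replicate qok_def)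
  thus ?thesis
    using law0_eq[OF decomp_iso[OF assms(1)], of f] pull_back_ones[OF assms(2)] assms dq_Id[of "qdom f"] by simp
qed

lemma law0_Id_left:
  assumes "g \<in> Arr Q"
  shows "law0 (Id Q (qcod g)) g = span_class Q g (Id Q (qdom g))"
proof -
  obtain ks c c' where d: "decomp g ks c c'" using decomp_exists assms by blast
  note D = decompD[OF d]
  have "law0 (Id Q (qcod g)) g = span_class Q (dq ks) c'"
    unfolding law0_eq[OF d] using D(1-9) by (simp add: tot_id)
  also have "... = span_class Q (dq ks\<star>c) (c'\<star>c)"
    using D(1-9) by (intro Q.span_class_iso[symmetric]) (auto simp: is_iso_def)
  finally show ?thesis unfolding D(10)[symmetric] D(11) .
qed

lemma cospans_Q: "(f, g) \<in> cospans Q \<longleftrightarrow> f \<in> Arr Q \<and> g \<in> Arr Q \<and> qcod f = qcod g"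
  by (simp add: cospans_def)

lemma law0_exists:
  assumes "f \<in> Arr Q" "g \<in> Arr Q" "qcod f = qcod g"
  obtains a b where "a \<in> Arr Q" "b \<in> Arr Q" "qdom a = qdom b" "qcod a = qdom f" "qcod b = qdom g" "law0 f g = span_class Q a b"
proof -
  obtain ks c c' where d: "decomp g ks c c'" using decomp_exists assms by blast
  show ?thesis using that[OF _ _ _ _ _ law0_eq[OF d, of f]] decompD(1-9)[OF d] assms by simp
qed

lemma law0_Arr:
  assumes "(a, b) \<in> law0 f g" "f \<in> Arr Q" "g \<in> Arr Q" "qcod f = qcod g"
  shows "a \<in> Arr Q" "b \<in> Arr Q" "qdom a = qdom b" "qcod a = qdom f" "qcod b = qdom g"
proof -
  obtain ks c c' where d: "decomp g ks c c'" using decomp_exists assms by blast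
  show "a \<in> Arr Q" "b \<in> Arr Q" "qdom a = qdom b" "qcod a = qdom f" "qcod b = qdom g"
    using law_comp_right[OF d assms(2) _ assms(1)] decompD[OF d] assms by metis+
qed

theorem distributive_law_law: "distributive_law Q law"
  unfolding distributive_law_def cospans_Q
proof (intro conjI allI impI ballI; (elim conjE)?)
  fix f g assume fg: "f \<in> Arr Q" "g \<in> Arr Q" "qcod f = qcod g"
  then obtain a b where "a \<in> Arr Q" "b \<in> Arr Q" "qdom a = qdom b" "qcod a = qdom f" "qcod b = qdom g" "law0 f g = span_class Q a b"
    using law0_exists by blast
  thus "\<exists>a b. (a, b) \<in> spans Q \<and> Cod Q a = Dom Q f \<and> Cod Q b = Dom Q g \<and> law (cospan_class Q f g) = span_class Q a b"
    using law_cospan[OF fg] by (auto simp: spans_def)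
next
  fix f assume f: "f \<in> Arr Q"
  show "law (cospan_class Q f (Id Q (Cod Q f))) = span_class Q (Id Q (Dom Q f)) f"
    using f law0_iso_right[of "Id Q (qcod f)" "Id Q (qcod f)" f] Q.inverse_arrows_Id[of "qcod f"] by (simp add: law_cospan)
  show "law (cospan_class Q (Id Q (Cod Q f)) f) = span_class Q f (Id Q (Dom Q f))"
    using f law0_Id_left[of f] by (simp add: law_cospan)
next
  fix f1 f2 g a1 b1 a2 b2
  assume h: "f1 \<in> Arr Q" "Cod Q f1 = Dom Q f2" "(a2, b2) \<in> law (cospan_class Q f2 g)" "(a1, b1) \<in> law (cospan_class Q f1 a2)"
    "f2 \<in> Arr Q" "g \<in> Arr Q" "qcod f2 = qcod g"
  have 2: "(a2, b2) \<in> law0 f2 g" using h by (simp add: law_cospan)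
  note t = law0_Arr[OF 2 h(5,6,7)]
  hence "(a1, b1) \<in> law0 f1 a2" using h by (simp add: law_cospan)
  from law_mult_left[OF h(1,5) _ h(6,7) 2 this] show "law (cospan_class Q (f2\<star>f1) g) = span_class Q a1 (b2\<star>b1)"
    using h by (simp add: law_cospan)
next
  fix f g1 g2 a1 b1 a2 b2
  assume h: "g1 \<in> Arr Q" "Cod Q g1 = Dom Q g2" "(a2, b2) \<in> law (cospan_class Q f g2)" "(a1, b1) \<in> law (cospan_class Q b2 g1)"
    "f \<in> Arr Q" "g2 \<in> Arr Q" "qcod f = qcod g2"
  have 2: "(a2, b2) \<in> law0 f g2" using h by (simp add: law_cospan)
  note t = law0_Arr[OF 2 h(5,6,7)]
  hence "(a1, b1) \<in> law0 b2 g1" using h by (simp add: law_cospan)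
  from law_mult_right[OF h(1,6) _ h(5,7) 2 this] show "law (cospan_class Q f (g2\<star>g1)) = span_class Q (a2\<star>a1) b1"
    using h by (simp add: law_cospan)
next
  fix f g f' g' a b a' b'
  assume h: "(a, b) \<in> law (cospan_class Q f g)" "(a', b') \<in> law (cospan_class Q f' g')"
    "f \<in> Arr Q" "f' \<in> Arr Q" "g \<in> Arr Q" "qcod f = qcod g" "g' \<in> Arr Q" "qcod f' = qcod g'"
  hence "(a, b) \<in> law0 f g" "(a', b') \<in> law0 f' g'" by (simp_all add: law_cospan)
  from law_tensor[OF h(3,5,6,4,7,8) this]
  show "law (cospan_class Q (f\<oplus>f') (g\<oplus>g')) = span_class Q (a\<oplus>a') (b\<oplus>b')"
    using h by (simp add: law_cospan)
qed

end

context group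
begin

lemma lbraid_carrier: "g \<in> carrier (lbraid_group G n) \<longleftrightarrow>
    (\<exists>xs w. iok n xs w \<and> g = (lab xs, braid_class n w))"
proof
  assume g: "g \<in> carrier (lbraid_group G n)"
  obtain xs where "length xs = n" "set xs \<subseteq> carrier G" "fst g = lab xs"
    using g lab_cases[of "fst g" n "carrier G"] by (auto simp: lbraid_group_def)
  moreover obtain w where "w \<in> bwords n" "snd g = braid_class n w"
    using g by (auto simp: lbraid_group_def carrier_braid_group)
  ultimately show "\<exists>xs w. iok n xs w \<and> g = (lab xs, braid_class n w)"
    by (cases g) (auto simp: qok_qiso)
qed (use lab_PiE[of _ "carrier G"] in \<open>auto simp: qok_qiso lbraid_group_def carrier_braid_group\<close>)

lemma q_of_braid_qiso: "iok n xs w ==> q_of_braid n (lab xs, braid_class n w) = qiso n xs w"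
  by (simp add: q_of_braid_mkq qok_qiso)

lemma q_of_braid_mult:
  assumes "g \<in> carrier (lbraid_group G n)" "h \<in> carrier (lbraid_group G n)"
  shows "q_of_braid n (g \<otimes>\<^bsub>lbraid_group G n\<^esub> h) = q_of_braid n g\<star>q_of_braid n h"
proof -
  obtain ys v where g: "iok n ys v" "g = (lab ys, braid_class n v)" using assms lbraid_carrier by auto
  obtain xs w where h: "iok n xs w" "h = (lab xs, braid_class n w)" using assms lbraid_carrier by auto
  have p: "pull n (D_id n) g = g"
    using pull_mkq[of ys "replicate n (Suc 0)" v] g by (simp add: qok_qiso D_id_dmap sum_list_replicate lcable_ones)
  have "qbr (q_of_braid n g\<star>q_of_braid n h) = g \<otimes>\<^bsub>lbraid_group G n\<^esub> h"
    using p by (simp add: Q_prob_def q_of_braid_def)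
  moreover have "q_of_braid n g\<star>q_of_braid n h = q_of_braid n (qbr (q_of_braid n g\<star>q_of_braid n h))"
    using q_of_braid_qiso g h qiso_comp[OF h(1) g(1)] by (simp add: mkq_def q_of_braid_def D_id_dmap sum_list_replicate)
  ultimately show ?thesis by simp
qed

lemma q_of_braid_one: "q_of_braid n \<one>\<^bsub>lbraid_group G n\<^esub> = Id Q n"
  using q_of_braid_mkq[of "ones n" n "[]"] by (simp add: lbraid_group_def braid_group_def lab_replicate Q_Id)

lemma q_of_braid_inverse:
  assumes "g \<in> carrier (lbraid_group G n)"
  shows "inverse_arrows Q (q_of_braid n g) (q_of_braid n (inv\<^bsub>lbraid_group G n\<^esub> g))"
proof -
  let ?B = "lbraid_group G n"
  obtain xs w where g: "iok n xs w" "g = (lab xs, braid_class n w)" using assms lbraid_carrier by auto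
  let ?ys = "map (m_inv G) (permute w xs)"
  let ?h = "(lab ?ys, braid_class n (inverse_word w))"
  have "set (permute w xs) \<subseteq> carrier G" using set_permute[of w xs] g by (simp add: qok_qiso)
  hence q: "iok n ?ys (inverse_word w)" using g by (auto simp: qok_qiso)
  hence hc: "?h \<in> carrier ?B" using lbraid_carrier by blast
  have gi: "q_of_braid n g = qiso n xs w" "q_of_braid n ?h = qiso n ?ys (inverse_word w)"
    using g q_of_braid_qiso[OF g(1)] q_of_braid_qiso[OF q] by simp_all
  have i: "inverse_arrows Q (q_of_braid n g) (q_of_braid n ?h)" unfolding gi by (rule inverse_qiso[OF g(1)])
  have inj: "x = y" if "q_of_braid n x = q_of_braid n y" for x y :: "'a lbraid"
    using that by (simp add: q_of_braid_def)
  have dc: "qdom (q_of_braid n x) = n" "qcod (q_of_braid n x) = n" for x :: "'a lbraid" by (simp_all add: q_of_braid_def)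
  have ar: "q_of_braid n x \<in> Arr Q" if x: "x \<in> carrier ?B" for x
  proof -
    obtain zs u where "iok n zs u" "x = (lab zs, braid_class n u)" using x lbraid_carrier by auto
    thus ?thesis using q_of_braid_qiso mkq_Arr by metis
  qed
  \<comment> \<open>The inverse is a definite description in the monoid of labelled braids. Its
    uniqueness comes from that of inverse arrows in \<open>Q\<close>, since
    \<open>q_of_braid n\<close> is injective and multiplicative.\<close>
  have "inv\<^bsub>?B\<^esub> g = ?h"
    unfolding m_inv_def[of ?B]
  proof (rule the_equality)
    note i' = i[unfolded inverse_arrows_Q dc]
    have "q_of_braid n (g \<otimes>\<^bsub>?B\<^esub> ?h) = q_of_braid n \<one>\<^bsub>?B\<^esub>" "q_of_braid n (?h \<otimes>\<^bsub>?B\<^esub> g) = q_of_braid n \<one>\<^bsub>?B\<^esub>"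
      unfolding q_of_braid_mult[OF assms hc] q_of_braid_mult[OF hc assms] q_of_braid_one using i' by blast+
    hence "g \<otimes>\<^bsub>?B\<^esub> ?h = \<one>\<^bsub>?B\<^esub>" "?h \<otimes>\<^bsub>?B\<^esub> g = \<one>\<^bsub>?B\<^esub>" using inj by blast+
    thus "?h \<in> carrier ?B \<and> g \<otimes>\<^bsub>?B\<^esub> ?h = \<one>\<^bsub>?B\<^esub> \<and> ?h \<otimes>\<^bsub>?B\<^esub> g = \<one>\<^bsub>?B\<^esub>" using hc by simp
    fix z assume z: "z \<in> carrier ?B \<and> g \<otimes>\<^bsub>?B\<^esub> z = \<one>\<^bsub>?B\<^esub> \<and> z \<otimes>\<^bsub>?B\<^esub> g = \<one>\<^bsub>?B\<^esub>"
    hence "inverse_arrows Q (q_of_braid n g) (q_of_braid n z)"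
      using q_of_braid_mult[of g n z] q_of_braid_mult[of z n g] assms ar[of g] ar[of z]
      by (simp add: inverse_arrows_Q dc q_of_braid_one)
    thus "z = ?h" using Q.inverse_arrows_unique[OF _ i] inj by blast
  qed
  thus ?thesis using i by simp
qed

lemma span_iso_swap:
  assumes "inverse_arrows Q k k'" "a \<in> Arr Q" "qdom a = qcod k" "b \<in> Arr Q" "qdom b = qcod k"
  shows "span_class Q (a\<star>k) (b\<star>k) = span_class Q a b"
  using assms by (intro Q.span_class_iso) (auto simp: is_iso_def)

lemma q_sigma_braid: "q_sigma G = braid Q 1 1"
  using crossing_Q_1[of True] by (simp add: q_sigma_qiso crossing_def)

lemma dq_decomp: "decomp (dq ks) ks (Id Q (sum_list ks)) (Id Q (sum_list ks))"
  using Q.inverse_arrows_Id[of "sum_list ks"] by (simp add: decomp_def)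

lemma law0_dq: "f \<in> Arr Q ==> qcod f = length ks ==> law0 f (dq ks) = span_class Q (dq (col G ks f)) (pull_back ks f)"
  using law0_eq[OF dq_decomp, of f ks] by simp

theorem bimonoid_law_law: "bimonoid_law G law"
  unfolding bimonoid_law_def
proof (intro conjI allI ballI)
  show "distributive_law Q law" by (rule distributive_law_law)
next
  fix n g h assume g: "g \<in> carrier (lbraid_group G n)" and h: "h \<in> carrier (lbraid_group G n)"
  let ?g = "q_of_braid n g" and ?h = "q_of_braid n h"
  let ?g' = "q_of_braid n (inv\<^bsub>lbraid_group G n\<^esub> g)" and ?h' = "q_of_braid n (inv\<^bsub>lbraid_group G n\<^esub> h)"
  note ig = q_of_braid_inverse[OF g] and ih = q_of_braid_inverse[OF h]
  have dc: "qdom (q_of_braid n x) = n" "qcod (q_of_braid n x) = n" for x :: "'a lbraid" by (simp_all add: q_of_braid_def)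
  have "law (cospan_class Q ?g ?h) = span_class Q (Id Q n) (?h'\<star>?g)"
    using law0_iso_right[OF ih, of ?g] ig ih by (simp add: law_cospan inverse_arrows_Q dc)
  also have "... = span_class Q (?g'\<star>?g) (?h'\<star>?g)" using ig by (simp add: inverse_arrows_Q dc)
  also have "... = span_class Q ?g' ?h'" using span_iso_swap[OF ig, of ?g' ?h'] ig ih by (simp add: inverse_arrows_Q dc)
  finally show "law (cospan_class Q ?g ?h) = span_class Q ?g' ?h'" .
next
  fix n m \<phi> g assume p: "\<phi> \<in> D_hom n m" and g: "g \<in> carrier (lbraid_group G m)"
  obtain ks where ks: "\<phi> = dmap ks" "n = sum_list ks" "m = length ks" using D_hom_cases[OF p] .
  obtain xs w where gx: "iok m xs w" "g = (lab xs, braid_class m w)" using g lbraid_carrier by auto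
  let ?ls = "permute w ks" and ?c = "qiso m xs w" and ?d = "qiso n (rep ks xs) (lcable ks w)"
  have x: "length xs = length ks" "set xs \<subseteq> carrier G" "w \<in> bwords (length ks)" using gx ks by (auto simp: qok_qiso)
  have qd: "iok n (rep ks xs) (lcable ks w)"
    using x set_rep[of ks xs] bwords_lcable[of w ks] ks by (auto simp: qok_qiso)
  have sl: "sum_list ?ls = n" "length ?ls = m" using x ks by simp_all
  have lsA [simp]: "mkq ?ls (ones n) [] \<in> Arr Q" using dq_Arr[of ?ls] sl by simp
  have psh: "push n m g \<phi> = dmap ?ls" using push_dmap[of w ks "lab xs"] x ks gx by simp
  have pll: "pull n \<phi> g = (lab (rep ks xs), braid_class n (lcable ks w))" using pull_mkq[of xs ks w] x ks gx by simp
  have e1: "q_of_map G n m (push n m g \<phi>) = dq ?ls" unfolding psh using q_of_map_mkq[of G ?ls] sl by simp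
  have e2: "q_of_map G n m \<phi> = dq ks" using q_of_map_mkq[of G ks] ks by simp
  have e3: "q_of_braid m g = ?c" using q_of_braid_qiso gx by simp
  have e4: "q_of_braid n (pull n \<phi> g) = ?d" unfolding pll by (rule q_of_braid_qiso[OF qd])
  have "?c\<star>dq ks = mkq ?ls (rep ks xs) (lcable ks w)"
    using Q_comp_left[of ks "ones n" "[]" xs w] gx(1) ks x set_rep[of ks xs]
    by (simp add: qok_dq src_def map2_ones)
  also have "... = dq ?ls\<star>?d" using mkq_decomp[of ?ls "rep ks xs" "lcable ks w"] qd sl
    by (simp add: qok_def sum_list_replicate)
  \<comment> \<open>The commuting square behind both clauses: a braid after a map is a map after the
    cabled braid.\<close>
  finally have sq: "?c\<star>dq ks = dq ?ls\<star>?d" .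
  obtain c' where ic: "inverse_arrows Q ?c c'" using inverse_qiso[OF gx(1)] by blast
  obtain d' where id: "inverse_arrows Q ?d d'" using inverse_qiso[OF qd] by blast
  note cc = ic[unfolded inverse_arrows_Q] and dd = id[unfolded inverse_arrows_Q]
  have t: "qdom ?c = m" "qcod ?c = m" "qdom ?d = n" "qcod ?d = n" by (simp_all add: sum_list_replicate)
  have cls: "c'\<star>dq ?ls\<star>?d = dq ks"
    unfolding sq[symmetric] using cc t ks Q.comp_assoc[of "dq ks" ?c c'] by simp
  have l1: "law0 (dq ?ls) ?c = span_class Q (Id Q n) (c'\<star>dq ?ls)"
    using law0_iso_right[OF ic, of "dq ?ls"] t sl by simp
  also have "... = span_class Q (Id Q n\<star>?d) ((c'\<star>dq ?ls)\<star>?d)"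
    using span_iso_swap[OF id, of "Id Q n" "c'\<star>dq ?ls"] cc t sl by simp
  also have "... = span_class Q ?d (dq ks)"
    using cls cc dd t sl Q.comp_assoc[of ?d "dq ?ls" c'] by simp
  finally show "law (cospan_class Q (q_of_map G n m (push n m g \<phi>)) (q_of_braid m g)) =
      span_class Q (q_of_braid n (pull n \<phi> g)) (q_of_map G n m \<phi>)"
    unfolding e1 e2 e3 e4 using cc t sl by (simp add: law_cospan)
  have co: "col G ?ls ?c = ks" using col_qiso[OF gx(1), of ?ls] x ks by (simp add: permute_inverse')
  have lsc: "length ?ls = qcod ?c" using t sl by simp
  have pb: "dq ?ls\<star>pull_back ?ls ?c = ?c\<star>dq ks" "inverse_arrows Q (pull_back ?ls ?c) (pull_back ks c')"
    using pull_back_inverse[OF ic lsc] co by simp_all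
  \<comment> \<open>The same arrow has two factorisations, and uniqueness identifies the pull-back
    of the braid with its cabling.\<close>
  have "decomp (?c\<star>dq ks) ?ls (pull_back ?ls ?c) (pull_back ks c')"
    using pb cc lsc unfolding decomp_def by simp
  moreover have "decomp (?c\<star>dq ks) ?ls ?d d'" using sq id t sl by (simp add: decomp_def)
  ultimately have "pull_back ?ls ?c = ?d" using decomp_unique by blast
  hence "law0 ?c (dq ?ls) = span_class Q (dq ks) ?d" using law0_dq[of ?c ?ls] cc lsc co by simp
  thus "law (cospan_class Q (q_of_braid m g) (q_of_map G n m (push n m g \<phi>))) =
      span_class Q (q_of_map G n m \<phi>) (q_of_braid n (pull n \<phi> g))"
    unfolding e1 e2 e3 e4 using cc t sl by (simp add: law_cospan)
next
  let ?s = "Id Q 1\<oplus>braid Q 1 1\<oplus>Id Q 1" and ?s' = "Id Q 1\<oplus>binv Q 1 1\<oplus>Id Q 1"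
  let ?mm = "q_m G\<oplus>q_m G"
  have i: "inverse_arrows Q ?s ?s'"
    by (intro Q.inverse_ten Q.inverse_braid Q.inverse_arrows_Id) auto
  have s: "?s \<in> Arr Q" "?s' \<in> Arr Q" "qdom ?s = 4" "qcod ?s = 4" "qdom ?s' = 4" "qcod ?s' = 4" "?s'\<star>?s = Id Q (Suc (Suc (Suc (Suc 0))))"
    using i by (simp_all add: inverse_arrows_Q)
  \<comment> \<open>The product on the second power contains the inverse crossing; reparametrising
    the span by \<open>?s\<close> removes it there and puts the crossing into the left leg.\<close>
  have "pmu 2 = ?mm\<star>?s'" using pmu_add[of 1 1] by (simp only: pmu_1 tmul_def one_add_one)
  hence "law0 (q_m G) (q_m G) = span_class Q ?mm (?mm\<star>?s')"
    using law0_dq[of "q_m G" "[2]"] dq_append[of "[2]" "[2]"] pow.col_m[of "2::nat"] pow.ev_m[of 2] by (simp add: q_m_dq)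
  also have "... = span_class Q (?mm\<star>?s) ((?mm\<star>?s')\<star>?s)"
    using span_iso_swap[OF i, of ?mm "?mm\<star>?s'"] s by simp
  also have "(?mm\<star>?s')\<star>?s = ?mm" using s by (simp add: Q.comp_assoc)
  finally show "law (cospan_class Q (q_m G) (q_m G)) = span_class Q (?mm\<star>q_sigma23 G) ?mm"
    by (simp add: law_cospan q_sigma23_def q_sigma_braid)
next
  show "law (cospan_class Q (q_u G) (q_u G)) = span_class Q (Id Q 0) (Id Q 0)"
    using law0_dq[of "q_u G" "[0]"] pow.col_u[of "0::nat"] pow.ev_u[of 0] by (simp add: law_cospan q_u_dq Q_Id)
  show "law (cospan_class Q (q_m G) (q_u G)) = span_class Q (q_u G\<oplus>q_u G) (Id Q 0)"
    using law0_dq[of "q_m G" "[0]"] dq_append[of "[0]" "[0]"] pow.col_m[of "0::nat"] pow.ev_m[of 0] by (simp add: law_cospan q_u_dq)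
  have "peta 2 = q_u G\<oplus>q_u G" using peta_add[of 1 1] by (simp only: pmu_1 one_add_one)
  thus "law (cospan_class Q (q_u G) (q_m G)) = span_class Q (Id Q 0) (q_u G\<oplus>q_u G)"
    using law0_dq[of "q_u G" "[2]"] pow.col_u[of "2::nat"] pow.ev_u[of 2] by (simp add: law_cospan q_m_dq Q_Id)
qed

end

section \<open>Composition and generators in the category of spans\<close>

section \<open>The category of spans\<close>

text \<open>\<open>bimonoid_prob\<close> takes a law by choice, so all arguments about spans have to
  work from its specification.\<close>

locale bialgebra_law = group G for G :: "('g, 'x) monoid_scheme" (structure) +
  fixes L :: "('g qmor \<times> 'g qmor) set => ('g qmor \<times> 'g qmor) set"
  assumes bimonoid_law: "bimonoid_law G L"
begin

abbreviation "T \<equiv> span_prob Q L"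
abbreviation T_Comp (infixr "o\<^sub>T" 70) where "g o\<^sub>T f \<equiv> g o\<^bsub>T\<^esub> f"
abbreviation T_tarr (infixr "**\<^sub>T" 75) where "f**\<^sub>Tg \<equiv> f**\<^bsub>T\<^esub>g"
abbreviation "sp \<equiv> span_class Q"
abbreviation "LL f g \<equiv> L (cospan_class Q f g)"
abbreviation "J f \<equiv> sp (Id Q (qdom f)) f"
abbreviation "J' f \<equiv> sp f (Id Q (qdom f))"

lemma distributive: "distributive_law Q L"
  using bimonoid_law by (simp add: bimonoid_law_def)

lemma LL_ex:
  assumes "f \<in> Arr Q" "g \<in> Arr Q" "qcod f = qcod g"
  obtains a b where "(a, b) \<in> LL f g"
proof -
  obtain a b where "(a, b) \<in> spans Q" "LL f g = sp a b"
    using distributive[unfolded distributive_law_def, THEN conjunct1, rule_format, of f g] assms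
    by (auto simp: cospans_def)
  thus ?thesis using that Q.span_class_self[of a b] by (auto simp: spans_def)
qed

lemma sp_mem: "(x, y) \<in> sp a b ==> a \<in> Arr Q ==> b \<in> Arr Q ==> qdom a = qdom b ==>
    x \<in> Arr Q \<and> y \<in> Arr Q \<and> qdom x = qdom y \<and> qcod x = qcod a \<and> qcod y = qcod b \<and> sp x y = sp a b"
proof -
  assume xy: "(x, y) \<in> sp a b" and a: "a \<in> Arr Q" "b \<in> Arr Q" "qdom a = qdom b"
  then obtain k where k: "x = a\<star>k" "y = b\<star>k" "is_iso Q k" "qcod k = qdom a"
    by (auto simp: span_class_def)
  hence "k \<in> Arr Q" using Q.iso_Hom by blast
  thus ?thesis using k a Q.span_class_iso[OF k(3), of a b] by simp
qed

lemma LL_mem: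
  assumes ab: "(a, b) \<in> LL f g" and f: "f \<in> Arr Q" "g \<in> Arr Q" "qcod f = qcod g"
  shows "a \<in> Arr Q" "b \<in> Arr Q" "qdom a = qdom b" "qcod a = qdom f" "qcod b = qdom g" "LL f g = sp a b"
proof -
  obtain a' b' where "(a', b') \<in> spans Q" "LL f g = sp a' b'" "qcod a' = qdom f" "qcod b' = qdom g"
    using distributive[unfolded distributive_law_def, THEN conjunct1, rule_format, of f g] f
    by (auto simp: cospans_def)
  thus "a \<in> Arr Q" "b \<in> Arr Q" "qdom a = qdom b" "qcod a = qdom f" "qcod b = qdom g" "LL f g = sp a b"
    using sp_mem[of a b a' b'] ab by (simp_all add: spans_def)
qed

lemma LL_Id_right: "f \<in> Arr Q ==> LL f (Id Q (qcod f)) = sp (Id Q (qdom f)) f"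
  and LL_Id_left: "g \<in> Arr Q ==> LL (Id Q (qcod g)) g = sp g (Id Q (qdom g))"
  using distributive unfolding distributive_law_def by auto

lemma LL_comp_left:
  "f1 \<in> Arr Q ==> f2 \<in> Arr Q ==> qcod f1 = qdom f2 ==> g \<in> Arr Q ==> qcod f2 = qcod g ==>
   (a2, b2) \<in> LL f2 g ==> (a1, b1) \<in> LL f1 a2 ==> LL (f2\<star>f1) g = sp a1 (b2\<star>b1)"
  using distributive[unfolded distributive_law_def, THEN conjunct2, THEN conjunct2, THEN conjunct2, THEN conjunct1]
  by (simp add: cospans_def)

lemma LL_comp_right:
  "g1 \<in> Arr Q ==> g2 \<in> Arr Q ==> qcod g1 = qdom g2 ==> f \<in> Arr Q ==> qcod f = qcod g2 ==>
   (a2, b2) \<in> LL f g2 ==> (a1, b1) \<in> LL b2 g1 ==> LL f (g2\<star>g1) = sp (a2\<star>a1) b1"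
  using distributive[unfolded distributive_law_def, THEN conjunct2, THEN conjunct2, THEN conjunct2, THEN conjunct2, THEN conjunct1]
  by (simp add: cospans_def)

lemma LL_tensor:
  "f \<in> Arr Q ==> g \<in> Arr Q ==> qcod f = qcod g ==> f' \<in> Arr Q ==> g' \<in> Arr Q ==> qcod f' = qcod g' ==>
   (a, b) \<in> LL f g ==> (a', b') \<in> LL f' g' ==> LL (f\<oplus>f') (g\<oplus>g') = sp (a\<oplus>a') (b\<oplus>b')"
  using distributive[unfolded distributive_law_def, THEN conjunct2, THEN conjunct2, THEN conjunct2, THEN conjunct2, THEN conjunct2]
  by (simp add: cospans_def)

text \<open>Cospans are spans in the opposite category, which transfers invariance under
  isomorphisms.\<close>

lemma cospan_class_opp: "cospan_class Q f g = span_class (opp Q) f g"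
  by (simp add: cospan_class_def span_class_def is_iso_def Q.inverse_arrows_opp)

lemma cospan_class_iso:
  assumes k: "inverse_arrows Q k k'" "f \<in> Arr Q" "g \<in> Arr Q" "qcod f = qcod g" "qdom k = qcod f"
  shows "cospan_class Q (k\<star>f) (k\<star>g) = cospan_class Q f g"
proof -
  interpret O: prob "opp Q" by (rule Q.prob_opp)
  have "is_iso (opp Q) k" using k(1) unfolding is_iso_def Q.inverse_arrows_opp by blast
  thus ?thesis using O.span_class_iso[of k f g] k by (simp add: cospan_class_opp)
qed

text \<open>Invariance of the class moves \<open>k\<close> to the other leg as its inverse, where
  the unit axiom applies.\<close>

lemma LL_iso_left:
  assumes k: "inverse_arrows Q k k'" "g \<in> Arr Q" "qcod g = qcod k"
  shows "LL k g = sp (k'\<star>g) (Id Q (qdom g))"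
proof -
  note kk = k(1)[unfolded inverse_arrows_Q]
  have "cospan_class Q k g = cospan_class Q (k'\<star>k) (k'\<star>g)"
    using cospan_class_iso[OF Q.inverse_arrows_sym[OF k(1)], of k g] kk k by simp
  thus ?thesis using LL_Id_left[of "k'\<star>g"] kk k by simp
qed

lemma LL_iso_right:
  assumes k: "inverse_arrows Q k k'" "f \<in> Arr Q" "qcod f = qcod k"
  shows "LL f k = sp (Id Q (qdom f)) (k'\<star>f)"
proof -
  note kk = k(1)[unfolded inverse_arrows_Q]
  have "cospan_class Q f k = cospan_class Q (k'\<star>f) (k'\<star>k)"
    using cospan_class_iso[OF Q.inverse_arrows_sym[OF k(1)], of f k] kk k by simp
  thus ?thesis using LL_Id_right[of "k'\<star>f"] kk k by simp
qed

lemma Arr_T: "t \<in> Arr T \<longleftrightarrow> (\<exists>a b. a \<in> Arr Q \<and> b \<in> Arr Q \<and> qdom a = qdom b \<and> t = sp a b)"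
  by (auto simp: span_prob_def spans_def)

lemma T_simps [simp]: "Obj T = UNIV" "tobj T = (+)" "tunit T = 0" "Id T n = sp (Id Q n) (Id Q n)"
  "braid T n m = sp (Id Q (n + m)) (braid Q n m)"
  by (simp_all add: span_prob_def)

lemma T_assoc: "assoc T n m k = Id T (n + m + k)" "lunit T n = Id T n" "runit T n = Id T n"
  by (simp_all add: span_prob_def Q_prob_def)

lemma T_dom [simp]: "a \<in> Arr Q ==> b \<in> Arr Q ==> qdom a = qdom b ==> Dom T (sp a b) = qcod a"
proof -
  assume a: "a \<in> Arr Q" "b \<in> Arr Q" "qdom a = qdom b"
  have "Dom T (sp a b) = (THE n. \<exists>(x, y)\<in>sp a b. qcod x = n)" by (simp add: span_prob_def)
  also have "... = qcod a"
  proof (rule the_equality)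
    show "\<exists>(x, y)\<in>sp a b. qcod x = qcod a" using Q.span_class_self[of a b] a by (intro bexI[of _ "(a, b)"]) simp_all
    fix n assume "\<exists>(x, y)\<in>sp a b. qcod x = n"
    thus "n = qcod a" using sp_mem[OF _ a] by blast
  qed
  finally show ?thesis .
qed

lemma T_cod [simp]: "a \<in> Arr Q ==> b \<in> Arr Q ==> qdom a = qdom b ==> Cod T (sp a b) = qcod b"
proof -
  assume a: "a \<in> Arr Q" "b \<in> Arr Q" "qdom a = qdom b"
  have "Cod T (sp a b) = (THE n. \<exists>(x, y)\<in>sp a b. qcod y = n)" by (simp add: span_prob_def)
  also have "... = qcod b"
  proof (rule the_equality)
    show "\<exists>(x, y)\<in>sp a b. qcod y = qcod b" using Q.span_class_self[of a b] a by (intro bexI[of _ "(a, b)"]) simp_all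
    fix n assume "\<exists>(x, y)\<in>sp a b. qcod y = n"
    thus "n = qcod b" using sp_mem[OF _ a] by blast
  qed
  finally show ?thesis .
qed

lemma sp_Arr [simp]: "a \<in> Arr Q ==> b \<in> Arr Q ==> qdom a = qdom b ==> sp a b \<in> Arr T"
  by (auto simp: Arr_T)

lemma T_tensor [simp]:
  assumes a: "a \<in> Arr Q" "b \<in> Arr Q" "qdom a = qdom b" and a': "a' \<in> Arr Q" "b' \<in> Arr Q" "qdom a' = qdom b'"
  shows "sp a b**\<^sub>Tsp a' b' = sp (a\<oplus>a') (b\<oplus>b')"
proof -
  have e: "sp (x\<oplus>x') (y\<oplus>y') = sp (a\<oplus>a') (b\<oplus>b')" if h: "(x, y) \<in> sp a b" "(x', y') \<in> sp a' b'" for x y x' y'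
  proof -
    obtain k where k: "x = a\<star>k" "y = b\<star>k" "is_iso Q k" "qcod k = qdom a" using h by (auto simp: span_class_def)
    obtain k' where k': "x' = a'\<star>k'" "y' = b'\<star>k'" "is_iso Q k'" "qcod k' = qdom a'" using h by (auto simp: span_class_def)
    have kk: "k \<in> Arr Q" "k' \<in> Arr Q" using k k' Q.iso_Hom by blast+
    have "is_iso Q (k\<oplus>k')" using k(3) k'(3) Q.inverse_ten unfolding is_iso_def by blast
    from Q.span_class_iso[OF this, of "a\<oplus>a'" "b\<oplus>b'"] show ?thesis
      using k k' kk a a' by (simp add: Q.ten_comp)
  qed
  have "sp a b**\<^sub>Tsp a' b' = (\<Union>(x, y)\<in>sp a b. \<Union>(x', y')\<in>sp a' b'. sp (a\<oplus>a') (b\<oplus>b'))"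
    unfolding span_prob_def bmcat.simps by (intro SUP_cong) (auto simp: e)
  thus ?thesis using Q.span_class_self[of a b] Q.span_class_self[of a' b'] a a' by auto
qed

text \<open>Composition is a union over representatives. Changing them by isomorphisms
  \<open>k\<close> and \<open>l\<close> changes the outcome of the law accordingly, by the
  multiplication axioms with one invertible factor; so all members of the union are the same
  class.\<close>

lemma T_comp:
  assumes 1: "a1 \<in> Arr Q" "b1 \<in> Arr Q" "qdom a1 = qdom b1" and 2: "a2 \<in> Arr Q" "b2 \<in> Arr Q" "qdom a2 = qdom b2"
    and c: "qcod b1 = qcod a2" and ab: "(a, b) \<in> LL b1 a2"
  shows "sp a2 b2 o\<^sub>T sp a1 b1 = sp (a1\<star>a) (b2\<star>b)"
proof -
  note t = LL_mem[OF ab 1(2) 2(1) c]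
  have e: "sp (x1\<star>x) (y2\<star>y) = sp (a1\<star>a) (b2\<star>b)"
    if h: "(x1, y1) \<in> sp a1 b1" "(x2, y2) \<in> sp a2 b2" "(x, y) \<in> LL y1 x2" for x1 y1 x2 y2 x y
  proof -
    obtain k where k: "x1 = a1\<star>k" "y1 = b1\<star>k" "is_iso Q k" "qcod k = qdom a1" using h by (auto simp: span_class_def)
    obtain l where l: "x2 = a2\<star>l" "y2 = b2\<star>l" "is_iso Q l" "qcod l = qdom a2" using h by (auto simp: span_class_def)
    obtain k' where ik: "inverse_arrows Q k k'" using k(3) unfolding is_iso_def by blast
    obtain l' where il: "inverse_arrows Q l l'" using l(3) unfolding is_iso_def by blast
    note kk = ik[unfolded inverse_arrows_Q] and ll = il[unfolded inverse_arrows_Q]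
    have "(k'\<star>a, Id Q (qdom a)) \<in> LL k a"
      using LL_iso_left[OF ik, of a] Q.span_class_self[of "k'\<star>a" "Id Q (qdom a)"] t kk k(4) 1 by simp
    from LL_comp_left[OF _ 1(2) _ 2(1) c ab this]
    have "LL y1 a2 = sp (k'\<star>a) b" using k kk 1 t by simp
    hence m1: "(k'\<star>a, b) \<in> LL y1 a2"
      using Q.span_class_self[of "k'\<star>a" b] t kk k(4) 1 by simp
    have m2: "(Id Q (qdom b), l'\<star>b) \<in> LL b l"
      using LL_iso_right[OF il, of b] Q.span_class_self[of "Id Q (qdom b)" "l'\<star>b"] t ll l(4) 2 by simp
    have "LL y1 x2 = sp ((k'\<star>a)\<star>Id Q (qdom b)) (l'\<star>b)"
      unfolding l(1) by (rule LL_comp_right[OF _ 2(1) _ _ _ m1 m2]) (use kk ll k l 1 c in simp_all)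
    hence "LL y1 x2 = sp (k'\<star>a) (l'\<star>b)" using t kk k(4) 1 by simp
    then obtain j where j: "x = (k'\<star>a)\<star>j" "y = (l'\<star>b)\<star>j" "is_iso Q j" "qcod j = qdom a"
      using h(3) t kk k(4) 1 by (auto simp: span_class_def)
    have ja: "j \<in> Arr Q" using j(3) Q.iso_Hom by blast
    have x: "x1\<star>x = (a1\<star>a)\<star>j"
    proof -
      have "k\<star>k'\<star>a\<star>j = a\<star>j"
        using Q.comp_assoc[of "a\<star>j" k' k] kk k(4) 1 t j(4) ja by simp
      thus ?thesis unfolding k(1) j(1) using kk k(4) 1 t j(4) ja by (simp add: Q.comp_assoc)
    qed
    have y: "y2\<star>y = (b2\<star>b)\<star>j"
    proof -
      have "l\<star>l'\<star>b\<star>j = b\<star>j"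
        using Q.comp_assoc[of "b\<star>j" l' l] ll l(4) 2 t j(4) ja by simp
      thus ?thesis unfolding l(2) j(2) using ll l(4) 2 t j(4) ja by (simp add: Q.comp_assoc)
    qed
    show ?thesis unfolding x y by (rule Q.span_class_iso[OF j(3)]) (use 1 2 t j in simp_all)
  qed
  have U: "sp a2 b2 o\<^sub>T sp a1 b1 = (\<Union>(x1, y1)\<in>sp a1 b1. \<Union>(x2, y2)\<in>sp a2 b2. \<Union>(x, y)\<in>LL y1 x2.
      sp (x1\<star>x) (y2\<star>y))" by (simp add: span_prob_def)
  have m: "(a1, b1) \<in> sp a1 b1" "(a2, b2) \<in> sp a2 b2" using Q.span_class_self[of a1 b1] Q.span_class_self[of a2 b2] 1 2 by simp_all
  show ?thesis unfolding U
  proof (intro equalityI subsetI)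
    fix z assume "z \<in> (\<Union>(x1, y1)\<in>sp a1 b1. \<Union>(x2, y2)\<in>sp a2 b2. \<Union>(x, y)\<in>LL y1 x2. sp (x1\<star>x) (y2\<star>y))"
    then obtain x1 y1 x2 y2 x y where "(x1, y1) \<in> sp a1 b1" "(x2, y2) \<in> sp a2 b2" "(x, y) \<in> LL y1 x2"
      "z \<in> sp (x1\<star>x) (y2\<star>y)" by blast
    thus "z \<in> sp (a1\<star>a) (b2\<star>b)" using e by blast
  qed (use m ab in blast)
qed

text \<open>Every span is a backward arrow followed by a forward one, so statements about spans
  reduce to the images of \<open>J\<close> and \<open>J'\<close>.\<close>

lemma T_comp_J: "a \<in> Arr Q ==> b \<in> Arr Q ==> qdom a = qdom b ==> sp a b = J b o\<^sub>T J' a"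
  using T_comp[of a "Id Q (qdom a)" "Id Q (qdom b)" b "Id Q (qdom a)" "Id Q (qdom a)"] LL_Id_left[of "Id Q (qdom a)"]
    Q.span_class_self[of "Id Q (qdom a)" "Id Q (qdom a)"] by simp

lemma J_comp: "f \<in> Arr Q ==> g \<in> Arr Q ==> qcod f = qdom g ==> J (g\<star>f) = J g o\<^sub>T J f"
  using T_comp[of "Id Q (qdom f)" f "Id Q (qdom g)" g "Id Q (qdom f)" f] LL_Id_right[of f]
    Q.span_class_self[of "Id Q (qdom f)" f] by simp

lemma J'_comp: "f \<in> Arr Q ==> g \<in> Arr Q ==> qcod f = qdom g ==> J' (g\<star>f) = J' f o\<^sub>T J' g"
  using T_comp[of g "Id Q (qdom g)" f "Id Q (qdom f)" f "Id Q (qdom f)"] LL_Id_left[of f]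
    Q.span_class_self[of f "Id Q (qdom f)"] by simp

lemma J'_J: "f \<in> Arr Q ==> g \<in> Arr Q ==> qcod f = qcod g ==> (a, b) \<in> LL f g ==> J' g o\<^sub>T J f = sp a b"
  using T_comp[of "Id Q (qdom f)" f g "Id Q (qdom g)" a b] LL_mem[of a b f g] by simp

lemma J_tensor: "f \<in> Arr Q ==> g \<in> Arr Q ==> J (f\<oplus>g) = J f**\<^sub>TJ g"
  and J'_tensor: "f \<in> Arr Q ==> g \<in> Arr Q ==> J' (f\<oplus>g) = J' f**\<^sub>TJ' g"
  by (simp_all add: Q.ten_id)

text \<open>The two spans differ by a reparametrisation of the middle object. Invertible arrows thus
  occur both as forward and as backward arrows.\<close>

lemma J'_inverse: "inverse_arrows Q k k' ==> J' k = J k'"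
  using span_iso_swap[of k k' "Id Q (qcod k)" k'] by (simp add: inverse_arrows_Q)

end

section \<open>Powers of an object as a strict braided category\<close>

section \<open>Strictification of the powers of an object\<close>

context braided_monoidal_category
begin

lemma ten_arr' [simp]: "f \<in> Arr B ==> g \<in> Arr B ==> f**g \<in> Arr B"
  and ten_dom' [simp]: "f \<in> Arr B ==> g \<in> Arr B ==> Dom B (f**g) = Dom B f \<odot> Dom B g"
  and ten_cod' [simp]: "f \<in> Arr B ==> g \<in> Arr B ==> Cod B (f**g) = Cod B f \<odot> Cod B g"
  using tarr_Hom[of f "Dom B f" "Cod B f" g "Dom B g" "Cod B g"] by (auto simp: Hom_def)

lemma ten_comp': "f \<in> Arr B ==> f' \<in> Arr B ==> g \<in> Arr B ==> g' \<in> Arr B ==> Cod B f = Dom B g ==> Cod B f' = Dom B g' ==>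
    (g**g') o (f**f') = (g o f)**(g' o f')"
  using interchange[of f "Dom B f" "Cod B f" g "Cod B g" f' "Dom B f'" "Cod B f'" g' "Cod B g'"] by (simp add: Hom_def)

lemma ten_comp_assoc': "f \<in> Arr B ==> f' \<in> Arr B ==> g \<in> Arr B ==> g' \<in> Arr B ==> h \<in> Arr B ==> Cod B f = Dom B g ==> Cod B f' = Dom B g' ==>
    Cod B h = Dom B f \<odot> Dom B f' ==> (g**g') o (f**f') o h = ((g o f)**(g' o f')) o h"
  by (subst comp_assoc[symmetric]) (simp_all add: ten_comp')

lemma id_simps [simp]: "X \<in> Obj B ==> Id B X \<in> Arr B" "X \<in> Obj B ==> Dom B (Id B X) = X" "X \<in> Obj B ==> Cod B (Id B X) = X"
  using Id_Hom[of X] by (auto simp: Hom_def)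

lemma assoc_simps [simp]: "X \<in> Obj B ==> Y \<in> Obj B ==> Z \<in> Obj B ==> assoc B X Y Z \<in> Arr B"
  "X \<in> Obj B ==> Y \<in> Obj B ==> Z \<in> Obj B ==> Dom B (assoc B X Y Z) = (X \<odot> Y) \<odot> Z"
  "X \<in> Obj B ==> Y \<in> Obj B ==> Z \<in> Obj B ==> Cod B (assoc B X Y Z) = X \<odot> Y \<odot> Z"
  using assoc_Hom[of X Y Z] by (auto simp: Hom_def)

lemma unit_simps [simp]: "X \<in> Obj B ==> lunit B X \<in> Arr B" "X \<in> Obj B ==> Dom B (lunit B X) = tunit B \<odot> X" "X \<in> Obj B ==> Cod B (lunit B X) = X"
  "X \<in> Obj B ==> runit B X \<in> Arr B" "X \<in> Obj B ==> Dom B (runit B X) = X \<odot> tunit B" "X \<in> Obj B ==> Cod B (runit B X) = X"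
  using lunit_Hom[of X] runit_Hom[of X] by (auto simp: Hom_def)

lemma braid_simps [simp]: "X \<in> Obj B ==> Y \<in> Obj B ==> braid B X Y \<in> Arr B"
  "X \<in> Obj B ==> Y \<in> Obj B ==> Dom B (braid B X Y) = X \<odot> Y" "X \<in> Obj B ==> Y \<in> Obj B ==> Cod B (braid B X Y) = Y \<odot> X"
  using braid_Hom[of X Y] by (auto simp: Hom_def)

lemma braid_nat': "f \<in> Arr B ==> g \<in> Arr B ==> braid B (Cod B f) (Cod B g) o (f**g) = (g**f) o braid B (Dom B f) (Dom B g)"
  using braid_nat[of f "Dom B f" "Cod B f" g "Dom B g" "Cod B g"] by (simp add: Hom_def)

lemma assoc_nat': "f \<in> Arr B ==> g \<in> Arr B ==> h \<in> Arr B ==>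
    assoc B (Cod B f) (Cod B g) (Cod B h) o ((f**g)**h) = (f**(g**h)) o assoc B (Dom B f) (Dom B g) (Dom B h)"
  using assoc_nat[of f "Dom B f" "Cod B f" g "Dom B g" "Cod B g" h "Dom B h" "Cod B h"] by (simp add: Hom_def)

lemma inverse_tensor: "inverse_arrows B f f' ==> inverse_arrows B g g' ==> inverse_arrows B (f**g) (f'**g')"
  using Dom_Obj[of f] Dom_Obj[of g] Cod_Obj[of f] Cod_Obj[of g]
  by (auto simp: inverse_arrows_def Hom_def ten_comp' tarr_Id)

lemma inv_arr_simps [simp]: "is_iso B f ==> inv_arr B f \<in> Arr B" "is_iso B f ==> Dom B (inv_arr B f) = Cod B f" "is_iso B f ==> Cod B (inv_arr B f) = Dom B f"
  "is_iso B f ==> inv_arr B f o f = Id B (Dom B f)" "is_iso B f ==> f o inv_arr B f = Id B (Cod B f)"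
  using inverse_arrows_inv_arr[of f] by (auto simp: inverse_arrows_def Hom_def)

lemma iso_Arr: "is_iso B f ==> f \<in> Arr B"
  by (auto simp: is_iso_def inverse_arrows_def)

lemma iso_ten [simp]: "is_iso B f ==> is_iso B g ==> is_iso B (f**g)"
  unfolding is_iso_def using inverse_tensor by blast

lemma iso_comp [simp]: "is_iso B f ==> is_iso B g ==> Cod B f = Dom B g ==> is_iso B (g o f)"
  by (rule is_iso_Comp)

lemma iso_id [simp]: "X \<in> Obj B ==> is_iso B (Id B X)"
  by (rule is_iso_Id)

lemma iso_inv [simp]: "is_iso B f ==> is_iso B (inv_arr B f)"
  using inverse_arrows_sym[OF inverse_arrows_inv_arr] unfolding is_iso_def by blast

lemma cancel_iso_right: "is_iso B k ==> f \<in> Arr B ==> g \<in> Arr B ==> Dom B f = Cod B k ==> Dom B g = Cod B k ==>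
    f o k = g o k \<longleftrightarrow> f = g"
proof
  assume a: "is_iso B k" "f \<in> Arr B" "g \<in> Arr B" "Dom B f = Cod B k" "Dom B g = Cod B k" and e: "f o k = g o k"
  have "f o k o inv_arr B k = (f o k) o inv_arr B k" using a iso_Arr by (intro comp_assoc[symmetric]) auto
  also have "... = g o k o inv_arr B k" unfolding e using a iso_Arr by (intro comp_assoc) auto
  finally show "f = g" using a by (simp add: comp_id_right)
qed simp

lemma cancel_iso_left: "is_iso B k ==> f \<in> Arr B ==> g \<in> Arr B ==> Cod B f = Dom B k ==> Cod B g = Dom B k ==>
    k o f = k o g \<longleftrightarrow> f = g"
proof
  assume a: "is_iso B k" "f \<in> Arr B" "g \<in> Arr B" "Cod B f = Dom B k" "Cod B g = Dom B k" and e: "k o f = k o g"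
  have "(inv_arr B k o k) o f = inv_arr B k o k o f" using a iso_Arr by (intro comp_assoc) auto
  also have "... = (inv_arr B k o k) o g" unfolding e using a iso_Arr by (intro comp_assoc[symmetric]) auto
  finally show "f = g" using a by (simp add: comp_id_left)
qed simp

lemma inv_cancel: "is_iso B k ==> f \<in> Arr B ==> Cod B f = Dom B k ==> inv_arr B k o k o f = f"
  "is_iso B k ==> f \<in> Arr B ==> Cod B f = Cod B k ==> k o inv_arr B k o f = f"
proof -
  assume a: "is_iso B k" "f \<in> Arr B"
  show "Cod B f = Dom B k ==> inv_arr B k o k o f = f"
    using a iso_Arr by (subst comp_assoc[symmetric]) (simp_all add: comp_id_left)
  show "Cod B f = Cod B k ==> k o inv_arr B k o f = f"
    using a iso_Arr by (subst comp_assoc[symmetric]) (simp_all add: comp_id_left)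
qed

end

text \<open>Arrows between powers, with tensor products and braidings conjugated by the comparison
  arrows \<open>pm\<close>. Their coherence is what makes this structure strict.\<close>

definition powcat :: "('o, 'a, 'z) bmcat_scheme => (nat => 'o) => (nat => nat => 'a) => (nat, nat \<times> nat \<times> 'a) bmcat" where
  "powcat B P pm = \<lparr>Obj = UNIV, Arr = {(n, m, f). f \<in> Hom B (P n) (P m)}, Dom = fst, Cod = (\<lambda>t. fst (snd t)),
     Id = \<lambda>n. (n, n, Id B (P n)), Comp = \<lambda>(_, k, g) (n, _, f). (n, k, g o\<^bsub>B\<^esub> f), tobj = (+),
     tarr = \<lambda>(n, m, f) (n', m', f'). (n + n', m + m', pm m m' o\<^bsub>B\<^esub> (f**\<^bsub>B\<^esub>f') o\<^bsub>B\<^esub> inv_arr B (pm n n')),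
     tunit = 0, assoc = \<lambda>n m k. (n + m + k, n + m + k, Id B (P (n + m + k))), lunit = \<lambda>n. (n, n, Id B (P n)),
     runit = \<lambda>n. (n, n, Id B (P n)),
     braid = \<lambda>n m. (n + m, m + n, pm m n o\<^bsub>B\<^esub> braid B (P n) (P m) o\<^bsub>B\<^esub> inv_arr B (pm n m))\<rparr>"

text \<open>The data of a strong monoidal functor to \<open>B\<close> from the natural numbers with
  identities only. Both the bracketed powers of an object and the values of an algebra are
  instances.\<close>

locale powers = braided_monoidal_category B
  for B :: "('o, 'a, 'z) bmcat_scheme" (structure) +
  fixes P :: "nat => 'o" and pm :: "nat => nat => 'a" and et :: 'a
  assumes P_Obj [simp]: "P n \<in> Obj B"
    and pm_Hom: "pm n m \<in> Hom B (P n \<odot> P m) (P (n + m))" and pm_iso [simp]: "is_iso B (pm n m)"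
    and et_Hom: "et \<in> Hom B (tunit B) (P 0)" and et_iso [simp]: "is_iso B et"
    and pm_assoc: "pm (n + m) k o (pm n m**Id B (P k)) = pm n (m + k) o (Id B (P n)**pm m k) o assoc B (P n) (P m) (P k)"
    and pm_lunit: "pm 0 n o (et**Id B (P n)) = lunit B (P n)"
    and pm_runit: "pm n 0 o (Id B (P n)**et) = runit B (P n)"
begin

abbreviation "K \<equiv> powcat B P pm"
abbreviation K_Comp (infixr "o\<^sub>K" 70) where "g o\<^sub>K f \<equiv> g o\<^bsub>K\<^esub> f"
abbreviation K_tarr (infixr "**\<^sub>K" 75) where "f**\<^sub>Kg \<equiv> f**\<^bsub>K\<^esub>g"
abbreviation "un t \<equiv> snd (snd t)"

declare comp_arr [simp] comp_dom [simp] comp_cod [simp] comp_id_left [simp] comp_id_right [simp] tunit_Obj [simp] tobj_Obj [simp]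
  assoc_iso [simp] lunit_iso [simp] runit_iso [simp] braid_iso [simp]

lemma pm_simps [simp]: "pm n m \<in> Arr B" "Dom B (pm n m) = P n \<odot> P m" "Cod B (pm n m) = P (n + m)"
  "et \<in> Arr B" "Dom B et = tunit B" "Cod B et = P 0"
  using pm_Hom[of n m] et_Hom by (auto simp: Hom_def)

lemma K_Arr: "t \<in> Arr K \<longleftrightarrow> un t \<in> Arr B \<and> Dom B (un t) = P (fst t) \<and> Cod B (un t) = P (fst (snd t))"
  by (auto simp: powcat_def Hom_def)

lemma K_simps [simp]: "Obj K = UNIV" "Dom K t = fst t" "Cod K t = fst (snd t)" "tobj K = (+)" "tunit K = 0"
  "Id K n = (n, n, Id B (P n))" "(n', k, g) o\<^sub>K (n, m, f) = (n, k, g o f)"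
  "(n, m, f)**\<^sub>K(n', m', f') = (n + n', m + m', pm m m' o (f**f') o inv_arr B (pm n n'))"
  "braid K n m = (n + m, m + n, pm m n o braid B (P n) (P m) o inv_arr B (pm n m))"
  by (auto simp: powcat_def)

text \<open>\<open>phi\<close> and \<open>psi\<close> compare the two bracketings of a threefold
  tensor product with the total power; they differ by the associator.\<close>

definition phi :: "nat => nat => nat => 'a" where "phi n m k = pm (n + m) k o (pm n m**Id B (P k))"
definition psi :: "nat => nat => nat => 'a" where "psi n m k = pm n (m + k) o (Id B (P n)**pm m k)"

lemma phi_psi: "phi n m k = psi n m k o assoc B (P n) (P m) (P k)"
  by (simp add: phi_def psi_def pm_assoc comp_assoc)

lemma phi_simps [simp]: "phi n m k \<in> Arr B" "Dom B (phi n m k) = (P n \<odot> P m) \<odot> P k" "Cod B (phi n m k) = P (n + m + k)" "is_iso B (phi n m k)"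
  "psi n m k \<in> Arr B" "Dom B (psi n m k) = P n \<odot> P m \<odot> P k" "Cod B (psi n m k) = P (n + (m + k))" "is_iso B (psi n m k)"
  by (simp_all add: phi_def psi_def)

lemma K_ten_pm:
  assumes "f \<in> Arr B" "Dom B f = P n" "Cod B f = P m" "g \<in> Arr B" "Dom B g = P n'" "Cod B g = P m'"
  shows "(pm m m' o (f**g) o inv_arr B (pm n n')) o pm n n' = pm m m' o (f**g)"
  using assms by (simp add: comp_assoc)

lemma K_ten_phi:
  assumes f: "f \<in> Arr B" "Dom B f = P n" "Cod B f = P m" and g: "g \<in> Arr B" "Dom B g = P n'" "Cod B g = P m'"
    and h: "h \<in> Arr B" "Dom B h = P n''" "Cod B h = P m''"
  shows "un (((n, m, f)**\<^sub>K(n', m', g))**\<^sub>K(n'', m'', h)) o phi n n' n'' = phi m m' m'' o ((f**g)**h)"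
    and "un ((n, m, f)**\<^sub>K((n', m', g)**\<^sub>K(n'', m'', h))) o psi n n' n'' = psi m m' m'' o (f**g**h)"
proof -
  let ?fg = "pm m m' o (f**g) o inv_arr B (pm n n')" and ?gh = "pm m' m'' o (g**h) o inv_arr B (pm n' n'')"
  have "un (((n, m, f)**\<^sub>K(n', m', g))**\<^sub>K(n'', m'', h)) o phi n n' n''
      = pm (m + m') m'' o (?fg**h) o (inv_arr B (pm (n + n') n'') o pm (n + n') n'') o (pm n n'**Id B (P n''))"
    using f g h by (simp add: phi_def comp_assoc del: inv_arr_simps(4))
  also have "... = pm (m + m') m'' o ((?fg o pm n n')**h)" using f g h by (simp add: ten_comp' tarr_Id)
  also have "?fg o pm n n' = pm m m' o (f**g)" using K_ten_pm[OF f g] .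
  also have "pm (m + m') m'' o ((pm m m' o (f**g))**h) = phi m m' m'' o ((f**g)**h)"
    using f g h by (simp add: phi_def comp_assoc ten_comp')
  finally show "un (((n, m, f)**\<^sub>K(n', m', g))**\<^sub>K(n'', m'', h)) o phi n n' n'' = phi m m' m'' o ((f**g)**h)" .
  have "un ((n, m, f)**\<^sub>K((n', m', g)**\<^sub>K(n'', m'', h))) o psi n n' n''
      = pm m (m' + m'') o (f**?gh) o (inv_arr B (pm n (n' + n'')) o pm n (n' + n'')) o (Id B (P n)**pm n' n'')"
    using f g h by (simp add: psi_def comp_assoc del: inv_arr_simps(4))
  also have "... = pm m (m' + m'') o (f**(?gh o pm n' n''))" using f g h by (simp add: ten_comp' tarr_Id)
  also have "?gh o pm n' n'' = pm m' m'' o (g**h)" using K_ten_pm[OF g h] .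
  also have "pm m (m' + m'') o (f**(pm m' m'' o (g**h))) = psi m m' m'' o (f**g**h)"
    using f g h by (simp add: psi_def comp_assoc ten_comp')
  finally show "un ((n, m, f)**\<^sub>K((n', m', g)**\<^sub>K(n'', m'', h))) o psi n n' n'' = psi m m' m'' o (f**g**h)" .
qed

text \<open>Precomposition with the invertible \<open>phi\<close> removes all inverses of
  \<open>pm\<close>; what remains is naturality of the associator.\<close>

lemma K_assoc_aux:
  assumes f: "f \<in> Arr B" "Dom B f = P n" "Cod B f = P m" and g: "g \<in> Arr B" "Dom B g = P n'" "Cod B g = P m'"
    and h: "h \<in> Arr B" "Dom B h = P n''" "Cod B h = P m''"
  shows "((n, m, f)**\<^sub>K(n', m', g))**\<^sub>K(n'', m'', h) = (n, m, f)**\<^sub>K((n', m', g)**\<^sub>K(n'', m'', h))"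
proof -
  let ?l = "un (((n, m, f)**\<^sub>K(n', m', g))**\<^sub>K(n'', m'', h))"
  let ?r = "un ((n, m, f)**\<^sub>K((n', m', g)**\<^sub>K(n'', m'', h)))"
  have t: "?l \<in> Arr B" "?r \<in> Arr B" "Dom B ?l = P (n + n' + n'')" "Dom B ?r = P (n + n' + n'')"
    using f g h by (simp_all add: add.assoc)
  have "?l o phi n n' n'' = phi m m' m'' o ((f**g)**h)" by (rule K_ten_phi[OF f g h])
  also have "... = psi m m' m'' o (f**g**h) o assoc B (P n) (P n') (P n'')"
    using f g h assoc_nat'[of f g h] by (simp add: phi_psi comp_assoc)
  also have "... = (?r o psi n n' n'') o assoc B (P n) (P n') (P n'')"
    unfolding K_ten_phi(2)[OF f g h] using f g h by (simp add: comp_assoc)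
  also have "... = ?r o phi n n' n''" unfolding phi_psi using t by (intro comp_assoc) (simp_all add: add.assoc)
  finally have "?l = ?r" using cancel_iso_right[of "phi n n' n''" ?l ?r] t by simp
  thus ?thesis by (simp add: add.assoc)
qed

lemma K_unit_aux:
  assumes f: "f \<in> Arr B" "Dom B f = P n" "Cod B f = P m"
  shows "pm 0 m o (Id B (P 0)**f) o inv_arr B (pm 0 n) = f" "pm m 0 o (f**Id B (P 0)) o inv_arr B (pm n 0) = f"
proof -
  let ?k = "pm 0 n o (et**Id B (P n))" and ?l = "pm n 0 o (Id B (P n)**et)"
  have "(pm 0 m o (Id B (P 0)**f) o inv_arr B (pm 0 n)) o ?k = pm 0 m o (Id B (P 0)**f) o (inv_arr B (pm 0 n) o pm 0 n) o (et**Id B (P n))"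
    using f by (simp add: comp_assoc del: inv_arr_simps(4))
  also have "... = (pm 0 m o (et**Id B (P m))) o (Id B (tunit B)**f)" using f by (simp add: ten_comp' comp_assoc tarr_Id)
  also have "... = f o ?k" unfolding pm_lunit using lunit_nat[of f "P n" "P m"] f by (simp add: Hom_def)
  finally show "pm 0 m o (Id B (P 0)**f) o inv_arr B (pm 0 n) = f"
    using cancel_iso_right[of ?k _ f] f by simp
  have "(pm m 0 o (f**Id B (P 0)) o inv_arr B (pm n 0)) o ?l = pm m 0 o (f**Id B (P 0)) o (inv_arr B (pm n 0) o pm n 0) o (Id B (P n)**et)"
    using f by (simp add: comp_assoc del: inv_arr_simps(4))
  also have "... = (pm m 0 o (Id B (P m)**et)) o (f**Id B (tunit B))" using f by (simp add: ten_comp' comp_assoc tarr_Id)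
  also have "... = f o ?l" unfolding pm_runit using runit_nat[of f "P n" "P m"] f by (simp add: Hom_def)
  finally show "pm m 0 o (f**Id B (P 0)) o inv_arr B (pm n 0) = f"
    using cancel_iso_right[of ?l _ f] f by simp
qed

abbreviation "kb n m \<equiv> pm m n o braid B (P n) (P m) o inv_arr B (pm n m)"

lemma kb_pm: "kb n m o pm n m = pm m n o braid B (P n) (P m)"
  by (simp add: comp_assoc)

text \<open>After precomposition with \<open>phi\<close> the right side is governed by the hexagon
  of \<open>B\<close>; naturality of the braiding against \<open>pm m k\<close> then recovers the
  left side.\<close>

lemma K_hex1: "kb n (m + k) = un (((m, m, Id B (P m))**\<^sub>K(n + k, k + n, kb n k)) o\<^sub>K ((n + m, m + n, kb n m)**\<^sub>K(k, k, Id B (P k))))"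
proof -
  let ?a = "pm (m + n) k o (kb n m**Id B (P k)) o inv_arr B (pm (n + m) k)"
  let ?b = "pm m (k + n) o (Id B (P m)**kb n k) o inv_arr B (pm m (n + k))"
  have t: "?a \<in> Arr B" "Dom B ?a = P (n + m + k)" "Cod B ?a = P (m + n + k)" "?b \<in> Arr B" "Dom B ?b = P (m + (n + k))" "Cod B ?b = P (m + (k + n))"
    by simp_all
  have a: "?a o phi n m k = phi m n k o (braid B (P n) (P m)**Id B (P k))"
  proof -
    have "?a o phi n m k = (?a o pm (n + m) k) o (pm n m**Id B (P k))" unfolding phi_def by (rule comp_assoc[symmetric]) simp_all
    also have "?a o pm (n + m) k = pm (m + n) k o (kb n m**Id B (P k))" by (rule K_ten_pm) simp_all
    also have "(pm (m + n) k o (kb n m**Id B (P k))) o (pm n m**Id B (P k)) = pm (m + n) k o ((kb n m o pm n m)**Id B (P k))"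
      by (simp add: comp_assoc ten_comp')
    also have "... = phi m n k o (braid B (P n) (P m)**Id B (P k))" unfolding kb_pm phi_def by (simp add: comp_assoc ten_comp')
    finally show ?thesis .
  qed
  have b: "?b o psi m n k = psi m k n o (Id B (P m)**braid B (P n) (P k))"
  proof -
    have "?b o psi m n k = (?b o pm m (n + k)) o (Id B (P m)**pm n k)" unfolding psi_def by (rule comp_assoc[symmetric]) simp_all
    also have "?b o pm m (n + k) = pm m (k + n) o (Id B (P m)**kb n k)" by (rule K_ten_pm) simp_all
    also have "(pm m (k + n) o (Id B (P m)**kb n k)) o (Id B (P m)**pm n k) = pm m (k + n) o (Id B (P m)**(kb n k o pm n k))"
      by (simp add: comp_assoc ten_comp')
    also have "... = psi m k n o (Id B (P m)**braid B (P n) (P k))" unfolding kb_pm psi_def by (simp add: comp_assoc ten_comp')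
    finally show ?thesis .
  qed
  have "(?b o ?a) o phi n m k = ?b o ?a o phi n m k" using t by (intro comp_assoc) (simp_all add: add.assoc)
  also have "... = (?b o psi m n k) o assoc B (P m) (P n) (P k) o (braid B (P n) (P m)**Id B (P k))"
    unfolding a unfolding phi_psi[of m n k] using t by (simp add: comp_assoc add.assoc)
  also have "... = psi m k n o ((Id B (P m)**braid B (P n) (P k)) o assoc B (P m) (P n) (P k) o (braid B (P n) (P m)**Id B (P k)))"
    unfolding b by (simp add: comp_assoc)
  also have "... = psi m k n o assoc B (P m) (P k) (P n) o braid B (P n) (P m \<odot> P k) o assoc B (P n) (P m) (P k)"
    using hexagon1[of "P n" "P m" "P k"] by simp
  also have "... = (phi m k n o braid B (P n) (P m \<odot> P k)) o assoc B (P n) (P m) (P k)"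
    unfolding phi_psi by (simp add: comp_assoc)
  also have "phi m k n o braid B (P n) (P m \<odot> P k) = pm (m + k) n o braid B (P n) (P (m + k)) o (Id B (P n)**pm m k)"
    using braid_nat'[of "Id B (P n)" "pm m k"] by (simp add: phi_def comp_assoc)
  also have "... = (kb n (m + k) o pm n (m + k)) o (Id B (P n)**pm m k)" unfolding kb_pm by (simp add: comp_assoc)
  also have "... = kb n (m + k) o psi n m k" unfolding psi_def by (rule comp_assoc) simp_all
  also have "(kb n (m + k) o psi n m k) o assoc B (P n) (P m) (P k) = kb n (m + k) o phi n m k"
    unfolding phi_psi by (rule comp_assoc) simp_all
  finally have "?b o ?a = kb n (m + k)"
    using cancel_iso_right[of "phi n m k" "?b o ?a" "kb n (m + k)"] t by (simp add: add.assoc)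
  thus ?thesis by simp
qed

lemma psi_phi: "psi n m k = phi n m k o inv_arr B (assoc B (P n) (P m) (P k))"
  by (simp add: phi_psi comp_assoc)

text \<open>The mirror image of \<open>K_hex1\<close>, with \<open>psi\<close> as test arrow and
  inverse associators.\<close>

lemma K_hex2: "kb (n + m) k = un (((n + k, k + n, kb n k)**\<^sub>K(m, m, Id B (P m))) o\<^sub>K ((n, n, Id B (P n))**\<^sub>K(m + k, k + m, kb m k)))"
proof -
  let ?a = "pm n (k + m) o (Id B (P n)**kb m k) o inv_arr B (pm n (m + k))"
  let ?b = "pm (k + n) m o (kb n k**Id B (P m)) o inv_arr B (pm (n + k) m)"
  let ?ai = "\<lambda>a b c. inv_arr B (assoc B (P a) (P b) (P c))"
  have t: "?a \<in> Arr B" "Dom B ?a = P (n + (m + k))" "Cod B ?a = P (n + (k + m))" "?b \<in> Arr B" "Dom B ?b = P (n + k + m)" "Cod B ?b = P (k + n + m)"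
    by simp_all
  have a: "?a o psi n m k = psi n k m o (Id B (P n)**braid B (P m) (P k))"
  proof -
    have "?a o psi n m k = (?a o pm n (m + k)) o (Id B (P n)**pm m k)" unfolding psi_def by (rule comp_assoc[symmetric]) simp_all
    also have "?a o pm n (m + k) = pm n (k + m) o (Id B (P n)**kb m k)" by (rule K_ten_pm) simp_all
    also have "(pm n (k + m) o (Id B (P n)**kb m k)) o (Id B (P n)**pm m k) = pm n (k + m) o (Id B (P n)**(kb m k o pm m k))"
      by (simp add: comp_assoc ten_comp')
    also have "... = psi n k m o (Id B (P n)**braid B (P m) (P k))" unfolding kb_pm psi_def by (simp add: comp_assoc ten_comp')
    finally show ?thesis .
  qed
  have b: "?b o phi n k m = phi k n m o (braid B (P n) (P k)**Id B (P m))"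
  proof -
    have "?b o phi n k m = (?b o pm (n + k) m) o (pm n k**Id B (P m))" unfolding phi_def by (rule comp_assoc[symmetric]) simp_all
    also have "?b o pm (n + k) m = pm (k + n) m o (kb n k**Id B (P m))" by (rule K_ten_pm) simp_all
    also have "(pm (k + n) m o (kb n k**Id B (P m))) o (pm n k**Id B (P m)) = pm (k + n) m o ((kb n k o pm n k)**Id B (P m))"
      by (simp add: comp_assoc ten_comp')
    also have "... = phi k n m o (braid B (P n) (P k)**Id B (P m))" unfolding kb_pm phi_def by (simp add: comp_assoc ten_comp')
    finally show ?thesis .
  qed
  have "(?b o ?a) o psi n m k = ?b o ?a o psi n m k" using t by (intro comp_assoc) (simp_all add: add.assoc)
  also have "... = (?b o phi n k m) o ?ai n k m o (Id B (P n)**braid B (P m) (P k))"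
    unfolding a unfolding psi_phi[of n k m] using t by (simp add: comp_assoc add.assoc)
  also have "... = phi k n m o ((braid B (P n) (P k)**Id B (P m)) o ?ai n k m o (Id B (P n)**braid B (P m) (P k)))"
    unfolding b by (simp add: comp_assoc)
  also have "... = phi k n m o ?ai k n m o braid B (P n \<odot> P m) (P k) o ?ai n m k"
    using hexagon2[of "P n" "P m" "P k"] by simp
  also have "... = (psi k n m o braid B (P n \<odot> P m) (P k)) o ?ai n m k"
    unfolding psi_phi by (simp add: comp_assoc)
  also have "psi k n m o braid B (P n \<odot> P m) (P k) = pm k (n + m) o braid B (P (n + m)) (P k) o (pm n m**Id B (P k))"
    using braid_nat'[of "pm n m" "Id B (P k)"] by (simp add: psi_def comp_assoc)
  also have "... = (kb (n + m) k o pm (n + m) k) o (pm n m**Id B (P k))" unfolding kb_pm by (simp add: comp_assoc)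
  also have "... = kb (n + m) k o phi n m k" unfolding phi_def by (rule comp_assoc) simp_all
  also have "(kb (n + m) k o phi n m k) o ?ai n m k = kb (n + m) k o psi n m k"
    unfolding psi_phi by (rule comp_assoc) simp_all
  finally have "?b o ?a = kb (n + m) k"
    using cancel_iso_right[of "psi n m k" "?b o ?a" "kb (n + m) k"] t by (simp add: add.assoc)
  thus ?thesis by simp
qed

lemma inverse_K: "inverse_arrows K (n, m, f) (m, n, g) \<longleftrightarrow> inverse_arrows B f g \<and> Dom B f = P n \<and> Cod B f = P m"
  by (auto simp: inverse_arrows_def Hom_def K_Arr)

lemma prob_K: "prob K"
proof
  fix f g h :: "nat \<times> nat \<times> 'a" and n m k l
  obtain n1 m1 f1 n2 m2 f2 n3 m3 f3 where s: "f = (n1, m1, f1)" "g = (n2, m2, f2)" "h = (n3, m3, f3)" by (metis prod_cases3)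
  show "f \<in> Hom K n m ==> f o\<^sub>K Id K n = f" "f \<in> Hom K n m ==> Id K m o\<^sub>K f = f"
    by (auto simp: s Hom_def K_Arr)
  show "f \<in> Hom K n m ==> g \<in> Hom K m k ==> g o\<^sub>K f \<in> Hom K n k" by (auto simp: s Hom_def K_Arr)
  show "f \<in> Hom K n m ==> g \<in> Hom K m k ==> h \<in> Hom K k l ==> (h o\<^sub>K g) o\<^sub>K f = h o\<^sub>K g o\<^sub>K f"
    by (auto simp: s Hom_def K_Arr comp_assoc)
  show "f \<in> Arr K ==> g \<in> Arr K ==> f**\<^sub>Kg \<in> Arr K" "f \<in> Arr K ==> g \<in> Arr K ==> Dom K (f**\<^sub>Kg) = Dom K f + Dom K g"
    "f \<in> Arr K ==> g \<in> Arr K ==> Cod K (f**\<^sub>Kg) = Cod K f + Cod K g" by (auto simp: s K_Arr)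
  show "f \<in> Arr K ==> g \<in> Arr K ==> h \<in> Arr K ==> (f**\<^sub>Kg)**\<^sub>Kh = f**\<^sub>Kg**\<^sub>Kh"
    unfolding s by (rule K_assoc_aux) (auto simp: K_Arr)
  show "f \<in> Arr K ==> Id K 0**\<^sub>Kf = f" "f \<in> Arr K ==> f**\<^sub>KId K 0 = f"
    by (auto simp: s K_Arr K_unit_aux)
  show "f \<in> Arr K ==> g \<in> Arr K ==> braid K (Cod K f) (Cod K g) o\<^sub>K (f**\<^sub>Kg) = (g**\<^sub>Kf) o\<^sub>K braid K (Dom K f) (Dom K g)"
  proof -
    assume "f \<in> Arr K" "g \<in> Arr K"
    hence t: "f1 \<in> Arr B" "Dom B f1 = P n1" "Cod B f1 = P m1" "f2 \<in> Arr B" "Dom B f2 = P n2" "Cod B f2 = P m2" by (auto simp: s K_Arr)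
    have "kb m1 m2 o pm m1 m2 o (f1**f2) o inv_arr B (pm n1 n2) = pm m2 m1 o (braid B (P m1) (P m2) o (f1**f2)) o inv_arr B (pm n1 n2)"
      using t by (simp add: comp_assoc inv_cancel)
    also have "braid B (P m1) (P m2) o (f1**f2) = (f2**f1) o braid B (P n1) (P n2)" using braid_nat'[of f1 f2] t by simp
    also have "pm m2 m1 o ((f2**f1) o braid B (P n1) (P n2)) o inv_arr B (pm n1 n2)
        = (pm m2 m1 o (f2**f1) o inv_arr B (pm n2 n1)) o kb n1 n2"
      using t by (simp add: comp_assoc inv_cancel)
    finally show ?thesis by (simp add: s)
  qed
next
  fix f f' g g' :: "nat \<times> nat \<times> 'a"
  obtain n1 m1 f1 n2 m2 f2 n3 m3 f3 n4 m4 f4 where s: "f = (n1, m1, f1)" "f' = (n2, m2, f2)" "g = (n3, m3, f3)" "g' = (n4, m4, f4)"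
    by (metis prod_cases3)
  assume "f \<in> Arr K" "f' \<in> Arr K" "g \<in> Arr K" "g' \<in> Arr K" "Cod K f = Dom K g" "Cod K f' = Dom K g'"
  thus "(g**\<^sub>Kg') o\<^sub>K (f**\<^sub>Kf') = (g o\<^sub>K f)**\<^sub>K(g' o\<^sub>K f')"
    by (auto simp: s K_Arr comp_assoc inv_cancel ten_comp_assoc')
next
  fix n m k
  show "Id K n**\<^sub>KId K m = Id K (n + m)" by (simp add: tarr_Id)
  show "braid K n m \<in> Hom K (n + m) (m + n)" by (simp add: Hom_def K_Arr)
  have "is_iso B (kb n m)" by simp
  from inverse_arrows_inv_arr[OF this]
  have "inverse_arrows K (n + m, m + n, kb n m) (m + n, n + m, inv_arr B (kb n m))" unfolding inverse_K by simp
  thus "is_iso K (braid K n m)" by (auto simp: is_iso_def)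
  show "braid K n (m + k) = (Id K m**\<^sub>Kbraid K n k) o\<^sub>K (braid K n m**\<^sub>KId K k)"
    by (simp add: K_hex1[simplified] add.assoc)
  show "braid K (n + m) k = (braid K n k**\<^sub>KId K m) o\<^sub>K (Id K n**\<^sub>Kbraid K m k)"
    by (simp add: K_hex2[simplified] add.assoc)
qed (auto simp: Hom_def K_Arr)

end

section \<open>Bimonoids in strict form, and twisting their comultiplication\<close>

section \<open>Bimonoids in strict braided categories\<close>

definition strict_bimonoid :: "(nat, 'a, 'z) bmcat_scheme => 'a => 'a => 'a => 'a => bool" where
  "strict_bimonoid C m u d e \<longleftrightarrow>
     m \<in> Hom C (Suc (Suc 0)) (Suc 0) \<and> u \<in> Hom C 0 (Suc 0) \<and> d \<in> Hom C (Suc 0) (Suc (Suc 0)) \<and> e \<in> Hom C (Suc 0) 0 \<and>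
     m o\<^bsub>C\<^esub> (m**\<^bsub>C\<^esub>Id C (Suc 0)) = m o\<^bsub>C\<^esub> (Id C (Suc 0)**\<^bsub>C\<^esub>m) \<and>
     m o\<^bsub>C\<^esub> (u**\<^bsub>C\<^esub>Id C (Suc 0)) = Id C (Suc 0) \<and> m o\<^bsub>C\<^esub> (Id C (Suc 0)**\<^bsub>C\<^esub>u) = Id C (Suc 0) \<and>
     (d**\<^bsub>C\<^esub>Id C (Suc 0)) o\<^bsub>C\<^esub> d = (Id C (Suc 0)**\<^bsub>C\<^esub>d) o\<^bsub>C\<^esub> d \<and>
     (e**\<^bsub>C\<^esub>Id C (Suc 0)) o\<^bsub>C\<^esub> d = Id C (Suc 0) \<and> (Id C (Suc 0)**\<^bsub>C\<^esub>e) o\<^bsub>C\<^esub> d = Id C (Suc 0) \<and>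
     d o\<^bsub>C\<^esub> m = (m**\<^bsub>C\<^esub>m) o\<^bsub>C\<^esub> (Id C (Suc 0)**\<^bsub>C\<^esub>braid C (Suc 0) (Suc 0)**\<^bsub>C\<^esub>Id C (Suc 0)) o\<^bsub>C\<^esub> (d**\<^bsub>C\<^esub>d) \<and>
     d o\<^bsub>C\<^esub> u = u**\<^bsub>C\<^esub>u \<and> e o\<^bsub>C\<^esub> m = e**\<^bsub>C\<^esub>e \<and> e o\<^bsub>C\<^esub> u = Id C 0"

context powers
begin

abbreviation "x1 \<equiv> P (Suc 0)"
abbreviation "p11 \<equiv> pm (Suc 0) (Suc 0)"
abbreviation "km m \<equiv> (Suc (Suc 0), Suc 0, m o inv_arr B p11)"
abbreviation "ku u \<equiv> (0, Suc 0, u o inv_arr B et)"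
abbreviation "kd d \<equiv> (Suc 0, Suc (Suc 0), p11 o d)"
abbreviation "ke e \<equiv> (Suc 0, 0, et o e)"

text \<open>Equations in \<open>powcat\<close> are turned into equations in \<open>B\<close> by
  precomposing with an invertible comparison arrow.\<close>

lemma test_right: "is_iso B k ==> f \<in> Arr B ==> g \<in> Arr B ==> Dom B f = Cod B k ==> Dom B g = Cod B k ==>
    f o k = f' ==> g o k = g' ==> f = g \<longleftrightarrow> f' = g'"
  using cancel_iso_right by blast

lemma pm_unit: "pm 0 0 o (et**et) = et o lunit B (tunit B)"
proof -
  have "pm 0 0 o (et**et) = (pm 0 0 o (et**Id B (P 0))) o (Id B (tunit B)**et)" by (simp add: comp_assoc ten_comp')
  thus ?thesis unfolding pm_lunit using lunit_nat[of et "tunit B" "P 0"] et_Hom by simp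
qed

text \<open>\<open>W\<close> compares the fourfold tensor product of \<open>x1\<close> with the
  fourth power. Through it the strict middle crossing corresponds to \<open>middle_braid\<close>
  with its four associators.\<close>

lemma middle_K:
  defines "W \<equiv> pm (Suc (Suc 0)) (Suc (Suc 0)) o (p11**p11)"
  shows "un (Id K (Suc 0)**\<^sub>Kbraid K (Suc 0) (Suc 0)**\<^sub>KId K (Suc 0)) o W = W o middle_braid B x1"
proof -
  let ?a = "assoc B x1 x1 x1" and ?A = "assoc B x1 x1 (x1 \<odot> x1)" and ?p13 = "pm (Suc 0) (Suc (Suc (Suc 0)))" and ?c = "braid B x1 x1"
  let ?C' = "un (braid K (Suc 0) (Suc 0)**\<^sub>KId K (Suc 0))"
  let ?ph = "phi (Suc 0) (Suc 0) (Suc 0)" and ?ps = "psi (Suc 0) (Suc 0) (Suc 0)"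
  have ph [simp]: "Cod B ?ph = P (Suc (Suc (Suc 0)))" "Cod B ?ps = P (Suc (Suc (Suc 0)))" "Cod B p11 = P (Suc (Suc 0))" by simp_all
  have W: "W = ?p13 o (Id B x1**?ps) o ?A"
  proof -
    have "W = (pm (Suc 0 + Suc 0) (Suc (Suc 0)) o (p11**Id B (P (Suc (Suc 0))))) o (Id B (x1 \<odot> x1)**p11)"
      by (simp add: W_def comp_assoc ten_comp')
    also have "... = ?p13 o (Id B x1**pm (Suc 0) (Suc (Suc 0))) o (assoc B x1 x1 (P (Suc (Suc 0))) o ((Id B x1**Id B x1)**p11))"
      unfolding pm_assoc by (simp add: comp_assoc tarr_Id)
    also have "assoc B x1 x1 (P (Suc (Suc 0))) o ((Id B x1**Id B x1)**p11) = (Id B x1**Id B x1**p11) o ?A"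
      using assoc_nat'[of "Id B x1" "Id B x1" p11] by simp
    also have "?p13 o (Id B x1**pm (Suc 0) (Suc (Suc 0))) o (Id B x1**Id B x1**p11) o ?A = ?p13 o (Id B x1**?ps) o ?A"
      by (simp add: psi_def ten_comp_assoc')
    finally show ?thesis .
  qed
  have C': "?C' \<in> Arr B" "Dom B ?C' = P (Suc (Suc (Suc 0)))" "Cod B ?C' = P (Suc (Suc (Suc 0)))" by simp_all
  have C'ph: "?C' o ?ph = ?ph o (?c**Id B x1)"
  proof -
    let ?k = "kb (Suc 0) (Suc 0)"
    have "?C' o ?ph = (pm (Suc (Suc 0)) (Suc 0) o (?k**Id B x1) o inv_arr B (pm (Suc (Suc 0)) (Suc 0))) o ?ph" by simp
    also have "... = pm (Suc (Suc 0)) (Suc 0) o ((?k o p11)**Id B x1)"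
      by (simp add: phi_def comp_assoc inv_cancel ten_comp')
    also have "... = ?ph o (?c**Id B x1)" unfolding kb_pm phi_def by (simp add: comp_assoc ten_comp')
    finally show ?thesis .
  qed
  have u: "un (Id K (Suc 0)**\<^sub>Kbraid K (Suc 0) (Suc 0)**\<^sub>KId K (Suc 0)) = ?p13 o (Id B x1**?C') o inv_arr B ?p13" by simp
  have "?C' o ?ps = (?C' o ?ph) o inv_arr B ?a"
    unfolding psi_phi using C' by (intro comp_assoc[symmetric]) (simp_all del: K_simps)
  hence c: "?C' o ?ps = ?ps o ?a o (?c**Id B x1) o inv_arr B ?a" unfolding C'ph unfolding phi_psi by (simp add: comp_assoc del: K_simps)
  have "(?p13 o (Id B x1**?C') o inv_arr B ?p13) o W = ?p13 o (Id B x1**(?C' o ?ps)) o ?A"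
    unfolding W using C' by (simp add: comp_assoc inv_cancel ten_comp_assoc' del: K_simps)
  hence 1: "(?p13 o (Id B x1**?C') o inv_arr B ?p13) o W = ?p13 o (Id B x1**(?ps o ?a o (?c**Id B x1) o inv_arr B ?a)) o ?A"
    unfolding c .
  have 2: "?p13 o (Id B x1**(?ps o ?a o (?c**Id B x1) o inv_arr B ?a)) o ?A = W o middle_braid B x1"
    unfolding W middle_braid_def by (simp add: comp_assoc inv_cancel ten_comp_assoc')
  show ?thesis unfolding u using HOL.trans[OF 1 2] .
qed

context
  fixes m u d e
  assumes mh: "m \<in> Hom B (x1 \<odot> x1) x1" and uh: "u \<in> Hom B (tunit B) x1" and dh: "d \<in> Hom B x1 (x1 \<odot> x1)" and eh: "e \<in> Hom B x1 (tunit B)"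
begin

lemma st [simp]: "m \<in> Arr B" "Dom B m = x1 \<odot> x1" "Cod B m = x1" "u \<in> Arr B" "Dom B u = tunit B" "Cod B u = x1"
  "d \<in> Arr B" "Dom B d = x1" "Cod B d = x1 \<odot> x1" "e \<in> Arr B" "Dom B e = x1" "Cod B e = tunit B"
  using mh uh dh eh by (auto simp: Hom_def)

lemma K_monoid:
  "km m o\<^sub>K (km m**\<^sub>KId K (Suc 0)) = km m o\<^sub>K (Id K (Suc 0)**\<^sub>Kkm m) \<longleftrightarrow> m o (m**Id B x1) = m o (Id B x1**m) o assoc B x1 x1 x1"
  (is "?l1 = ?r1 \<longleftrightarrow> _")
  "km m o\<^sub>K (ku u**\<^sub>KId K (Suc 0)) = Id K (Suc 0) \<longleftrightarrow> m o (u**Id B x1) = lunit B x1" (is "?l2 = _ \<longleftrightarrow> _")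
  "km m o\<^sub>K (Id K (Suc 0)**\<^sub>Kku u) = Id K (Suc 0) \<longleftrightarrow> m o (Id B x1**u) = runit B x1" (is "?l3 = _ \<longleftrightarrow> _")
proof -
  let ?n = "Suc 0"
  let ?k = "pm (Suc ?n) ?n o (p11**Id B x1)" and ?k2 = "pm 0 ?n o (et**Id B x1)" and ?k3 = "pm ?n 0 o (Id B x1**et)"
  have a: "?k = pm ?n (Suc ?n) o (Id B x1**p11) o assoc B x1 x1 x1" using pm_assoc[of ?n ?n ?n] by simp
  have "un ?l1 o ?k = m o (m**Id B x1)" by (simp add: comp_assoc inv_cancel ten_comp')
  moreover have "un ?r1 o ?k = m o (Id B x1**m) o assoc B x1 x1 x1"
    unfolding a by (simp add: comp_assoc inv_cancel ten_comp_assoc')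
  ultimately show "?l1 = ?r1 \<longleftrightarrow> m o (m**Id B x1) = m o (Id B x1**m) o assoc B x1 x1 x1"
    using test_right[of ?k "un ?l1" "un ?r1"] by simp
  have "un ?l2 o ?k2 = m o (u**Id B x1)" by (simp add: comp_assoc inv_cancel ten_comp')
  thus "?l2 = Id K ?n \<longleftrightarrow> m o (u**Id B x1) = lunit B x1"
    using test_right[of ?k2 "un ?l2" "Id B x1"] by (simp add: pm_lunit)
  have "un ?l3 o ?k3 = m o (Id B x1**u)" by (simp add: comp_assoc inv_cancel ten_comp')
  thus "?l3 = Id K ?n \<longleftrightarrow> m o (Id B x1**u) = runit B x1"
    using test_right[of ?k3 "un ?l3" "Id B x1"] by (simp add: pm_runit)
qed

lemma K_comonoid:
  "(kd d**\<^sub>KId K (Suc 0)) o\<^sub>K kd d = (Id K (Suc 0)**\<^sub>Kkd d) o\<^sub>K kd d \<longleftrightarrow> assoc B x1 x1 x1 o (d**Id B x1) o d = (Id B x1**d) o d"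
  (is "?l1 = ?r1 \<longleftrightarrow> ?e1")
  "(ke e**\<^sub>KId K (Suc 0)) o\<^sub>K kd d = Id K (Suc 0) \<longleftrightarrow> lunit B x1 o (e**Id B x1) o d = Id B x1" (is "?l2 = _ \<longleftrightarrow> ?e2")
  "(Id K (Suc 0)**\<^sub>Kke e) o\<^sub>K kd d = Id K (Suc 0) \<longleftrightarrow> runit B x1 o (Id B x1**e) o d = Id B x1" (is "?l3 = _ \<longleftrightarrow> ?e3")
proof -
  let ?n = "Suc 0"
  have "un ?l1 = phi ?n ?n ?n o (d**Id B x1) o d" by (simp add: phi_def comp_assoc inv_cancel ten_comp_assoc')
  hence "un ?l1 = psi ?n ?n ?n o assoc B x1 x1 x1 o (d**Id B x1) o d" unfolding phi_psi by (simp add: comp_assoc)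
  moreover have "un ?r1 = psi ?n ?n ?n o (Id B x1**d) o d" by (simp add: psi_def comp_assoc inv_cancel ten_comp_assoc')
  ultimately show "?l1 = ?r1 \<longleftrightarrow> ?e1"
    using cancel_iso_left[of "psi ?n ?n ?n" "assoc B x1 x1 x1 o (d**Id B x1) o d" "(Id B x1**d) o d"] by simp
  have "un ?l2 = (pm 0 ?n o (et**Id B x1)) o (e**Id B x1) o d" by (simp add: comp_assoc inv_cancel ten_comp_assoc')
  thus "?l2 = Id K ?n \<longleftrightarrow> ?e2" unfolding pm_lunit by simp
  have "un ?l3 = (pm ?n 0 o (Id B x1**et)) o (Id B x1**e) o d" by (simp add: comp_assoc inv_cancel ten_comp_assoc')
  thus "?l3 = Id K ?n \<longleftrightarrow> ?e3" unfolding pm_runit by simp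
qed

lemma K_compat:
  "kd d o\<^sub>K km m = (km m**\<^sub>Kkm m) o\<^sub>K (Id K (Suc 0)**\<^sub>Kbraid K (Suc 0) (Suc 0)**\<^sub>KId K (Suc 0)) o\<^sub>K (kd d**\<^sub>Kkd d)
    \<longleftrightarrow> d o m = (m**m) o middle_braid B x1 o (d**d)" (is "?l1 = ?r1 \<longleftrightarrow> ?e1")
  "kd d o\<^sub>K ku u = ku u**\<^sub>Kku u \<longleftrightarrow> d o u = (u**u) o inv_arr B (lunit B (tunit B))" (is "?l2 = ?r2 \<longleftrightarrow> ?e2")
  "ke e o\<^sub>K km m = ke e**\<^sub>Kke e \<longleftrightarrow> e o m = lunit B (tunit B) o (e**e)" (is "?l3 = ?r3 \<longleftrightarrow> ?e3")
  "ke e o\<^sub>K ku u = Id K 0 \<longleftrightarrow> e o u = Id B (tunit B)" (is "?l4 = _ \<longleftrightarrow> ?e4")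
proof -
  let ?n = "Suc 0" and ?p = "pm (Suc (Suc 0)) (Suc (Suc 0))" and ?l = "lunit B (tunit B)"
  let ?C = "un (Id K ?n**\<^sub>Kbraid K ?n ?n**\<^sub>KId K ?n)" and ?W = "?p o (p11**p11)" and ?M = "middle_braid B x1"
  have C: "?C \<in> Arr B" "Dom B ?C = P (Suc (Suc (Suc (Suc 0))))" "Cod B ?C = P (Suc (Suc (Suc (Suc 0))))" by simp_all
  have M [simp]: "?M \<in> Arr B" "Dom B ?M = (x1 \<odot> x1) \<odot> (x1 \<odot> x1)" "Cod B ?M = (x1 \<odot> x1) \<odot> (x1 \<odot> x1)" by (simp_all add: middle_braid_def)
  have pc [simp]: "Cod B p11 = P (Suc (Suc 0))" "Cod B ?p = P (Suc (Suc (Suc (Suc 0))))" by simp_all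
  let ?mm = "p11 o ((m o inv_arr B p11)**(m o inv_arr B p11)) o inv_arr B ?p" and ?dd = "?p o ((p11 o d)**(p11 o d)) o inv_arr B p11"
  have dd: "?dd o p11 = ?W o (d**d)" and mm: "?mm o ?W = p11 o (m**m)" by (simp_all add: comp_assoc inv_cancel ten_comp')
  have "(?mm o ?C o ?dd) o p11 = ?mm o ?C o ?dd o p11" using C by (simp add: comp_assoc del: K_simps)
  also have "... = ?mm o (?C o ?W) o (d**d)" unfolding dd using C by (simp add: comp_assoc del: K_simps)
  also have "... = (?mm o ?W) o ?M o (d**d)" unfolding middle_K by (simp add: comp_assoc)
  also have "... = p11 o (m**m) o ?M o (d**d)" unfolding mm by (simp add: comp_assoc)
  finally have e: "(?mm o ?C o ?dd) o p11 = p11 o (m**m) o ?M o (d**d)" .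
  have "(p11 o d) o (m o inv_arr B p11) = ?mm o ?C o ?dd \<longleftrightarrow> p11 o d o m = p11 o (m**m) o ?M o (d**d)"
  proof (rule test_right[OF _ _ _ _ _ _ e])
    show "((p11 o d) o m o inv_arr B p11) o p11 = p11 o d o m" by (simp add: comp_assoc)
  qed (use C in \<open>simp_all del: K_simps\<close>)
  thus "?l1 = ?r1 \<longleftrightarrow> ?e1" using cancel_iso_left[of p11 "d o m" "(m**m) o ?M o (d**d)"] by simp
  have "un ?r2 o et = p11 o ((u o inv_arr B et)**(u o inv_arr B et)) o inv_arr B (pm 0 0) o (et o ?l) o inv_arr B ?l" by (simp add: comp_assoc)
  hence "un ?r2 o et = p11 o (u**u) o inv_arr B ?l" unfolding pm_unit[symmetric] by (simp add: comp_assoc inv_cancel ten_comp_assoc')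
  moreover have "un ?l2 o et = p11 o d o u" by (simp add: comp_assoc)
  ultimately show "?l2 = ?r2 \<longleftrightarrow> ?e2"
    using test_right[of et "un ?l2" "un ?r2"] cancel_iso_left[of p11 "d o u" "(u**u) o inv_arr B ?l"] by simp
  have "un ?r3 o p11 = (pm 0 0 o (et**et)) o (e**e)" by (simp add: comp_assoc ten_comp')
  hence "un ?r3 o p11 = et o ?l o (e**e)" unfolding pm_unit by (simp add: comp_assoc)
  moreover have "un ?l3 o p11 = et o e o m" by (simp add: comp_assoc)
  ultimately show "?l3 = ?r3 \<longleftrightarrow> ?e3"
    using test_right[of p11 "un ?l3" "un ?r3"] cancel_iso_left[of et "e o m" "?l o (e**e)"] by simp
  have "un ?l4 o et = et o e o u" by (simp add: comp_assoc)
  thus "?l4 = Id K 0 \<longleftrightarrow> ?e4"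
    using test_right[of et "un ?l4" "Id B (P 0)"] cancel_iso_left[of et "e o u" "Id B (tunit B)"] by simp
qed

lemma strict_bimonoid_K:
  "strict_bimonoid K (km m) (ku u) (kd d) (ke e) \<longleftrightarrow>
    is_bimonoid B \<lparr>bobj = x1, bmult = m, bunit = u, bcomult = d, bcounit = e\<rparr>"
proof -
  have h: "km m \<in> Hom K (Suc (Suc 0)) (Suc 0)" "ku u \<in> Hom K 0 (Suc 0)" "kd d \<in> Hom K (Suc 0) (Suc (Suc 0))" "ke e \<in> Hom K (Suc 0) 0"
    by (simp_all add: Hom_def K_Arr)
  show ?thesis unfolding strict_bimonoid_def is_bimonoid_def is_monoid_def is_comonoid_def K_monoid K_comonoid K_compat
    using h mh uh dh eh by auto
qed

lemma strict_bimonoid_hom_K: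
  assumes f: "f \<in> Hom B x1 x1"
  defines "F \<equiv> (Suc 0, Suc 0, f)"
  shows "F o\<^sub>K km m = km m o\<^sub>K (F**\<^sub>KF) \<and> F o\<^sub>K ku u = ku u \<and>
      kd d o\<^sub>K F = (F**\<^sub>KF) o\<^sub>K kd d \<and> ke e o\<^sub>K F = ke e \<longleftrightarrow>
    is_bimonoid_hom B \<lparr>bobj = x1, bmult = m, bunit = u, bcomult = d, bcounit = e\<rparr>
      \<lparr>bobj = x1, bmult = m, bunit = u, bcomult = d, bcounit = e\<rparr> f"
proof -
  have [simp]: "f \<in> Arr B" "Dom B f = x1" "Cod B f = x1" using f by (auto simp: Hom_def)
  have [simp]: "Cod B p11 = P (Suc (Suc 0))" by simp
  have "f o m o inv_arr B p11 = (m o inv_arr B p11) o p11 o (f**f) o inv_arr B p11 \<longleftrightarrow> f o m = m o (f**f)"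
    by (rule test_right[of p11]) (simp_all add: comp_assoc inv_cancel)
  moreover have "f o u o inv_arr B et = u o inv_arr B et \<longleftrightarrow> f o u = u"
    by (rule test_right[of et]) (simp_all add: comp_assoc)
  moreover have "(p11 o d) o f = (p11 o (f**f) o inv_arr B p11) o p11 o d \<longleftrightarrow> d o f = (f**f) o d"
    using cancel_iso_left[of p11 "d o f" "(f**f) o d"] by (simp add: comp_assoc inv_cancel)
  moreover have "(et o e) o f = et o e \<longleftrightarrow> e o f = e"
    using cancel_iso_left[of et "e o f" e] by (simp add: comp_assoc)
  ultimately show ?thesis using f by (simp add: F_def is_bimonoid_hom_def)
qed

end

end

context prob
begin

text \<open>This is the co-opposite bimonoid, which in a braided setting lives over the reverse
  braiding. Its coassociativity is a Yang-Baxter relation; its compatibility with the product is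
  \<open>b22\<close>.\<close>

lemma strict_bimonoid_twist:
  assumes "strict_bimonoid C m u d e"
  shows "strict_bimonoid (rev_braid C) m u (binv C (Suc 0) (Suc 0) o d) e"
proof -
  let ?n = "Suc 0"
  let ?b = "binv C ?n ?n" and ?i = "Id C ?n"
  have h: "m \<in> Hom C (Suc ?n) ?n" "u \<in> Hom C 0 ?n" "d \<in> Hom C ?n (Suc ?n)" "e \<in> Hom C ?n 0"
    using assms unfolding strict_bimonoid_def by blast+
  have [simp]: "m \<in> Arr C" "Dom C m = Suc ?n" "Cod C m = ?n" "u \<in> Arr C" "Dom C u = 0" "Cod C u = ?n"
    "d \<in> Arr C" "Dom C d = ?n" "Cod C d = Suc ?n" "e \<in> Arr C" "Dom C e = ?n" "Cod C e = 0"
    using h by (auto simp: Hom_def)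
  have eq: "(d**?i) o d = (?i**d) o d" "(e**?i) o d = ?i" "(?i**e) o d = ?i"
    "d o m = (m**m) o (?i**braid C ?n ?n**?i) o (d**d)" "d o u = u**u"
    using assms unfolding strict_bimonoid_def by blast+
  have h12: "binv C ?n (Suc ?n) = (?b**?i) o (?i**?b)" "binv C (Suc ?n) ?n = (?i**?b) o (?b**?i)"
    using binv_hex1[of ?n ?n ?n] binv_hex2[of ?n ?n ?n] by simp_all
  have YB: "binv C ?n (Suc ?n) o (?b**?i) = (?i**?b) o binv C ?n (Suc ?n)"
    using binv_nat[of ?i ?b] by simp
  have "((?b o d)**?i) o ?b o d = (((?b o d)**?i) o ?b) o d" by (simp add: comp_assoc)
  also have "((?b o d)**?i) o ?b = binv C (Suc ?n) ?n o (?i**(?b o d))" using binv_nat[of "?b o d" ?i] by simp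
  also have "(binv C (Suc ?n) ?n o (?i**(?b o d))) o d = (?i**?b) o ((?b**?i) o (?i**?b)) o (?i**d) o d"
    unfolding h12 by (simp add: comp_assoc ten_comp_assoc)
  also have "... = ((?i**?b) o binv C ?n (Suc ?n)) o (d**?i) o d" unfolding h12 eq(1) by (simp add: comp_assoc)
  also have "... = (binv C ?n (Suc ?n) o ((?b o d)**?i)) o d" unfolding YB[symmetric] by (simp add: comp_assoc ten_comp_assoc)
  also have "binv C ?n (Suc ?n) o ((?b o d)**?i) = (?i**(?b o d)) o ?b" using binv_nat[of ?i "?b o d"] by simp
  finally have 1: "((?b o d)**?i) o ?b o d = (?i**(?b o d)) o ?b o d" by (simp add: comp_assoc)
  have "(e**?i) o ?b = ?i**e" "(?i**e) o ?b = e**?i" using binv_nat[of e ?i] binv_nat[of ?i e] by simp_all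
  hence 2: "(e**?i) o ?b o d = ?i" "(?i**e) o ?b o d = ?i"
    using comp_assoc[of d ?b "e**?i"] comp_assoc[of d ?b "?i**e"] eq(2,3) by simp_all
  let ?c = "braid C ?n ?n"
  \<comment> \<open>The crossing of two pairs of strands is a product of four crossings. The one
    acting first cancels against \<open>?c\<close>; the others are one for each twisted
    comultiplication and the middle crossing of the reverse braiding.\<close>
  have b22: "binv C (Suc ?n) (Suc ?n) o (?i**?c**?i) = (?i**?b**?i) o (?b**?b)"
  proof -
    have "binv C (Suc ?n) (Suc ?n) = (?i**binv C ?n (Suc ?n)) o (binv C ?n (Suc ?n)**?i)"
      using binv_hex2[of ?n ?n "Suc ?n"] by simp
    also have "... = (?i**?b**?i) o (?i**?i**?b) o (?b**?i**?i) o (?i**?b**?i)"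
    proof -
      have "?i**((?b**?i) o (?i**?b)) = (?i**?b**?i) o (?i**?i**?b)" by (simp add: ten_comp)
      moreover have "((?b**?i) o (?i**?b))**?i = (?b**?i**?i) o (?i**?b**?i)"
        using ten_comp[of "?i**?b" ?i "?b**?i" ?i] by (simp add: ten_assoc)
      ultimately show ?thesis unfolding h12 by (simp add: comp_assoc)
    qed
    finally have "binv C (Suc ?n) (Suc ?n) o (?i**?c**?i) =
      (?i**?b**?i) o ((?i**?i**?b) o (?b**?i**?i)) o (?i**?b**?i) o (?i**?c**?i)"
      by (simp add: comp_assoc)
    also have "(?i**?b**?i) o (?i**?c**?i) = Id C (?n + (Suc ?n + ?n))" by (simp add: ten_comp ten_id)
    also have "(?i**?i**?b) o (?b**?i**?i) = ?b**?b"
    proof -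
      have "?i**?i**?b = Id C (Suc ?n)**?b" "?b**?i**?i = ?b**Id C (Suc ?n)"
        by (simp_all add: ten_id flip: ten_assoc)
      thus ?thesis by (simp add: ten_comp)
    qed
    finally show ?thesis by simp
  qed
  have "(?b o d) o m = ?b o d o m" by (rule comp_assoc) simp_all
  also have "... = (?b o (m**m)) o (?i**?c**?i) o (d**d)" unfolding eq(4) by (simp add: comp_assoc)
  also have "?b o (m**m) = (m**m) o binv C (Suc ?n) (Suc ?n)" using binv_nat[of m m] by simp
  also have "((m**m) o binv C (Suc ?n) (Suc ?n)) o (?i**?c**?i) o (d**d) =
      (m**m) o (binv C (Suc ?n) (Suc ?n) o (?i**?c**?i)) o (d**d)" by (simp add: comp_assoc)
  also have "... = (m**m) o (?i**?b**?i) o ((?b o d)**(?b o d))"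
    unfolding b22 by (simp add: comp_assoc ten_comp)
  finally have 3: "(?b o d) o m = (m**m) o (?i**?b**?i) o ((?b o d)**(?b o d))" .
  have 4: "(?b o d) o u = u**u" using binv_nat[of u u] eq(5) by (simp add: comp_assoc)
  have "?b o d \<in> Hom C ?n (Suc ?n)" by (simp add: Hom_def)
  moreover have H: "Hom (rev_braid C) = Hom C" by (auto simp: Hom_def fun_eq_iff)
  ultimately show ?thesis using assms 1 2 3 4 unfolding strict_bimonoid_def H by simp
qed

lemma rev_rev: "rev_braid (rev_braid C) = C"
  unfolding rev_braid_def[of "rev_braid C"] binv_rev by (simp add: rev_braid_def)

end

text \<open>The case of a single colour whose object is the generator: evaluation becomes a strict
  braided functor \<open>ff\<close> from \<open>Q\<close> to \<open>C\<close>.\<close>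

locale gmonoid1 = prob C + G: group G
  for C :: "(nat, 'a, 'z) bmcat_scheme" (structure) and G :: "('g, 'x) monoid_scheme" +
  fixes m u :: 'a and r :: "'g => 'a"
  assumes gmonoid1: "gmonoid G C (Suc 0) m u r"
begin

sublocale E: gmonoids C G "\<lambda>_::unit. Suc 0" "\<lambda>_. m" "\<lambda>_. u" "\<lambda>_. r"
  by unfold_locales (rule gmonoid1)

definition ff :: "'g qmor => 'a" where "ff f = E.ev (replicate (qcod f) ()) f"

lemma unit_list: "(xs :: unit list) = replicate (length xs) ()"
  by (induction xs) auto

lemma col_unit: "f \<in> Arr G.Q ==> col G (replicate (qcod f) ()) f = replicate (qdom f) ()"
  using unit_list[of "col G (replicate (qcod f) ()) f"] by simp

lemma tot_unit [simp]: "tot (\<lambda>_::unit. Suc 0) xs = length xs"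
  by (induction xs) (auto simp: tot_def)

lemma ff_arr [simp]: "f \<in> Arr G.Q ==> ff f \<in> Arr C" "f \<in> Arr G.Q ==> Dom C (ff f) = qdom f" "f \<in> Arr G.Q ==> Cod C (ff f) = qcod f"
  by (simp_all add: ff_def)

lemma ff_comp: "f \<in> Arr G.Q ==> g \<in> Arr G.Q ==> qcod f = qdom g ==> ff (g\<star>f) = ff g o ff f"
  using E.ev_comp[of f g "replicate (qcod g) ()"] by (simp add: ff_def col_unit)

lemma ff_tensor: "f \<in> Arr G.Q ==> g \<in> Arr G.Q ==> ff (f\<oplus>g) = ff f**ff g"
  using E.ev_tensor[of f g "replicate (qcod f) ()" "replicate (qcod g) ()"] by (simp add: ff_def replicate_add)

lemma ff_Id [simp]: "ff (Id G.Q n) = Id C n"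
  by (simp add: ff_def)

lemma ff_braid: "ff (braid G.Q n k) = braid C n k"
  using E.ev_braid[of "replicate n ()" n "replicate k ()" k] by (simp add: ff_def replicate_add)

lemma ff_m: "ff (q_m G) = m" and ff_u: "ff (q_u G) = u"
  using E.ev_m[of "()"] E.ev_u[of "()"] by (simp_all add: ff_def G.q_m_dq G.q_u_dq)

lemma ff_label: "x \<in> carrier G ==> ff (G.qiso 1 [x] []) = r x"
  using E.ev_label[of x "()"] by (simp add: ff_def)

lemma ff_swap: "ff (G.qiso 2 (G.ones 2) [(1, s)]) = crossing C s (Suc 0) (Suc 0)"
  using E.ev_swap[of "()" "()" s] by (simp add: ff_def numeral_2_eq_2)

end

section \<open>The strict functor on spans determined by a bimonoid with an action of G\<close>

section \<open>The functor on spans defined by a bimonoid\<close>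

text \<open>The reverse braiding is required because left legs of spans, and with them
  \<open>q_sigma23\<close>, are evaluated contravariantly.\<close>

locale bialgebra = prob C + bialgebra_law G L
  for C :: "(nat, 'a, 'z) bmcat_scheme" (structure) and G :: "('g, 'x) monoid_scheme" and L +
  fixes m u d e :: 'a and r :: "'g => 'a"
  assumes bimon: "strict_bimonoid (rev_braid C) m u d e"
    and act: "x \<in> carrier G ==> r x \<in> Hom C (Suc 0) (Suc 0)" "r \<one>\<^bsub>G\<^esub> = Id C (Suc 0)"
      "x \<in> carrier G ==> y \<in> carrier G ==> r (x \<otimes>\<^bsub>G\<^esub> y) = r x o r y"
    and act_hom: "x \<in> carrier G ==> r x o m = m o (r x**r x)" "x \<in> carrier G ==> r x o u = u"
      "x \<in> carrier G ==> d o r x = (r x**r x) o d" "x \<in> carrier G ==> e o r x = e"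
begin

lemmas bimon' = bimon[unfolded strict_bimonoid_def Hom_def, simplified]

sublocale F: gmonoid1 C G m u r
proof
  show "gmonoid G C (Suc 0) m u r"
    using bimon' act act_hom unfolding gmonoid_def by (auto simp: Hom_def)
qed

text \<open>A comonoid in \<open>C\<close> is a monoid in the opposite category. Labels act through
  inverses there, which compensates for the reversed composition and makes the two evaluations of a
  label mutually inverse.\<close>

sublocale F': gmonoid1 "opp C" G d e "\<lambda>x. r (inv\<^bsub>G\<^esub> x)"
proof -
  interpret O: prob "opp C" by (rule prob_opp)
  have H: "f \<in> Hom (opp C) n k \<longleftrightarrow> f \<in> Hom C k n" for f n k by (auto simp: Hom_def)
  show "gmonoid1 (opp C) G d e (\<lambda>x. r (inv\<^bsub>G\<^esub> x))"
  proof
    show "gmonoid G (opp C) (Suc 0) d e (\<lambda>x. r (inv\<^bsub>G\<^esub> x))"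
      using bimon' act act_hom unfolding gmonoid_def H by (auto simp: Hom_def inv_mult_group)
  qed
qed

abbreviation "ff \<equiv> F.ff"
abbreviation "gg \<equiv> F'.ff"

lemma gg_arr [simp]: "f \<in> Arr Q ==> gg f \<in> Arr C" "f \<in> Arr Q ==> Dom C (gg f) = qcod f" "f \<in> Arr Q ==> Cod C (gg f) = qdom f"
  using F'.ff_arr[of f] by simp_all

lemma gg_comp: "f \<in> Arr Q ==> g \<in> Arr Q ==> qcod f = qdom g ==> gg (g\<star>f) = gg f o gg g"
  using F'.ff_comp[of f g] by simp

lemma gg_tensor: "f \<in> Arr Q ==> g \<in> Arr Q ==> gg (f\<oplus>g) = gg f**gg g"
  using F'.ff_tensor[of f g] by simp

text \<open>Generators of the labelled braids suffice; for these the braiding of \<open>opp\<close>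
  and the inverted labels were chosen. The consequence is that the value of a span does not depend
  on its representative.\<close>

lemma gg_inverse:
  assumes "is_iso Q k"
  shows "inverse_arrows C (ff k) (gg k)"
proof -
  obtain n xs w where k: "k = qiso n xs w" "iok n xs w" using Q_iso_cases[OF assms] by blast
  show ?thesis unfolding k(1) using k(2)
  proof (induction rule: qiso_induct)
    case (Id n) show ?case using inverse_arrows_Id[of n] obj_UNIV by simp
  next
    case (comp f g) thus ?case using inverse_arrows_Comp by (simp add: F.ff_comp gg_comp)
  next
    case (tensor f g) thus ?case using inverse_ten by (simp add: F.ff_tensor gg_tensor)
  next
    case (swap s)
    show ?case unfolding F.ff_swap F'.ff_swap
      using inverse_braid[of "Suc 0" "Suc 0"] inverse_arrows_sym[OF inverse_braid[of "Suc 0" "Suc 0"]] by (simp add: crossing_def)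
  next
    case (label x)
    have "r (inv\<^bsub>G\<^esub> x) o r x = Id C (Suc 0)" "r x o r (inv\<^bsub>G\<^esub> x) = Id C (Suc 0)"
      using label act(2) act(3)[of x "inv\<^bsub>G\<^esub> x"] act(3)[of "inv\<^bsub>G\<^esub> x" x] by simp_all
    thus ?case unfolding F.ff_label[OF label] F'.ff_label[OF label]
      using act(1)[of x] act(1)[of "inv\<^bsub>G\<^esub> x"] label by (intro iso_HomI) simp_all
  qed
qed

definition EE :: "('g qmor \<times> 'g qmor) set => 'a" where
  "EE t = (case SOME p. p \<in> t of (a, b) => ff b o gg a)"

text \<open>Changing the representative by \<open>k\<close> inserts \<open>ff k o gg k\<close>,
  which is an identity.\<close>

lemma EE_sp [simp]:
  assumes a: "a \<in> Arr Q" "b \<in> Arr Q" "qdom a = qdom b"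
  shows "EE (sp a b) = ff b o gg a"
proof -
  obtain x y where xy: "(SOME p. p \<in> sp a b) = (x, y)" by fastforce
  hence "(x, y) \<in> sp a b" using Q.span_class_self[of a b] a someI[of "\<lambda>p. p \<in> sp a b" "(a, b)"] by simp
  then obtain k where k: "x = a\<star>k" "y = b\<star>k" "is_iso Q k" "qcod k = qdom a" by (auto simp: span_class_def)
  have kA: "k \<in> Arr Q" using k(3) Q.iso_Hom by blast
  have i: "ff k o gg k = Id C (qdom a)" using gg_inverse[OF k(3)] k(4) kA by (simp add: inverse_arrows_def)
  have "EE (sp a b) = (ff b o ff k) o (gg k o gg a)" unfolding EE_def xy k(1,2) using k a kA by (simp add: F.ff_comp gg_comp)
  also have "... = ff b o (ff k o gg k) o gg a" using k(4) a kA by (simp add: comp_assoc del: binv_braid)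
  finally show ?thesis unfolding i using a by simp
qed

text \<open>The values of the two arrows are exchanged in \<open>C\<close> as the law prescribes.
  Holding for all cospans, this is compatibility of \<open>EE\<close> with composition.\<close>

definition ok :: "'g qmor => 'g qmor => bool" where
  "ok f g \<longleftrightarrow> gg g o ff f = EE (LL f g)"

lemma ok_mem: "f \<in> Arr Q ==> g \<in> Arr Q ==> qcod f = qcod g ==> (a, b) \<in> LL f g ==> ok f g \<longleftrightarrow> gg g o ff f = ff b o gg a"
  using LL_mem[of a b f g] by (simp add: ok_def)

text \<open>The exchange is done first with \<open>f2\<close> and then with \<open>f1\<close>, and
  the multiplication axiom of the law describes its result in the same two steps.\<close>

lemma ok_comp_left:
  assumes f: "f1 \<in> Arr Q" "f2 \<in> Arr Q" "qcod f1 = qdom f2" "g \<in> Arr Q" "qcod f2 = qcod g"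
    and ab: "(a2, b2) \<in> LL f2 g" and ok: "ok f2 g" "ok f1 a2"
  shows "ok (f2\<star>f1) g"
proof -
  note m2 = LL_mem[OF ab f(2,4,5)]
  obtain a1 b1 where ab1: "(a1, b1) \<in> LL f1 a2" using LL_ex[of f1 a2] f m2 by metis
  have m1: "a1 \<in> Arr Q" "b1 \<in> Arr Q" "qdom a1 = qdom b1" "qcod a1 = qdom f1" "qcod b1 = qdom a2"
    using LL_mem[OF ab1] f m2 by simp_all
  have e1: "gg g o ff f2 = ff b2 o gg a2" using ok(1) ok_mem[OF f(2,4,5) ab] by simp
  have e2: "gg a2 o ff f1 = ff b1 o gg a1" using ok(2) ok_mem[OF f(1) m2(1) _ ab1] f m2 by simp
  have "gg g o ff (f2\<star>f1) = (gg g o ff f2) o ff f1" using f by (simp add: F.ff_comp comp_assoc)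
  also have "... = ff b2 o (gg a2 o ff f1)" unfolding e1 using f m2 by (simp add: comp_assoc)
  also have "... = ff (b2\<star>b1) o gg a1" unfolding e2 using f m1 m2 by (simp add: F.ff_comp comp_assoc)
  also have "... = EE (LL (f2\<star>f1) g)" unfolding LL_comp_left[OF f ab ab1] using m1 m2 by simp
  finally show ?thesis by (simp add: ok_def)
qed

lemma ok_comp_right:
  assumes g: "g1 \<in> Arr Q" "g2 \<in> Arr Q" "qcod g1 = qdom g2" "f \<in> Arr Q" "qcod f = qcod g2"
    and ab: "(a2, b2) \<in> LL f g2" and ok: "ok f g2" "ok b2 g1"
  shows "ok f (g2\<star>g1)"
proof -
  note m2 = LL_mem[OF ab g(4,2,5)]
  obtain a1 b1 where ab1: "(a1, b1) \<in> LL b2 g1" using LL_ex[of b2 g1] g m2 by metis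
  have m1: "a1 \<in> Arr Q" "b1 \<in> Arr Q" "qdom a1 = qdom b1" "qcod a1 = qdom b2" "qcod b1 = qdom g1"
    using LL_mem[OF ab1] g m2 by simp_all
  have e1: "gg g2 o ff f = ff b2 o gg a2" using ok(1) ok_mem[OF g(4,2,5) ab] by simp
  have e2: "gg g1 o ff b2 = ff b1 o gg a1" using ok(2) ok_mem[OF m2(2) g(1) _ ab1] g m2 by simp
  have "gg (g2\<star>g1) o ff f = gg g1 o (gg g2 o ff f)" using g by (simp add: gg_comp comp_assoc)
  also have "... = (gg g1 o ff b2) o gg a2" unfolding e1 using g m2 by (simp add: comp_assoc)
  also have "... = ff b1 o gg (a2\<star>a1)" unfolding e2 using g m1 m2 by (simp add: gg_comp comp_assoc)
  also have "... = EE (LL f (g2\<star>g1))" unfolding LL_comp_right[OF g ab ab1] using m1 m2 by simp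
  finally show ?thesis by (simp add: ok_def)
qed

lemma ok_tensor:
  assumes f: "f \<in> Arr Q" "g \<in> Arr Q" "qcod f = qcod g" and f': "f' \<in> Arr Q" "g' \<in> Arr Q" "qcod f' = qcod g'"
    and ok: "ok f g" "ok f' g'"
  shows "ok (f\<oplus>f') (g\<oplus>g')"
proof -
  obtain a b where ab: "(a, b) \<in> LL f g" using LL_ex[OF f] by metis
  obtain a' b' where ab': "(a', b') \<in> LL f' g'" using LL_ex[OF f'] by metis
  note t = LL_mem[OF ab f] LL_mem[OF ab' f']
  have "gg (g\<oplus>g') o ff (f\<oplus>f') = (gg g o ff f)**(gg g' o ff f')"
    using f f' by (simp add: gg_tensor F.ff_tensor ten_comp)
  also have "... = ff (b\<oplus>b') o gg (a\<oplus>a')"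
    using ok ok_mem[OF f ab] ok_mem[OF f' ab'] t by (simp add: gg_tensor F.ff_tensor ten_comp)
  also have "... = EE (LL (f\<oplus>f') (g\<oplus>g'))" unfolding LL_tensor[OF f f' ab ab'] using t by simp
  finally show ?thesis by (simp add: ok_def)
qed

lemma gg_iso:
  assumes "inverse_arrows Q k k'"
  shows "ff k' = gg k" "gg k' = ff k"
proof -
  have k: "is_iso Q k" "is_iso Q k'" using assms Q.inverse_arrows_sym unfolding is_iso_def by blast+
  have t: "k \<in> Arr Q" "k' \<in> Arr Q" "qdom k' = qcod k" "qcod k' = qdom k" "k'\<star>k = Id Q (qdom k)"
    using assms[unfolded inverse_arrows_Q] by blast+
  have v: "gg k o ff k = Id C (qdom k)" "ff k o gg k = Id C (qcod k)"
    using gg_inverse[OF k(1)] t(1) by (simp_all add: inverse_arrows_def)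
  have w: "ff k' o ff k = Id C (qdom k)" using t F.ff_comp[of k k'] by simp
  show "ff k' = gg k"
    by (rule inverse_unique_right[of "ff k"]) (use t v w in simp_all)
  have w': "gg k o gg k' = Id C (qdom k)" using t gg_comp[of k k'] by simp
  show "gg k' = ff k"
    by (rule inverse_unique_right[of "gg k", symmetric]) (use t v w' in simp_all)
qed

lemma ok_iso_left: "is_iso Q k ==> g \<in> Arr Q ==> qcod g = qcod k ==> ok k g"
proof -
  assume k: "is_iso Q k" and g: "g \<in> Arr Q" "qcod g = qcod k"
  obtain k' where i: "inverse_arrows Q k k'" using k unfolding is_iso_def by blast
  note t = i[unfolded inverse_arrows_Q]
  show ?thesis unfolding ok_def LL_iso_left[OF i g] using t g gg_iso[OF i] by (simp add: gg_comp)
qed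

lemma ok_iso_right: "is_iso Q k ==> f \<in> Arr Q ==> qcod f = qcod k ==> ok f k"
proof -
  assume k: "is_iso Q k" and f: "f \<in> Arr Q" "qcod f = qcod k"
  obtain k' where i: "inverse_arrows Q k k'" using k unfolding is_iso_def by blast
  note t = i[unfolded inverse_arrows_Q]
  show ?thesis unfolding ok_def LL_iso_right[OF i f] using t f gg_iso[OF i] by (simp add: F.ff_comp)
qed

lemma dq_iso_cases:
  assumes "f \<in> Arr Q"
  obtains ks k where "f = dq ks\<star>k" "is_iso Q k" "qcod k = sum_list ks" "length ks = qcod f" "k \<in> Arr Q"
proof -
  obtain ks xs w where f: "f = mkq ks xs w" "qok G ks xs w" using assms by (auto simp: Arr_Q)
  hence q: "iok (sum_list ks) xs w" by (simp add: qok_def sum_list_replicate)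
  show ?thesis
    by (rule that[of ks "qiso (sum_list ks) xs w"])
      (use f mkq_decomp[OF f(2)] inverse_qiso[OF q] mkq_Arr[OF q] in \<open>auto simp: is_iso_def sum_list_replicate\<close>)
qed

text \<open>The isomorphism in a factorisation of \<open>f\<close> can be exchanged with anything,
  so order-preserving maps suffice.\<close>

lemma ok_left:
  assumes f: "f \<in> Arr Q" "g \<in> Arr Q" "qcod f = qcod g" and ok: "\<And>ks. length ks = qcod f ==> ok (dq ks) g"
  shows "ok f g"
proof -
  obtain ks k where k: "f = dq ks\<star>k" "is_iso Q k" "qcod k = sum_list ks" "length ks = qcod f" "k \<in> Arr Q"
    using dq_iso_cases[OF f(1)] .
  obtain a b where ab: "(a, b) \<in> LL (dq ks) g" using LL_ex[of "dq ks" g] f k(4) by auto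
  note t = LL_mem[OF ab]
  show ?thesis unfolding k(1)
    by (rule ok_comp_left[of k "dq ks" g a b]) (use ok_iso_left[OF k(2), of a] t f k(2-5) ok[OF k(4)] ab in simp_all)
qed

lemma ok_right:
  assumes f: "f \<in> Arr Q" "g \<in> Arr Q" "qcod f = qcod g" and ok: "\<And>ks. length ks = qcod g ==> ok f (dq ks)"
  shows "ok f g"
proof -
  obtain ks k where k: "g = dq ks\<star>k" "is_iso Q k" "qcod k = sum_list ks" "length ks = qcod g" "k \<in> Arr Q"
    using dq_iso_cases[OF f(2)] .
  obtain a b where ab: "(a, b) \<in> LL f (dq ks)" using LL_ex[of f "dq ks"] f k(4) by auto
  note t = LL_mem[OF ab]
  show ?thesis unfolding k(1)
    by (rule ok_comp_right[of k "dq ks" f a b]) (use ok_iso_right[OF k(2), of b] t f k(2-5) ok[OF k(4)] ab in simp_all)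
qed

end

context group
begin

lemma q_gens_typing [simp]: "q_m G \<in> Arr Q" "qdom (q_m G) = Suc (Suc 0)" "qcod (q_m G) = Suc 0"
  "q_u G \<in> Arr Q" "qdom (q_u G) = 0" "qcod (q_u G) = Suc 0"
  using dq_Arr[of "[2]"] dq_Arr[of "[0]"] unfolding q_m_dq q_u_dq by (simp_all add: numeral_2_eq_2)

lemma q_label_Arr: "x \<in> carrier G ==> qiso 1 [x] [] \<in> Arr Q"
  by (rule mkq_Arr) (simp add: qok_def bwords_def)

end

context bialgebra
begin

lemma law_gens:
  "LL (q_m G) (q_m G) = sp ((q_m G\<oplus>q_m G)\<star>q_sigma23 G) (q_m G\<oplus>q_m G)"
  "LL (q_u G) (q_u G) = sp (Id Q 0) (Id Q 0)"
  "LL (q_m G) (q_u G) = sp (q_u G\<oplus>q_u G) (Id Q 0)"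
  "LL (q_u G) (q_m G) = sp (Id Q 0) (q_u G\<oplus>q_u G)"
  using bimonoid_law unfolding bimonoid_law_def by blast+

lemma sigma23: "q_sigma23 G \<in> Arr Q" "qdom (q_sigma23 G) = Suc (Suc (Suc (Suc 0)))" "qcod (q_sigma23 G) = Suc (Suc (Suc (Suc 0)))"
    "is_iso Q (q_sigma23 G)" "gg (q_sigma23 G) = Id C (Suc 0)**binv C (Suc 0) (Suc 0)**Id C (Suc 0)"
proof -
  have i: "inverse_arrows Q (q_sigma23 G) (Id Q 1\<oplus>binv Q 1 1\<oplus>Id Q 1)"
    unfolding q_sigma23_def q_sigma_braid using Q.inverse_ten Q.inverse_braid Q.inverse_arrows_Id Q.obj_UNIV by (metis UNIV_I)
  thus "is_iso Q (q_sigma23 G)" unfolding is_iso_def by blast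
  show "q_sigma23 G \<in> Arr Q" "qdom (q_sigma23 G) = Suc (Suc (Suc (Suc 0)))" "qcod (q_sigma23 G) = Suc (Suc (Suc (Suc 0)))"
    unfolding q_sigma23_def q_sigma_braid by simp_all
  show "gg (q_sigma23 G) = Id C (Suc 0)**binv C (Suc 0) (Suc 0)**Id C (Suc 0)"
    unfolding q_sigma23_def q_sigma_braid using F'.ff_braid[of "Suc 0" "Suc 0"] by (simp add: gg_tensor)
qed

lemma gens [simp]: "ff (q_m G) = m" "ff (q_u G) = u" "gg (q_m G) = d" "gg (q_u G) = e"
  by (simp_all add: F.ff_m F.ff_u F'.ff_m F'.ff_u)

lemma bim_arr [simp]: "m \<in> Arr C" "Dom C m = Suc (Suc 0)" "Cod C m = Suc 0" "u \<in> Arr C" "Dom C u = 0" "Cod C u = Suc 0"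
  "d \<in> Arr C" "Dom C d = Suc 0" "Cod C d = Suc (Suc 0)" "e \<in> Arr C" "Dom C e = Suc 0" "Cod C e = 0"
  using bimon' by blast+

lemma ok_gens: "ok (q_m G) (q_m G)" "ok (q_u G) (q_u G)" "ok (q_m G) (q_u G)" "ok (q_u G) (q_m G)"
  unfolding ok_def law_gens using bimon' sigma23 by (simp_all add: F.ff_tensor gg_tensor gg_comp)

lemma Id_mem: "g \<in> Arr Q ==> qcod g = n ==> ok (Id Q n) g" "f \<in> Arr Q ==> qcod f = n ==> ok f (Id Q n)"
  using ok_iso_left[OF Q.is_iso_Id, of n g] ok_iso_right[OF Q.is_iso_Id, of n f] Q.obj_UNIV by simp_all

text \<open>\<open>dq [Suc k]\<close> is \<open>q_m\<close> after \<open>dq [k]\<close> on one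
  factor. Exchanging \<open>q_m\<close> with \<open>q_m\<close> leaves two multiplications after
  \<open>q_sigma23\<close> as left leg, treated factor by factor and by
  \<open>ok_iso_right\<close>.\<close>

lemma ok_dq_gens: "ok (dq [k]) (q_m G) \<and> ok (dq [k]) (q_u G)"
proof (induction k)
  case 0 show ?case using ok_gens by (simp add: q_u_dq)
next
  case (Suc k)
  let ?f = "Id Q 1\<oplus>dq [k]"
  have t: "?f \<in> Arr Q" "qdom ?f = Suc k" "qcod ?f = Suc (Suc 0)" by simp_all
  have 1: "ok ?f (q_m G\<oplus>q_m G)"
    using Suc Id_mem(1)[of "q_m G" 1] by (intro ok_tensor) simp_all
  have 2: "ok ?f (q_u G\<oplus>q_u G)"
    using Suc Id_mem(1)[of "q_u G" 1] by (intro ok_tensor) simp_all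
  obtain a b where ab: "(a, b) \<in> LL ?f (q_m G\<oplus>q_m G)" using LL_ex[of ?f "q_m G\<oplus>q_m G"] t by auto
  have b: "b \<in> Arr Q" "qcod b = Suc (Suc (Suc (Suc 0)))" using LL_mem[OF ab] t by simp_all
  have "ok ?f ((q_m G\<oplus>q_m G)\<star>q_sigma23 G)"
    by (rule ok_comp_right[OF _ _ _ _ _ ab 1 ok_iso_right]) (use t b sigma23 in simp_all)
  moreover have "((q_m G\<oplus>q_m G)\<star>q_sigma23 G, q_m G\<oplus>q_m G) \<in> LL (q_m G) (q_m G)"
    unfolding law_gens by (rule Q.span_class_self) (use sigma23 in simp_all)
  ultimately have "ok (q_m G\<star>?f) (q_m G)"
    using ok_gens t by (intro ok_comp_left[of ?f "q_m G" "q_m G"]) simp_all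
  moreover have "(q_u G\<oplus>q_u G, Id Q 0) \<in> LL (q_m G) (q_u G)" unfolding law_gens by (rule Q.span_class_self) simp_all
  hence "ok (q_m G\<star>?f) (q_u G)"
    using ok_gens t 2 by (intro ok_comp_left[of ?f "q_m G" "q_u G"]) simp_all
  ultimately show ?case unfolding dq_Suc by simp
qed

text \<open>Exchanging \<open>dq [j]\<close> with the last multiplication in
  \<open>dq [Suc k]\<close> produces a general arrow into two points, which \<open>ok_left\<close>
  reduces to fibre sizes \<open>[i, l]\<close>. Hence the induction on \<open>k\<close> has to allow
  every \<open>j\<close>.\<close>

lemma ok_dq1: "ok (dq [j]) (dq [k])"
proof (induction k arbitrary: j)
  case 0 show ?case using ok_dq_gens[of j] by (simp add: q_u_dq)
next
  case (Suc k)
  let ?g = "Id Q 1\<oplus>dq [k]"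
  have t: "?g \<in> Arr Q" "qdom ?g = Suc k" "qcod ?g = Suc (Suc 0)" by simp_all
  obtain a b where ab: "(a, b) \<in> LL (dq [j]) (q_m G)" using LL_ex[of "dq [j]" "q_m G"] by auto
  have b: "b \<in> Arr Q" "qcod b = Suc (Suc 0)" using LL_mem[OF ab] by simp_all
  have "ok b ?g"
  proof (rule ok_left)
    fix ks :: "nat list" assume "length ks = qcod b"
    then obtain i l where ks: "ks = [i] @ [l]" using b by (auto simp: length_Suc_conv)
    show "ok (dq ks) ?g" unfolding ks dq_append
      by (rule ok_tensor) (use Suc[of l] Id_mem(2)[of "dq [i]" 1] in simp_all)
  qed (use b t in simp_all)
  thus ?case unfolding dq_Suc using ok_dq_gens[of j] ab t by (intro ok_comp_right[of ?g "q_m G" "dq [j]" a b]) simp_all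
qed

lemma ok_dq: "length js = length ks ==> ok (dq js) (dq ks)"
proof (induction js ks rule: list_induct2)
  case Nil show ?case using Id_mem(1)[of "Id Q 0" 0] dq_Id[of 0] by simp
next
  case (Cons j js k ks)
  thus ?case using ok_tensor[of "dq [j]" "dq [k]" "dq js" "dq ks"] ok_dq1[of j k] dq_append[of "[j]" js] dq_append[of "[k]" ks]
    by (simp del: ok_def)
qed

lemma ok_all: "f \<in> Arr Q ==> g \<in> Arr Q ==> qcod f = qcod g ==> ok f g"
proof (rule ok_left)
  assume g: "f \<in> Arr Q" "g \<in> Arr Q" "qcod f = qcod g"
  fix ks :: "nat list" assume ks: "length ks = qcod f"
  show "ok (dq ks) g" by (rule ok_right) (use g ks ok_dq[of ks] in simp_all)
qed

lemma EE_arr: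
  assumes "t \<in> Arr T"
  shows "EE t \<in> Hom C (Dom T t) (Cod T t)"
  using assms by (auto simp: Arr_T Hom_def)

lemma EE_comp:
  assumes "s \<in> Arr T" "t \<in> Arr T" "Cod T s = Dom T t"
  shows "EE (t o\<^sub>T s) = EE t o EE s"
proof -
  obtain a1 b1 where s: "s = sp a1 b1" "a1 \<in> Arr Q" "b1 \<in> Arr Q" "qdom a1 = qdom b1" using assms by (auto simp: Arr_T)
  obtain a2 b2 where t: "t = sp a2 b2" "a2 \<in> Arr Q" "b2 \<in> Arr Q" "qdom a2 = qdom b2" using assms by (auto simp: Arr_T)
  have c: "qcod b1 = qcod a2" using assms(3) s t by simp
  obtain a b where ab: "(a, b) \<in> LL b1 a2" using LL_ex[of b1 a2] s t c by metis
  note l = LL_mem[OF ab s(3) t(2) c]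
  have e: "gg a2 o ff b1 = ff b o gg a" using ok_all[OF s(3) t(2) c] ok_mem[OF s(3) t(2) c ab] by simp
  have "EE (t o\<^sub>T s) = ff b2 o (ff b o gg a) o gg a1"
    unfolding s(1) t(1) T_comp[OF s(2-4) t(2-4) c ab] using s(2-4) t(2-4) l c by (simp add: F.ff_comp gg_comp comp_assoc)
  also have "... = EE t o EE s" unfolding e[symmetric] using s t c by (simp add: comp_assoc)
  finally show ?thesis .
qed

lemma EE_tensor:
  assumes "s \<in> Arr T" "t \<in> Arr T"
  shows "EE (s**\<^sub>Tt) = EE s**EE t"
proof -
  obtain a1 b1 where s: "s = sp a1 b1" "a1 \<in> Arr Q" "b1 \<in> Arr Q" "qdom a1 = qdom b1" using assms by (auto simp: Arr_T)
  obtain a2 b2 where t: "t = sp a2 b2" "a2 \<in> Arr Q" "b2 \<in> Arr Q" "qdom a2 = qdom b2" using assms by (auto simp: Arr_T)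
  show ?thesis using s t by (simp add: F.ff_tensor gg_tensor ten_comp)
qed

lemma EE_Id: "EE (Id T n) = Id C n" and EE_braid: "EE (braid T n k) = braid C n k"
  by (simp_all add: F.ff_braid)

lemma EE_gens: "EE (J (q_m G)) = m" "EE (J (q_u G)) = u" "EE (J' (q_m G)) = d" "EE (J' (q_u G)) = e"
  "x \<in> carrier G ==> EE (J (qiso 1 [x] [])) = r x"
proof -
  show "x \<in> carrier G ==> EE (J (qiso 1 [x] [])) = r x"
    using q_label_Arr[of x] act(1)[of x] F.ff_label[of x] by (simp add: Hom_def)
qed simp_all

end

section \<open>Bracketed powers of an object and their comparison arrows\<close>

section \<open>Powers of an object\<close>

context braided_monoidal_category
begin

declare comp_arr [simp] comp_dom [simp] comp_cod [simp] comp_id_left [simp] comp_id_right [simp] tunit_Obj [simp] tobj_Obj [simp]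
  assoc_iso [simp] lunit_iso [simp] runit_iso [simp] braid_iso [simp]

lemma canonical_iso: "f \<in> canonical B ==> is_iso B f"
proof (induction rule: canonical.induct)
  case (can_inverse f g) thus ?case using inverse_arrows_sym unfolding is_iso_def by blast
qed auto

lemma canonical_inv: "f \<in> canonical B ==> inv_arr B f \<in> canonical B"
  by (rule can_inverse[OF _ inverse_arrows_inv_arr[OF canonical_iso]])

text \<open>Naturality of the unitors makes tensoring with the unit isomorphic to the identity
  functor.\<close>

lemma ten_unit_faithful:
  assumes f: "f \<in> Arr B" "g \<in> Arr B" "Dom B f = Dom B g" "Cod B f = Cod B g"
  shows "f**Id B (tunit B) = g**Id B (tunit B) ==> f = g" "Id B (tunit B)**f = Id B (tunit B)**g ==> f = g"
proof -
  have o: "Dom B g \<in> Obj B" "Cod B g \<in> Obj B" using f Dom_Obj Cod_Obj by auto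
  have "f \<in> Hom B (Dom B g) (Cod B g)" "g \<in> Hom B (Dom B g) (Cod B g)" using f by (auto simp: Hom_def)
  note r = runit_nat[OF this(1)] runit_nat[OF this(2)] and l = lunit_nat[OF this(1)] lunit_nat[OF this(2)]
  show "f = g" if "f**Id B (tunit B) = g**Id B (tunit B)"
    using cancel_iso_right[of "runit B (Dom B g)" f g] r that f o by simp
  show "f = g" if "Id B (tunit B)**f = Id B (tunit B)**g"
    using cancel_iso_right[of "lunit B (Dom B g)" f g] l that f o by simp
qed

context
  fixes X Y assumes X [simp]: "X \<in> Obj B" and Y [simp]: "Y \<in> Obj B"
begin

text \<open>A classical consequence of triangle and pentagon. Both sides are first tensored with the
  unit on the right, where the triangles can be inserted; \<open>ten_unit_faithful\<close> removes
  the extra factor.\<close>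

lemma runit_tensor: "runit B (X \<odot> Y) = (Id B X**runit B Y) o assoc B X Y (tunit B)"
proof -
  let ?I = "tunit B"
  let ?i = "Id B ?I" and ?f = "(Id B X**runit B Y) o assoc B X Y ?I"
  have "assoc B X Y ?I o (?f**?i) = (assoc B X Y ?I o ((Id B X**runit B Y)**?i)) o (assoc B X Y ?I**?i)"
    by (simp add: comp_assoc ten_comp')
  also have "assoc B X Y ?I o ((Id B X**runit B Y)**?i) = (Id B X**(runit B Y**?i)) o assoc B X (Y \<odot> ?I) ?I"
    using assoc_nat'[of "Id B X" "runit B Y" ?i] by simp
  also have "Id B X**(runit B Y**?i) = (Id B X**Id B Y**lunit B ?I) o (Id B X**assoc B Y ?I ?I)"
    using triangle[of Y ?I] by (simp add: ten_comp')
  also have "(((Id B X**Id B Y**lunit B ?I) o (Id B X**assoc B Y ?I ?I)) o assoc B X (Y \<odot> ?I) ?I) o (assoc B X Y ?I**?i)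
      = (Id B X**Id B Y**lunit B ?I) o assoc B X Y (?I \<odot> ?I) o assoc B (X \<odot> Y) ?I ?I"
    using pentagon[of X Y ?I ?I] by (simp add: comp_assoc)
  also have "... = (assoc B X Y ?I o (Id B (X \<odot> Y)**lunit B ?I)) o assoc B (X \<odot> Y) ?I ?I"
    using assoc_nat'[of "Id B X" "Id B Y" "lunit B ?I"] by (simp add: tarr_Id comp_assoc[symmetric])
  also have "... = assoc B X Y ?I o (runit B (X \<odot> Y)**?i)" using triangle[of "X \<odot> Y" ?I] by (simp add: comp_assoc)
  finally have "?f**?i = runit B (X \<odot> Y)**?i"
    using cancel_iso_left[of "assoc B X Y ?I" "?f**?i" "runit B (X \<odot> Y)**?i"] by simp
  thus ?thesis using ten_unit_faithful(1)[of ?f "runit B (X \<odot> Y)"] by simp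
qed

text \<open>The same argument with an extra unit on the left.\<close>

lemma lunit_tensor: "lunit B (X \<odot> Y) o assoc B (tunit B) X Y = lunit B X**Id B Y"
proof -
  let ?I = "tunit B"
  let ?i = "Id B ?I" and ?f = "lunit B (X \<odot> Y) o assoc B ?I X Y"
  let ?k = "assoc B ?I (?I \<odot> X) Y o (assoc B ?I ?I X**Id B Y)"
  have "(?i**?f) o ?k = (?i**lunit B (X \<odot> Y)) o (?i**assoc B ?I X Y) o ?k" by (simp add: ten_comp_assoc')
  also have "... = ((?i**lunit B (X \<odot> Y)) o assoc B ?I ?I (X \<odot> Y)) o assoc B (?I \<odot> ?I) X Y"
    unfolding pentagon[OF tunit_Obj tunit_Obj X Y] by (simp add: comp_assoc)
  also have "... = (runit B ?I**Id B X**Id B Y) o assoc B (?I \<odot> ?I) X Y" using triangle[of ?I "X \<odot> Y"] by (simp add: tarr_Id)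
  also have "... = assoc B ?I X Y o ((runit B ?I**Id B X)**Id B Y)" using assoc_nat'[of "runit B ?I" "Id B X" "Id B Y"] by simp
  also have "(runit B ?I**Id B X)**Id B Y = ((?i**lunit B X)**Id B Y) o (assoc B ?I ?I X**Id B Y)"
    using triangle[of ?I X] by (simp add: ten_comp')
  also have "assoc B ?I X Y o ((?i**lunit B X)**Id B Y) o (assoc B ?I ?I X**Id B Y) =
      (assoc B ?I X Y o ((?i**lunit B X)**Id B Y)) o (assoc B ?I ?I X**Id B Y)" by (simp add: comp_assoc)
  also have "assoc B ?I X Y o ((?i**lunit B X)**Id B Y) = (?i**lunit B X**Id B Y) o assoc B ?I (?I \<odot> X) Y"
    using assoc_nat'[of ?i "lunit B X" "Id B Y"] by simp
  finally have "(?i**?f) o ?k = (?i**lunit B X**Id B Y) o ?k" by (simp add: comp_assoc)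
  hence "?i**?f = ?i**lunit B X**Id B Y"
    using cancel_iso_right[of ?k "?i**?f" "?i**lunit B X**Id B Y"] by simp
  thus ?thesis using ten_unit_faithful(2)[of ?f "lunit B X**Id B Y"] by simp
qed

end

text \<open>Naturality of \<open>lunit\<close> against itself evaluates it on the square of the
  unit. Comparing \<open>lunit_tensor\<close> with the triangle then gives the equality after
  tensoring with the unit.\<close>

lemma lunit_runit: "lunit B (tunit B) = runit B (tunit B)"
proof -
  let ?I = "tunit B"
  let ?i = "Id B ?I"
  have "lunit B ?I o (?i**lunit B ?I) = lunit B ?I o lunit B (?I \<odot> ?I)" using lunit_nat[OF lunit_Hom[OF tunit_Obj]] .
  hence "?i**lunit B ?I = lunit B (?I \<odot> ?I)"
    using cancel_iso_left[of "lunit B ?I" "?i**lunit B ?I" "lunit B (?I \<odot> ?I)"] by simp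
  hence "lunit B ?I**?i = runit B ?I**?i" using lunit_tensor[of ?I ?I] triangle[of ?I ?I] by simp
  thus ?thesis using ten_unit_faithful(1)[of "lunit B ?I" "runit B ?I"] by simp
qed

text \<open>Powers are bracketed to the left and start from the unit. The first power is therefore
  the unit tensored with \<open>X\<close> rather than \<open>X\<close>, which
  \<open>powers_exist\<close> repairs.\<close>

primrec pw :: "'o => nat => 'o" where
  "pw X 0 = tunit B" | "pw X (Suc n) = pw X n \<odot> X"

primrec px :: "'o => nat => nat => 'a" where
  "px X n 0 = runit B (pw X n)"
| "px X n (Suc m) = (px X n m**Id B X) o inv_arr B (assoc B (pw X n) (pw X m) X)"

context
  fixes X assumes X [simp]: "X \<in> Obj B"
begin

lemma pw_Obj [simp]: "pw X n \<in> Obj B"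
  by (induction n) auto

lemma px_canonical: "px X n m \<in> canonical B \<and> px X n m \<in> Hom B (pw X n \<odot> pw X m) (pw X (n + m))"
proof (induction m)
  case 0 show ?case by (simp add: can_runit Hom_def)
next
  case (Suc m)
  hence [simp]: "px X n m \<in> canonical B" "px X n m \<in> Arr B" "Dom B (px X n m) = pw X n \<odot> pw X m" "Cod B (px X n m) = pw X (n + m)"
    by (auto simp: Hom_def)
  show ?case using canonical_inv[OF can_assoc[of "pw X n" B "pw X m" X]]
    by (auto simp: Hom_def intro!: can_Comp can_tarr can_Id)
qed

lemma px_simps [simp]: "px X n m \<in> Arr B" "Dom B (px X n m) = pw X n \<odot> pw X m" "Cod B (px X n m) = pw X (n + m)" "is_iso B (px X n m)"
  using px_canonical[of n m] canonical_iso by (auto simp: Hom_def)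

lemma pentagon_inv:
  assumes [simp]: "U \<in> Obj B" "V \<in> Obj B" "W \<in> Obj B" "Z \<in> Obj B"
  shows "(assoc B U V W**Id B Z) o inv_arr B (assoc B (U \<odot> V) W Z) =
    inv_arr B (assoc B U (V \<odot> W) Z) o (Id B U**inv_arr B (assoc B V W Z)) o assoc B U V (W \<odot> Z)"
proof -
  let ?l = "(assoc B U V W**Id B Z) o inv_arr B (assoc B (U \<odot> V) W Z)" and ?k = "assoc B (U \<odot> V) W Z"
  let ?r = "inv_arr B (assoc B U (V \<odot> W) Z) o (Id B U**inv_arr B (assoc B V W Z)) o assoc B U V (W \<odot> Z)"
  have "?r o ?k = inv_arr B (assoc B U (V \<odot> W) Z) o (Id B U**inv_arr B (assoc B V W Z)) o assoc B U V (W \<odot> Z) o ?k"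
    by (simp add: comp_assoc)
  also have "... = assoc B U V W**Id B Z"
    unfolding pentagon[OF assms, symmetric] by (simp add: ten_comp_assoc' inv_cancel tarr_Id)
  finally have "?l o ?k = ?r o ?k" by (simp add: comp_assoc)
  thus ?thesis using cancel_iso_right[of ?k ?l ?r] by simp
qed

lemma assoc_nat_inv:
  assumes [simp]: "f \<in> Arr B" "g \<in> Arr B" "h \<in> Arr B"
  shows "inv_arr B (assoc B (Cod B f) (Cod B g) (Cod B h)) o (f**g**h) = ((f**g)**h) o inv_arr B (assoc B (Dom B f) (Dom B g) (Dom B h))"
proof -
  let ?a = "assoc B (Cod B f) (Cod B g) (Cod B h)" and ?b = "assoc B (Dom B f) (Dom B g) (Dom B h)"
  have [simp]: "Dom B f \<in> Obj B" "Cod B f \<in> Obj B" "Dom B g \<in> Obj B" "Cod B g \<in> Obj B" "Dom B h \<in> Obj B" "Cod B h \<in> Obj B"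
    using Dom_Obj Cod_Obj assms by auto
  have "inv_arr B ?a o (f**g**h) = inv_arr B ?a o ((f**g**h) o ?b) o inv_arr B ?b" by (simp add: comp_assoc)
  also have "... = ((f**g)**h) o inv_arr B ?b" unfolding assoc_nat'[OF assms, symmetric] by (simp add: comp_assoc inv_cancel)
  finally show ?thesis .
qed

text \<open>Induction on the last exponent: the base case is \<open>runit_tensor\<close>, and the
  step is one pentagon in the form \<open>pentagon_inv\<close>.\<close>

lemma px_assoc: "px X (n + m) k o (px X n m**Id B (pw X k)) =
    px X n (m + k) o (Id B (pw X n)**px X m k) o assoc B (pw X n) (pw X m) (pw X k)"
proof (induction k)
  case 0
  have "runit B (pw X (n + m)) o (px X n m**Id B (tunit B)) = px X n m o runit B (pw X n \<odot> pw X m)"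
    using runit_nat[of "px X n m" "pw X n \<odot> pw X m" "pw X (n + m)"] px_canonical[of n m] by simp
  thus ?case using runit_tensor[of "pw X n" "pw X m"] by simp
next
  case (Suc k)
  let ?n = "pw X n" and ?m = "pw X m" and ?k = "pw X k"
  have "px X (n + m) (Suc k) o (px X n m**Id B (pw X (Suc k))) =
     (px X (n + m) k**Id B X) o (inv_arr B (assoc B (pw X (n + m)) ?k X) o (px X n m**Id B ?k**Id B X))"
    by (simp add: comp_assoc tarr_Id)
  also have "inv_arr B (assoc B (pw X (n + m)) ?k X) o (px X n m**Id B ?k**Id B X) =
      ((px X n m**Id B ?k)**Id B X) o inv_arr B (assoc B (?n \<odot> ?m) ?k X)"
    using assoc_nat_inv[of "px X n m" "Id B ?k" "Id B X"] by simp
  also have "(px X (n + m) k**Id B X) o ((px X n m**Id B ?k)**Id B X) o inv_arr B (assoc B (?n \<odot> ?m) ?k X) =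
     ((px X (n + m) k o (px X n m**Id B ?k))**Id B X) o inv_arr B (assoc B (?n \<odot> ?m) ?k X)"
    by (simp add: ten_comp_assoc')
  also have "... = ((px X n (m + k) o (Id B ?n**px X m k))**Id B X) o (assoc B ?n ?m ?k**Id B X) o inv_arr B (assoc B (?n \<odot> ?m) ?k X)"
    unfolding Suc by (simp add: ten_comp_assoc' comp_assoc)
  also have "(assoc B ?n ?m ?k**Id B X) o inv_arr B (assoc B (?n \<odot> ?m) ?k X) =
      inv_arr B (assoc B ?n (?m \<odot> ?k) X) o (Id B ?n**inv_arr B (assoc B ?m ?k X)) o assoc B ?n ?m (?k \<odot> X)"
    by (rule pentagon_inv) simp_all
  also have "((px X n (m + k) o (Id B ?n**px X m k))**Id B X) o inv_arr B (assoc B ?n (?m \<odot> ?k) X) o (Id B ?n**inv_arr B (assoc B ?m ?k X)) o assoc B ?n ?m (?k \<odot> X) =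
      (px X n (m + k)**Id B X) o (((Id B ?n**px X m k)**Id B X) o inv_arr B (assoc B ?n (?m \<odot> ?k) X)) o (Id B ?n**inv_arr B (assoc B ?m ?k X)) o assoc B ?n ?m (?k \<odot> X)"
    by (simp add: ten_comp_assoc' comp_assoc)
  also have "((Id B ?n**px X m k)**Id B X) o inv_arr B (assoc B ?n (?m \<odot> ?k) X) =
      inv_arr B (assoc B ?n (pw X (m + k)) X) o (Id B ?n**px X m k**Id B X)"
    using assoc_nat_inv[of "Id B ?n" "px X m k" "Id B X"] by simp
  also have "(px X n (m + k)**Id B X) o (inv_arr B (assoc B ?n (pw X (m + k)) X) o (Id B ?n**px X m k**Id B X)) o (Id B ?n**inv_arr B (assoc B ?m ?k X)) o assoc B ?n ?m (?k \<odot> X) =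
     px X n (m + Suc k) o (Id B ?n**px X m (Suc k)) o assoc B ?n ?m (pw X (Suc k))"
    by (simp add: ten_comp_assoc' comp_assoc)
  finally show ?case .
qed

lemma px_lunit: "px X 0 n = lunit B (pw X n)"
proof (induction n)
  case 0 show ?case by (simp add: lunit_runit)
next
  case (Suc n)
  have "(lunit B (pw X n)**Id B X) o inv_arr B (assoc B (tunit B) (pw X n) X) = lunit B (pw X n \<odot> X)"
    unfolding lunit_tensor[OF pw_Obj X, symmetric] by (simp add: comp_assoc)
  thus ?case using Suc by simp
qed

lemma powers_pw: "powers B (pw X) (px X) (Id B (tunit B))"
  by unfold_locales (use px_canonical px_assoc px_lunit in \<open>simp_all add: tarr_Id Hom_def\<close>)

end

end

context powers
begin

text \<open>The inverse isomorphisms cancel inside the coherence equations, and naturality of the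
  associator and unitors carries the rest. This permits a change of the individual powers up to
  isomorphism.\<close>

lemma powers_transport:
  assumes th: "\<And>n. is_iso B (th n)" "\<And>n. Dom B (th n) = P n"
  shows "powers B (\<lambda>n. Cod B (th n)) (\<lambda>n m. th (n + m) o pm n m o (inv_arr B (th n)**inv_arr B (th m))) (th 0 o et)"
proof -
  have [simp]: "th n \<in> Arr B" "Dom B (th n) = P n" "is_iso B (th n)" "Cod B (th n) \<in> Obj B" for n
    using th iso_Arr[of "th n"] Cod_Obj by auto
  let ?t = "\<lambda>n. inv_arr B (th n)" and ?P = "\<lambda>n. Cod B (th n)"
  let ?p = "\<lambda>n m. th (n + m) o pm n m o (?t n**?t m)"
  have t: "?t n \<in> Hom B (?P n) (P n)" for n unfolding Hom_def mem_Collect_eq by (intro conjI; simp)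
  have H: "?p n m \<in> Hom B (?P n \<odot> ?P m) (?P (n + m))" for n m
    unfolding Hom_def mem_Collect_eq by (intro conjI; simp)
  have I: "is_iso B (?p n m)" for n m by simp
  have A: "?p (n + m) k o (?p n m**Id B (?P k)) = ?p n (m + k) o (Id B (?P n)**?p m k) o assoc B (?P n) (?P m) (?P k)" for n m k
  proof -
  have "?p (n + m) k o (?p n m**Id B (?P k)) = th (n + m + k) o (pm (n + m) k o (pm n m**Id B (P k))) o ((?t n**?t m)**?t k)"
    by (simp add: comp_assoc ten_comp_assoc' ten_comp' inv_cancel)
  also have "... = th (n + m + k) o pm n (m + k) o (Id B (P n)**pm m k) o (assoc B (P n) (P m) (P k) o ((?t n**?t m)**?t k))"
    unfolding pm_assoc by (simp add: comp_assoc add.assoc)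
  also have "assoc B (P n) (P m) (P k) o ((?t n**?t m)**?t k) = (?t n**?t m**?t k) o assoc B (?P n) (?P m) (?P k)"
    using assoc_nat'[of "?t n" "?t m" "?t k"] by simp
  also have "th (n + m + k) o pm n (m + k) o (Id B (P n)**pm m k) o (?t n**?t m**?t k) o assoc B (?P n) (?P m) (?P k) =
     ?p n (m + k) o (Id B (?P n)**?p m k) o assoc B (?P n) (?P m) (?P k)"
    by (simp add: comp_assoc ten_comp_assoc' ten_comp' inv_cancel add.assoc)
  finally show ?thesis .
  qed
  have L: "?p 0 n o ((th 0 o et)**Id B (?P n)) = lunit B (?P n)" for n
  proof -
  have "?p 0 n o ((th 0 o et)**Id B (?P n)) = th n o (pm 0 n o (et**Id B (P n))) o (Id B (tunit B)**?t n)"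
    by (simp add: comp_assoc ten_comp_assoc' ten_comp' inv_cancel)
  also have "... = th n o ?t n o lunit B (?P n)" unfolding pm_lunit unfolding lunit_nat[OF t] ..
  finally show ?thesis by (simp add: inv_cancel)
  qed
  have R: "?p n 0 o (Id B (?P n)**(th 0 o et)) = runit B (?P n)" for n
  proof -
  have "?p n 0 o (Id B (?P n)**(th 0 o et)) = th n o (pm n 0 o (Id B (P n)**et)) o (?t n**Id B (tunit B))"
    by (simp add: comp_assoc ten_comp_assoc' ten_comp' inv_cancel)
  also have "... = th n o ?t n o runit B (?P n)" unfolding pm_runit unfolding runit_nat[OF t] ..
  finally show ?thesis by (simp add: inv_cancel)
  qed
  have E: "th 0 o et \<in> Hom B (tunit B) (?P 0)" "is_iso B (th 0 o et)"
    unfolding Hom_def mem_Collect_eq by (intro conjI; simp) simp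
  show ?thesis
    by (unfold_locales; (rule H I A L R E)?) simp
qed

end

lemma (in braided_monoidal_category) powers_exist:
  assumes X: "X \<in> Obj B"
  obtains P pm et where "powers B P pm et" "P (Suc 0) = X" "\<And>n m. pm n m \<in> canonical B" "et \<in> canonical B"
proof -
  interpret p: powers B "pw X" "px X" "Id B (tunit B)" by (rule powers_pw[OF X])
  \<comment> \<open>Only the first power is changed: \<open>lunit B X\<close> identifies it with
    \<open>X\<close>. The equality \<open>P (Suc 0) = X\<close> later allows a given bimonoid to be
    recovered on the nose.\<close>
  define th where "th n = (if n = Suc 0 then lunit B X else Id B (pw X n))" for n
  have c: "th n \<in> canonical B" "Dom B (th n) = pw X n" for n using X by (auto simp: th_def can_lunit can_Id)
  note a = canonical_iso[OF c(1)]
  have [simp]: "th n \<in> Arr B" for n using iso_Arr a by blast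
  note px = px_canonical[OF X, unfolded Hom_def]
  show ?thesis
  proof (rule that[OF p.powers_transport[of th]])
    show "Cod B (th (Suc 0)) = X" using X by (simp add: th_def)
    show "th (n + m) o px X n m o (inv_arr B (th n)**inv_arr B (th m)) \<in> canonical B" for n m
      using px[of n m] c a canonical_inv[OF c(1)] by (auto intro!: can_Comp can_tarr)
    show "th 0 o Id B (tunit B) \<in> canonical B" using c(2)[of 0] by (auto intro!: can_Comp can_Id c(1))
  qed (use a c in auto)
qed

section \<open>The bimonoid with action of G carried by the generating object of an algebra\<close>

section \<open>The bimonoid of an algebra\<close>

context group
begin

abbreviation "lb x \<equiv> mkq [Suc 0] [x] []"

lemma lb_one: "lb \<one> = Id Q (Suc 0)"
  using base_gmonoid by (simp add: gmonoid_def)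

lemma lb_mult: "x \<in> carrier G ==> y \<in> carrier G ==> lb (x \<otimes> y) = lb x\<star>lb y"
  using base_gmonoid by (simp add: gmonoid_def)

lemma lb_inverse: "x \<in> carrier G ==> inverse_arrows Q (lb x) (lb (inv x))"
  using lb_mult[of x "inv x"] lb_mult[of "inv x" x] lb_one by (simp add: inverse_arrows_Q)

lemma q_rel: "q_m G\<star>(q_m G\<oplus>Id Q (Suc 0)) = q_m G\<star>(Id Q (Suc 0)\<oplus>q_m G)"
  "q_m G\<star>(q_u G\<oplus>Id Q (Suc 0)) = Id Q (Suc 0)" "q_m G\<star>(Id Q (Suc 0)\<oplus>q_u G) = Id Q (Suc 0)"
  "x \<in> carrier G ==> lb x\<star>q_m G = q_m G\<star>(lb x\<oplus>lb x)" "x \<in> carrier G ==> lb x\<star>q_u G = q_u G"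
  using base_gmonoid unfolding gmonoid_def by auto

end

context bialgebra_law
begin

lemma T_arr_comp:
  assumes "s \<in> Arr T" "t \<in> Arr T" "Cod T s = Dom T t"
  shows "t o\<^sub>T s \<in> Arr T" "Dom T (t o\<^sub>T s) = Dom T s" "Cod T (t o\<^sub>T s) = Cod T t"
proof -
  obtain a1 b1 where s: "s = sp a1 b1" "a1 \<in> Arr Q" "b1 \<in> Arr Q" "qdom a1 = qdom b1" using assms by (auto simp: Arr_T)
  obtain a2 b2 where t: "t = sp a2 b2" "a2 \<in> Arr Q" "b2 \<in> Arr Q" "qdom a2 = qdom b2" using assms by (auto simp: Arr_T)
  have c: "qcod b1 = qcod a2" using assms(3) s t by simp
  obtain a b where ab: "(a, b) \<in> LL b1 a2" using LL_ex[of b1 a2] s t c by metis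
  note l = LL_mem[OF ab s(3) t(2) c]
  show "t o\<^sub>T s \<in> Arr T" "Dom T (t o\<^sub>T s) = Dom T s" "Cod T (t o\<^sub>T s) = Cod T t"
    unfolding s(1) t(1) T_comp[OF s(2-4) t(2-4) c ab] using s(2-4) t(2-4) l c by simp_all
qed

lemma T_arr_ten:
  assumes "s \<in> Arr T" "t \<in> Arr T"
  shows "s**\<^sub>Tt \<in> Arr T" "Dom T (s**\<^sub>Tt) = Dom T s + Dom T t" "Cod T (s**\<^sub>Tt) = Cod T s + Cod T t"
proof -
  obtain a1 b1 where s: "s = sp a1 b1" "a1 \<in> Arr Q" "b1 \<in> Arr Q" "qdom a1 = qdom b1" using assms by (auto simp: Arr_T)
  obtain a2 b2 where t: "t = sp a2 b2" "a2 \<in> Arr Q" "b2 \<in> Arr Q" "qdom a2 = qdom b2" using assms by (auto simp: Arr_T)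
  show "s**\<^sub>Tt \<in> Arr T" "Dom T (s**\<^sub>Tt) = Dom T s + Dom T t" "Cod T (s**\<^sub>Tt) = Cod T s + Cod T t"
    using s t by simp_all
qed

lemma J_arr [simp]: "f \<in> Arr Q ==> J f \<in> Arr T" "f \<in> Arr Q ==> Dom T (J f) = qdom f" "f \<in> Arr Q ==> Cod T (J f) = qcod f"
  "f \<in> Arr Q ==> J' f \<in> Arr T" "f \<in> Arr Q ==> Dom T (J' f) = qcod f" "f \<in> Arr Q ==> Cod T (J' f) = qdom f"
  by simp_all

lemma J_Id: "J (Id Q n) = Id T n" "J' (Id Q n) = Id T n"
  by simp_all

lemma J_cong: "f \<in> Arr Q ==> g \<in> Arr Q ==> qcod f = qdom g ==> h \<in> Arr Q ==> k \<in> Arr Q ==> qcod h = qdom k ==>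
    g\<star>f = k\<star>h ==> J g o\<^sub>T J f = J k o\<^sub>T J h \<and> J' f o\<^sub>T J' g = J' h o\<^sub>T J' k"
  using J_comp[of f g] J_comp[of h k] J'_comp[of f g] J'_comp[of h k] by simp

lemma J_cong': "f \<in> Arr Q ==> g \<in> Arr Q ==> qcod f = qdom g ==> g\<star>f = h ==>
    J g o\<^sub>T J f = J h \<and> J' f o\<^sub>T J' g = J' h"
  using J_comp[of f g] J'_comp[of f g] by simp

text \<open>\<open>T\<close> with the reverse braiding; the inverse of a forward crossing is the
  same crossing as a backward arrow.\<close>

definition "T' = T\<lparr>braid := \<lambda>n m. J' (braid Q m n)\<rparr>"

lemma T'_simps: "Comp T' = Comp T" "tarr T' = tarr T" "Id T' = Id T" "Hom T' = Hom T" "braid T' n m = J' (braid Q m n)"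
  by (auto simp: T'_def Hom_def fun_eq_iff)

text \<open>The four values of the law on generators are the four compatibilities. The other laws
  are relations in \<open>Q\<close>, read forwards for the monoid and backwards for the
  comonoid.\<close>

lemma strict_bimonoid_T': "strict_bimonoid T' (J (q_m G)) (J (q_u G)) (J' (q_m G)) (J' (q_u G))"
proof -
  let ?m = "q_m G" and ?u = "q_u G" and ?i = "Id Q (Suc 0)"
  have law: "LL ?m ?m = sp ((?m\<oplus>?m)\<star>q_sigma23 G) (?m\<oplus>?m)" "LL ?u ?u = sp (Id Q 0) (Id Q 0)"
    "LL ?m ?u = sp (?u\<oplus>?u) (Id Q 0)" "LL ?u ?m = sp (Id Q 0) (?u\<oplus>?u)"
    using bimonoid_law unfolding bimonoid_law_def by blast+
  have s: "q_sigma23 G \<in> Arr Q" "qdom (q_sigma23 G) = Suc (Suc (Suc (Suc 0)))" "qcod (q_sigma23 G) = Suc (Suc (Suc (Suc 0)))"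
    unfolding q_sigma23_def q_sigma_braid by simp_all
  have JJ: "J' g o\<^sub>T J f = sp a b" if "f \<in> Arr Q" "g \<in> Arr Q" "qcod f = qcod g" "LL f g = sp a b" "a \<in> Arr Q" "b \<in> Arr Q" "qdom a = qdom b" for f g a b
    using J'_J[OF that(1-3), of a b] Q.span_class_self[of a b] that by simp
  have "J' ?m o\<^sub>T J ?m = J (?m\<oplus>?m) o\<^sub>T J' ((?m\<oplus>?m)\<star>q_sigma23 G)"
    unfolding JJ[OF _ _ _ law(1)] using T_comp_J[of "(?m\<oplus>?m)\<star>q_sigma23 G" "?m\<oplus>?m"]
      JJ[OF _ _ _ law(1)] s by simp
  also have "J' ((?m\<oplus>?m)\<star>q_sigma23 G) = J' (q_sigma23 G) o\<^sub>T J' (?m\<oplus>?m)"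
    by (rule J'_comp) (use s in simp_all)
  also have "J' (q_sigma23 G) = Id T (Suc 0)**\<^sub>TJ' (braid Q (Suc 0) (Suc 0))**\<^sub>TId T (Suc 0)"
    unfolding q_sigma23_def q_sigma_braid by (simp add: Q.ten_id)
  finally have 1: "J' ?m o\<^sub>T J ?m = (J ?m**\<^sub>TJ ?m) o\<^sub>T (Id T (Suc 0)**\<^sub>TJ' (braid Q (Suc 0) (Suc 0))**\<^sub>TId T (Suc 0)) o\<^sub>T (J' ?m**\<^sub>TJ' ?m)"
    by (simp only: J_tensor J'_tensor q_gens_typing)
  have 2: "J' ?m o\<^sub>T J ?u = J ?u**\<^sub>TJ ?u" "J' ?u o\<^sub>T J ?m = J' ?u**\<^sub>TJ' ?u" "J' ?u o\<^sub>T J ?u = Id T 0"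
    using JJ[OF _ _ _ law(4)] JJ[OF _ _ _ law(3)] JJ[OF _ _ _ law(2)] by simp_all
  have t: "J ?m**\<^sub>TId T (Suc 0) = J (?m\<oplus>?i)" "Id T (Suc 0)**\<^sub>TJ ?m = J (?i\<oplus>?m)"
    "J ?u**\<^sub>TId T (Suc 0) = J (?u\<oplus>?i)" "Id T (Suc 0)**\<^sub>TJ ?u = J (?i\<oplus>?u)"
    "J' ?m**\<^sub>TId T (Suc 0) = J' (?m\<oplus>?i)" "Id T (Suc 0)**\<^sub>TJ' ?m = J' (?i\<oplus>?m)"
    "J' ?u**\<^sub>TId T (Suc 0) = J' (?u\<oplus>?i)" "Id T (Suc 0)**\<^sub>TJ' ?u = J' (?i\<oplus>?u)"
    by (simp_all add: Q.ten_id)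
  have "J ?m o\<^sub>T J (?m\<oplus>?i) = J ?m o\<^sub>T J (?i\<oplus>?m) \<and> J' (?m\<oplus>?i) o\<^sub>T J' ?m = J' (?i\<oplus>?m) o\<^sub>T J' ?m"
    by (rule J_cong) (use q_rel in simp_all)
  moreover have "J ?m o\<^sub>T J (?u\<oplus>?i) = J ?i \<and> J' (?u\<oplus>?i) o\<^sub>T J' ?m = J' ?i"
    "J ?m o\<^sub>T J (?i\<oplus>?u) = J ?i \<and> J' (?i\<oplus>?u) o\<^sub>T J' ?m = J' ?i"
    by (rule J_cong'; use q_rel in simp)+
  ultimately have 3: "J ?m o\<^sub>T (J ?m**\<^sub>TId T (Suc 0)) = J ?m o\<^sub>T (Id T (Suc 0)**\<^sub>TJ ?m)"
    "J ?m o\<^sub>T (J ?u**\<^sub>TId T (Suc 0)) = Id T (Suc 0)" "J ?m o\<^sub>T (Id T (Suc 0)**\<^sub>TJ ?u) = Id T (Suc 0)"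
    "(J' ?m**\<^sub>TId T (Suc 0)) o\<^sub>T J' ?m = (Id T (Suc 0)**\<^sub>TJ' ?m) o\<^sub>T J' ?m"
    "(J' ?u**\<^sub>TId T (Suc 0)) o\<^sub>T J' ?m = Id T (Suc 0)" "(Id T (Suc 0)**\<^sub>TJ' ?u) o\<^sub>T J' ?m = Id T (Suc 0)"
    unfolding t J_Id by blast+
  have "J ?m \<in> Hom T (Suc (Suc 0)) (Suc 0)" "J ?u \<in> Hom T 0 (Suc 0)" "J' ?m \<in> Hom T (Suc 0) (Suc (Suc 0))" "J' ?u \<in> Hom T (Suc 0) 0"
    by (simp_all add: Hom_def)
  thus ?thesis unfolding strict_bimonoid_def T'_simps using 1 2 3 by blast
qed

text \<open>A label is also a backward arrow, that of its inverse; its compatibility with the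
  comonoid is that with the monoid read backwards.\<close>

lemma T_label:
  assumes x: "x \<in> carrier G"
  shows "J (lb x) o\<^sub>T J (q_m G) = J (q_m G) o\<^sub>T (J (lb x)**\<^sub>TJ (lb x))" "J (lb x) o\<^sub>T J (q_u G) = J (q_u G)"
    "J' (q_m G) o\<^sub>T J (lb x) = (J (lb x)**\<^sub>TJ (lb x)) o\<^sub>T J' (q_m G)" "J' (q_u G) o\<^sub>T J (lb x) = J' (q_u G)"
proof -
  have e: "J (lb x) = J' (lb (inv x))" using J'_inverse[OF lb_inverse[of "inv x"]] x by simp
  have t: "J (lb x)**\<^sub>TJ (lb x) = J (lb x\<oplus>lb x)" "J' (lb (inv x))**\<^sub>TJ' (lb (inv x)) = J' (lb (inv x)\<oplus>lb (inv x))"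
    using J_tensor[of "lb x" "lb x"] J'_tensor[of "lb (inv x)" "lb (inv x)"] x by simp_all
  have y: "inv x \<in> carrier G" using x by simp
  show "J (lb x) o\<^sub>T J (q_m G) = J (q_m G) o\<^sub>T (J (lb x)**\<^sub>TJ (lb x))"
    unfolding t by (rule conjunct1[OF J_cong]) (use q_rel(4)[OF x] x in simp_all)
  show "J (lb x) o\<^sub>T J (q_u G) = J (q_u G)"
    by (rule conjunct1[OF J_cong']) (use q_rel(5)[OF x] x in simp_all)
  show "J' (q_m G) o\<^sub>T J (lb x) = (J (lb x)**\<^sub>TJ (lb x)) o\<^sub>T J' (q_m G)"
    unfolding e t by (rule conjunct2[OF J_cong]) (use q_rel(4)[OF y] y in simp_all)
  show "J' (q_u G) o\<^sub>T J (lb x) = J' (q_u G)"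
    unfolding e by (rule conjunct2[OF J_cong']) (use q_rel(5)[OF y] y in simp_all)
qed

end

locale algebras = braided_monoidal_category B + bialgebra_law G L
  for B :: "('o, 'a, 'z) bmcat_scheme" (structure) and G :: "('g, 'x) monoid_scheme" and L

locale one_algebra = algebras B G L
  for B :: "('o, 'a, 'z) bmcat_scheme" (structure) and G :: "('g, 'x) monoid_scheme" and L +
  fixes F :: "(nat, ('g qmor \<times> 'g qmor) set, 'o, 'a) mfunct"
  assumes F: "F \<in> alg_obj T B"
begin

abbreviation "P \<equiv> fobj F"
abbreviation "pm \<equiv> fmult F"
abbreviation "et \<equiv> funit F"
abbreviation "fa \<equiv> farr F"

lemma F_props: "P n \<in> Obj B" "t \<in> Arr T ==> fa t \<in> Hom B (P (Dom T t)) (P (Cod T t))" "fa (Id T n) = Id B (P n)"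
  "s \<in> Arr T ==> t \<in> Arr T ==> Cod T s = Dom T t ==> fa (t o\<^sub>T s) = fa t o fa s"
  "pm n m \<in> Hom B (P n \<odot> P m) (P (n + m))" "pm n m \<in> canonical B" "et \<in> Hom B (tunit B) (P 0)" "et \<in> canonical B"
  "s \<in> Arr T ==> t \<in> Arr T ==> fa (s**\<^sub>Tt) o pm (Dom T s) (Dom T t) = pm (Cod T s) (Cod T t) o (fa s**fa t)"
  "fa (braid T n m) o pm n m = pm m n o braid B (P n) (P m)"
  using F unfolding alg_obj_def braided_strict_functor_def is_functor_def by (auto simp del: T_simps(4,5) simp: T_simps(1-3))

lemma F_coh: "fa (Id T (n + m + k)) o pm (n + m) k o (pm n m**Id B (P k)) = pm n (m + k) o (Id B (P n)**pm m k) o assoc B (P n) (P m) (P k)"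
  "fa (Id T n) o pm 0 n o (et**Id B (P n)) = lunit B (P n)" "fa (Id T n) o pm n 0 o (Id B (P n)**et) = runit B (P n)"
  using F unfolding alg_obj_def braided_strict_functor_def by (simp_all del: T_simps(4,5) add: T_simps(1-3) T_assoc)

text \<open>The coherence conditions of an algebra are the three equations of \<open>powers\<close>,
  and canonicity of its structure arrows supplies their invertibility. The algebra thereby becomes a
  strict functor \<open>FK\<close> into its own strictified powers.\<close>

sublocale powers B P pm et
proof -
  have [simp]: "P n \<in> Obj B" "pm n m \<in> Arr B" "Dom B (pm n m) = P n \<odot> P m" "Cod B (pm n m) = P (n + m)"
    "et \<in> Arr B" "Dom B et = tunit B" "Cod B et = P 0" for n m
    using F_props(1)[of n] F_props(5)[of n m] F_props(7) by (auto simp: Hom_def)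
  have 1: "pm (n + m) k o (pm n m**Id B (P k)) = pm n (m + k) o (Id B (P n)**pm m k) o assoc B (P n) (P m) (P k)" for n m k
    using F_coh(1)[of n m k] unfolding F_props(3) by simp
  have 2: "pm 0 n o (et**Id B (P n)) = lunit B (P n)" "pm n 0 o (Id B (P n)**et) = runit B (P n)" for n
    using F_coh(2,3)[of n] unfolding F_props(3) by simp_all
  show "powers B P pm et"
    using F_props(1,5,7) canonical_iso[OF F_props(6)] canonical_iso[OF F_props(8)] 1 2 by unfold_locales
qed

sublocale K: prob K by (rule prob_K)

notation K_Comp (infixr "o\<^sub>K" 70) and K_tarr (infixr "**\<^sub>K" 75)

definition FK :: "('g qmor \<times> 'g qmor) set => nat \<times> nat \<times> 'a" where
  "FK t = (Dom T t, Cod T t, fa t)"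

lemma FK_simps: "t \<in> Arr T ==> FK t \<in> Arr K" "Dom K (FK t) = Dom T t" "Cod K (FK t) = Cod T t" "FK (Id T n) = Id K n"
  "s \<in> Arr T ==> t \<in> Arr T ==> Cod T s = Dom T t ==> FK (t o\<^sub>T s) = FK t o\<^sub>K FK s"
proof -
  show "t \<in> Arr T ==> FK t \<in> Arr K" "Dom K (FK t) = Dom T t" "Cod K (FK t) = Cod T t"
    using HomD[OF F_props(2)[of t]] by (simp_all add: FK_def K_Arr)
  show "FK (Id T n) = Id K n" unfolding FK_def F_props(3) by simp
  show "FK (t o\<^sub>T s) = FK t o\<^sub>K FK s" if st: "s \<in> Arr T" "t \<in> Arr T" "Cod T s = Dom T t"
    unfolding FK_def T_arr_comp(2,3)[OF st] F_props(4)[OF st] by simp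
qed

lemma FK_tensor: "s \<in> Arr T ==> t \<in> Arr T ==> FK (s**\<^sub>Tt) = FK s**\<^sub>KFK t"
proof -
  assume s: "s \<in> Arr T" and t: "t \<in> Arr T"
  note a = F_props(2)[OF s] F_props(2)[OF t] F_props(2)[OF T_arr_ten(1)[OF s t]]
  have [simp]: "fa s \<in> Arr B" "Dom B (fa s) = P (Dom T s)" "Cod B (fa s) = P (Cod T s)"
    "fa t \<in> Arr B" "Dom B (fa t) = P (Dom T t)" "Cod B (fa t) = P (Cod T t)"
    "fa (s**\<^sub>Tt) \<in> Arr B" "Dom B (fa (s**\<^sub>Tt)) = P (Dom T s + Dom T t)" "Cod B (fa (s**\<^sub>Tt)) = P (Cod T s + Cod T t)"
    using HomD[OF a(1)] HomD[OF a(2)] HomD[OF a(3)] unfolding T_arr_ten[OF s t] by blast+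
  have "fa (s**\<^sub>Tt) = pm (Cod T s) (Cod T t) o (fa s**fa t) o inv_arr B (pm (Dom T s) (Dom T t))"
    using cancel_iso_right[of "pm (Dom T s) (Dom T t)" "fa (s**\<^sub>Tt)" "pm (Cod T s) (Cod T t) o (fa s**fa t) o inv_arr B (pm (Dom T s) (Dom T t))"]
      F_props(9)[OF s t] by (simp add: comp_assoc)
  thus ?thesis using T_arr_ten[OF s t] by (simp add: FK_def)
qed

lemma FK_braid: "FK (braid T n m) = braid K n m"
proof -
  let ?b = "braid T n m"
  have b: "?b \<in> Arr T" "Dom T ?b = n + m" "Cod T ?b = m + n" by simp_all
  have [simp]: "fa ?b \<in> Arr B" "Dom B (fa ?b) = P (n + m)" "Cod B (fa ?b) = P (m + n)"
    using HomD[OF F_props(2)[OF b(1)]] unfolding b by blast+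
  have "fa ?b = kb n m"
    using cancel_iso_right[of "pm n m" "fa ?b" "kb n m"] F_props(10)[of n m] kb_pm[of m n] by (simp del: T_simps)
  thus ?thesis using b by (simp add: FK_def del: T_simps)
qed

lemma FK_braid': "FK (J' (braid Q n m)) = binv K n m"
proof (rule K.binv_eqI[symmetric])
  have i: "J' (braid Q n m) = J (binv Q n m)" by (rule J'_inverse) (rule Q.inverse_braid)
  show "FK (J' (braid Q n m)) \<in> Arr K" "Dom K (FK (J' (braid Q n m))) = m + n" "Cod K (FK (J' (braid Q n m))) = n + m"
    using FK_simps(1-3)[of "J' (braid Q n m)"] by (simp_all del: K_simps)
  have "FK (braid T n m) o\<^sub>K FK (J (binv Q n m)) = FK (J (braid Q n m) o\<^sub>T J (binv Q n m))"
    using FK_simps(5)[of "J (binv Q n m)" "J (braid Q n m)"] by (simp del: K_simps)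
  also have "... = Id K (m + n)" using J_comp[of "binv Q n m" "braid Q n m"] FK_simps(4)[of "m + n"] by (simp del: K_simps)
  finally show "braid K n m o\<^sub>K FK (J' (braid Q n m)) = Id K (m + n)" unfolding FK_braid i .
qed

end

lemma functor_cat_Obj: "X \<in> Obj (functor_cat C D) \<longleftrightarrow> is_functor C D X \<and> fobj X \<in> extensional (Obj C) \<and> farr X \<in> extensional (Arr C)"
  by (simp add: functor_cat_def)

lemma functor_cat_Hom: "f \<in> Hom (functor_cat C D) X Y \<longleftrightarrow> (\<exists>a. f = (X, Y, a) \<and> X \<in> Obj (functor_cat C D) \<and>
    Y \<in> Obj (functor_cat C D) \<and> is_nat_trans C D X Y a \<and> a \<in> extensional (Obj C))"
  by (auto simp: functor_cat_def Hom_def)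

lemma functor_cat_Comp: "(Y, Z, b) o\<^bsub>functor_cat C D\<^esub> (X, Y, a) = (X, Z, \<lambda>X\<in>Obj C. b X o\<^bsub>D\<^esub> a X)"
  and functor_cat_Id: "Id (functor_cat C D) X = (X, X, \<lambda>Y\<in>Obj C. Id D (fobj X Y))"
  by (simp_all add: functor_cat_def)

lemma bimon_Hom: "f \<in> Hom (bimon_cat B) X Y \<longleftrightarrow> (\<exists>k. f = (X, Y, k) \<and> is_bimonoid B X \<and> is_bimonoid B Y \<and> is_bimonoid_hom B X Y k)"
  by (auto simp: bimon_cat_def Hom_def)

lemma bimon_Comp: "(Y, Z, g) o\<^bsub>bimon_cat B\<^esub> (X, Y, f) = (X, Z, g o\<^bsub>B\<^esub> f)" and bimon_Id: "Id (bimon_cat B) X = (X, X, Id B (bobj X))"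
  and bimon_Obj: "X \<in> Obj (bimon_cat B) \<longleftrightarrow> is_bimonoid B X"
  by (simp_all add: bimon_cat_def)

lemma category_functor_cat:
  fixes C :: "('c, 'd, 'y) cat_scheme" and D :: "('e, 'f, 'z) cat_scheme" (structure)
  assumes C: "category C" and D: "category D"
  shows "category (functor_cat C D)"
proof -
  let ?F = "functor_cat C D"
  interpret C: category C by fact
  interpret D: category D by fact
  have Id: "is_nat_trans C D F F (\<lambda>X\<in>Obj C. Id D (fobj F X))" if F: "is_functor C D F" for F :: "('c, 'd, 'e, 'f) funct"
    using that C.Dom_Obj C.Cod_Obj D.Id_Hom unfolding is_nat_trans_def is_functor_def
    by (auto simp: Hom_def D.comp_id_left D.comp_id_right)
  have Comp: "is_nat_trans C D F K (\<lambda>X\<in>Obj C. b X o a X)"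
    if F: "is_functor C D F" "is_functor C D H" "is_functor C D K" and a: "is_nat_trans C D F H a" and b: "is_nat_trans C D H K b"
    for F H K :: "('c, 'd, 'e, 'f) funct" and a b
    unfolding is_nat_trans_def
  proof (intro conjI ballI)
    fix X assume X: "X \<in> Obj C"
    thus "(\<lambda>X\<in>Obj C. b X o a X) X \<in> Hom D (fobj F X) (fobj K X)"
      using a b D.Comp_Hom unfolding is_nat_trans_def by auto
  next
    fix f assume f: "f \<in> Arr C"
    define X Y where "X = Dom C f" and "Y = Cod C f"
    have XY: "X \<in> Obj C" "Y \<in> Obj C" using f C.Dom_Obj C.Cod_Obj by (auto simp: X_def Y_def)
    have h: "a X \<in> Hom D (fobj F X) (fobj H X)" "a Y \<in> Hom D (fobj F Y) (fobj H Y)" "b X \<in> Hom D (fobj H X) (fobj K X)" "b Y \<in> Hom D (fobj H Y) (fobj K Y)"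
      "farr F f \<in> Hom D (fobj F X) (fobj F Y)" "farr H f \<in> Hom D (fobj H X) (fobj H Y)" "farr K f \<in> Hom D (fobj K X) (fobj K Y)"
      "a Y o farr F f = farr H f o a X" "b Y o farr H f = farr K f o b X"
      using F a b XY f unfolding is_nat_trans_def is_functor_def X_def Y_def by auto
    have "(b Y o a Y) o farr F f = (b Y o farr H f) o a X"
      using D.Comp_assoc[OF h(5,2,4)] D.Comp_assoc[OF h(1,6,4)] h(8) by simp
    also have "... = farr K f o b X o a X" unfolding h(9) by (rule D.Comp_assoc[OF h(1,3,7)])
    finally show "(\<lambda>X\<in>Obj C. b X o a X) (Cod C f) o farr F f = farr K f o (\<lambda>X\<in>Obj C. b X o a X) (Dom C f)"
      using XY by (simp add: X_def Y_def)
  qed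
  have nt: "X \<in> Obj C ==> a X \<in> Hom D (fobj F X) (fobj H X)" if "is_nat_trans C D F H a" for F H :: "('c, 'd, 'e, 'f) funct" and a X
    using that unfolding is_nat_trans_def by blast
  show ?thesis
  proof
    fix W X Y Z and f g h :: "('c, 'd, 'e, 'f) funct \<times> ('c, 'd, 'e, 'f) funct \<times> ('c => 'f)"
    show "f \<in> Arr ?F ==> Dom ?F f \<in> Obj ?F"
      "f \<in> Arr ?F ==> Cod ?F f \<in> Obj ?F"
      by (auto simp: functor_cat_def)
    show "X \<in> Obj ?F ==> Id ?F X \<in> Hom ?F X X"
      using Id[of X] by (simp add: functor_cat_Hom functor_cat_Id functor_cat_Obj)
    show "f \<in> Hom ?F X Y ==> g \<in> Hom ?F Y Z ==> g o\<^bsub>?F\<^esub> f \<in> Hom ?F X Z"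
      using Comp[of X Y Z] by (auto simp: functor_cat_Hom functor_cat_Comp functor_cat_Obj)
    show "f \<in> Hom ?F X Y ==> f o\<^bsub>?F\<^esub> Id ?F X = f"
      "f \<in> Hom ?F X Y ==> Id ?F Y o\<^bsub>?F\<^esub> f = f"
      by (auto simp: functor_cat_Hom functor_cat_Comp functor_cat_Id fun_eq_iff restrict_def extensional_def D.Comp_Id_right[OF nt] D.Comp_Id_left[OF nt])
    show "f \<in> Hom ?F W X ==> g \<in> Hom ?F X Y ==> h \<in> Hom ?F Y Z ==>
      (h o\<^bsub>?F\<^esub> g) o\<^bsub>?F\<^esub> f = h o\<^bsub>?F\<^esub> g o\<^bsub>?F\<^esub> f"
      by (auto simp: functor_cat_Hom functor_cat_Comp fun_eq_iff restrict_def D.Comp_assoc[OF nt nt nt])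
  qed
qed

context braided_monoidal_category
begin

lemma bimonoid_typing:
  assumes "is_bimonoid B X"
  shows "bobj X \<in> Obj B" "bmult X \<in> Hom B (bobj X \<odot> bobj X) (bobj X)" "bunit X \<in> Hom B (tunit B) (bobj X)"
    "bcomult X \<in> Hom B (bobj X) (bobj X \<odot> bobj X)" "bcounit X \<in> Hom B (bobj X) (tunit B)"
  using assms unfolding is_bimonoid_def is_monoid_def is_comonoid_def by blast+

lemma bimonoid_hom_Id: "is_bimonoid B X ==> is_bimonoid_hom B X X (Id B (bobj X))"
  using bimonoid_typing[of X] Id_Hom[of "bobj X"]
  by (auto simp: is_bimonoid_hom_def tarr_Id Comp_Id_left Comp_Id_right tobj_Obj)

lemma bimonoid_hom_Comp:
  assumes X: "is_bimonoid B X" "is_bimonoid B Y" "is_bimonoid B Z" and f: "is_bimonoid_hom B X Y f" and g: "is_bimonoid_hom B Y Z g"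
  shows "is_bimonoid_hom B X Z (g o f)"
proof -
  note x = bimonoid_typing[OF X(1)] bimonoid_typing[OF X(2)] bimonoid_typing[OF X(3)]
  have h: "f \<in> Hom B (bobj X) (bobj Y)" "g \<in> Hom B (bobj Y) (bobj Z)"
    and fe: "f o bmult X = bmult Y o (f**f)" "f o bunit X = bunit Y" "bcomult Y o f = (f**f) o bcomult X" "bcounit Y o f = bcounit X"
    and ge: "g o bmult Y = bmult Z o (g**g)" "g o bunit Y = bunit Z" "bcomult Z o g = (g**g) o bcomult Y" "bcounit Z o g = bcounit Y"
    using f g unfolding is_bimonoid_hom_def by blast+
  note ff = tarr_Hom[OF h(1) h(1)] and gg = tarr_Hom[OF h(2) h(2)]
  have i: "(g o f)**(g o f) = (g**g) o (f**f)" by (rule interchange[OF h h])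
  have "(g o f) o bmult X = g o bmult Y o (f**f)" unfolding fe(1)[symmetric] by (rule Comp_assoc[OF x(2) h])
  also have "... = (bmult Z o (g**g)) o (f**f)" unfolding ge(1)[symmetric] by (rule Comp_assoc[OF ff x(7) h(2), symmetric])
  also have "... = bmult Z o ((g o f)**(g o f))" unfolding i by (rule Comp_assoc[OF ff gg x(12)])
  finally have 1: "(g o f) o bmult X = bmult Z o ((g o f)**(g o f))" .
  have 2: "(g o f) o bunit X = bunit Z" using Comp_assoc[OF x(3) h] fe ge by simp
  have "bcomult Z o g o f = (bcomult Z o g) o f" by (rule Comp_assoc[OF h x(14), symmetric])
  also have "... = (g**g) o bcomult Y o f" unfolding ge(3) by (rule Comp_assoc[OF h(1) x(9) gg])
  also have "... = ((g o f)**(g o f)) o bcomult X" unfolding fe(3) i by (rule Comp_assoc[OF x(4) ff gg, symmetric])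
  finally have 3: "bcomult Z o g o f = ((g o f)**(g o f)) o bcomult X" .
  have 4: "bcounit Z o g o f = bcounit X" using Comp_assoc[OF h x(15)] fe ge by simp
  show ?thesis unfolding is_bimonoid_hom_def using Comp_Hom[OF h] 1 2 3 4 by blast
qed

lemma category_bimon_cat: "category (bimon_cat B)"
proof
  fix W X Y Z :: "('o, 'a) bimon" and f g h :: "('o, 'a) bimon \<times> ('o, 'a) bimon \<times> 'a"
  have bh: "is_bimonoid_hom B X Y f ==> f \<in> Hom B (bobj X) (bobj Y)" for X Y f by (simp add: is_bimonoid_hom_def)
  show "f \<in> Arr (bimon_cat B) ==> Dom (bimon_cat B) f \<in> Obj (bimon_cat B)" "f \<in> Arr (bimon_cat B) ==> Cod (bimon_cat B) f \<in> Obj (bimon_cat B)"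
    by (auto simp: bimon_cat_def)
  show "X \<in> Obj (bimon_cat B) ==> Id (bimon_cat B) X \<in> Hom (bimon_cat B) X X"
    using bimonoid_hom_Id by (auto simp: bimon_Hom bimon_Id bimon_Obj)
  show "f \<in> Hom (bimon_cat B) X Y ==> g \<in> Hom (bimon_cat B) Y Z ==> g o\<^bsub>bimon_cat B\<^esub> f \<in> Hom (bimon_cat B) X Z"
    using bimonoid_hom_Comp by (auto simp: bimon_Hom bimon_Comp)
  show "f \<in> Hom (bimon_cat B) X Y ==> f o\<^bsub>bimon_cat B\<^esub> Id (bimon_cat B) X = f"
    "f \<in> Hom (bimon_cat B) X Y ==> Id (bimon_cat B) Y o\<^bsub>bimon_cat B\<^esub> f = f"
    "f \<in> Hom (bimon_cat B) W X ==> g \<in> Hom (bimon_cat B) X Y ==> h \<in> Hom (bimon_cat B) Y Z ==>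
      (h o\<^bsub>bimon_cat B\<^esub> g) o\<^bsub>bimon_cat B\<^esub> f = h o\<^bsub>bimon_cat B\<^esub> g o\<^bsub>bimon_cat B\<^esub> f"
    by (auto simp: bimon_Hom bimon_Comp bimon_Id Comp_Id_left[OF bh] Comp_Id_right[OF bh] Comp_assoc[OF bh bh bh])
qed

end

lemma (in group) category_group_cat: "category (group_cat G)"
  by unfold_locales (auto simp: group_cat_def Hom_def m_assoc)

context one_algebra
begin

text \<open>\<open>FK\<close> preserves composition and tensor products and sends the crossing of
  \<open>T'\<close> to an inverse crossing of \<open>K\<close>, hence the reverse braiding in the
  target.\<close>

lemma strict_transport:
  assumes "strict_bimonoid T' m u d e"
  shows "strict_bimonoid (rev_braid K) (FK m) (FK u) (FK d) (FK e)"
proof -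
  let ?i = "Id T (Suc 0)" and ?b = "J' (braid Q (Suc 0) (Suc 0))"
  have h: "m \<in> Hom T (Suc (Suc 0)) (Suc 0)" "u \<in> Hom T 0 (Suc 0)" "d \<in> Hom T (Suc 0) (Suc (Suc 0))" "e \<in> Hom T (Suc 0) 0"
    using assms unfolding strict_bimonoid_def T'_simps by blast+
  have t: "m \<in> Arr T" "Dom T m = Suc (Suc 0)" "Cod T m = Suc 0" "u \<in> Arr T" "Dom T u = 0" "Cod T u = Suc 0"
    "d \<in> Arr T" "Dom T d = Suc 0" "Cod T d = Suc (Suc 0)" "e \<in> Arr T" "Dom T e = Suc 0" "Cod T e = 0"
    using h unfolding Hom_def by blast+
  have i: "?i \<in> Arr T" "Dom T ?i = Suc 0" "Cod T ?i = Suc 0" by simp_all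
  have b: "?b \<in> Arr T" "Dom T ?b = Suc (Suc 0)" "Cod T ?b = Suc (Suc 0)" by simp_all
  have fk: "FK (sp (braid Q (Suc 0) (Suc 0)) (Id Q (Suc (Suc 0)))) = binv K (Suc 0) (Suc 0)"
    using FK_braid'[of "Suc 0" "Suc 0"] by (simp del: K_simps)
  have a: "(FK m \<in> Arr K \<and> Dom K (FK m) = Suc (Suc 0) \<and> Cod K (FK m) = Suc 0) \<and> (FK u \<in> Arr K \<and> Dom K (FK u) = 0 \<and> Cod K (FK u) = Suc 0) \<and>
     (FK d \<in> Arr K \<and> Dom K (FK d) = Suc 0 \<and> Cod K (FK d) = Suc (Suc 0)) \<and> (FK e \<in> Arr K \<and> Dom K (FK e) = Suc 0 \<and> Cod K (FK e) = 0)"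
    unfolding FK_simps(2,3) using FK_simps(1) t by blast
  note r = FK_simps(5) FK_tensor FK_simps(4) T_arr_ten T_arr_comp t i b fk
  note eq = assms[unfolded strict_bimonoid_def T'_simps]
  have "FK (m o\<^sub>T (m**\<^sub>T?i)) = FK (m o\<^sub>T (?i**\<^sub>Tm))" "FK (m o\<^sub>T (u**\<^sub>T?i)) = FK ?i" "FK (m o\<^sub>T (?i**\<^sub>Tu)) = FK ?i"
    "FK ((d**\<^sub>T?i) o\<^sub>T d) = FK ((?i**\<^sub>Td) o\<^sub>T d)" "FK ((e**\<^sub>T?i) o\<^sub>T d) = FK ?i" "FK ((?i**\<^sub>Te) o\<^sub>T d) = FK ?i"
    "FK (d o\<^sub>T m) = FK ((m**\<^sub>Tm) o\<^sub>T (?i**\<^sub>T?b**\<^sub>T?i) o\<^sub>T (d**\<^sub>Td))"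
    "FK (d o\<^sub>T u) = FK (u**\<^sub>Tu)" "FK (e o\<^sub>T m) = FK (e**\<^sub>Te)" "FK (e o\<^sub>T u) = FK (Id T 0)"
    using eq by argo+
  thus ?thesis using a unfolding strict_bimonoid_def Hom_def
    by (simp del: K_simps T_simps add: r)
qed

end

context bialgebra_law
begin

definition "tm = J (q_m G)"
definition "tu = J (q_u G)"
definition "td = J' (q_m G)"
definition "te = J' (q_u G)"
definition "tlab x = J (lb x)"

lemma t_simps [simp]: "tm \<in> Arr T" "Dom T tm = Suc (Suc 0)" "Cod T tm = Suc 0" "tu \<in> Arr T" "Dom T tu = 0" "Cod T tu = Suc 0"
  "td \<in> Arr T" "Dom T td = Suc 0" "Cod T td = Suc (Suc 0)" "te \<in> Arr T" "Dom T te = Suc 0" "Cod T te = 0"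
  "x \<in> carrier G ==> tlab x \<in> Arr T" "x \<in> carrier G ==> Dom T (tlab x) = Suc 0" "x \<in> carrier G ==> Cod T (tlab x) = Suc 0"
  by (simp_all add: tm_def tu_def td_def te_def tlab_def)

lemma tlab_rel: "tlab \<one> = Id T (Suc 0)" "x \<in> carrier G ==> y \<in> carrier G ==> tlab (x \<otimes> y) = tlab x o\<^sub>T tlab y"
  unfolding tlab_def using lb_one J_comp[of "lb y" "lb x"] lb_mult[of x y] by simp_all

end

context algebras
begin

abbreviation "AA \<equiv> alg_cat T B"
abbreviation "GB \<equiv> gbimon_cat G B"

text \<open>The images of the generators, with the comparison arrows stripped off. The braiding in
  the comultiplication undoes the reversal imposed by the law.\<close>

definition bim :: "(nat, ('g qmor \<times> 'g qmor) set, 'o, 'a) mfunct => ('o, 'a) bimon" where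
  "bim F = \<lparr>bobj = fobj F (Suc 0), bmult = farr F tm o fmult F (Suc 0) (Suc 0), bunit = farr F tu o funit F,
     bcomult = braid B (fobj F (Suc 0)) (fobj F (Suc 0)) o inv_arr B (fmult F (Suc 0) (Suc 0)) o farr F td,
     bcounit = inv_arr B (funit F) o farr F te\<rparr>"

definition gbim where
  "gbim F = \<lparr>fobj = \<lambda>_. bim F, farr = \<lambda>x\<in>carrier G. (bim F, bim F, farr F (tlab x))\<rparr>"

end

context one_algebra
begin

lemma fa_typing [simp]: "fa tm \<in> Arr B" "Dom B (fa tm) = P (Suc (Suc 0))" "Cod B (fa tm) = x1" "fa tu \<in> Arr B" "Dom B (fa tu) = P 0" "Cod B (fa tu) = x1"
  "fa td \<in> Arr B" "Dom B (fa td) = x1" "Cod B (fa td) = P (Suc (Suc 0))" "fa te \<in> Arr B" "Dom B (fa te) = x1" "Cod B (fa te) = P 0"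
  "x \<in> carrier G ==> fa (tlab x) \<in> Arr B" "x \<in> carrier G ==> Dom B (fa (tlab x)) = x1" "x \<in> carrier G ==> Cod B (fa (tlab x)) = x1"
  using HomD[OF F_props(2)[of tm]] HomD[OF F_props(2)[of tu]] HomD[OF F_props(2)[of td]] HomD[OF F_props(2)[of te]] HomD[OF F_props(2)[of "tlab x"]]
  by simp_all

lemma bim_Hom: "bmult (bim F) \<in> Hom B (x1 \<odot> x1) x1" "bunit (bim F) \<in> Hom B (tunit B) x1"
  "bcomult (bim F) \<in> Hom B x1 (x1 \<odot> x1)" "bcounit (bim F) \<in> Hom B x1 (tunit B)"
  unfolding Hom_def mem_Collect_eq by (simp_all add: bim_def)

lemma bim_K: "km (bmult (bim F)) = FK tm" "ku (bunit (bim F)) = FK tu"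
  "kd (bcomult (bim F)) = braid K (Suc 0) (Suc 0) o\<^sub>K FK td" "ke (bcounit (bim F)) = FK te"
  by (simp_all add: bim_def FK_def comp_assoc inv_cancel)

lemma bim_eta: "bim F = \<lparr>bobj = x1, bmult = bmult (bim F), bunit = bunit (bim F), bcomult = bcomult (bim F), bcounit = bcounit (bim F)\<rparr>"
  by (simp add: bim_def)

text \<open>The twist is applied in the reversed category: its inverse braiding is the braiding of
  \<open>K\<close>, and reversing twice returns to \<open>K\<close>.\<close>

lemma is_bimonoid_bim: "is_bimonoid B (bim F)"
proof -
  interpret R: prob "rev_braid K" by (rule K.prob_rev)
  have "strict_bimonoid T' tm tu td te" unfolding tm_def tu_def td_def te_def by (rule strict_bimonoid_T')
  from R.strict_bimonoid_twist[OF strict_transport[OF this]]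
  have "strict_bimonoid K (FK tm) (FK tu) (braid K (Suc 0) (Suc 0) o\<^sub>K FK td) (FK te)"
    unfolding K.rev_rev K.binv_rev by (simp del: K_simps)
  thus ?thesis unfolding bim_K[symmetric] strict_bimonoid_K[OF bim_Hom] using bim_eta by simp
qed

lemma bim_act:
  assumes x: "x \<in> carrier G"
  shows "is_bimonoid_hom B (bim F) (bim F) (fa (tlab x))"
proof -
  let ?l = "FK (tlab x)" and ?c = "braid K (Suc 0) (Suc 0)"
  have l: "?l = (Suc 0, Suc 0, fa (tlab x))" using x by (simp add: FK_def)
  note rel = T_label[OF x, folded tm_def tu_def td_def te_def tlab_def]
  have t: "?l \<in> Arr K" "Dom K ?l = Suc 0" "Cod K ?l = Suc 0" "FK td \<in> Arr K" "Dom K (FK td) = Suc 0" "Cod K (FK td) = Suc (Suc 0)"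
    using x FK_simps(1)[of "tlab x"] FK_simps(1)[of td] by (simp_all add: FK_simps(2,3) del: K_simps)
  have 1: "?l o\<^sub>K FK tm = FK tm o\<^sub>K (?l**\<^sub>K?l)" "?l o\<^sub>K FK tu = FK tu"
    "FK te o\<^sub>K ?l = FK te" "FK td o\<^sub>K ?l = (?l**\<^sub>K?l) o\<^sub>K FK td"
    using arg_cong[OF rel(1), of FK] arg_cong[OF rel(2), of FK] arg_cong[OF rel(4), of FK] arg_cong[OF rel(3), of FK] x
    by (simp_all add: FK_simps(5) FK_tensor T_arr_ten del: K_simps)
  have 2: "(?c o\<^sub>K FK td) o\<^sub>K ?l = (?l**\<^sub>K?l) o\<^sub>K ?c o\<^sub>K FK td"
    by (rule K.twist_Comp) (use t 1(4) in \<open>simp_all del: K_simps\<close>)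
  have f: "fa (tlab x) \<in> Hom B x1 x1" using F_props(2)[of "tlab x"] x by simp
  show ?thesis
    using strict_bimonoid_hom_K[OF bim_Hom f] 1(1-3) 2 unfolding bim_K l bim_eta[symmetric] by blast
qed

lemma gbim_Obj: "gbim F \<in> Obj GB"
proof -
  have h: "(bim F, bim F, fa (tlab x)) \<in> Hom (bimon_cat B) (bim F) (bim F)" if "x \<in> carrier G" for x
    using bim_act[OF that] is_bimonoid_bim by (auto simp: bimon_Hom)
  have "fa (tlab (x \<otimes>\<^bsub>G\<^esub> y)) = fa (tlab x) o fa (tlab y)" if "x \<in> carrier G" "y \<in> carrier G" for x y
    using F_props(4)[of "tlab y" "tlab x"] that tlab_rel(2)[OF that] by simp
  moreover have "fa (tlab \<one>\<^bsub>G\<^esub>) = Id B x1" unfolding tlab_rel F_props(3) ..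
  ultimately have "is_functor (group_cat G) (bimon_cat B) (gbim F)"
    unfolding is_functor_def using h is_bimonoid_bim
    by (simp add: group_cat_def gbim_def bimon_Id bimon_Comp bimon_Obj) (simp add: bim_def)
  thus ?thesis unfolding functor_cat_Obj by (simp add: gbim_def group_cat_def extensional_def)
qed

end

context algebras
begin

lemma mnt_iff: "monoidal_nat_trans T B F H \<alpha> \<longleftrightarrow> (\<forall>n. \<alpha> n \<in> Hom B (fobj F n) (fobj H n)) \<and>
    (\<forall>t\<in>Arr T. \<alpha> (Cod T t) o farr F t = farr H t o \<alpha> (Dom T t)) \<and>
    (\<forall>n m. \<alpha> (n + m) o fmult F n m = fmult H n m o (\<alpha> n**\<alpha> m)) \<and> \<alpha> 0 o funit F = funit H"
  unfolding monoidal_nat_trans_def is_nat_trans_def by simp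

lemma alg_Hom: "f \<in> Hom AA F H \<longleftrightarrow> (\<exists>a. f = (F, H, a) \<and> F \<in> alg_obj T B \<and> H \<in> alg_obj T B \<and> monoidal_nat_trans T B F H a)"
  by (auto simp: alg_cat_def Hom_def)

lemma alg_Comp: "(H, K, b) o\<^bsub>AA\<^esub> (F, H, a) = (F, K, \<lambda>n. b n o a n)" and alg_Id: "Id AA F = (F, F, \<lambda>n. Id B (fobj F n))"
  and alg_Obj: "Obj AA = alg_obj T B"
  by (simp_all add: alg_cat_def)

lemma mnt_Comp:
  assumes F: "F \<in> alg_obj T B" "H \<in> alg_obj T B" "K \<in> alg_obj T B" and a: "monoidal_nat_trans T B F H a" and b: "monoidal_nat_trans T B H K b"
  shows "monoidal_nat_trans T B F K (\<lambda>n. b n o a n)"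
proof -
  interpret F: one_algebra B G L F using F by unfold_locales
  interpret H: one_algebra B G L H using F by unfold_locales
  interpret K: one_algebra B G L K using F by unfold_locales
  have ah: "a n \<in> Hom B (fobj F n) (fobj H n)" and bh: "b n \<in> Hom B (fobj H n) (fobj K n)" for n using a b by (auto simp: mnt_iff)
  have [simp]: "a n \<in> Arr B" "Dom B (a n) = fobj F n" "Cod B (a n) = fobj H n" "b n \<in> Arr B" "Dom B (b n) = fobj H n" "Cod B (b n) = fobj K n" for n
    using HomD[OF ah] HomD[OF bh] by auto
  have nat: "(b (Cod T t) o a (Cod T t)) o farr F t = farr K t o b (Dom T t) o a (Dom T t)" if t: "t \<in> Arr T" for t
  proof -
    note f = F.F_props(2)[OF t] H.F_props(2)[OF t] K.F_props(2)[OF t]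
    have "(b (Cod T t) o a (Cod T t)) o farr F t = b (Cod T t) o a (Cod T t) o farr F t" by (rule Comp_assoc[OF f(1) ah bh])
    also have "... = (b (Cod T t) o farr H t) o a (Dom T t)"
      using a t Comp_assoc[OF ah f(2) bh] by (simp add: mnt_iff)
    also have "... = farr K t o b (Dom T t) o a (Dom T t)" using b t Comp_assoc[OF ah bh f(3)] by (simp add: mnt_iff)
    finally show ?thesis .
  qed
  have mon: "(b (n + m) o a (n + m)) o fmult F n m = fmult K n m o ((b n o a n)**(b m o a m))" for n m
  proof -
    have "(b (n + m) o a (n + m)) o fmult F n m = b (n + m) o a (n + m) o fmult F n m" by (simp add: comp_assoc)
    also have "... = (b (n + m) o fmult H n m) o (a n**a m)" using a by (simp add: mnt_iff comp_assoc)
    also have "... = fmult K n m o ((b n o a n)**(b m o a m))" using b by (simp add: mnt_iff comp_assoc ten_comp')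
    finally show ?thesis .
  qed
  have "(b 0 o a 0) o funit F = funit K" using a b by (simp add: mnt_iff comp_assoc)
  thus ?thesis unfolding mnt_iff using nat mon Comp_Hom[OF ah bh] by blast
qed

lemma mnt_Id:
  assumes F: "F \<in> alg_obj T B"
  shows "monoidal_nat_trans T B F F (\<lambda>n. Id B (fobj F n))"
proof -
  interpret F: one_algebra B G L F using F by unfold_locales
  have "Id B (fobj F (Cod T t)) o farr F t = farr F t o Id B (fobj F (Dom T t))" if "t \<in> Arr T" for t
    using HomD[OF F.F_props(2)[OF that]] by simp
  thus ?thesis unfolding mnt_iff using Id_Hom[OF F.P_Obj] by (simp add: tarr_Id)
qed

lemma category_alg_cat: "category AA"
proof
  have h: "a n \<in> Hom B (fobj F n) (fobj H n)" if "monoidal_nat_trans T B F H a" for F H a n using that by (simp add: mnt_iff)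
  fix W X Y Z and f g k :: "(nat, ('g qmor \<times> 'g qmor) set, 'o, 'a) mfunct \<times> (nat, ('g qmor \<times> 'g qmor) set, 'o, 'a) mfunct \<times> (nat => 'a)"
  show "f \<in> Arr AA ==> Dom AA f \<in> Obj AA" "f \<in> Arr AA ==> Cod AA f \<in> Obj AA"
    by (auto simp: alg_cat_def)
  show "X \<in> Obj AA ==> Id AA X \<in> Hom AA X X"
    using mnt_Id by (auto simp: alg_Hom alg_Id alg_Obj)
  show "f \<in> Hom AA X Y ==> g \<in> Hom AA Y Z ==> g o\<^bsub>AA\<^esub> f \<in> Hom AA X Z"
    using mnt_Comp by (auto simp: alg_Hom alg_Comp)
  show "f \<in> Hom AA X Y ==> f o\<^bsub>AA\<^esub> Id AA X = f" "f \<in> Hom AA X Y ==> Id AA Y o\<^bsub>AA\<^esub> f = f"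
    "f \<in> Hom AA W X ==> g \<in> Hom AA X Y ==> k \<in> Hom AA Y Z ==>
      (k o\<^bsub>AA\<^esub> g) o\<^bsub>AA\<^esub> f = k o\<^bsub>AA\<^esub> g o\<^bsub>AA\<^esub> f"
    by (auto simp: alg_Hom alg_Comp alg_Id fun_eq_iff Comp_Id_left[OF h] Comp_Id_right[OF h] Comp_assoc[OF h h h])
qed

text \<open>The arrows \<open>c\<close> and \<open>b\<close> play the components at two and at zero
  points. Comparison arrows and braidings are invertible and natural, so they cancel from each
  condition; the twist in \<open>bim\<close> does not change what a homomorphism is.\<close>

lemma bimonoid_hom_iff:
  assumes F: "F \<in> alg_obj T B" "H \<in> alg_obj T B" and f: "f \<in> Hom B (fobj F (Suc 0)) (fobj H (Suc 0))"
    and c: "c \<in> Hom B (fobj F (Suc (Suc 0))) (fobj H (Suc (Suc 0)))" "c o fmult F (Suc 0) (Suc 0) = fmult H (Suc 0) (Suc 0) o (f**f)"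
    and b: "b \<in> Hom B (fobj F 0) (fobj H 0)" "b o funit F = funit H"
  shows "is_bimonoid_hom B (bim F) (bim H) f \<longleftrightarrow> f o farr F tm = farr H tm o c \<and> f o farr F tu = farr H tu o b \<and>
    c o farr F td = farr H td o f \<and> b o farr F te = farr H te o f"
proof -
  interpret F: one_algebra B G L F using F by unfold_locales
  interpret H: one_algebra B G L H using F by unfold_locales
  note [simp] = f[THEN HomD, THEN conjunct1] f[THEN HomD, THEN conjunct2, THEN conjunct1] f[THEN HomD, THEN conjunct2, THEN conjunct2, THEN conjunct1]
    c(1)[THEN HomD, THEN conjunct1] c(1)[THEN HomD, THEN conjunct2, THEN conjunct1] c(1)[THEN HomD, THEN conjunct2, THEN conjunct2, THEN conjunct1]
    b(1)[THEN HomD, THEN conjunct1] b(1)[THEN HomD, THEN conjunct2, THEN conjunct1] b(1)[THEN HomD, THEN conjunct2, THEN conjunct2, THEN conjunct1]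
  let ?n = "Suc 0"
  let ?p = "fmult F ?n ?n" and ?q = "fmult H ?n ?n" and ?b = "braid B (fobj H ?n) (fobj H ?n)" and ?e = "inv_arr B (funit H)"
  have 1: "f o bmult (bim F) = bmult (bim H) o (f**f) \<longleftrightarrow> f o farr F tm = farr H tm o c"
    using cancel_iso_right[of ?p "f o farr F tm" "farr H tm o c"] by (simp add: bim_def comp_assoc c)
  have 2: "f o bunit (bim F) = bunit (bim H) \<longleftrightarrow> f o farr F tu = farr H tu o b"
    using cancel_iso_right[of "funit F" "f o farr F tu" "farr H tu o b"] by (simp add: bim_def comp_assoc b)
  have "inv_arr B ?q o c = (f**f) o inv_arr B ?p"
    using cancel_iso_right[of ?p "inv_arr B ?q o c" "(f**f) o inv_arr B ?p"] by (simp add: comp_assoc c inv_cancel)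
  hence "?b o inv_arr B ?q o c o farr F td = (?b o (f**f)) o inv_arr B ?p o farr F td"
    by (simp add: comp_assoc flip: comp_assoc[of "farr F td" c])
  hence "?b o inv_arr B ?q o c o farr F td = (f**f) o bcomult (bim F)"
    unfolding braid_nat[OF f f] by (simp add: bim_def comp_assoc)
  hence 3: "bcomult (bim H) o f = (f**f) o bcomult (bim F) \<longleftrightarrow> c o farr F td = farr H td o f"
    using cancel_iso_left[of "?b o inv_arr B ?q" "farr H td o f" "c o farr F td"] by (auto simp: bim_def comp_assoc)
  have "?e o b = inv_arr B (funit F)"
    using cancel_iso_right[of "funit F" "?e o b" "inv_arr B (funit F)"] by (simp add: comp_assoc b)
  hence 4: "bcounit (bim H) o f = bcounit (bim F) \<longleftrightarrow> b o farr F te = farr H te o f"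
    using cancel_iso_left[of ?e "farr H te o f" "b o farr F te"] comp_assoc[of "farr F te" b ?e] by (auto simp: bim_def comp_assoc)
  show ?thesis unfolding is_bimonoid_hom_def 1 2 3 4 using f by (simp add: bim_def)
qed

lemma mnt_hom:
  assumes F: "F \<in> alg_obj T B" "H \<in> alg_obj T B" and a: "monoidal_nat_trans T B F H a"
  shows "is_bimonoid_hom B (bim F) (bim H) (a (Suc 0))" "x \<in> carrier G ==> a (Suc 0) o farr F (tlab x) = farr H (tlab x) o a (Suc 0)"
proof -
  have ah: "a n \<in> Hom B (fobj F n) (fobj H n)" and m: "a (n + k) o fmult F n k = fmult H n k o (a n**a k)" and u: "a 0 o funit F = funit H"
    and nat: "t \<in> Arr T ==> a (Cod T t) o farr F t = farr H t o a (Dom T t)" for n k t using a by (simp_all add: mnt_iff)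
  show "is_bimonoid_hom B (bim F) (bim H) (a (Suc 0))"
    using bimonoid_hom_iff[OF F ah ah _ ah u] m[of "Suc 0" "Suc 0"] nat[of tm] nat[of tu] nat[of td] nat[of te] by simp
  show "x \<in> carrier G ==> a (Suc 0) o farr F (tlab x) = farr H (tlab x) o a (Suc 0)" using nat[of "tlab x"] by simp
qed

definition UU where
  "UU = \<lparr>fobj = gbim, farr = \<lambda>(F, H, a). (gbim F, gbim H, \<lambda>_. (bim F, bim H, a (Suc 0)))\<rparr>"

lemma UU_Hom:
  assumes F: "F \<in> alg_obj T B" "H \<in> alg_obj T B" and a: "monoidal_nat_trans T B F H a"
  shows "(gbim F, gbim H, \<lambda>_. (bim F, bim H, a (Suc 0))) \<in> Hom GB (gbim F) (gbim H)"
proof -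
  interpret F: one_algebra B G L F using F by unfold_locales
  interpret H: one_algebra B G L H using F by unfold_locales
  have "is_nat_trans (group_cat G) (bimon_cat B) (gbim F) (gbim H) (\<lambda>_. (bim F, bim H, a (Suc 0)))"
    unfolding is_nat_trans_def using mnt_hom[OF F a] F.is_bimonoid_bim H.is_bimonoid_bim
    by (simp add: group_cat_def gbim_def bimon_Hom bimon_Comp)
  thus ?thesis unfolding functor_cat_Hom using F.gbim_Obj H.gbim_Obj by (simp add: group_cat_def extensional_def)
qed

lemma UU_functor: "is_functor AA GB UU"
  unfolding is_functor_def
proof (intro conjI ballI impI)
  fix F assume F: "F \<in> Obj AA"
  then interpret F: one_algebra B G L F by unfold_locales (simp add: alg_Obj)
  show "fobj UU F \<in> Obj GB" using F.gbim_Obj by (simp add: UU_def)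
  show "farr UU (Id AA F) = Id GB (fobj UU F)"
    by (simp add: UU_def alg_Id functor_cat_Id bimon_Id gbim_def group_cat_def fun_eq_iff) (simp add: bim_def)
next
  fix f assume "f \<in> Arr AA"
  hence "f \<in> Hom AA (Dom AA f) (Cod AA f)" by (simp add: Hom_def)
  then obtain F H a where f: "f = (F, H, a)" "F \<in> alg_obj T B" "H \<in> alg_obj T B" "monoidal_nat_trans T B F H a"
    unfolding alg_Hom by blast
  show "farr UU f \<in> Hom GB (fobj UU (Dom AA f)) (fobj UU (Cod AA f))"
    using UU_Hom[OF f(2-4)] by (simp add: f(1) UU_def alg_cat_def)
next
  fix f g assume fg: "f \<in> Arr AA" "g \<in> Arr AA" "Cod AA f = Dom AA g"
  obtain F H a where f: "f = (F, H, a)" by (metis prod_cases3)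
  obtain H' K b where g: "g = (H', K, b)" by (metis prod_cases3)
  have [simp]: "H' = H" using fg f g by (simp add: alg_cat_def)
  show "farr UU (g o\<^bsub>AA\<^esub> f) = farr UU g o\<^bsub>GB\<^esub> farr UU f"
    by (simp add: f g UU_def alg_Comp functor_cat_Comp bimon_Comp group_cat_def fun_eq_iff)
qed

end

section \<open>Evaluation at the generator: faithfulness, fullness and surjectivity on
  objects\<close>

section \<open>The equivalence\<close>

context algebras
begin

text \<open>The component at \<open>0\<close> is fixed by the unit arrow, and that at
  \<open>Suc n\<close> by those at \<open>n\<close> and \<open>Suc 0\<close>, since
  \<open>funit F\<close> and \<open>fmult F n (Suc 0)\<close> are invertible.\<close>

lemma mnt_eqI:
  assumes F: "F \<in> alg_obj T B" "H \<in> alg_obj T B" and a: "monoidal_nat_trans T B F H a" and b: "monoidal_nat_trans T B F H b"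
    and e: "a (Suc 0) = b (Suc 0)"
  shows "a = b"
proof
  interpret F: one_algebra B G L F using F by unfold_locales
  interpret H: one_algebra B G L H using F by unfold_locales
  have ah: "a n \<in> Hom B (fobj F n) (fobj H n)" and bh: "b n \<in> Hom B (fobj F n) (fobj H n)" for n using a b by (simp_all add: mnt_iff)
  have [simp]: "a n \<in> Arr B" "Dom B (a n) = fobj F n" "Cod B (a n) = fobj H n" "b n \<in> Arr B" "Dom B (b n) = fobj F n" "Cod B (b n) = fobj H n" for n
    using HomD[OF ah] HomD[OF bh] by auto
  fix n show "a n = b n"
  proof (induction n)
    case 0
    have "a 0 o funit F = b 0 o funit F" using a b by (simp add: mnt_iff)
    thus ?case using cancel_iso_right[of "funit F" "a 0" "b 0"] by simp
  next
    case (Suc n)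
    have "a (n + Suc 0) o fmult F n (Suc 0) = b (n + Suc 0) o fmult F n (Suc 0)"
      using a b Suc e unfolding mnt_iff by metis
    thus ?case using cancel_iso_right[of "fmult F n (Suc 0)" "a (Suc n)" "b (Suc n)"] by simp
  qed
qed

text \<open>Forward and backward arrows generate \<open>T\<close>, and each kind is generated as in
  \<open>Q_induct\<close>. Backward labels are forward labels of inverses, and the four directed
  crossings coincide in pairs.\<close>

lemma T_induct [consumes 1, case_names comp tensor Id m u d e label braid binv]:
  assumes t: "t \<in> Arr T"
    and comp: "\<And>s t. s \<in> Arr T ==> t \<in> Arr T ==> Cod T s = Dom T t ==> R s ==> R t ==> R (t o\<^sub>T s)"
    and tensor: "\<And>s t. s \<in> Arr T ==> t \<in> Arr T ==> R s ==> R t ==> R (s**\<^sub>Tt)"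
    and Id: "\<And>n. R (Id T n)" and gens: "R tm" "R tu" "R td" "R te"
    and label: "\<And>x. x \<in> carrier G ==> R (tlab x)" and braid: "R (braid T (Suc 0) (Suc 0))" "R (J' (braid Q (Suc 0) (Suc 0)))"
  shows "R t"
proof -
  let ?s = "\<lambda>s. qiso 2 (ones 2) [(1, s)]"
  have c: "?s True = braid Q (Suc 0) (Suc 0)" "?s False = binv Q (Suc 0) (Suc 0)"
    using crossing_Q_1[of True] crossing_Q_1[of False] by (simp_all add: crossing_def)
  have i: "J' (braid Q (Suc 0) (Suc 0)) = J (binv Q (Suc 0) (Suc 0))" "J' (binv Q (Suc 0) (Suc 0)) = J (braid Q (Suc 0) (Suc 0))"
    by (rule J'_inverse, rule Q.inverse_braid) (rule J'_inverse, rule Q.inverse_arrows_sym, rule Q.inverse_braid)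
  have R: "R (J f) \<and> R (J' f)" if "f \<in> Arr Q" for f
    using that
  proof (induction rule: Q_induct)
    case (Id n) show ?case using assms(4)[of n] by simp
  next
    case (comp f g)
    thus ?case unfolding J_comp[OF comp(1-3)] J'_comp[OF comp(1-3)] using comp(4,5) by (auto intro!: assms(2))
  next
    case (tensor f g)
    thus ?case unfolding J_tensor[OF tensor(1,2)] J'_tensor[OF tensor(1,2)]
      using tensor(3,4) assms(3)[OF J_arr(1)[OF tensor(1)] J_arr(1)[OF tensor(2)]] assms(3)[OF J_arr(4)[OF tensor(1)] J_arr(4)[OF tensor(2)]] by blast
  next
    case mult show ?case using gens by (simp add: tm_def td_def)
  next
    case unit show ?case using gens by (simp add: tu_def te_def)
  next
    case (swap s)
    have b: "J (braid Q (Suc 0) (Suc 0)) = braid T (Suc 0) (Suc 0)" by simp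
    have "R (J (braid Q (Suc 0) (Suc 0)))" "R (J' (braid Q (Suc 0) (Suc 0)))" "R (J (binv Q (Suc 0) (Suc 0)))" "R (J' (binv Q (Suc 0) (Suc 0)))"
      unfolding i(2) b using braid unfolding i(1) by simp_all
    thus ?case using c by (cases s) simp_all
  next
    case (label x)
    have "J' (lb x) = J (lb (inv\<^bsub>G\<^esub> x))" by (rule J'_inverse) (rule lb_inverse[OF label])
    thus ?case using assms(9)[of x] assms(9)[of "inv\<^bsub>G\<^esub> x"] label by (simp add: tlab_def)
  qed
  obtain a b where ab: "t = sp a b" "a \<in> Arr Q" "b \<in> Arr Q" "qdom a = qdom b" using t by (auto simp: Arr_T)
  show ?thesis unfolding ab(1) T_comp_J[OF ab(2-4)] by (rule assms(2)) (use ab R[OF ab(2)] R[OF ab(3)] in simp_all)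
qed

text \<open>The components are forced by recursion. Naturality is closed under composition and
  tensor products, so it is checked on the generators of \<open>T\<close>, where it amounts to the
  hypotheses on \<open>f\<close> and naturality of the braiding.\<close>

lemma UU_full:
  assumes F: "F \<in> alg_obj T B" "H \<in> alg_obj T B" and f: "is_bimonoid_hom B (bim F) (bim H) f"
    and l: "\<And>x. x \<in> carrier G ==> f o farr F (tlab x) = farr H (tlab x) o f"
  obtains a where "monoidal_nat_trans T B F H a" "a (Suc 0) = f"
proof -
  interpret F: one_algebra B G L F using F by unfold_locales
  interpret H: one_algebra B G L H using F by unfold_locales
  let ?n = "Suc 0"
  have fh: "f \<in> Hom B (fobj F ?n) (fobj H ?n)" using f by (simp add: is_bimonoid_hom_def bim_def)
  have [simp]: "f \<in> Arr B" "Dom B f = fobj F ?n" "Cod B f = fobj H ?n" using HomD[OF fh] by auto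
  \<comment> \<open>The only possible components: the unit comparison at \<open>0\<close>, then one
    factor \<open>f\<close> at a time.\<close>
  define a where "a = rec_nat (funit H o inv_arr B (funit F)) (\<lambda>n an. fmult H n ?n o (an**f) o inv_arr B (fmult F n ?n))"
  have a0: "a 0 = funit H o inv_arr B (funit F)" and aS: "a (Suc n) = fmult H n ?n o (a n**f) o inv_arr B (fmult F n ?n)" for n
    by (simp_all add: a_def)
  have at: "a n \<in> Arr B \<and> Dom B (a n) = fobj F n \<and> Cod B (a n) = fobj H n" for n
    by (induction n) (simp_all add: a0 aS)
  have [simp]: "a n \<in> Arr B" "Dom B (a n) = fobj F n" "Cod B (a n) = fobj H n" for n using at by auto
  have ah: "a n \<in> Hom B (fobj F n) (fobj H n)" for n using at unfolding Hom_def by blast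
  have u0: "a 0 o funit F = funit H" by (simp add: a0 comp_assoc)
  have S: "a (Suc n) o fmult F n ?n = fmult H n ?n o (a n**f)" for n by (simp add: aS comp_assoc)
  \<comment> \<open>The recursion splits off one factor on the right; associativity of the
    comparison arrows extends this to arbitrary splittings.\<close>
  have mon: "a (n + m) o fmult F n m = fmult H n m o (a n**a m)" for n m
  proof (induction m)
    case 0
    let ?k = "Id B (fobj F n)**funit F"
    have "(fmult H n 0 o (a n**a 0)) o ?k = (fmult H n 0 o (Id B (fobj H n)**funit H)) o (a n**Id B (tunit B))"
      by (simp add: comp_assoc ten_comp' u0)
    also have "... = a n o runit B (fobj F n)" unfolding H.pm_runit by (rule runit_nat[OF ah])
    also have "... = (a n o fmult F n 0) o ?k" unfolding F.pm_runit[symmetric] by (simp add: comp_assoc)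
    finally have "(a n o fmult F n 0) o ?k = (fmult H n 0 o (a n**a 0)) o ?k" ..
    thus ?case using cancel_iso_right[of ?k "a n o fmult F n 0" "fmult H n 0 o (a n**a 0)"] by simp
  next
    case (Suc m)
    let ?A = "assoc B (fobj F n) (fobj F m) (fobj F ?n)" and ?A' = "assoc B (fobj H n) (fobj H m) (fobj H ?n)"
    let ?k = "(Id B (fobj F n)**fmult F m ?n) o ?A"
    have pF: "fmult F n (Suc m) o ?k = fmult F (n + m) ?n o (fmult F n m**Id B (fobj F ?n))" using F.pm_assoc[of n m ?n] by simp
    have pH: "fmult H n (Suc m) o (Id B (fobj H n)**fmult H m ?n) o ?A' = fmult H (n + m) ?n o (fmult H n m**Id B (fobj H ?n))" using H.pm_assoc[of n m ?n] by simp
    have [simp]: "Cod B (fmult F m ?n) = fobj F (Suc m)" "Cod B (fmult H m ?n) = fobj H (Suc m)"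
      "Cod B (fmult F (n + m) ?n) = fobj F (Suc (n + m))" "Cod B (fmult H (n + m) ?n) = fobj H (Suc (n + m))"
      "Cod B (fmult F n (Suc m)) = fobj F (Suc (n + m))" "Cod B (fmult H n (Suc m)) = fobj H (Suc (n + m))" by simp_all
    have "(a (n + Suc m) o fmult F n (Suc m)) o ?k = a (Suc (n + m)) o fmult F n (Suc m) o ?k" by (simp add: comp_assoc)
    also have "... = (a (Suc (n + m)) o fmult F (n + m) ?n) o (fmult F n m**Id B (fobj F ?n))" unfolding pF by (simp add: comp_assoc)
    also have "... = fmult H (n + m) ?n o ((a (n + m) o fmult F n m)**f)" unfolding S by (simp add: comp_assoc ten_comp')
    also have "... = (fmult H (n + m) ?n o (fmult H n m**Id B (fobj H ?n))) o ((a n**a m)**f)"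
      unfolding Suc by (simp add: comp_assoc ten_comp')
    also have "... = fmult H n (Suc m) o (Id B (fobj H n)**fmult H m ?n) o (?A' o ((a n**a m)**f))"
      unfolding pH[symmetric] by (simp add: comp_assoc)
    also have "?A' o ((a n**a m)**f) = (a n**a m**f) o ?A" using assoc_nat'[of "a n" "a m" f] by simp
    also have "fmult H n (Suc m) o (Id B (fobj H n)**fmult H m ?n) o (a n**a m**f) o ?A =
        fmult H n (Suc m) o (a n**(a (Suc m) o fmult F m ?n)) o ?A" unfolding S by (simp add: ten_comp_assoc')
    also have "... = (fmult H n (Suc m) o (a n**a (Suc m))) o ?k" by (simp add: comp_assoc ten_comp_assoc')
    finally show ?case using cancel_iso_right[of ?k "a (n + Suc m) o fmult F n (Suc m)" "fmult H n (Suc m) o (a n**a (Suc m))"] by simp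
  qed
  \<comment> \<open>The recursion starts at \<open>0\<close>, so its first value is \<open>f\<close>
    with unit comparisons around it; they cancel by the left unit law.\<close>
  have a1: "a ?n = f"
  proof -
    let ?k = "funit F**Id B (fobj F ?n)"
    have "(a ?n o fmult F 0 ?n) o ?k = (fmult H 0 ?n o (funit H**Id B (fobj H ?n))) o (Id B (tunit B)**f)"
      unfolding S by (simp add: comp_assoc ten_comp' u0)
    also have "... = f o lunit B (fobj F ?n)" unfolding H.pm_lunit by (rule lunit_nat[OF fh])
    also have "... = (f o fmult F 0 ?n) o ?k" unfolding F.pm_lunit[symmetric] by (simp add: comp_assoc)
    finally have "a ?n o fmult F 0 ?n = f o fmult F 0 ?n"
      using cancel_iso_right[of ?k "a ?n o fmult F 0 ?n" "f o fmult F 0 ?n"] by simp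
    thus ?thesis using cancel_iso_right[of "fmult F 0 ?n" "a ?n" f] by simp
  qed
  have m': "a (Suc ?n) o fmult F ?n ?n = fmult H ?n ?n o (f**f)" using S[of ?n] unfolding a1 .
  have fe: "f o farr F tm = farr H tm o a (Suc ?n)" "f o farr F tu = farr H tu o a 0" "a (Suc ?n) o farr F td = farr H td o f" "a 0 o farr F te = farr H te o f"
    using f unfolding bimonoid_hom_iff[OF F fh ah m' ah u0] by blast+
  have ft: "farr F t \<in> Arr B" "Dom B (farr F t) = fobj F (Dom T t)" "Cod B (farr F t) = fobj F (Cod T t)"
    "farr H t \<in> Arr B" "Dom B (farr H t) = fobj H (Dom T t)" "Cod B (farr H t) = fobj H (Cod T t)" if "t \<in> Arr T" for t
    using HomD[OF F.F_props(2)[OF that]] HomD[OF H.F_props(2)[OF that]] by auto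
  let ?b = "braid T ?n ?n" and ?b' = "J' (braid Q ?n ?n)"
  have d: "Dom T ?b = Suc ?n" "Cod T ?b = Suc ?n" "Dom T ?b' = Suc ?n" "Cod T ?b' = Suc ?n" "?b \<in> Arr T" "?b' \<in> Arr T" by simp_all
  note ts = ft[OF d(5), unfolded d] ft[OF d(6), unfolded d]
  let ?k = "fmult F ?n ?n"
  have pF: "farr F ?b o ?k = ?k o braid B (fobj F ?n) (fobj F ?n)" and pH: "farr H ?b o fmult H ?n ?n = fmult H ?n ?n o braid B (fobj H ?n) (fobj H ?n)"
    using F.F_props(10)[of ?n ?n] H.F_props(10)[of ?n ?n] by blast+
  have [simp]: "Cod B ?k = fobj F (Suc ?n)" "Cod B (fmult H ?n ?n) = fobj H (Suc ?n)" by simp_all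
  have "(a (Suc ?n) o farr F ?b) o ?k = a (Suc ?n) o farr F ?b o ?k" using ts by (simp add: comp_assoc del: T_simps)
  also have "... = (a (Suc ?n) o ?k) o braid B (fobj F ?n) (fobj F ?n)" unfolding pF by (simp add: comp_assoc)
  also have "... = fmult H ?n ?n o (f**f) o braid B (fobj F ?n) (fobj F ?n)" unfolding m' by (simp add: comp_assoc)
  also have "... = fmult H ?n ?n o braid B (fobj H ?n) (fobj H ?n) o (f**f)" unfolding braid_nat[OF fh fh] ..
  also have "... = (farr H ?b o fmult H ?n ?n) o (f**f)" unfolding pH by (simp add: comp_assoc)
  also have "... = (farr H ?b o a (Suc ?n)) o ?k" using ts by (simp add: comp_assoc m' del: T_simps)
  finally have br: "a (Suc ?n) o farr F ?b = farr H ?b o a (Suc ?n)"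
    using cancel_iso_right[of ?k "a (Suc ?n) o farr F ?b" "farr H ?b o a (Suc ?n)"] ts by (simp del: T_simps)
  have "a (Cod T t) o farr F t = farr H t o a (Dom T t)" if "t \<in> Arr T" for t
    using that
  proof (induction rule: T_induct)
    case (comp s t)
    note ts = ft[OF comp(1)] ft[OF comp(2)]
    have "a (Cod T t) o farr F t o farr F s = (a (Cod T t) o farr F t) o farr F s" using ts comp(3) by (simp add: comp_assoc)
    also have "... = farr H t o (a (Dom T t) o farr F s)" unfolding comp(5) using ts comp(3) by (simp add: comp_assoc)
    also have "... = (farr H t o farr H s) o a (Dom T s)" unfolding comp(3)[symmetric] comp(4) using ts comp(3) by (simp add: comp_assoc)
    finally show ?case unfolding F.F_props(4)[OF comp(1-3)] H.F_props(4)[OF comp(1-3)] T_arr_comp(2,3)[OF comp(1-3)] .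
  next
    case (tensor s t)
    note ts = ft[OF tensor(1)] ft[OF tensor(2)] ft[OF T_arr_ten(1)[OF tensor(1,2)], unfolded T_arr_ten(2,3)[OF tensor(1,2)]]
    let ?k = "fmult F (Dom T s) (Dom T t)" and ?st = "s**\<^sub>Tt"
    have "(a (Cod T s + Cod T t) o farr F ?st) o ?k = a (Cod T s + Cod T t) o farr F ?st o ?k" using ts by (simp add: comp_assoc)
    also have "... = (a (Cod T s + Cod T t) o fmult F (Cod T s) (Cod T t)) o (farr F s**farr F t)"
      unfolding F.F_props(9)[OF tensor(1,2)] using ts by (simp add: comp_assoc)
    also have "... = fmult H (Cod T s) (Cod T t) o ((a (Cod T s) o farr F s)**(a (Cod T t) o farr F t))"
      unfolding mon using ts by (simp add: comp_assoc ten_comp')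
    also have "... = (fmult H (Cod T s) (Cod T t) o (farr H s**farr H t)) o (a (Dom T s)**a (Dom T t))"
      unfolding tensor(3,4) using ts by (simp add: comp_assoc ten_comp')
    also have "... = farr H ?st o fmult H (Dom T s) (Dom T t) o (a (Dom T s)**a (Dom T t))"
      unfolding H.F_props(9)[OF tensor(1,2), symmetric] using ts by (simp add: comp_assoc)
    also have "... = (farr H ?st o a (Dom T s + Dom T t)) o ?k" unfolding mon[symmetric] using ts by (simp add: comp_assoc)
    finally have "a (Cod T s + Cod T t) o farr F ?st = farr H ?st o a (Dom T s + Dom T t)"
      using cancel_iso_right[of ?k "a (Cod T s + Cod T t) o farr F ?st" "farr H ?st o a (Dom T s + Dom T t)"] ts by simp
    thus ?case unfolding T_arr_ten(2,3)[OF tensor(1,2)] .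
  next
    case (Id n)
    have "Dom T (Id T n) = n" "Cod T (Id T n) = n" by simp_all
    thus ?case unfolding F.F_props(3) H.F_props(3) by (simp del: T_simps)
  next
    case m show ?case using fe by (simp add: a1)
  next
    case u show ?case using fe by (simp add: a1)
  next
    case d show ?case using fe by (simp add: a1)
  next
    case e show ?case using fe by (simp add: a1)
  next
    case (label x) thus ?case using l[of x] by (simp add: a1)
  next
    case braid show ?case unfolding d by fact
  next
    \<comment> \<open>The square for the inverse crossing arises from that for the crossing by
      multiplying with inverses on both sides.\<close>
    case binv
      have "J' (braid Q ?n ?n) = J (binv Q ?n ?n)" by (rule J'_inverse) (rule Q.inverse_braid)
      hence "?b o\<^sub>T ?b' = Id T (Suc ?n)" "?b' o\<^sub>T ?b = Id T (Suc ?n)"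
        using J_comp[of "binv Q ?n ?n" "braid Q ?n ?n"] J_comp[of "braid Q ?n ?n" "binv Q ?n ?n"] by simp_all
      hence i: "farr F ?b o farr F ?b' = Id B (fobj F (Suc ?n))" "farr H ?b' o farr H ?b = Id B (fobj H (Suc ?n))"
        using F.F_props(4)[OF d(6,5)] H.F_props(4)[OF d(5,6)] d F.F_props(3) H.F_props(3) by metis+
      have "a (Suc ?n) o farr F ?b' = ((farr H ?b' o farr H ?b) o a (Suc ?n)) o farr F ?b'" unfolding i using ts by simp
      also have "... = farr H ?b' o (farr H ?b o a (Suc ?n)) o farr F ?b'" using ts by (simp add: comp_assoc del: T_simps)
      also have "... = (farr H ?b' o a (Suc ?n)) o farr F ?b o farr F ?b'" unfolding br[symmetric] using ts by (simp add: comp_assoc del: T_simps)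
      finally show ?case unfolding d i using ts by simp
  qed
  hence "monoidal_nat_trans T B F H a" unfolding mnt_iff using mon u0 ah by blast
  thus thesis using a1 by (rule that)
qed

end

context algebras
begin

text \<open>Objects are hit exactly and not only up to isomorphism: the first power equals the given
  object, and the twist used to define the functor is undone in \<open>bim\<close>.\<close>

lemma UU_ess:
  assumes Y: "Y \<in> Obj GB"
  shows "\<exists>F\<in>alg_obj T B. gbim F = Y"
proof -
  let ?n = "Suc 0"
  define X where "X = fobj Y ()"
  define r where "r x = snd (snd (farr Y x))" for x
  have fY: "is_functor (group_cat G) (bimon_cat B) Y" and eY: "farr Y \<in> extensional (carrier G)"
    using Y unfolding functor_cat_Obj by (simp_all add: group_cat_def)
  have X: "is_bimonoid B X" using fY by (simp add: is_functor_def X_def group_cat_def bimon_Obj)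
  have Yx: "farr Y x = (X, X, r x)" "is_bimonoid_hom B X X (r x)" if "x \<in> carrier G" for x
  proof -
    have "farr Y x \<in> Hom (bimon_cat B) X X" using fY that by (simp add: is_functor_def X_def group_cat_def)
    thus "farr Y x = (X, X, r x)" "is_bimonoid_hom B X X (r x)" unfolding bimon_Hom r_def by auto
  qed
  have r1: "r \<one>\<^bsub>G\<^esub> = Id B (bobj X)" using fY by (simp add: is_functor_def X_def r_def group_cat_def bimon_Id)
  have rm: "r (x \<otimes>\<^bsub>G\<^esub> y) = r x o r y" if "x \<in> carrier G" "y \<in> carrier G" for x y
  proof -
    have "farr Y (x \<otimes>\<^bsub>G\<^esub> y) = farr Y x o\<^bsub>bimon_cat B\<^esub> farr Y y" using fY that by (simp add: is_functor_def group_cat_def)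
    thus ?thesis unfolding Yx(1)[OF that(1)] Yx(1)[OF that(2)] bimon_Comp by (simp add: r_def)
  qed
  note ty = bimonoid_typing[OF X]
  obtain P pm et where p: "powers B P pm et" "P ?n = bobj X" "\<And>n m. pm n m \<in> canonical B" "et \<in> canonical B"
    using powers_exist[OF ty(1)] by blast
  interpret p: powers B P pm et by fact
  interpret K: prob p.K by (rule p.prob_K)
  note ty' = ty(2-5)[folded p(2)]
  have Xe: "X = \<lparr>bobj = p.x1, bmult = bmult X, bunit = bunit X, bcomult = bcomult X, bcounit = bcounit X\<rparr>" using p(2) by simp
  let ?m = "p.km (bmult X)" and ?u = "p.ku (bunit X)" and ?d = "p.kd (bcomult X)" and ?e = "p.ke (bcounit X)"
  let ?R = "\<lambda>x. (?n, ?n, r x)" and ?c = "binv p.K ?n ?n"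
  have sb: "strict_bimonoid p.K ?m ?u ?d ?e" unfolding p.strict_bimonoid_K[OF ty'] using X Xe by simp
  have rh: "r x \<in> Hom B p.x1 p.x1" if "x \<in> carrier G" for x using Yx(2)[OF that] p(2) by (simp add: is_bimonoid_hom_def)
  have rK: "?R x \<in> Arr p.K \<and> Dom p.K (?R x) = ?n \<and> Cod p.K (?R x) = ?n" if "x \<in> carrier G" for x
    using HomD[OF rh[OF that]] by (simp add: p.K_Arr)
  have rr: "?R x o\<^bsub>p.K\<^esub> ?m = ?m o\<^bsub>p.K\<^esub> (?R x**\<^bsub>p.K\<^esub>?R x) \<and> ?R x o\<^bsub>p.K\<^esub> ?u = ?u \<and>
      ?d o\<^bsub>p.K\<^esub> ?R x = (?R x**\<^bsub>p.K\<^esub>?R x) o\<^bsub>p.K\<^esub> ?d \<and> ?e o\<^bsub>p.K\<^esub> ?R x = ?e" if "x \<in> carrier G" for x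
    unfolding p.strict_bimonoid_hom_K[OF ty' rh[OF that]] using Yx(2)[OF that] Xe by simp
  have dh: "?d \<in> Arr p.K" "Dom p.K ?d = ?n" "Cod p.K ?d = Suc ?n" using sb unfolding strict_bimonoid_def Hom_def by blast+
  \<comment> \<open>The given bimonoid is twisted into one for the reverse braiding, as evaluation
    on spans requires.\<close>
  interpret b: bialgebra p.K G L ?m ?u "?c o\<^bsub>p.K\<^esub> ?d" ?e ?R
  proof
    show "strict_bimonoid (rev_braid p.K) ?m ?u (?c o\<^bsub>p.K\<^esub> ?d) ?e" by (rule K.strict_bimonoid_twist[OF sb])
    show "?R \<one>\<^bsub>G\<^esub> = Id p.K ?n" using r1 p(2) by simp
    fix x assume x: "x \<in> carrier G"
    show "?R x \<in> Hom p.K ?n ?n" unfolding Hom_def using rK[OF x] by blast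
    show "?R x o\<^bsub>p.K\<^esub> ?m = ?m o\<^bsub>p.K\<^esub> (?R x**\<^bsub>p.K\<^esub>?R x)" "?R x o\<^bsub>p.K\<^esub> ?u = ?u" "?e o\<^bsub>p.K\<^esub> ?R x = ?e" using rr[OF x] by blast+
    have R: "?R x \<in> Arr p.K" "Dom p.K (?R x) = ?n" "Cod p.K (?R x) = ?n" using rK[OF x] by blast+
    show "(?c o\<^bsub>p.K\<^esub> ?d) o\<^bsub>p.K\<^esub> ?R x = (?R x**\<^bsub>p.K\<^esub>?R x) o\<^bsub>p.K\<^esub> ?c o\<^bsub>p.K\<^esub> ?d"
      by (rule K.twist_Comp) (simp_all only: R dh rr[OF x] add_Suc add_0)
    fix y assume "y \<in> carrier G"
    thus "?R (x \<otimes>\<^bsub>G\<^esub> y) = ?R x o\<^bsub>p.K\<^esub> ?R y" using rm x by simp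
  qed
  define F where "F = \<lparr>fobj = P, farr = \<lambda>t\<in>Arr T. snd (snd (b.EE t)), fmult = pm, funit = et\<rparr>"
  have F: "fobj F = P" "fmult F = pm" "funit F = et" "t \<in> Arr T ==> farr F t = snd (snd (b.EE t))" for t
    by (simp_all add: F_def)
  have E: "b.EE t = (Dom T t, Cod T t, farr F t)" "farr F t \<in> Hom B (P (Dom T t)) (P (Cod T t))" if t: "t \<in> Arr T" for t
    using b.EE_arr[OF t] unfolding Hom_def F(4)[OF t] mem_Collect_eq p.K_Arr by (auto simp: prod_eq_iff)
  have Ea: "farr F t \<in> Arr B" "Dom B (farr F t) = P (Dom T t)" "Cod B (farr F t) = P (Cod T t)" if t: "t \<in> Arr T" for t
    using HomD[OF E(2)[OF t]] by blast+
  have T1: "Id T n \<in> Arr T" "Dom T (Id T n) = n" "Cod T (Id T n) = n" "braid T n m \<in> Arr T" for n m by simp_all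
  have FI: "farr F (Id T n) = Id B (P n)" for n unfolding F(4)[OF T1(1)] b.EE_Id by simp
  have FC: "farr F (t o\<^sub>T s) = farr F t o farr F s" if "s \<in> Arr T" "t \<in> Arr T" "Cod T s = Dom T t" for s t
    unfolding F(4)[OF T_arr_comp(1)[OF that]] b.EE_comp[OF that] E(1)[OF that(1)] E(1)[OF that(2)] by simp
  have FT: "farr F (s**\<^sub>Tt) o pm (Dom T s) (Dom T t) = pm (Cod T s) (Cod T t) o (farr F s**farr F t)"
    if "s \<in> Arr T" "t \<in> Arr T" for s t
  proof -
    have "farr F (s**\<^sub>Tt) = pm (Cod T s) (Cod T t) o (farr F s**farr F t) o inv_arr B (pm (Dom T s) (Dom T t))"
      unfolding F(4)[OF T_arr_ten(1)[OF that]] b.EE_tensor[OF that] E(1)[OF that(1)] E(1)[OF that(2)] by simp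
    thus ?thesis using p.K_ten_pm[OF Ea[OF that(1)] Ea[OF that(2)]] by simp
  qed
  have FB: "farr F (braid T n m) o pm n m = pm m n o braid B (P n) (P m)" for n m
    unfolding F(4)[OF T1(4)] b.EE_braid using p.kb_pm[of m n] by simp
  have ext: "farr F \<in> extensional (Arr T)" by (simp add: F_def)
  have "F \<in> alg_obj T B"
    unfolding alg_obj_def braided_strict_functor_def is_functor_def mem_Collect_eq F T_simps(1-3) T_assoc FI
    using E(2) FC FT FB p(3,4) p.pm_Hom p.et_Hom p.pm_assoc p.pm_lunit p.pm_runit ext
    by (auto simp del: T_simps simp: add.assoc)
  moreover have "gbim F = Y"
  proof -
    have g: "farr F tm = bmult X o inv_arr B (pm ?n ?n)" "farr F tu = bunit X o inv_arr B et" "farr F te = et o bcounit X"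
      "farr F td = snd (snd (?c o\<^bsub>p.K\<^esub> ?d))"
      using b.EE_gens(1-4)[folded tm_def tu_def td_def te_def] by (simp_all add: F(4))
    have gl: "farr F (tlab x) = r x" if "x \<in> carrier G" for x
      using b.EE_gens(5)[OF that] that F(4)[of "tlab x"] by (simp add: tlab_def)
    have [simp]: "bmult X \<in> Arr B" "Dom B (bmult X) = p.x1 \<odot> p.x1" "Cod B (bmult X) = p.x1" "bunit X \<in> Arr B" "Dom B (bunit X) = tunit B"
      "Cod B (bunit X) = p.x1" "bcomult X \<in> Arr B" "Dom B (bcomult X) = p.x1" "Cod B (bcomult X) = p.x1 \<odot> p.x1"
      "bcounit X \<in> Arr B" "Dom B (bcounit X) = p.x1" "Cod B (bcounit X) = tunit B"
      using HomD[OF ty'(1)] HomD[OF ty'(2)] HomD[OF ty'(3)] HomD[OF ty'(4)] by blast+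
    obtain i j c where c: "?c = (i, j, c)" by (metis prod_cases3)
    have ct: "c \<in> Arr B" "Dom B c = P (Suc ?n)" "Cod B c = P (Suc ?n)"
      using K.binv_arr[of ?n ?n] K.binv_dom[of ?n ?n] K.binv_cod[of ?n ?n] unfolding c p.K_Arr by simp_all
    \<comment> \<open>The inverse crossing inside \<open>farr F td\<close> cancels against the
      braiding in \<open>bim\<close>, which returns the original comultiplication.\<close>
    have "(pm ?n ?n o braid B p.x1 p.x1 o inv_arr B (pm ?n ?n)) o c = Id B (P (Suc ?n))"
      using K.braid_binv[of ?n ?n] unfolding c by simp
    hence "inv_arr B (pm ?n ?n) o ((pm ?n ?n o braid B p.x1 p.x1 o inv_arr B (pm ?n ?n)) o c) o pm ?n ?n o bcomult X = bcomult X"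
      by (simp add: inv_cancel)
    hence d: "braid B p.x1 p.x1 o inv_arr B (pm ?n ?n) o c o pm ?n ?n o bcomult X = bcomult X"
      using ct by (simp add: comp_assoc inv_cancel)
    have "bim F = X" unfolding bim_def F g c
      using d p(2) by (simp add: comp_assoc inv_cancel)
    thus ?thesis using Yx(1) gl eY by (intro funct.equality) (auto simp: gbim_def X_def extensional_def fun_eq_iff)
  qed
  ultimately show ?thesis by blast
qed

lemma algebras_equivalent: "equivalent_categories AA GB"
proof (rule equivalent_categoriesI[OF category_alg_cat category_functor_cat[OF category_group_cat category_bimon_cat] UU_functor])
  fix F H f g assume fg: "f \<in> Hom AA F H" "g \<in> Hom AA F H" "farr UU f = farr UU g"
  then obtain a b where a: "f = (F, H, a)" "F \<in> alg_obj T B" "H \<in> alg_obj T B" "monoidal_nat_trans T B F H a"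
    and b: "g = (F, H, b)" "monoidal_nat_trans T B F H b" unfolding alg_Hom by blast
  have "a (Suc 0) = b (Suc 0)" using fg(3) by (simp add: a b UU_def fun_eq_iff)
  thus "f = g" using mnt_eqI[OF a(2-4) b(2)] a b by simp
next
  fix F H h assume F: "F \<in> Obj AA" "H \<in> Obj AA" and h: "h \<in> Hom GB (fobj UU F) (fobj UU H)"
  then obtain b where b: "h = (gbim F, gbim H, b)" "is_nat_trans (group_cat G) (bimon_cat B) (gbim F) (gbim H) b"
    by (auto simp: functor_cat_Hom UU_def)
  have "b () \<in> Hom (bimon_cat B) (bim F) (bim H)" using b(2) by (simp add: is_nat_trans_def group_cat_def gbim_def)
  then obtain f where f: "b () = (bim F, bim H, f)" "is_bimonoid_hom B (bim F) (bim H) f" unfolding bimon_Hom by blast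
  have l: "f o farr F (tlab x) = farr H (tlab x) o f" if "x \<in> carrier G" for x
    using b(2) that f(1) by (simp add: is_nat_trans_def group_cat_def gbim_def bimon_Comp)
  obtain a where a: "monoidal_nat_trans T B F H a" "a (Suc 0) = f" using UU_full[OF _ _ f(2) l] F unfolding alg_Obj by blast
  have "(F, H, a) \<in> Hom AA F H" unfolding alg_Hom using F a by (simp add: alg_Obj)
  moreover have "farr UU (F, H, a) = h" using f a by (simp add: UU_def b(1) fun_eq_iff)
  ultimately show "\<exists>f\<in>Hom AA F H. farr UU f = h" by blast
next
  interpret D: category "GB" by (rule category_functor_cat[OF category_group_cat category_bimon_cat])
  fix Y assume Y: "Y \<in> Obj GB"
  obtain F where F: "F \<in> alg_obj T B" "gbim F = Y" using UU_ess[OF Y] by blast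
  have "Id GB Y \<in> Hom GB (fobj UU F) Y" using D.Id_Hom[OF Y] F by (simp add: UU_def)
  thus "\<exists>F\<in>Obj AA. \<exists>e e'. e \<in> Hom GB (fobj UU F) Y \<and> inverse_arrows GB e e'"
    using D.inverse_arrows_Id[OF Y] F alg_Obj by blast
qed

end

theorem theorem5p3:
  fixes B :: "('o, 'a, 'z) bmcat_scheme" and G :: "('g, 'x) monoid_scheme"
  assumes "braided_monoidal_category B" and "group G"
  shows "equivalent_categories (alg_cat (bimonoid_prob G) B) (gbimon_cat G B)"
proof -
  interpret group G by fact
  \<comment> \<open>The law constructed above shows that the choice meets its specification, which
    is all that the locale asks of it.\<close>
  have "bimonoid_law G (SOME L. bimonoid_law G L)" by (rule someI[of "bimonoid_law G", OF bimonoid_law_law])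
  then interpret algebras B G "SOME L. bimonoid_law G L"
    using assms by (intro algebras.intro bialgebra_law.intro bialgebra_law_axioms.intro)
  show ?thesis unfolding bimonoid_prob_def by (rule algebras_equivalent)
qed

end
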